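(* Let $d\ge2$. (1) For any $\lambda,\lambda'\in V_d$ with $\mathcal{I}(\lambda)=\mathcal{I}(\lambda')$ and $\mathcal{K}(\lambda)=\mathcal{K}(\lambda')$, there exist open neighborhoods $\widetilde U\ni\bar\lambda$ and $\widetilde U'\ni\bar\lambda'$ in $\widetilde V_d$ and biholomorphic maps $\mathfrak{L}:\Phi_d^{-1}(\widetilde U)\to\Phi_d^{-1}(\widetilde U')$, $\widetilde L:\widetilde U\to\widetilde U'$ and $L:U\to U'$ with $L(\lambda)=\lambda'$, where $U,U'$ are the connected components of $pr^{-1}(\widetilde U)$, $pr^{-1}(\widetilde U')$ in $V_d$ containing $\lambda,\lambda'$ respectively, such that: (a) $\Phi_d\circ\mathfrak{L}=\widetilde L\circ\Phi_d|_{\Phi_d^{-1}(\widetilde U)}$ and $pr\circ L=\widetilde L\circ pr|_U$; (b) for any $\lambda''\in U$, $\mathcal{I}(\lambda'')=\mathcal{I}(L(\lambda''))$ and $\mathcal{K}(\lambda'')=\mathcal{K}(L(\lambda''))$. (2) For any $(\mathcal{I},\mathcal{K})\in\{(\mathcal{I}(\lambda),\mathcal{K}(\lambda))\mid\lambda\in V_d\}$ put $$\widetilde V(\mathcal{I},\mathcal{K}):=\{\bar\lambda\in\widetilde V_d\mid\lambda\in V_d,\ \mathcal{I}(\lambda)=\mathcal{I},\ \mathcal{K}(\lambda)=\mathcal{K}\},$$ $$\widetilde V(\mathcal{I},* ):=\{\bar\lambda\in\widetilde V_d\mid\lambda\in V_d,\ \mathcal{I}(\lambda)=\mathcal{I}\},\qquad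 \widetilde V( *,\mathcal{K}):=\{\bar\lambda\in\widetilde V_d\mid\lambda\in V_d,\ \mathcal{K}(\lambda)=\mathcal{K}\}.$$ Then: (a) the map $\Phi_d|:\Phi_d^{-1}(\widetilde V(\mathcal{I},* ))\to\widetilde V(\mathcal{I},* )$ is proper; (b) the map $\Phi_d|:\Phi_d^{-1}(\widetilde V( *,\mathcal{K}))\to\widetilde V( *,\mathcal{K})$ is locally homeomorphic; (c) for each connected component $X$ of $\Phi_d^{-1}(\widetilde V(\mathcal{I},\mathcal{K}))$, the map $\Phi_d|_X:X\to\widetilde V(\mathcal{I},\mathcal{K})$ is an unbranched covering.
   Context: For $d\ge 2$ let $\mathrm{Poly}_d:=\{f\in\mathbb{C}[z]\mid \deg f=d\}$ and $\mathrm{Aut}(\mathbb{C}):=\{\gamma(z)=az+b\mid a,b\in\mathbb{C},a\ne0\}$, acting on $\mathrm{Poly}_d$ by $\gamma\cdot f=\gamma\circ f\circ\gamma^{-1}$; put $\mathrm{MP}_d:=\mathrm{Poly}_d/\mathrm{Aut}(\mathbb{C})$, with its quotient complex structure; one has $\mathrm{MP}_d\cong\mathbb{C}^{d-1}/(\mathbb{Z}/(d-1)\mathbb{Z})$. For $f\in\mathrm{Poly}_d$, $\mathrm{Fix}(f)$ is the collection of the $d$ fixed points of $f$ in $\mathbb{C}$ counted with multiplicity. Put $\Lambda_d:=\{(\lambda_1,\ldots,\lambda_d)\in\mathbb{C}^d\mid\sum_{i=1}^d\prod_{j\ne i}(1-\lambda_j)=0\}$, $\widetilde\Lambda_d:=\Lambda_d/\mathfrak{S}_d$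 (coordinates permuted; $\widetilde\Lambda_d\cong\mathbb{C}^{d-1}$), and let $pr:\Lambda_d\to\widetilde\Lambda_d$ be the projection, $\bar\lambda:=pr(\lambda)$. The map $\Phi_d:\mathrm{MP}_d\to\widetilde\Lambda_d$ sends the class of $f$ to the unordered collection $(f'(\zeta))_{\zeta\in\mathrm{Fix}(f)}$. Put $V_d:=\{(\lambda_1,\ldots,\lambda_d)\in\Lambda_d\mid\lambda_i\ne1\text{ for all }i\}$ and $\widetilde V_d:=V_d/\mathfrak{S}_d$, Zariski open subsets of $\Lambda_d$ and $\widetilde\Lambda_d$. For $\lambda\in V_d$, $$\mathcal{I}(\lambda):=\Bigl\{I\subsetneq\{1,\ldots,d\}\ \Bigm|\ I\neq\emptyset,\ \sum_{i\in I}\tfrac{1}{1-\lambda_i}=0\Bigr\},\qquad \mathcal{K}(\lambda):=\bigl\{K\subseteq\{1,\ldots,d\}\bigm| K\neq\emptyset,\ \lambda_i=\lambda_j\text{ for all } i,j\in K\bigr\}.$$ *)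

theory Defs
  imports "HOL-Analysis.Analysis" "HOL-Computational_Algebra.Fundamental_Theorem_Algebra"
begin

text \<open>
  Quotients such as \<open>Poly\<^sub>d / Aut(C)\<close> may be singular, so they are not treated as manifolds.
  A (reduced) complex space is given by its topology and, for every open set \<open>W\<close>, the set of
  holomorphic functions on \<open>W\<close>. Functions are total; \<open>cs_hol X W\<close> only constrains their values
  on \<open>W\<close>, and is only meant for open \<open>W\<close>.
\<close>

record 'a complex_space =
  cs_top :: "'a topology"
  cs_hol :: "'a set \<Rightarrow> ('a \<Rightarrow> complex) set"

text \<open>The space \<open>C\<^sup>n\<close>, with coordinates \<open>0, \<dots>, n - 1\<close>; as a subspace of the product
  \<open>nat \<Rightarrow> complex\<close> it carries its usual topology.\<close>

definition Cn :: "nat \<Rightarrow> (nat \<Rightarrow> complex) set" where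
  "Cn n = {z. \<forall>i\<ge>n. z i = 0}"

text \<open>Holomorphy on an open subset \<open>N\<close> of \<open>C\<^sup>n\<close>: at every point there is a complex-linear
  Frechet derivative \<open>v \<mapsto> (\<Sum>i<n. a i * v i)\<close>. The displayed limit uses the \<open>l\<^sup>1\<close> norm.\<close>

definition holomorphic_Cn :: "nat \<Rightarrow> ((nat \<Rightarrow> complex) \<Rightarrow> complex) \<Rightarrow> (nat \<Rightarrow> complex) set \<Rightarrow> bool" where
  "holomorphic_Cn n F N \<longleftrightarrow>
     (\<forall>z\<in>N. \<exists>a :: nat \<Rightarrow> complex.
        ((\<lambda>w. (F w - F z - (\<Sum>i<n. a i * (w i - z i))) / of_real (\<Sum>i<n. cmod (w i - z i)))
           \<longlongrightarrow> 0) (at z within N))"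

text \<open>The reduced structure induced on a set \<open>A\<close> by an injection \<open>e\<close> of \<open>A\<close> into \<open>C\<^sup>n\<close> (onto a
  locally closed analytic subset): holomorphic functions are locally restrictions of
  holomorphic functions of the ambient space.\<close>

definition embedded_space :: "nat \<Rightarrow> ('a \<Rightarrow> nat \<Rightarrow> complex) \<Rightarrow> 'a set \<Rightarrow> 'a complex_space" where
  "embedded_space n e A =
     \<lparr> cs_top = pullback_topology A e (top_of_set (Cn n)),
       cs_hol = (\<lambda>W. {F. \<forall>x\<in>W. \<exists>N G. openin (top_of_set (Cn n)) N \<and> e x \<in> N \<and>
                          holomorphic_Cn n G N \<and> (\<forall>y\<in>W. e y \<in> N \<longrightarrow> F y = G (e y))}) \<rparr>"

definition quotient_space :: "('a \<Rightarrow> 'b) \<Rightarrow> 'a complex_space \<Rightarrow> 'b complex_space" where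
  "quotient_space p X =
     \<lparr> cs_top = topology (\<lambda>W. W \<subseteq> p ` topspace (cs_top X) \<and>
                              openin (cs_top X) {x \<in> topspace (cs_top X). p x \<in> W}),
       cs_hol = (\<lambda>W. {F. F \<circ> p \<in> cs_hol X {x \<in> topspace (cs_top X). p x \<in> W}}) \<rparr>"

lemma openin_quotient_space:
  "openin (cs_top (quotient_space p X)) W \<longleftrightarrow>
     W \<subseteq> p ` topspace (cs_top X) \<and> openin (cs_top X) {x \<in> topspace (cs_top X). p x \<in> W}"
proof -
  let ?T = "cs_top X"
  let ?P = "\<lambda>W. W \<subseteq> p ` topspace ?T \<and> openin ?T {x \<in> topspace ?T. p x \<in> W}"
  have "istopology ?P"
    unfolding istopology_def
  proof (intro conjI allI impI)
    fix S S' assume S: "?P S" and S': "?P S'"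
    have "{x \<in> topspace ?T. p x \<in> S \<inter> S'} = {x \<in> topspace ?T. p x \<in> S} \<inter> {x \<in> topspace ?T. p x \<in> S'}"
      by blast
    moreover have "openin ?T ({x \<in> topspace ?T. p x \<in> S} \<inter> {x \<in> topspace ?T. p x \<in> S'})"
      using S S' by (intro openin_Int) blast+
    ultimately show "openin ?T {x \<in> topspace ?T. p x \<in> S \<inter> S'}" by (simp only:)
    show "S \<inter> S' \<subseteq> p ` topspace ?T" using S by blast
  next
    fix \<K> assume K: "\<forall>S\<in>\<K>. ?P S"
    have "{x \<in> topspace ?T. p x \<in> \<Union>\<K>} = (\<Union>S\<in>\<K>. {x \<in> topspace ?T. p x \<in> S})"
      by blast
    moreover have "openin ?T (\<Union>S\<in>\<K>. {x \<in> topspace ?T. p x \<in> S})"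
      using K by (intro openin_Union) blast
    ultimately show "openin ?T {x \<in> topspace ?T. p x \<in> \<Union>\<K>}" by (simp only:)
    show "\<Union>\<K> \<subseteq> p ` topspace ?T" using K by blast
  qed
  then have "openin (topology ?P) = ?P" by (rule topology_inverse')
  then show ?thesis unfolding quotient_space_def complex_space.simps by (rule fun_cong)
qed

lemma topspace_quotient_space:
  "topspace (cs_top (quotient_space p X)) = p ` topspace (cs_top X)"
proof -
  have "{x \<in> topspace (cs_top X). p x \<in> p ` topspace (cs_top X)} = topspace (cs_top X)"
    by blast
  then have "openin (cs_top (quotient_space p X)) (p ` topspace (cs_top X))"
    by (simp add: openin_quotient_space)
  then have "p ` topspace (cs_top X) \<subseteq> topspace (cs_top (quotient_space p X))"
    by (rule openin_subset)
  moreover have "topspace (cs_top (quotient_space p X)) \<subseteq> p ` topspace (cs_top X)"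
    using openin_topspace[of "cs_top (quotient_space p X)"] unfolding openin_quotient_space by (rule conjunct1)
  ultimately show ?thesis by blast
qed

lemma quotient_map_quotient_space:
  "quotient_map (cs_top X) (cs_top (quotient_space p X)) p"
  by (auto simp: quotient_map_def topspace_quotient_space openin_quotient_space)

text \<open>A biholomorphic map from the open set \<open>U\<close> of \<open>X\<close> to the open set \<open>V\<close> of \<open>Y\<close> is an
  isomorphism of the spaces with their sheaves of holomorphic functions.\<close>

definition biholomorphic_between ::
  "'a complex_space \<Rightarrow> 'a set \<Rightarrow> 'b complex_space \<Rightarrow> 'b set \<Rightarrow> ('a \<Rightarrow> 'b) \<Rightarrow> bool" where
  "biholomorphic_between X U Y V f \<longleftrightarrow>
     openin (cs_top X) U \<and> openin (cs_top Y) V \<and>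
     homeomorphic_map (subtopology (cs_top X) U) (subtopology (cs_top Y) V) f \<and>
     (\<forall>W F. openin (cs_top Y) W \<and> W \<subseteq> V \<longrightarrow>
        (F \<in> cs_hol Y W \<longleftrightarrow> F \<circ> f \<in> cs_hol X {x \<in> U. f x \<in> W}))"

definition locally_homeomorphic_map :: "'a topology \<Rightarrow> 'b topology \<Rightarrow> ('a \<Rightarrow> 'b) \<Rightarrow> bool" where
  "locally_homeomorphic_map X Y f \<longleftrightarrow>
     f \<in> topspace X \<rightarrow> topspace Y \<and>
     (\<forall>x\<in>topspace X. \<exists>W T. openin X W \<and> x \<in> W \<and> openin Y T \<and>
        homeomorphic_map (subtopology X W) (subtopology Y T) f)"

text \<open>The analogue of \<^const>\<open>covering_space\<close> for abstract topologies.\<close>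

definition covering_map :: "'a topology \<Rightarrow> 'b topology \<Rightarrow> ('a \<Rightarrow> 'b) \<Rightarrow> bool" where
  "covering_map X Y f \<longleftrightarrow>
     continuous_map X Y f \<and> f ` topspace X = topspace Y \<and>
     (\<forall>y\<in>topspace Y. \<exists>T. y \<in> T \<and> openin Y T \<and>
        (\<exists>\<V>. \<Union>\<V> = {x \<in> topspace X. f x \<in> T} \<and> (\<forall>W\<in>\<V>. openin X W) \<and> pairwise disjnt \<V> \<and>
             (\<forall>W\<in>\<V>. homeomorphic_map (subtopology X W) (subtopology Y T) f)))"

definition Poly_deg :: "nat \<Rightarrow> complex poly set" where
  "Poly_deg d = {f. degree f = d}"

text \<open>The action of \<open>\<gamma>(z) = a z + b\<close>, that is \<open>\<gamma> \<circ> f \<circ> \<gamma>\<^bsup>-1\<^esup>\<close>.\<close>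

definition aff_act :: "complex \<Rightarrow> complex \<Rightarrow> complex poly \<Rightarrow> complex poly" where
  "aff_act a b f = [:b, a:] \<circ>\<^sub>p f \<circ>\<^sub>p [:- b / a, 1 / a:]"

definition aff_conj :: "nat \<Rightarrow> (complex poly \<times> complex poly) set" where
  "aff_conj d = {(f, g). f \<in> Poly_deg d \<and> g \<in> Poly_deg d \<and> (\<exists>a b. a \<noteq> 0 \<and> g = aff_act a b f)}"

definition MP :: "nat \<Rightarrow> complex poly set set" where
  "MP d = Poly_deg d // aff_conj d"

definition moduli_class :: "nat \<Rightarrow> complex poly \<Rightarrow> complex poly set" where
  "moduli_class d f = aff_conj d `` {f}"

definition Poly_space :: "nat \<Rightarrow> complex poly complex_space" where
  "Poly_space d = embedded_space (d + 1) coeff (Poly_deg d)"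

definition MP_space :: "nat \<Rightarrow> complex poly set complex_space" where
  "MP_space d = quotient_space (moduli_class d) (Poly_space d)"

definition Fix :: "complex poly \<Rightarrow> complex multiset" where
  "Fix f = proots (f - [:0, 1:])"

definition fixed_multipliers :: "complex poly \<Rightarrow> complex multiset" where
  "fixed_multipliers f = image_mset (poly (pderiv f)) (Fix f)"

definition Phi :: "complex poly set \<Rightarrow> complex multiset" where
  "Phi c = the_elem (fixed_multipliers ` c)"

text \<open>The labels \<open>1, \<dots>, d\<close> of the multipliers are represented by \<open>0, \<dots>, d - 1\<close>.
  The quotient by the symmetric group is represented by multisets of size \<open>d\<close>.\<close>

definition Lambda :: "nat \<Rightarrow> (nat \<Rightarrow> complex) set" where
  "Lambda d = {l \<in> Cn d. (\<Sum>i<d. \<Prod>j\<in>{..<d} - {i}. (1 - l j)) = 0}"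

definition pr :: "nat \<Rightarrow> (nat \<Rightarrow> complex) \<Rightarrow> complex multiset" where
  "pr d l = image_mset l (mset_set {..<d})"

definition Lambda_space :: "nat \<Rightarrow> (nat \<Rightarrow> complex) complex_space" where
  "Lambda_space d = embedded_space d (\<lambda>l. l) (Lambda d)"

definition Lambda_tilde_space :: "nat \<Rightarrow> complex multiset complex_space" where
  "Lambda_tilde_space d = quotient_space (pr d) (Lambda_space d)"

definition V :: "nat \<Rightarrow> (nat \<Rightarrow> complex) set" where
  "V d = {l \<in> Lambda d. \<forall>i<d. l i \<noteq> 1}"

definition V_tilde :: "nat \<Rightarrow> complex multiset set" where
  "V_tilde d = pr d ` V d"

definition I_set :: "nat \<Rightarrow> (nat \<Rightarrow> complex) \<Rightarrow> nat set set" where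
  "I_set d l = {I. I \<subset> {..<d} \<and> I \<noteq> {} \<and> (\<Sum>i\<in>I. 1 / (1 - l i)) = 0}"

definition K_set :: "nat \<Rightarrow> (nat \<Rightarrow> complex) \<Rightarrow> nat set set" where
  "K_set d l = {K. K \<subseteq> {..<d} \<and> K \<noteq> {} \<and> (\<forall>i\<in>K. \<forall>j\<in>K. l i = l j)}"

definition V_tilde_IK :: "nat \<Rightarrow> nat set set \<Rightarrow> nat set set \<Rightarrow> complex multiset set" where
  "V_tilde_IK d \<I> \<K> = pr d ` {l \<in> V d. I_set d l = \<I> \<and> K_set d l = \<K>}"

definition V_tilde_I :: "nat \<Rightarrow> nat set set \<Rightarrow> complex multiset set" where
  "V_tilde_I d \<I> = pr d ` {l \<in> V d. I_set d l = \<I>}"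

definition V_tilde_K :: "nat \<Rightarrow> nat set set \<Rightarrow> complex multiset set" where
  "V_tilde_K d \<K> = pr d ` {l \<in> V d. K_set d l = \<K>}"

definition Phi_preimage :: "nat \<Rightarrow> complex multiset set \<Rightarrow> complex poly set set" where
  "Phi_preimage d S = {c \<in> MP d. Phi c \<in> S}"

definition pr_preimage :: "nat \<Rightarrow> complex multiset set \<Rightarrow> (nat \<Rightarrow> complex) set" where
  "pr_preimage d S = {l \<in> Lambda d. pr d l \<in> S}"

abbreviation MP_sub :: "nat \<Rightarrow> complex poly set set \<Rightarrow> complex poly set topology" where
  "MP_sub d S \<equiv> subtopology (cs_top (MP_space d)) S"

abbreviation Lambda_tilde_sub :: "nat \<Rightarrow> complex multiset set \<Rightarrow> complex multiset topology" where
  "Lambda_tilde_sub d S \<equiv> subtopology (cs_top (Lambda_tilde_space d)) S"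

lemma degree_aff_act: "a \<noteq> 0 \<Longrightarrow> degree (aff_act a b f) = degree f"
  by (simp add: aff_act_def degree_pcompose)

lemma poly_aff_act: "poly (aff_act a b f) z = a * poly f ((z - b) / a) + b"
  by (simp add: aff_act_def poly_pcompose algebra_simps diff_divide_distrib)

lemma aff_act_id: "aff_act 1 0 f = f"
  by (rule poly_ext) (simp add: poly_aff_act)

lemma aff_act_comp:
  assumes "a \<noteq> 0" "a' \<noteq> 0"
  shows "aff_act a b (aff_act a' b' f) = aff_act (a * a') (a * b' + b) f"
proof (rule poly_ext)
  fix z
  have "((z - b) / a - b') / a' = (z - (a * b' + b)) / (a * a')"
    using assms by (simp add: field_simps)
  then show "poly (aff_act a b (aff_act a' b' f)) z = poly (aff_act (a * a') (a * b' + b) f) z"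
    by (simp add: poly_aff_act algebra_simps)
qed

lemma equiv_aff_conj: "equiv (Poly_deg d) (aff_conj d)"
proof (rule equivI)
  show "aff_conj d \<subseteq> Poly_deg d \<times> Poly_deg d" by (auto simp: aff_conj_def)
  show "refl_on (Poly_deg d) (aff_conj d)"
  proof (rule refl_onI)
    fix f assume "f \<in> Poly_deg d"
    moreover have "\<exists>a b. a \<noteq> 0 \<and> f = aff_act a b f"
      using aff_act_id[of f] one_neq_zero by metis
    ultimately show "(f, f) \<in> aff_conj d" by (simp add: aff_conj_def)
  qed
  show "sym (aff_conj d)"
  proof (rule symI)
    fix f g assume "(f, g) \<in> aff_conj d"
    then obtain a b where fg: "f \<in> Poly_deg d" "g \<in> Poly_deg d" "a \<noteq> 0" "g = aff_act a b f"
      by (auto simp: aff_conj_def)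
    have "aff_act (1 / a) (- b / a) g = aff_act 1 0 f"
      unfolding fg(4) using fg(3) by (subst aff_act_comp) (auto simp: field_simps)
    then have "f = aff_act (1 / a) (- b / a) g" by (simp add: aff_act_id)
    then have "\<exists>a b. a \<noteq> 0 \<and> f = aff_act a b g"
      using fg(3) by (intro exI[of _ "1 / a"] exI[of _ "- b / a"]) simp
    then show "(g, f) \<in> aff_conj d" using fg(1,2) by (simp add: aff_conj_def)
  qed
  show "trans (aff_conj d)"
  proof (rule transI)
    fix f g h assume "(f, g) \<in> aff_conj d" "(g, h) \<in> aff_conj d"
    then obtain a b a' b' where fg: "f \<in> Poly_deg d" "a \<noteq> 0" "g = aff_act a b f"
      and gh: "h \<in> Poly_deg d" "a' \<noteq> 0" "h = aff_act a' b' g"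
      by (auto simp: aff_conj_def)
    have "h = aff_act (a' * a) (a' * b + b') f"
      unfolding gh(3) fg(3) using fg(2) gh(2) by (rule aff_act_comp[rotated])
    then have "\<exists>a b. a \<noteq> 0 \<and> h = aff_act a b f"
      using fg(2) gh(2) by (intro exI[of _ "a' * a"] exI[of _ "a' * b + b'"]) simp
    then show "(f, h) \<in> aff_conj d" using fg(1) gh(1) by (simp add: aff_conj_def)
  qed
qed

lemma proots_prod_linear: "proots (\<Prod>x\<in>#A. [:- x, 1:]) = (A :: complex multiset)"
proof (induction A)
  case (add x A)
  have "(\<Prod>x\<in>#A. [:- x, 1:]) \<noteq> 0" by auto
  then have "proots ([:- x, 1:] * (\<Prod>x\<in>#A. [:- x, 1:])) = proots [:- x, 1:] + proots (\<Prod>x\<in>#A. [:- x, 1:])"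
    by (intro proots_mult) auto
  then show ?case using add by (simp del: mult_pCons_left mult_pCons_right)
qed simp

lemma proots_pcompose_linear:
  fixes p :: "complex poly"
  assumes "a \<noteq> 0" "p \<noteq> 0"
  shows "proots (p \<circ>\<^sub>p [:- b / a, 1 / a:]) = image_mset (\<lambda>z. a * z + b) (proots p)"
proof -
  have lin: "[:- x, 1:] \<circ>\<^sub>p [:- b / a, 1 / a:] = smult (1 / a) [:- (a * x + b), 1:]" for x
    using assms(1) by (simp add: pcompose_pCons field_simps)
  have split: "\<exists>c. c \<noteq> 0 \<and> (\<Prod>x\<in>#A. [:- x, 1:]) \<circ>\<^sub>p [:- b / a, 1 / a:] =
      smult c (\<Prod>x\<in>#image_mset (\<lambda>z. a * z + b) A. [:- x, 1:])" for A
  proof (induction A)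
    case empty
    show ?case by (intro exI[of _ 1]) (simp add: pcompose_1)
  next
    case (add x A)
    then obtain c where "c \<noteq> 0" and c: "(\<Prod>x\<in>#A. [:- x, 1:]) \<circ>\<^sub>p [:- b / a, 1 / a:] =
      smult c (\<Prod>x\<in>#image_mset (\<lambda>z. a * z + b) A. [:- x, 1:])" by blast
    have "(\<Prod>x\<in>#add_mset x A. [:- x, 1:]) \<circ>\<^sub>p [:- b / a, 1 / a:] =
        ([:- x, 1:] \<circ>\<^sub>p [:- b / a, 1 / a:]) * ((\<Prod>x\<in>#A. [:- x, 1:]) \<circ>\<^sub>p [:- b / a, 1 / a:])"
      by (simp only: image_mset_add_mset prod_mset.add_mset pcompose_mult)
    also have "\<dots> = smult (c * (1 / a)) (\<Prod>x\<in>#image_mset (\<lambda>z. a * z + b) (add_mset x A). [:- x, 1:])"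
      unfolding lin c
      by (simp only: image_mset_add_mset prod_mset.add_mset mult_smult_left mult_smult_right smult_smult)
    finally show ?case
      using \<open>c \<noteq> 0\<close> assms(1) by (intro exI[of _ "c * (1 / a)"]) simp
  qed
  obtain c where c: "c \<noteq> 0" "(\<Prod>x\<in>#proots p. [:- x, 1:]) \<circ>\<^sub>p [:- b / a, 1 / a:] =
      smult c (\<Prod>x\<in>#image_mset (\<lambda>z. a * z + b) (proots p). [:- x, 1:])"
    using split by blast
  have "p \<circ>\<^sub>p [:- b / a, 1 / a:] =
      smult (lead_coeff p) ((\<Prod>x\<in>#proots p. [:- x, 1:]) \<circ>\<^sub>p [:- b / a, 1 / a:])"
    by (metis complex_poly_decompose_multiset pcompose_smult)
  then show ?thesis
    using assms(2) c(1) by (simp only: c(2) proots_smult proots_prod_linear leading_coeff_0_iff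
        not_False_eq_True simp_thms)
qed

lemma fixed_multipliers_aff_act:
  assumes "a \<noteq> 0" "f \<noteq> [:0, 1:]"
  shows "fixed_multipliers (aff_act a b f) = fixed_multipliers f"
proof -
  have eq: "aff_act a b f - [:0, 1:] = smult a ((f - [:0, 1:]) \<circ>\<^sub>p [:- b / a, 1 / a:])"
    by (rule poly_ext) (use assms in \<open>simp add: poly_aff_act poly_pcompose field_simps\<close>)
  have nz: "f - [:0, 1:] \<noteq> 0" using assms(2) by simp
  have "Fix (aff_act a b f) = image_mset (\<lambda>z. a * z + b) (Fix f)"
    unfolding Fix_def eq using assms(1) proots_pcompose_linear[OF assms(1) nz, of b]
    by (simp only: proots_smult simp_thms)
  moreover have "poly (pderiv (aff_act a b f)) (a * z + b) = poly (pderiv f) z" for z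
  proof -
    have "- (b / a) + (a * z + b) / a = z" using assms(1) by (simp add: field_simps)
    then show ?thesis
      using assms(1) by (simp add: aff_act_def pderiv_pcompose poly_pcompose pderiv_pCons)
  qed
  ultimately show ?thesis
    by (simp add: fixed_multipliers_def image_mset.compositionality o_def)
qed

lemma Phi_class:
  assumes "d \<ge> 2" "f \<in> Poly_deg d"
  shows "Phi (moduli_class d f) = fixed_multipliers f"
proof -
  have "f \<noteq> [:0, 1:]" using assms by (auto simp: Poly_deg_def)
  then have "fixed_multipliers g = fixed_multipliers f" if "(f, g) \<in> aff_conj d" for g
    using that by (auto simp: aff_conj_def fixed_multipliers_aff_act)
  moreover have "(f, f) \<in> aff_conj d"
    using equiv_aff_conj assms(2) by (auto simp: equiv_def refl_on_def)
  ultimately have "fixed_multipliers ` moduli_class d f = {fixed_multipliers f}"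
    unfolding moduli_class_def by blast
  then show ?thesis by (simp add: Phi_def)
qed

end

theory Submission
  imports Defs "HOL-Combinatorics.Permutations"
begin

text \<open>
  Over \<open>V d\<close> every fixed point \<open>\<zeta>\<close> of \<open>f\<close> is simple, and \<open>1 / (1 - f' \<zeta>)\<close> is the residue of
  \<open>1 / (z - f z)\<close> at \<open>\<zeta>\<close>. In terms of these residues \<open>m i\<close>, the set \<open>V d\<close> consists of the tuples of
  nonzero numbers with sum zero (\<open>Res\<close>), \<open>\<I>\<close> lists the nonempty proper subsets over which the residues sum
  to zero, and \<open>\<K>\<close> records which residues coincide: both are cut out by linear forms. The partial
  fraction expansion \<open>1 / (z - f z) = (\<Sum>i. m i / (z - z i))\<close> vanishes to order \<open>d\<close> at infinity, which
  says that \<open>(\<Sum>i. m i * g (z i)) = 0\<close> for all polynomials \<open>g\<close> of degree at most \<open>d - 2\<close>, and distinct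
  points satisfying these equations determine \<open>f\<close>. Moving the first two fixed points to 0 and 1 removes
  the affine group. Hence, over \<open>V d\<close>, the map \<open>\<Phi>\<close> is the labelled map that sends a pair \<open>(m, z)\<close>, with
  \<open>z\<close> a normalised configuration in \<open>config d m\<close>, to \<open>m\<close>, divided by the permutations of the labels.

  The labelled map has two properties. It is etale (\<open>config_local_equations\<close>, \<open>config_section\<close>), since
  testing with antiderivatives of a Lagrange basis diagonalises its derivative. It is proper as long as
  no new vanishing sum of residues appears in the limit (\<open>config_sequentially_compact\<close>): if a rescaled
  sequence of configurations converges, but points merge, then each merging cluster has residue sum zero
  and so do the same labels along the sequence. Linear algebra then gives nonconstant polynomials
  of small degree that are constant on every cluster along the sequence, and the limit of these
  polynomials, made compact by scaling, has a derivative with more zeros than its degree permits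
  (\<open>limit_configuration_injective\<close>).

  For the first part, points \<open>m\<close>, \<open>m'\<close> with the same \<open>\<I>\<close> and \<open>\<K>\<close> lie in one stratum of a hyperplane
  arrangement, and a path from \<open>m\<close> to \<open>m'\<close> on the complex line through them stays in the stratum.
  Translation along this path moves a whole polydisc around \<open>m\<close> to a polydisc around \<open>m'\<close> and keeps every
  point in its own stratum. By properness and etaleness configurations can be continued uniquely along
  the translation, and the result depends holomorphically on the starting point (locale \<open>transport\<close>).
  The permutations that move a point of the polydisc to another one fix \<open>m\<close>, hence also \<open>m'\<close>
  because \<open>\<K>\<close> is the same, so transport is equivariant and descends to \<open>MP d\<close>. Transport along the reversed
  path is the inverse.

  For the second part, near a point of \<open>V_tilde_I\<close> the set \<open>\<I>\<close> is locally constant in suitable labels,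
  so sequential compactness gives closedness of \<open>\<Phi>\<close> and finiteness of its fibres. Over \<open>V_tilde_K\<close> nearby
  labelled points are determined by their classes, so the local sections of the labelled map descend.
  Over \<open>V_tilde_IK\<close>, a connected and locally connected space, a proper local homeomorphism with Hausdorff
  source is a covering on each component (\<open>proper_local_homeomorphism_component_covering\<close>).
\<close>

section \<open>Polydiscs and complex differentiability\<close>

definition polydisc :: "nat \<Rightarrow> (nat \<Rightarrow> complex) \<Rightarrow> real \<Rightarrow> (nat \<Rightarrow> complex) set" where
  "polydisc n z r = {w \<in> Cn n. \<forall>i<n. cmod (w i - z i) < r}"

text \<open>The neighbourhood filter of \<open>z\<close> in \<open>Cn n\<close>, the centre included. Phrasing openness, continuity and
  differentiability by this one filter avoids the topology of the function space that contains \<open>Cn n\<close>.\<close>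

definition near :: "nat \<Rightarrow> (nat \<Rightarrow> complex) \<Rightarrow> (nat \<Rightarrow> complex) filter" where
  "near n z = (INF r\<in>{0<..}. principal (polydisc n z r))"

lemma polydisc_mono: "r \<le> s \<Longrightarrow> polydisc n z r \<subseteq> polydisc n z s"
  by (auto simp: polydisc_def)

lemma polydisc_subset_Cn: "polydisc n z r \<subseteq> Cn n"
  by (auto simp: polydisc_def)

lemma centre_in_polydisc: "z \<in> Cn n \<Longrightarrow> 0 < r \<Longrightarrow> z \<in> polydisc n z r"
  by (auto simp: polydisc_def)

lemma eventually_near: "eventually P (near n z) \<longleftrightarrow> (\<exists>r>0. \<forall>w\<in>polydisc n z r. P w)"
proof -
  have "eventually P (near n z) \<longleftrightarrow> (\<exists>r\<in>{0<..}. eventually P (principal (polydisc n z r)))"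
    unfolding near_def
  proof (rule eventually_INF_base)
    fix a b :: real assume "a \<in> {0<..}" "b \<in> {0<..}"
    then show "\<exists>x\<in>{0<..}. principal (polydisc n z x) \<le> inf (principal (polydisc n z a)) (principal (polydisc n z b))"
      by (intro bexI[of _ "min a b"]) (auto simp: polydisc_def)
  qed auto
  then show ?thesis by (auto simp: eventually_principal)
qed

lemma eventually_near_centre: "eventually P (near n z) \<Longrightarrow> z \<in> Cn n \<Longrightarrow> P z"
  by (auto simp: eventually_near dest: centre_in_polydisc)

lemma eventually_polydisc_near: "r > 0 \<Longrightarrow> eventually (\<lambda>w. w \<in> polydisc n z r) (near n z)"
  by (auto simp: eventually_near)

lemma polydisc_near:
  assumes "w \<in> polydisc n z r"
  shows "eventually (\<lambda>v. v \<in> polydisc n z r) (near n w)"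
proof -
  define s where "s = Min (insert 1 ((\<lambda>i. r - cmod (w i - z i)) ` {..<n}))"
  have s: "s > 0" "\<And>i. i < n \<Longrightarrow> s \<le> r - cmod (w i - z i)"
    using assms by (auto simp: s_def polydisc_def)
  have "v \<in> polydisc n z r" if v: "v \<in> polydisc n w s" for v
  proof -
    have "cmod (v i - z i) < r" if "i < n" for i
    proof -
      have "cmod (v i - w i) < s" using v that by (auto simp: polydisc_def)
      moreover have "cmod (v i - z i) \<le> cmod (v i - w i) + cmod (w i - z i)"
        using norm_triangle_ineq[of "v i - w i" "w i - z i"] by simp
      ultimately show ?thesis using s(2)[OF that] by linarith
    qed
    then show ?thesis using v by (auto simp: polydisc_def)
  qed
  then show ?thesis using s(1) unfolding eventually_near by blast
qed

lemma filterlim_near: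
  "filterlim f (near n z) F \<longleftrightarrow>
     eventually (\<lambda>x. f x \<in> Cn n) F \<and> (\<forall>i<n. ((\<lambda>x. f x i) \<longlongrightarrow> z i) F)"
proof
  assume L: "filterlim f (near n z) F"
  have ev: "eventually (\<lambda>x. f x \<in> polydisc n z r) F" if "r > 0" for r
    using eventually_compose_filterlim[OF eventually_polydisc_near[OF that] L] .
  have "((\<lambda>x. f x i) \<longlongrightarrow> z i) F" if "i < n" for i
    unfolding tendsto_iff
  proof (intro allI impI)
    fix e :: real assume "e > 0"
    from ev[OF this] show "eventually (\<lambda>x. dist (f x i) (z i) < e) F"
      by (rule eventually_mono) (use that in \<open>auto simp: polydisc_def dist_norm\<close>)
  qed
  moreover have "eventually (\<lambda>x. f x \<in> Cn n) F"
    using ev[OF zero_less_one] by (rule eventually_mono) (auto simp: polydisc_def)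
  ultimately show "eventually (\<lambda>x. f x \<in> Cn n) F \<and> (\<forall>i<n. ((\<lambda>x. f x i) \<longlongrightarrow> z i) F)" by blast
next
  assume R: "eventually (\<lambda>x. f x \<in> Cn n) F \<and> (\<forall>i<n. ((\<lambda>x. f x i) \<longlongrightarrow> z i) F)"
  show "filterlim f (near n z) F"
    unfolding filterlim_iff
  proof (intro allI impI)
    fix P assume "eventually P (near n z)"
    then obtain r where r: "r > 0" "\<And>w. w \<in> polydisc n z r \<Longrightarrow> P w" by (auto simp: eventually_near)
    have "eventually (\<lambda>x. \<forall>i\<in>{..<n}. dist (f x i) (z i) < r) F"
      using R r(1) by (intro eventually_ball_finite) (auto simp: tendsto_iff)
    with conjunct1[OF R] show "eventually (\<lambda>x. P (f x)) F"
      by (rule eventually_elim2) (auto intro!: r(2) simp: polydisc_def dist_norm)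
  qed
qed

lemma tendsto_coord_near: "i < n \<Longrightarrow> ((\<lambda>w. w i) \<longlongrightarrow> z i) (near n z)"
  using filterlim_ident[of "near n z"] by (auto simp: filterlim_near)

lemma openin_Cn_iff:
  "openin (top_of_set (Cn n)) N \<longleftrightarrow> N \<subseteq> Cn n \<and> (\<forall>z\<in>N. eventually (\<lambda>w. w \<in> N) (near n z))"
proof
  assume "openin (top_of_set (Cn n)) N"
  then obtain O' where O': "open O'" "N = Cn n \<inter> O'" by (auto simp: openin_open)
  have "\<exists>r>0. \<forall>w\<in>polydisc n z r. w \<in> N" if "z \<in> N" for z
  proof -
    have "openin (product_topology (\<lambda>i. euclidean) UNIV) O'" "z \<in> O'"
      using O' that by (auto simp: open_fun_def)
    then have "\<exists>U. finite {i \<in> UNIV. U i \<noteq> topspace euclidean} \<and> (\<forall>i\<in>UNIV. openin euclidean (U i)) \<and>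
        z \<in> Pi\<^sub>E UNIV U \<and> Pi\<^sub>E UNIV U \<subseteq> O'"
      unfolding openin_product_topology_alt by (rule bspec)
    then obtain U where "\<forall>i\<in>UNIV. openin euclidean (U i)" and U: "z \<in> Pi\<^sub>E UNIV U" "Pi\<^sub>E UNIV U \<subseteq> O'"
      by blast
    then have Uo: "\<And>i. open (U i)" by simp
    have "\<exists>e>0. \<forall>y. dist y (z i) < e \<longrightarrow> y \<in> U i" for i
      using Uo[of i] U(1) unfolding open_dist by (auto simp: PiE_iff)
    then obtain e where e: "\<And>i. e i > 0" "\<And>i y. dist y (z i) < e i \<Longrightarrow> y \<in> U i" by metis
    define r where "r = Min (insert 1 (e ` {..<n}))"
    have r: "r > 0" "\<And>i. i < n \<Longrightarrow> r \<le> e i" using e(1) by (auto simp: r_def)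
    have "w \<in> N" if w: "w \<in> polydisc n z r" for w
    proof -
      have "w i \<in> U i" for i
      proof (cases "i < n")
        case True
        then have "cmod (w i - z i) < r" using w by (auto simp: polydisc_def)
        then have "dist (w i) (z i) < e i" using r(2)[OF True] by (simp add: dist_norm)
        then show ?thesis by (rule e(2))
      next
        case False
        then have "w i = z i" using w that \<open>z \<in> N\<close> O'(2) by (auto simp: polydisc_def Cn_def)
        then show ?thesis using U(1) by (auto simp: PiE_iff)
      qed
      then have "w \<in> O'" using U(2) by (auto simp: PiE_iff)
      then show ?thesis using O'(2) w by (auto simp: polydisc_def)
    qed
    then show ?thesis using r(1) by blast
  qed
  then show "N \<subseteq> Cn n \<and> (\<forall>z\<in>N. eventually (\<lambda>w. w \<in> N) (near n z))"
    using O' by (auto simp: eventually_near)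
next
  assume R: "N \<subseteq> Cn n \<and> (\<forall>z\<in>N. eventually (\<lambda>w. w \<in> N) (near n z))"
  then obtain r where r: "\<And>z. z \<in> N \<Longrightarrow> r z > 0" "\<And>z. z \<in> N \<Longrightarrow> polydisc n z (r z) \<subseteq> N"
    unfolding eventually_near subset_eq by metis
  have "open {w::nat \<Rightarrow> complex. cmod (w i - z i) < s}" for i z s
    by (intro open_Collect_less continuous_intros continuous_on_product_coordinates)
  then have op: "open (\<Inter>i\<in>{..<n}. {w::nat \<Rightarrow> complex. cmod (w i - z i) < s})" for z s
    by (intro open_INT) auto
  have "N = Cn n \<inter> (\<Union>z\<in>N. \<Inter>i\<in>{..<n}. {w. cmod (w i - z i) < r z})"
  proof (intro set_eqI iffI)
    fix x assume "x \<in> N"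
    then show "x \<in> Cn n \<inter> (\<Union>z\<in>N. \<Inter>i\<in>{..<n}. {w. cmod (w i - z i) < r z})"
      using R r(1)[of x] by (intro IntI UN_I[of x]) auto
  next
    fix x assume "x \<in> Cn n \<inter> (\<Union>z\<in>N. \<Inter>i\<in>{..<n}. {w. cmod (w i - z i) < r z})"
    then obtain z where "z \<in> N" "x \<in> polydisc n z (r z)" by (auto simp: polydisc_def)
    then show "x \<in> N" using r(2) by blast
  qed
  moreover have "open (\<Union>z\<in>N. \<Inter>i\<in>{..<n}. {w. cmod (w i - z i) < r z})"
    using op by (intro open_UN) auto
  ultimately show "openin (top_of_set (Cn n)) N" unfolding openin_open by blast
qed

lemma openin_polydisc: "openin (top_of_set (Cn n)) (polydisc n z r)"
  by (simp add: openin_Cn_iff polydisc_near polydisc_subset_Cn)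

lemma eventually_at_within_Cn:
  assumes N: "openin (top_of_set (Cn n)) N" and z: "z \<in> N"
  shows "eventually P (at z within N) \<longleftrightarrow> eventually (\<lambda>w. w \<noteq> z \<longrightarrow> P w) (near n z)"
proof
  assume "eventually P (at z within N)"
  then obtain S where S: "open S" "z \<in> S" "\<And>x. x \<in> S \<Longrightarrow> x \<noteq> z \<Longrightarrow> x \<in> N \<Longrightarrow> P x"
    unfolding eventually_at_topological by auto
  have "openin (top_of_set (Cn n)) (N \<inter> S)" using N S(1) by (rule openin_Int_open)
  then have "eventually (\<lambda>w. w \<in> N \<inter> S) (near n z)"
    using z S(2) by (auto simp: openin_Cn_iff)
  then show "eventually (\<lambda>w. w \<noteq> z \<longrightarrow> P w) (near n z)"
    by (rule eventually_mono) (use S(3) in auto)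
next
  assume "eventually (\<lambda>w. w \<noteq> z \<longrightarrow> P w) (near n z)"
  then obtain r where r: "r > 0" "\<And>w. w \<in> polydisc n z r \<Longrightarrow> w \<noteq> z \<Longrightarrow> P w"
    by (auto simp: eventually_near)
  obtain O' where O': "open O'" "polydisc n z r = Cn n \<inter> O'"
    using openin_polydisc[of n z r] by (auto simp: openin_open)
  have "N \<subseteq> Cn n" using N by (simp add: openin_Cn_iff)
  then have "z \<in> O'" using O'(2) centre_in_polydisc[of z n r] r(1) z by auto
  then show "eventually P (at z within N)"
    unfolding eventually_at_topological using O' r(2) \<open>N \<subseteq> Cn n\<close> by blast
qed

definition l1 :: "nat \<Rightarrow> (nat \<Rightarrow> complex) \<Rightarrow> (nat \<Rightarrow> complex) \<Rightarrow> real" where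
  "l1 n w z = (\<Sum>i<n. cmod (w i - z i))"

text \<open>Complex differentiability with the denominator of the difference quotient multiplied out, so that
  the centre needs no exception.\<close>

definition cdiff :: "nat \<Rightarrow> ((nat \<Rightarrow> complex) \<Rightarrow> complex) \<Rightarrow> (nat \<Rightarrow> complex) \<Rightarrow> bool" where
  "cdiff n F z \<longleftrightarrow> (\<exists>a. \<forall>e>0. eventually (\<lambda>w. cmod (F w - F z - (\<Sum>i<n. a i * (w i - z i))) \<le> e * l1 n w z) (near n z))"

lemma l1_nonneg: "0 \<le> l1 n w z"
  by (simp add: l1_def sum_nonneg)

lemma l1_ge: "i < n \<Longrightarrow> cmod (w i - z i) \<le> l1 n w z"
  unfolding l1_def by (rule member_le_sum) auto

lemma l1_pos: "w \<in> Cn n \<Longrightarrow> z \<in> Cn n \<Longrightarrow> w \<noteq> z \<Longrightarrow> 0 < l1 n w z"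
proof -
  assume "w \<in> Cn n" "z \<in> Cn n" "w \<noteq> z"
  then obtain i where "w i \<noteq> z i" "i < n" by (auto simp: Cn_def fun_eq_iff) (metis linorder_not_le)
  then show ?thesis using l1_ge[of i n w z] by (smt (verit) zero_less_norm_iff right_minus_eq)
qed

lemma cmod_linear_le: "cmod (\<Sum>i<n. a i * (w i - z i)) \<le> (\<Sum>i<n. cmod (a i)) * l1 n w z"
proof -
  have "cmod (\<Sum>i<n. a i * (w i - z i)) \<le> (\<Sum>i<n. cmod (a i) * cmod (w i - z i))"
    by (rule order_trans[OF norm_sum]) (simp add: norm_mult)
  also have "\<dots> \<le> (\<Sum>i<n. cmod (a i) * l1 n w z)"
    by (intro sum_mono mult_left_mono l1_ge) auto
  finally show ?thesis by (simp add: sum_distrib_right)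
qed

lemma holomorphic_Cn_iff:
  assumes N: "openin (top_of_set (Cn n)) N"
  shows "holomorphic_Cn n F N \<longleftrightarrow> (\<forall>z\<in>N. cdiff n F z)"
proof -
  have "(((\<lambda>w. (F w - F z - (\<Sum>i<n. a i * (w i - z i))) / of_real (\<Sum>i<n. cmod (w i - z i)))
           \<longlongrightarrow> 0) (at z within N)) \<longleftrightarrow>
     (\<forall>e>0. eventually (\<lambda>w. cmod (F w - F z - (\<Sum>i<n. a i * (w i - z i))) \<le> e * l1 n w z) (near n z))"
    (is "?L \<longleftrightarrow> ?R") if z: "z \<in> N" for z a
  proof -
    have zC: "z \<in> Cn n" using N z by (auto simp: openin_Cn_iff)
    let ?Q = "\<lambda>w. F w - F z - (\<Sum>i<n. a i * (w i - z i))"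
    have *: "cmod (?Q w / of_real (\<Sum>i<n. cmod (w i - z i))) = cmod (?Q w) / l1 n w z" for w
      using l1_nonneg[of n w z] unfolding norm_divide norm_of_real l1_def by simp
    have pos: "eventually (\<lambda>w. w \<noteq> z \<longrightarrow> 0 < l1 n w z) (near n z)"
      using eventually_polydisc_near[OF zero_less_one, of n z]
      by (rule eventually_mono) (auto simp: polydisc_def intro: l1_pos zC)
    have "?L \<longleftrightarrow> (\<forall>e>0. eventually (\<lambda>w. w \<noteq> z \<longrightarrow> cmod (?Q w) / l1 n w z < e) (near n z))"
      unfolding tendsto_iff dist_norm diff_0_right * eventually_at_within_Cn[OF N z] ..
    also have "\<dots> \<longleftrightarrow> ?R"
    proof safe
      fix e :: real assume L: "\<forall>e>0. eventually (\<lambda>w. w \<noteq> z \<longrightarrow> cmod (?Q w) / l1 n w z < e) (near n z)" and "e > 0"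
      then have "eventually (\<lambda>w. w \<noteq> z \<longrightarrow> cmod (?Q w) / l1 n w z < e) (near n z)" by blast
      then show "eventually (\<lambda>w. cmod (?Q w) \<le> e * l1 n w z) (near n z)"
        using pos by (rule eventually_elim2) (auto simp: pos_divide_less_eq l1_def)
    next
      fix e :: real assume R: ?R and "e > 0"
      then have "eventually (\<lambda>w. cmod (?Q w) \<le> e/2 * l1 n w z) (near n z)" by (meson half_gt_zero)
      then show "eventually (\<lambda>w. w \<noteq> z \<longrightarrow> cmod (?Q w) / l1 n w z < e) (near n z)"
        using pos
      proof (rule eventually_elim2, intro impI)
        fix w assume a: "cmod (?Q w) \<le> e/2 * l1 n w z" "w \<noteq> z \<longrightarrow> 0 < l1 n w z" "w \<noteq> z"
        then have "cmod (?Q w) / l1 n w z \<le> e / 2" by (simp add: pos_divide_le_eq)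
        then show "cmod (?Q w) / l1 n w z < e" using \<open>e > 0\<close> by linarith
      qed
    qed
    finally show ?thesis .
  qed
  then show ?thesis by (auto simp: holomorphic_Cn_def cdiff_def)
qed

lemma cdiff_lipschitz:
  assumes "cdiff n F z"
  obtains C where "C > 0" "eventually (\<lambda>w. cmod (F w - F z) \<le> C * l1 n w z) (near n z)"
proof -
  obtain a where a: "\<And>e. e > 0 \<Longrightarrow> eventually (\<lambda>w. cmod (F w - F z - (\<Sum>i<n. a i * (w i - z i))) \<le> e * l1 n w z) (near n z)"
    using assms by (auto simp: cdiff_def)
  have "eventually (\<lambda>w. cmod (F w - F z) \<le> (1 + (\<Sum>i<n. cmod (a i))) * l1 n w z) (near n z)"
    using a[OF zero_less_one]
  proof (rule eventually_mono)
    fix w assume "cmod (F w - F z - (\<Sum>i<n. a i * (w i - z i))) \<le> 1 * l1 n w z"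
    then show "cmod (F w - F z) \<le> (1 + (\<Sum>i<n. cmod (a i))) * l1 n w z"
      using cmod_linear_le[of a w z n] norm_triangle_ineq[of "F w - F z - (\<Sum>i<n. a i * (w i - z i))" "\<Sum>i<n. a i * (w i - z i)"]
      by (simp add: algebra_simps)
  qed
  moreover have "0 < 1 + (\<Sum>i<n. cmod (a i))" by (simp add: add_pos_nonneg sum_nonneg)
  ultimately show ?thesis using that by blast
qed

lemma l1_tendsto: "((\<lambda>w. l1 n w z) \<longlongrightarrow> 0) (near n z)"
proof -
  have "((\<lambda>w. l1 n w z) \<longlongrightarrow> (\<Sum>i<n. cmod (z i - z i))) (near n z)"
    unfolding l1_def by (intro tendsto_sum tendsto_norm tendsto_diff tendsto_const tendsto_coord_near) auto
  then show ?thesis by simp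
qed

lemma cdiff_tendsto:
  assumes "cdiff n F z"
  shows "(F \<longlongrightarrow> F z) (near n z)"
proof -
  obtain C where C: "C > 0" "eventually (\<lambda>w. cmod (F w - F z) \<le> C * l1 n w z) (near n z)"
    using cdiff_lipschitz[OF assms] .
  have "((\<lambda>w. C * l1 n w z) \<longlongrightarrow> C * 0) (near n z)" by (intro tendsto_mult tendsto_const l1_tendsto)
  then have "((\<lambda>w. F w - F z) \<longlongrightarrow> 0) (near n z)"
    using Lim_null_comparison[OF C(2)] by simp
  then show ?thesis by (simp add: LIM_zero_iff)
qed

lemma cdiff_const: "cdiff n (\<lambda>w. c) z"
  unfolding cdiff_def by (rule exI[of _ "\<lambda>_. 0"]) (auto simp: l1_nonneg)

lemma cdiff_coord: "cdiff n (\<lambda>w. w j) z" if "j < n"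
proof -
  have "(\<Sum>i<n. (if i = j then 1 else 0) * (w i - z i)) = w j - z j" for w
    using that by (simp add: if_distrib[of "\<lambda>x. x * _"] sum.delta cong: if_cong)
  then show ?thesis
    unfolding cdiff_def by (intro exI[of _ "\<lambda>i. if i = j then 1 else 0"]) (auto simp: l1_nonneg)
qed

text \<open>Chain rule. Sums, products and quotients of differentiable functions are obtained from it.\<close>

lemma cdiff_compose:
  assumes F: "cdiff k F (\<Psi> z)" and \<Psi>: "\<And>j. j < k \<Longrightarrow> cdiff n (\<lambda>w. \<Psi> w j) z"
    and C: "eventually (\<lambda>w. \<Psi> w \<in> Cn k) (near n z)"
  shows "cdiff n (\<lambda>w. F (\<Psi> w)) z"
proof -
  obtain c where c: "\<And>e. e > 0 \<Longrightarrow> eventually (\<lambda>w. cmod (F w - F (\<Psi> z) - (\<Sum>i<k. c i * (w i - \<Psi> z i))) \<le> e * l1 k w (\<Psi> z)) (near k (\<Psi> z))"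
    using F by (auto simp: cdiff_def)
  have "\<forall>j. \<exists>a. j < k \<longrightarrow> (\<forall>e>0. eventually (\<lambda>w. cmod (\<Psi> w j - \<Psi> z j - (\<Sum>i<n. a i * (w i - z i))) \<le> e * l1 n w z) (near n z))"
    using \<Psi> by (auto simp: cdiff_def)
  then obtain a where a: "\<And>j e. j < k \<Longrightarrow> e > 0 \<Longrightarrow> eventually (\<lambda>w. cmod (\<Psi> w j - \<Psi> z j - (\<Sum>i<n. a j i * (w i - z i))) \<le> e * l1 n w z) (near n z)"
    using choice[of "\<lambda>j a. j < k \<longrightarrow> (\<forall>e>0. eventually (\<lambda>w. cmod (\<Psi> w j - \<Psi> z j - (\<Sum>i<n. a i * (w i - z i))) \<le> e * l1 n w z) (near n z))"]
    by blast
  have "\<forall>j. \<exists>C>0. j < k \<longrightarrow> eventually (\<lambda>w. cmod (\<Psi> w j - \<Psi> z j) \<le> C * l1 n w z) (near n z)"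
  proof
    fix j show "\<exists>C>0. j < k \<longrightarrow> eventually (\<lambda>w. cmod (\<Psi> w j - \<Psi> z j) \<le> C * l1 n w z) (near n z)"
    proof (cases "j < k")
      case True
      then show ?thesis using cdiff_lipschitz[OF \<Psi>[OF True]] by blast
    qed (auto intro: zero_less_one)
  qed
  then obtain B where B: "\<And>j. B j > 0" "\<And>j. j < k \<Longrightarrow> eventually (\<lambda>w. cmod (\<Psi> w j - \<Psi> z j) \<le> B j * l1 n w z) (near n z)"
    using choice[of "\<lambda>j C. C > 0 \<and> (j < k \<longrightarrow> eventually (\<lambda>w. cmod (\<Psi> w j - \<Psi> z j) \<le> C * l1 n w z) (near n z))"]
    by blast
  have lim: "filterlim \<Psi> (near k (\<Psi> z)) (near n z)"
    unfolding filterlim_near using C \<Psi> by (auto intro: cdiff_tendsto)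
  define BB where "BB = 1 + (\<Sum>j<k. B j)"
  define CC where "CC = 1 + (\<Sum>j<k. cmod (c j))"
  have BB: "BB > 0" and CC: "CC > 0"
    unfolding BB_def CC_def by (auto intro!: add_pos_nonneg sum_nonneg less_imp_le[OF B(1)])
  show ?thesis
    unfolding cdiff_def
  proof (intro exI[of _ "\<lambda>i. \<Sum>j<k. c j * a j i"] allI impI)
    fix e :: real assume e: "e > 0"
    have e1: "e / 2 / BB > 0" and e2: "e / 2 / CC > 0" using e BB CC by auto
    have "eventually (\<lambda>w. cmod (F (\<Psi> w) - F (\<Psi> z) - (\<Sum>i<k. c i * (\<Psi> w i - \<Psi> z i))) \<le> e / 2 / BB * l1 k (\<Psi> w) (\<Psi> z)) (near n z)"
      using eventually_compose_filterlim[OF c[OF e1] lim] .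
    moreover have "eventually (\<lambda>w. \<forall>j\<in>{..<k}. cmod (\<Psi> w j - \<Psi> z j - (\<Sum>i<n. a j i * (w i - z i))) \<le> e / 2 / CC * l1 n w z) (near n z)"
      using a[OF _ e2] by (intro eventually_ball_finite) auto
    moreover have "eventually (\<lambda>w. \<forall>j\<in>{..<k}. cmod (\<Psi> w j - \<Psi> z j) \<le> B j * l1 n w z) (near n z)"
      using B(2) by (intro eventually_ball_finite) auto
    ultimately show "eventually (\<lambda>w. cmod (F (\<Psi> w) - F (\<Psi> z) - (\<Sum>i<n. (\<Sum>j<k. c j * a j i) * (w i - z i))) \<le> e * l1 n w z) (near n z)"
    proof eventually_elim
      case (elim w)
      define l where "l = l1 n w z"
      define q where "q j = \<Psi> w j - \<Psi> z j - (\<Sum>i<n. a j i * (w i - z i))" for j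
      have l: "l \<ge> 0" by (simp add: l_def l1_nonneg)
      have "l1 k (\<Psi> w) (\<Psi> z) \<le> (\<Sum>j<k. B j * l)"
        unfolding l1_def using elim(3) by (intro sum_mono) (auto simp: l_def)
      also have "\<dots> \<le> BB * l" using l by (simp add: BB_def sum_distrib_right[symmetric] distrib_right)
      finally have "e / 2 / BB * l1 k (\<Psi> w) (\<Psi> z) \<le> e / 2 / BB * (BB * l)"
        using e1 by (intro mult_left_mono) auto
      also have "\<dots> = e / 2 * l" using BB by simp
      finally have 1: "cmod (F (\<Psi> w) - F (\<Psi> z) - (\<Sum>i<k. c i * (\<Psi> w i - \<Psi> z i))) \<le> e / 2 * l"
        using elim(1) by linarith
      have "cmod (\<Sum>j<k. c j * q j) \<le> (\<Sum>j<k. cmod (c j) * (e / 2 / CC * l))"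
        using elim(2) unfolding l_def q_def
        by (intro order_trans[OF norm_sum] sum_mono) (simp only: norm_mult, intro mult_left_mono, auto)
      also have "\<dots> = (\<Sum>j<k. cmod (c j)) * (e / 2 / CC * l)" by (rule sum_distrib_right[symmetric])
      also have "\<dots> \<le> CC * (e / 2 / CC * l)" using mult_nonneg_nonneg[OF less_imp_le[OF e2] l] by (intro mult_right_mono) (simp_all add: CC_def)
      also have "\<dots> = e / 2 * l" using CC by simp
      finally have 2: "cmod (\<Sum>j<k. c j * q j) \<le> e / 2 * l" .
      have "(\<Sum>i<n. (\<Sum>j<k. c j * a j i) * (w i - z i)) = (\<Sum>j<k. c j * (\<Sum>i<n. a j i * (w i - z i)))"
        by (simp add: sum_distrib_left sum_distrib_right mult.assoc) (rule sum.swap)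
      then have eq: "F (\<Psi> w) - F (\<Psi> z) - (\<Sum>i<n. (\<Sum>j<k. c j * a j i) * (w i - z i)) =
          (F (\<Psi> w) - F (\<Psi> z) - (\<Sum>i<k. c i * (\<Psi> w i - \<Psi> z i))) + (\<Sum>j<k. c j * q j)"
        by (simp add: q_def algebra_simps sum_subtractf sum.distrib)
      have "cmod (F (\<Psi> w) - F (\<Psi> z) - (\<Sum>i<n. (\<Sum>j<k. c j * a j i) * (w i - z i))) \<le> e / 2 * l + e / 2 * l"
        unfolding eq by (rule norm_triangle_mono[OF 1 2])
      also have "\<dots> = e * l" by simp
      finally show ?case by (simp add: l_def)
    qed
  qed
qed

lemma cdiff_field_compose:
  assumes "(\<phi> has_field_derivative D) (at (F z))" "cdiff n F z"
  shows "cdiff n (\<lambda>w. \<phi> (F w)) z"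
proof -
  let ?\<Psi> = "\<lambda>w i. if i = 0 then F w else (0::complex)"
  have "cdiff 1 (\<lambda>v. \<phi> (v 0)) (?\<Psi> z)"
    unfolding cdiff_def
  proof (intro exI[of _ "\<lambda>_. D"] allI impI)
    fix e :: real assume "e > 0"
    then obtain r where r: "r > 0" "\<And>y. cmod (y - F z) < r \<Longrightarrow> cmod (\<phi> y - \<phi> (F z) - D * (y - F z)) \<le> e * cmod (y - F z)"
      using assms(1) unfolding has_field_derivative_def has_derivative_at_alt by blast
    then show "eventually (\<lambda>w. cmod (\<phi> (w 0) - \<phi> (?\<Psi> z 0) - (\<Sum>i<1. D * (w i - ?\<Psi> z i))) \<le> e * l1 1 w (?\<Psi> z)) (near 1 (?\<Psi> z))"
      unfolding eventually_near by (intro exI[of _ r]) (auto simp: polydisc_def l1_def)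
  qed
  from cdiff_compose[of 1 "\<lambda>v. \<phi> (v 0)" ?\<Psi> z n, OF this] assms(2)
  show ?thesis by (auto simp: Cn_def)
qed

lemma cdiff_add:
  assumes "cdiff n F z" "cdiff n G z" shows "cdiff n (\<lambda>w. F w + G w) z"
proof -
  let ?\<Psi> = "\<lambda>w i. if i = 0 then F w else if i = 1 then G w else (0::complex)"
  have "cdiff 2 (\<lambda>v. v 0 + v 1) (?\<Psi> z)"
    unfolding cdiff_def by (intro exI[of _ "\<lambda>_. 1"]) (auto simp: l1_nonneg numeral_2_eq_2)
  moreover have "cdiff n (\<lambda>w. ?\<Psi> w j) z" if "j < 2" for j :: nat
    using assms that by (cases "j = 0") (auto simp: less_2_cases_iff)
  ultimately show ?thesis
    using cdiff_compose[of 2 "\<lambda>v. v 0 + v 1" ?\<Psi> z n] by (auto simp: Cn_def)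
qed

lemma cdiff_cmult: "cdiff n F z \<Longrightarrow> cdiff n (\<lambda>w. c * F w) z"
  by (rule cdiff_field_compose[of "\<lambda>y. c * y" c]) (auto intro!: derivative_eq_intros)

lemma cdiff_diff: "cdiff n F z \<Longrightarrow> cdiff n G z \<Longrightarrow> cdiff n (\<lambda>w. F w - G w) z"
  using cdiff_add[of n F z "\<lambda>w. (-1) * G w"] cdiff_cmult[of n G z "-1"] by simp

text \<open>Polarisation reduces products to the derivative of a square.\<close>

lemma cdiff_mult:
  assumes "cdiff n F z" "cdiff n G z" shows "cdiff n (\<lambda>w. F w * G w) z"
proof -
  have sq: "cdiff n (\<lambda>w. (H w)\<^sup>2) z" if "cdiff n H z" for H
    by (rule cdiff_field_compose[of "\<lambda>y. y\<^sup>2" "2 * H z"]) (use that in \<open>auto intro!: derivative_eq_intros\<close>)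
  have "cdiff n (\<lambda>w. (1/4) * ((F w + G w)\<^sup>2 - (F w - G w)\<^sup>2)) z"
    using assms by (intro cdiff_cmult cdiff_diff sq cdiff_add)
  moreover have "(1/4) * ((x + y)\<^sup>2 - (x - y)\<^sup>2) = x * y" for x y :: complex
    by (simp add: power2_eq_square algebra_simps)
  ultimately show ?thesis by simp
qed

lemma cdiff_inverse:
  assumes "cdiff n F z" "F z \<noteq> 0" shows "cdiff n (\<lambda>w. 1 / F w) z"
  by (rule cdiff_field_compose[of "\<lambda>y. 1 / y" "- 1 / (F z)\<^sup>2"])
    (use assms in \<open>auto intro!: derivative_eq_intros simp: power2_eq_square\<close>)

lemma cdiff_divide: "cdiff n F z \<Longrightarrow> cdiff n G z \<Longrightarrow> G z \<noteq> 0 \<Longrightarrow> cdiff n (\<lambda>w. F w / G w) z"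
  using cdiff_mult[of n F z "\<lambda>w. 1 / G w"] cdiff_inverse[of n G z] by simp

lemma cdiff_sum: "(\<And>i. i \<in> A \<Longrightarrow> cdiff n (F i) z) \<Longrightarrow> cdiff n (\<lambda>w. \<Sum>i\<in>A. F i w) z"
  by (induction A rule: infinite_finite_induct) (auto intro: cdiff_const cdiff_add)

lemma cdiff_prod: "(\<And>i. i \<in> A \<Longrightarrow> cdiff n (F i) z) \<Longrightarrow> cdiff n (\<lambda>w. \<Prod>i\<in>A. F i w) z"
  by (induction A rule: infinite_finite_induct) (auto intro: cdiff_const cdiff_mult)

lemma cdiff_power: "cdiff n F z \<Longrightarrow> cdiff n (\<lambda>w. F w ^ k) z"
  by (induction k) (auto intro: cdiff_const cdiff_mult)

section \<open>Quotients of embedded spaces and local holomorphic lifts\<close>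

lemma topspace_embedded_space:
  assumes "e ` A \<subseteq> Cn n" shows "topspace (cs_top (embedded_space n e A)) = A"
  using assms by (auto simp: embedded_space_def topspace_pullback_topology)

text \<open>The set of \<open>y\<close> with \<open>e y = w\<close> is quantified over because \<open>near\<close> lives on the ambient space.\<close>

lemma openin_embedded_space:
  assumes e: "e ` A \<subseteq> Cn n"
  shows "openin (cs_top (embedded_space n e A)) W \<longleftrightarrow>
     W \<subseteq> A \<and> (\<forall>x\<in>W. eventually (\<lambda>w. \<forall>y\<in>A. e y = w \<longrightarrow> y \<in> W) (near n (e x)))"
proof
  assume "openin (cs_top (embedded_space n e A)) W"
  then obtain U where U: "openin (top_of_set (Cn n)) U" "W = e -` U \<inter> A"
    by (auto simp: embedded_space_def openin_pullback_topology)
  have "eventually (\<lambda>w. \<forall>y\<in>A. e y = w \<longrightarrow> y \<in> W) (near n (e x))" if "x \<in> W" for x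
  proof -
    have "eventually (\<lambda>w. w \<in> U) (near n (e x))" using U that by (auto simp: openin_Cn_iff)
    then show ?thesis by (rule eventually_mono) (use U(2) in auto)
  qed
  then show "W \<subseteq> A \<and> (\<forall>x\<in>W. eventually (\<lambda>w. \<forall>y\<in>A. e y = w \<longrightarrow> y \<in> W) (near n (e x)))"
    using U(2) by auto
next
  assume R: "W \<subseteq> A \<and> (\<forall>x\<in>W. eventually (\<lambda>w. \<forall>y\<in>A. e y = w \<longrightarrow> y \<in> W) (near n (e x)))"
  then have "\<forall>x\<in>W. \<exists>r>0. \<forall>y\<in>A. e y \<in> polydisc n (e x) r \<longrightarrow> y \<in> W"
    unfolding eventually_near by blast
  from bchoice[OF this] obtain r where r: "\<And>x. x \<in> W \<Longrightarrow> r x > 0"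
    "\<And>x y. x \<in> W \<Longrightarrow> y \<in> A \<Longrightarrow> e y \<in> polydisc n (e x) (r x) \<Longrightarrow> y \<in> W" by blast
  let ?U = "\<Union>x\<in>W. polydisc n (e x) (r x)"
  have "openin (top_of_set (Cn n)) ?U" by (intro openin_Union) (auto intro: openin_polydisc)
  moreover have "W = e -` ?U \<inter> A"
  proof
    show "W \<subseteq> e -` ?U \<inter> A" using R r(1) e by (blast intro: centre_in_polydisc)
    show "e -` ?U \<inter> A \<subseteq> W" using r(2) by auto
  qed
  ultimately show "openin (cs_top (embedded_space n e A)) W"
    by (auto simp: embedded_space_def openin_pullback_topology)
qed

lemma cs_hol_embedded_space:
  "F \<in> cs_hol (embedded_space n e A) W \<longleftrightarrow>
     (\<forall>x\<in>W. \<exists>N G. openin (top_of_set (Cn n)) N \<and> e x \<in> N \<and>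
        holomorphic_Cn n G N \<and> (\<forall>y\<in>W. e y \<in> N \<longrightarrow> F y = G (e y)))"
  by (simp add: embedded_space_def)

lemma cs_hol_quotient_space:
  "F \<in> cs_hol (quotient_space p X) W \<longleftrightarrow> F \<circ> p \<in> cs_hol X {x \<in> topspace (cs_top X). p x \<in> W}"
  by (simp add: quotient_space_def)

lemma cs_hol_quotient_embedded_cong:
  assumes "F \<in> cs_hol (quotient_space p (embedded_space n e A)) W" "\<And>x. x \<in> W \<Longrightarrow> F x = F' x"
  shows "F' \<in> cs_hol (quotient_space p (embedded_space n e A)) W"
  unfolding cs_hol_quotient_space cs_hol_embedded_space
proof
  fix x assume x: "x \<in> {x \<in> topspace (cs_top (embedded_space n e A)). p x \<in> W}"
  then obtain N G where NG: "openin (top_of_set (Cn n)) N" "e x \<in> N" "holomorphic_Cn n G N"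
      "\<forall>y\<in>{x \<in> topspace (cs_top (embedded_space n e A)). p x \<in> W}. e y \<in> N \<longrightarrow> (F \<circ> p) y = G (e y)"
    using assms(1) unfolding cs_hol_quotient_space cs_hol_embedded_space by blast
  show "\<exists>N G. openin (top_of_set (Cn n)) N \<and> e x \<in> N \<and> holomorphic_Cn n G N \<and>
      (\<forall>y\<in>{x \<in> topspace (cs_top (embedded_space n e A)). p x \<in> W}. e y \<in> N \<longrightarrow> (F' \<circ> p) y = G (e y))"
    by (intro exI[of _ N] exI[of _ G] conjI NG(1-3)) (use NG(4) assms(2) in auto)
qed

text \<open>\<open>local_lift\<close> says that a map \<open>\<phi>\<close> on the subset \<open>U\<close> of the quotient of \<open>A\<close> by \<open>p\<close> is, near each
  point of \<open>A\<close> over \<open>U\<close>, induced by a holomorphic map \<open>\<Psi>\<close> of the ambient spaces. The clause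
  \<open>p y \<in> U\<close> makes \<open>U\<close> open.\<close>

definition local_lift ::
  "nat \<Rightarrow> ('a \<Rightarrow> nat \<Rightarrow> complex) \<Rightarrow> 'a set \<Rightarrow> ('a \<Rightarrow> 'c) \<Rightarrow>
   nat \<Rightarrow> ('b \<Rightarrow> nat \<Rightarrow> complex) \<Rightarrow> 'b set \<Rightarrow> ('b \<Rightarrow> 'd) \<Rightarrow> 'c set \<Rightarrow> ('c \<Rightarrow> 'd) \<Rightarrow> bool" where
  "local_lift n e A p k e' A' q U \<phi> \<longleftrightarrow>
     (\<forall>x\<in>A. p x \<in> U \<longrightarrow>
        (\<exists>\<Psi>. eventually (\<lambda>w. \<Psi> w \<in> Cn k \<and> (\<forall>j<k. cdiff n (\<lambda>w. \<Psi> w j) w) \<and>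
               (\<forall>y\<in>A. e y = w \<longrightarrow> p y \<in> U \<and> (\<exists>y'\<in>A'. e' y' = \<Psi> w \<and> q y' = \<phi> (p y)))) (near n (e x))))"

context
  fixes n k :: nat and e :: "'a \<Rightarrow> nat \<Rightarrow> complex" and A and p :: "'a \<Rightarrow> 'c"
    and e' :: "'b \<Rightarrow> nat \<Rightarrow> complex" and A' and q :: "'b \<Rightarrow> 'd" and U \<phi>
  assumes e: "e ` A \<subseteq> Cn n" and e': "e' ` A' \<subseteq> Cn k" and U: "U \<subseteq> p ` A"
    and lift: "local_lift n e A p k e' A' q U \<phi>"
begin

lemma local_lift_obtain:
  assumes "x \<in> A" "p x \<in> U"
  obtains \<Psi> N where "openin (top_of_set (Cn n)) N" "e x \<in> N" "\<And>w. w \<in> N \<Longrightarrow> \<Psi> w \<in> Cn k"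
    "\<And>w j. w \<in> N \<Longrightarrow> j < k \<Longrightarrow> cdiff n (\<lambda>w. \<Psi> w j) w"
    "\<And>y. y \<in> A \<Longrightarrow> e y \<in> N \<Longrightarrow> p y \<in> U"
    "\<And>y. y \<in> A \<Longrightarrow> e y \<in> N \<Longrightarrow> (\<exists>y'\<in>A'. e' y' = \<Psi> (e y) \<and> q y' = \<phi> (p y))"
proof -
  obtain \<Psi> r where "r > 0" and r: "\<forall>w\<in>polydisc n (e x) r. \<Psi> w \<in> Cn k \<and> (\<forall>j<k. cdiff n (\<lambda>w. \<Psi> w j) w) \<and>
               (\<forall>y\<in>A. e y = w \<longrightarrow> p y \<in> U \<and> (\<exists>y'\<in>A'. e' y' = \<Psi> w \<and> q y' = \<phi> (p y)))"
    using lift assms unfolding local_lift_def eventually_near by blast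
  show ?thesis
    by (rule that[of "polydisc n (e x) r" \<Psi>])
      (use r \<open>r > 0\<close> e assms in \<open>auto intro!: openin_polydisc centre_in_polydisc\<close>)
qed

lemma local_lift_open_vimage:
  assumes W: "openin (cs_top (quotient_space q (embedded_space k e' A'))) W"
  shows "openin (cs_top (quotient_space p (embedded_space n e A))) {x \<in> U. \<phi> x \<in> W}"
  unfolding openin_quotient_space topspace_embedded_space[OF e] openin_embedded_space[OF e]
proof (intro conjI ballI)
  show "{x \<in> U. \<phi> x \<in> W} \<subseteq> p ` A" using U by blast
  fix x assume x: "x \<in> {x \<in> A. p x \<in> {x \<in> U. \<phi> x \<in> W}}"
  then have xA: "x \<in> A" and xU: "p x \<in> U" by auto
  obtain \<Psi> N where N: "openin (top_of_set (Cn n)) N" "e x \<in> N" "\<And>w. w \<in> N \<Longrightarrow> \<Psi> w \<in> Cn k"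
    "\<And>w j. w \<in> N \<Longrightarrow> j < k \<Longrightarrow> cdiff n (\<lambda>w. \<Psi> w j) w"
    "\<And>y. y \<in> A \<Longrightarrow> e y \<in> N \<Longrightarrow> p y \<in> U"
    "\<And>y. y \<in> A \<Longrightarrow> e y \<in> N \<Longrightarrow> (\<exists>y'\<in>A'. e' y' = \<Psi> (e y) \<and> q y' = \<phi> (p y))"
    by (rule local_lift_obtain[OF xA xU]) auto
  obtain x' where x': "x' \<in> A'" "e' x' = \<Psi> (e x)" "q x' = \<phi> (p x)" using N(6)[OF xA N(2)] by blast
  have "eventually (\<lambda>w. \<forall>y\<in>A'. e' y = w \<longrightarrow> q y \<in> W) (near k (e' x'))"
    using W x' x unfolding openin_quotient_space topspace_embedded_space[OF e'] openin_embedded_space[OF e']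
    by (auto elim!: eventually_mono)
  moreover have evN: "eventually (\<lambda>w. w \<in> N) (near n (e x))" using N(1,2) by (auto simp: openin_Cn_iff)
  then have "eventually (\<lambda>w. \<Psi> w \<in> Cn k) (near n (e x))" by (rule eventually_mono) (use N in auto)
  then have "filterlim \<Psi> (near k (e' x')) (near n (e x))"
    unfolding filterlim_near x'(2) using N(2,4) by (auto intro!: cdiff_tendsto)
  ultimately have "eventually (\<lambda>w. \<forall>y\<in>A'. e' y = \<Psi> w \<longrightarrow> q y \<in> W) (near n (e x))"
    by (rule eventually_compose_filterlim)
  then show "eventually (\<lambda>w. \<forall>y\<in>A. e y = w \<longrightarrow> y \<in> {x \<in> A. p x \<in> {x \<in> U. \<phi> x \<in> W}}) (near n (e x))"
    using evN
  proof eventually_elim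
    case (elim w)
    show ?case
    proof (intro ballI impI)
      fix y assume y: "y \<in> A" "e y = w"
      then obtain y' where "y' \<in> A'" "e' y' = \<Psi> (e y)" "q y' = \<phi> (p y)" using N(6) elim(2) by blast
      then have "\<phi> (p y) \<in> W" using elim(1) y by metis
      then show "y \<in> {x \<in> A. p x \<in> {x \<in> U. \<phi> x \<in> W}}" using y N(5) elim(2) by auto
    qed
  qed
qed auto

lemma local_lift_open: "openin (cs_top (quotient_space p (embedded_space n e A))) U"
proof -
  have "{x \<in> U. \<phi> x \<in> topspace (cs_top (quotient_space q (embedded_space k e' A')))} = U"
  proof (intro set_eqI iffI)
    fix u assume u: "u \<in> U"
    then obtain x where "x \<in> A" "p x = u" using U by auto
    then obtain y' where "y' \<in> A'" "q y' = \<phi> u" using local_lift_obtain[of x] u by metis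
    then have "\<phi> u \<in> q ` A'" by (metis imageI)
    then show "u \<in> {x \<in> U. \<phi> x \<in> topspace (cs_top (quotient_space q (embedded_space k e' A')))}"
      using u by (auto simp: topspace_quotient_space topspace_embedded_space[OF e'])
  qed auto
  then show ?thesis using local_lift_open_vimage[OF openin_topspace] by simp
qed

lemma local_lift_hol:
  assumes W: "openin (cs_top (quotient_space q (embedded_space k e' A'))) W"
    and F: "F \<in> cs_hol (quotient_space q (embedded_space k e' A')) W"
  shows "F \<circ> \<phi> \<in> cs_hol (quotient_space p (embedded_space n e A)) {x \<in> U. \<phi> x \<in> W}"
  unfolding cs_hol_quotient_space topspace_embedded_space[OF e] cs_hol_embedded_space
proof
  fix x assume x: "x \<in> {x \<in> A. p x \<in> {x \<in> U. \<phi> x \<in> W}}"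
  then have xA: "x \<in> A" and xU: "p x \<in> U" by auto
  obtain \<Psi> N where N: "openin (top_of_set (Cn n)) N" "e x \<in> N" "\<And>w. w \<in> N \<Longrightarrow> \<Psi> w \<in> Cn k"
    "\<And>w j. w \<in> N \<Longrightarrow> j < k \<Longrightarrow> cdiff n (\<lambda>w. \<Psi> w j) w"
    "\<And>y. y \<in> A \<Longrightarrow> e y \<in> N \<Longrightarrow> p y \<in> U"
    "\<And>y. y \<in> A \<Longrightarrow> e y \<in> N \<Longrightarrow> (\<exists>y'\<in>A'. e' y' = \<Psi> (e y) \<and> q y' = \<phi> (p y))"
    by (rule local_lift_obtain[OF xA xU]) auto
  obtain x' where x': "x' \<in> A'" "e' x' = \<Psi> (e x)" "q x' = \<phi> (p x)" using N(6)[OF xA N(2)] by blast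
  obtain N' G where G: "openin (top_of_set (Cn k)) N'" "e' x' \<in> N'" "holomorphic_Cn k G N'"
      "\<And>y. y \<in> A' \<Longrightarrow> q y \<in> W \<Longrightarrow> e' y \<in> N' \<Longrightarrow> F (q y) = G (e' y)"
  proof -
    have "x' \<in> {x \<in> A'. q x \<in> W}" using x' x by auto
    then have "\<exists>N G. openin (top_of_set (Cn k)) N \<and> e' x' \<in> N \<and> holomorphic_Cn k G N \<and>
        (\<forall>y\<in>{x \<in> A'. q x \<in> W}. e' y \<in> N \<longrightarrow> (F \<circ> q) y = G (e' y))"
      using F unfolding cs_hol_quotient_space topspace_embedded_space[OF e'] cs_hol_embedded_space
      by blast
    then show ?thesis using that by auto
  qed
  define M where "M = {w \<in> N. \<Psi> w \<in> N'}"
  have evN: "eventually (\<lambda>w. w \<in> N) (near n z)" if "z \<in> N" for z using N(1) that by (auto simp: openin_Cn_iff)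
  have M: "openin (top_of_set (Cn n)) M"
    unfolding openin_Cn_iff
  proof (intro conjI ballI)
    show "M \<subseteq> Cn n" using N(1) by (auto simp: M_def openin_Cn_iff)
    fix z assume z: "z \<in> M"
    have "eventually (\<lambda>w. \<Psi> w \<in> Cn k) (near n z)"
      using evN[of z] by (rule eventually_mono) (use z N in \<open>auto simp: M_def\<close>)
    then have "filterlim \<Psi> (near k (\<Psi> z)) (near n z)"
      unfolding filterlim_near using z N(4) by (auto intro!: cdiff_tendsto simp: M_def)
    moreover have "eventually (\<lambda>v. v \<in> N') (near k (\<Psi> z))" using G(1) z by (auto simp: openin_Cn_iff M_def)
    ultimately have "eventually (\<lambda>w. \<Psi> w \<in> N') (near n z)" by (rule eventually_compose_filterlim[rotated])
    with evN[of z] z show "eventually (\<lambda>w. w \<in> M) (near n z)"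
      by (auto simp: M_def elim: eventually_elim2)
  qed
  have hol: "holomorphic_Cn n (\<lambda>w. G (\<Psi> w)) M"
    unfolding holomorphic_Cn_iff[OF M]
  proof
    fix z assume z: "z \<in> M"
    show "cdiff n (\<lambda>w. G (\<Psi> w)) z"
    proof (rule cdiff_compose[of k G \<Psi>])
      show "cdiff k G (\<Psi> z)" using G(3) z by (auto simp: holomorphic_Cn_iff[OF G(1)] M_def)
      show "eventually (\<lambda>w. \<Psi> w \<in> Cn k) (near n z)"
        using evN[of z] by (rule eventually_mono) (use z N in \<open>auto simp: M_def\<close>)
    qed (use z N in \<open>auto simp: M_def\<close>)
  qed
  show "\<exists>N G. openin (top_of_set (Cn n)) N \<and> e x \<in> N \<and> holomorphic_Cn n G N \<and>
     (\<forall>y\<in>{x \<in> A. p x \<in> {x \<in> U. \<phi> x \<in> W}}. e y \<in> N \<longrightarrow> (F \<circ> \<phi> \<circ> p) y = G (e y))"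
  proof (intro exI conjI ballI impI)
    show "openin (top_of_set (Cn n)) M" by (rule M)
    show "holomorphic_Cn n (\<lambda>w. G (\<Psi> w)) M" by (rule hol)
    show "e x \<in> M" using N(2) G(2) x'(2) by (auto simp: M_def)
    fix y assume y: "y \<in> {x \<in> A. p x \<in> {x \<in> U. \<phi> x \<in> W}}" "e y \<in> M"
    obtain y' where "y' \<in> A'" "e' y' = \<Psi> (e y)" "q y' = \<phi> (p y)" using N(6) y by (auto simp: M_def)
    then show "(F \<circ> \<phi> \<circ> p) y = G (\<Psi> (e y))" using G(4)[of y'] y by (auto simp: M_def)
  qed
qed

end

text \<open>The lifts are local and depend on a choice of representatives, so the inverse relation is asked of
  the induced maps on the quotients.\<close>

lemma biholomorphic_between_local_lift:
  assumes e: "e ` A \<subseteq> Cn n" and e': "e' ` A' \<subseteq> Cn k" and U: "U \<subseteq> p ` A" and U': "U' \<subseteq> q ` A'"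
    and l1: "local_lift n e A p k e' A' q U \<phi>" and l2: "local_lift k e' A' q n e A p U' \<psi>"
    and m1: "\<And>x. x \<in> U \<Longrightarrow> \<phi> x \<in> U'" and m2: "\<And>y. y \<in> U' \<Longrightarrow> \<psi> y \<in> U"
    and i1: "\<And>x. x \<in> U \<Longrightarrow> \<psi> (\<phi> x) = x" and i2: "\<And>y. y \<in> U' \<Longrightarrow> \<phi> (\<psi> y) = y"
  shows "biholomorphic_between (quotient_space p (embedded_space n e A)) U
           (quotient_space q (embedded_space k e' A')) U' \<phi>"
proof -
  let ?X = "quotient_space p (embedded_space n e A)" and ?Y = "quotient_space q (embedded_space k e' A')"
  have oU: "openin (cs_top ?X) U" by (rule local_lift_open[OF e e' U l1])
  have oU': "openin (cs_top ?Y) U'" by (rule local_lift_open[OF e' e U' l2])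
  have tU: "topspace (subtopology (cs_top ?X) U) = U" and tU': "topspace (subtopology (cs_top ?Y) U') = U'"
    using openin_subset[OF oU] openin_subset[OF oU'] by auto
  have c1: "continuous_map (subtopology (cs_top ?X) U) (subtopology (cs_top ?Y) U') \<phi>"
    unfolding continuous_map_def tU tU'
  proof (intro conjI allI impI)
    show "\<phi> \<in> U \<rightarrow> U'" using m1 by auto
    fix W assume "openin (subtopology (cs_top ?Y) U') W"
    then have "openin (cs_top ?Y) W" using oU' openin_trans_full by blast
    from local_lift_open_vimage[OF e e' U l1 this]
    show "openin (subtopology (cs_top ?X) U) {x \<in> U. \<phi> x \<in> W}" by (simp add: openin_open_subtopology oU)
  qed
  have c2: "continuous_map (subtopology (cs_top ?Y) U') (subtopology (cs_top ?X) U) \<psi>"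
    unfolding continuous_map_def tU tU'
  proof (intro conjI allI impI)
    show "\<psi> \<in> U' \<rightarrow> U" using m2 by auto
    fix W assume "openin (subtopology (cs_top ?X) U) W"
    then have "openin (cs_top ?X) W" using oU openin_trans_full by blast
    from local_lift_open_vimage[OF e' e U' l2 this]
    show "openin (subtopology (cs_top ?Y) U') {x \<in> U'. \<psi> x \<in> W}" by (simp add: openin_open_subtopology oU')
  qed
  have "homeomorphic_map (subtopology (cs_top ?X) U) (subtopology (cs_top ?Y) U') \<phi>"
    unfolding homeomorphic_map_maps homeomorphic_maps_def tU tU' using c1 c2 i1 i2 by blast
  moreover have "F \<in> cs_hol ?Y W \<longleftrightarrow> F \<circ> \<phi> \<in> cs_hol ?X {x \<in> U. \<phi> x \<in> W}"
    if W: "openin (cs_top ?Y) W" "W \<subseteq> U'" for W F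
  proof
    assume "F \<in> cs_hol ?Y W"
    then show "F \<circ> \<phi> \<in> cs_hol ?X {x \<in> U. \<phi> x \<in> W}" by (rule local_lift_hol[OF e e' U l1 W(1)])
  next
    assume L: "F \<circ> \<phi> \<in> cs_hol ?X {x \<in> U. \<phi> x \<in> W}"
    have "(F \<circ> \<phi>) \<circ> \<psi> \<in> cs_hol ?Y {y \<in> U'. \<psi> y \<in> {x \<in> U. \<phi> x \<in> W}}"
      by (rule local_lift_hol[OF e' e U' l2 local_lift_open_vimage[OF e e' U l1 W(1)] L])
    moreover have "{y \<in> U'. \<psi> y \<in> {x \<in> U. \<phi> x \<in> W}} = W" using W m2 i2 by auto
    ultimately have "(F \<circ> \<phi>) \<circ> \<psi> \<in> cs_hol ?Y W" by simp
    then show "F \<in> cs_hol ?Y W"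
      by (rule cs_hol_quotient_embedded_cong) (use W i2 in auto)
  qed
  ultimately show ?thesis using oU oU' by (simp add: biholomorphic_between_def)
qed

text \<open>An embedded space is its own quotient by the identity, so that the criterion for quotients covers
  it as well.\<close>

lemma biholomorphic_between_quotient_id:
  assumes e: "e ` A \<subseteq> Cn n" and e': "e' ` A' \<subseteq> Cn k"
    and B: "biholomorphic_between (quotient_space (\<lambda>x. x) (embedded_space n e A)) U
           (quotient_space (\<lambda>x. x) (embedded_space k e' A')) U' \<phi>"
  shows "biholomorphic_between (embedded_space n e A) U (embedded_space k e' A') U' \<phi>"
proof -
  have top: "cs_top (quotient_space (\<lambda>x. x) X) = cs_top X" for X :: "'x complex_space"
  proof -
    have "openin (cs_top (quotient_space (\<lambda>x. x) X)) S \<longleftrightarrow> openin (cs_top X) S" for S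
    proof -
      have "{x \<in> topspace (cs_top X). x \<in> S} = S" if "S \<subseteq> topspace (cs_top X)" using that by blast
      then show ?thesis unfolding openin_quotient_space using openin_subset[of "cs_top X" S] by auto
    qed
    then show ?thesis by (simp add: topology_eq)
  qed
  have hol: "cs_hol (quotient_space (\<lambda>x. x) X) W = cs_hol X W" if "W \<subseteq> topspace (cs_top X)" for X :: "'x complex_space" and W
  proof -
    have "{x \<in> topspace (cs_top X). x \<in> W} = W" using that by blast
    then show ?thesis by (auto simp: cs_hol_quotient_space o_def)
  qed
  have 1: "{x \<in> U. \<phi> x \<in> W} \<subseteq> topspace (cs_top (embedded_space n e A))" for W
    using B openin_subset unfolding biholomorphic_between_def top by blast
  show ?thesis
    using B unfolding biholomorphic_between_def top
    by (simp add: hol[OF 1] hol[OF openin_subset] cong: conj_cong imp_cong)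
qed

section \<open>An implicit function theorem\<close>

text \<open>Strict differentiability of \<open>F\<close> in the unknown \<open>z\<close> and the parameter \<open>x\<close>, with derivatives \<open>a\<close>
  and \<open>b\<close>: increments between any two nearby points are compared with the derivative at the centre.
  This gives contraction estimates without a mean value theorem.\<close>

definition strict_diff ::
  "nat \<Rightarrow> nat \<Rightarrow> ((nat \<Rightarrow> complex) \<Rightarrow> (nat \<Rightarrow> complex) \<Rightarrow> complex) \<Rightarrow> (nat \<Rightarrow> complex) \<Rightarrow> (nat \<Rightarrow> complex) \<Rightarrow>
   (nat \<Rightarrow> complex) \<Rightarrow> (nat \<Rightarrow> complex) \<Rightarrow> bool" where
  "strict_diff n p F a b z0 x0 \<longleftrightarrow>
     (\<forall>e>0. \<exists>r>0. \<forall>z\<in>polydisc n z0 r. \<forall>z'\<in>polydisc n z0 r. \<forall>x\<in>polydisc p x0 r. \<forall>x'\<in>polydisc p x0 r.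
        cmod (F z x - F z' x' - (\<Sum>i<n. a i * (z i - z' i)) - (\<Sum>j<p. b j * (x j - x' j)))
          \<le> e * (l1 n z z' + l1 p x x'))"

lemma strict_diffE:
  assumes "strict_diff n p F a b z0 x0" "e > 0"
  obtains r where "r > 0" "\<And>z z' x x'. z \<in> polydisc n z0 r \<Longrightarrow> z' \<in> polydisc n z0 r \<Longrightarrow> x \<in> polydisc p x0 r \<Longrightarrow> x' \<in> polydisc p x0 r \<Longrightarrow>
        cmod (F z x - F z' x' - (\<Sum>i<n. a i * (z i - z' i)) - (\<Sum>j<p. b j * (x j - x' j)))
          \<le> e * (l1 n z z' + l1 p x x')"
proof -
  from assms(1)[unfolded strict_diff_def, rule_format, OF assms(2)]
  show ?thesis using that by auto
qed

lemma strict_diff_add: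
  assumes F: "strict_diff n p F a b z0 x0" and G: "strict_diff n p G a' b' z0 x0"
  shows "strict_diff n p (\<lambda>z x. F z x + G z x) (\<lambda>i. a i + a' i) (\<lambda>j. b j + b' j) z0 x0"
  unfolding strict_diff_def
proof (intro allI impI)
  fix e :: real assume e: "e > 0"
  obtain r where r: "r > 0" "\<And>z z' x x'. z \<in> polydisc n z0 r \<Longrightarrow> z' \<in> polydisc n z0 r \<Longrightarrow> x \<in> polydisc p x0 r \<Longrightarrow> x' \<in> polydisc p x0 r \<Longrightarrow>
        cmod (F z x - F z' x' - (\<Sum>i<n. a i * (z i - z' i)) - (\<Sum>j<p. b j * (x j - x' j)))
          \<le> e/2 * (l1 n z z' + l1 p x x')"
    using strict_diffE[OF F half_gt_zero[OF e]] by blast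
  obtain s where s: "s > 0" "\<And>z z' x x'. z \<in> polydisc n z0 s \<Longrightarrow> z' \<in> polydisc n z0 s \<Longrightarrow> x \<in> polydisc p x0 s \<Longrightarrow> x' \<in> polydisc p x0 s \<Longrightarrow>
        cmod (G z x - G z' x' - (\<Sum>i<n. a' i * (z i - z' i)) - (\<Sum>j<p. b' j * (x j - x' j)))
          \<le> e/2 * (l1 n z z' + l1 p x x')"
    using strict_diffE[OF G half_gt_zero[OF e]] by blast
  show "\<exists>r>0. \<forall>z\<in>polydisc n z0 r. \<forall>z'\<in>polydisc n z0 r. \<forall>x\<in>polydisc p x0 r. \<forall>x'\<in>polydisc p x0 r.
        cmod (F z x + G z x - (F z' x' + G z' x') - (\<Sum>i<n. (a i + a' i) * (z i - z' i)) - (\<Sum>j<p. (b j + b' j) * (x j - x' j)))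
          \<le> e * (l1 n z z' + l1 p x x')"
  proof (intro exI[of _ "min r s"] conjI ballI)
    fix z z' x x' assume "z \<in> polydisc n z0 (min r s)" "z' \<in> polydisc n z0 (min r s)"
      "x \<in> polydisc p x0 (min r s)" "x' \<in> polydisc p x0 (min r s)"
    then have "z \<in> polydisc n z0 r" "z' \<in> polydisc n z0 r" "x \<in> polydisc p x0 r" "x' \<in> polydisc p x0 r"
        "z \<in> polydisc n z0 s" "z' \<in> polydisc n z0 s" "x \<in> polydisc p x0 s" "x' \<in> polydisc p x0 s"
      by (auto simp: polydisc_def)
    from norm_triangle_mono[OF r(2)[OF this(1-4)] s(2)[OF this(5-8)]]
    show "cmod (F z x + G z x - (F z' x' + G z' x') - (\<Sum>i<n. (a i + a' i) * (z i - z' i)) - (\<Sum>j<p. (b j + b' j) * (x j - x' j)))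
          \<le> e * (l1 n z z' + l1 p x x')"
      by (simp add: algebra_simps sum.distrib sum_subtractf)
  qed (use r(1) s(1) in auto)
qed

lemma strict_diff_const: "strict_diff n p (\<lambda>z x. c) (\<lambda>_. 0) (\<lambda>_. 0) z0 x0"
  unfolding strict_diff_def by (auto intro!: exI[of _ 1] mult_nonneg_nonneg add_nonneg_nonneg l1_nonneg)

lemma strict_diff_sum:
  assumes "finite A" "\<And>k. k \<in> A \<Longrightarrow> strict_diff n p (F k) (a k) (b k) z0 x0"
  shows "strict_diff n p (\<lambda>z x. \<Sum>k\<in>A. F k z x) (\<lambda>i. \<Sum>k\<in>A. a k i) (\<lambda>j. \<Sum>k\<in>A. b k j) z0 x0"
  using assms by (induction A rule: finite_induct) (auto intro: strict_diff_const strict_diff_add)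

lemma poly_strict_diff:
  fixes L :: "complex poly"
  assumes "e > 0"
  obtains r where "r > 0" "\<And>z z'. cmod (z - z0) < r \<Longrightarrow> cmod (z' - z0) < r \<Longrightarrow>
    cmod (poly L z - poly L z' - poly (pderiv L) z0 * (z - z')) \<le> e * cmod (z - z')"
proof -
  have "isCont (poly (pderiv L)) z0" by simp
  then obtain r where r: "r > 0" "\<And>z. dist z z0 < r \<Longrightarrow> dist (poly (pderiv L) z) (poly (pderiv L) z0) < e"
    unfolding continuous_at_eps_delta using assms by blast
  have "cmod (poly L z - poly L z' - poly (pderiv L) z0 * (z - z')) \<le> e * cmod (z - z')"
    if "cmod (z - z0) < r" "cmod (z' - z0) < r" for z z'
  proof -
    let ?f = "\<lambda>z. poly L z - poly (pderiv L) z0 * z"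
    have "cmod (?f z - ?f z') \<le> e * cmod (z - z')"
    proof (rule field_differentiable_bound[of "ball z0 r" ?f "\<lambda>z. poly (pderiv L) z - poly (pderiv L) z0"])
      fix w assume w: "w \<in> ball z0 r"
      show "(?f has_field_derivative poly (pderiv L) w - poly (pderiv L) z0) (at w within ball z0 r)"
        by (auto intro!: derivative_eq_intros poly_DERIV[THEN DERIV_subset])
      show "cmod (poly (pderiv L) w - poly (pderiv L) z0) \<le> e"
        using r(2)[of w] w by (simp add: dist_norm norm_minus_commute less_imp_le)
    qed (use that in \<open>auto simp: dist_norm norm_minus_commute\<close>)
    then show ?thesis by (simp add: algebra_simps)
  qed
  then show ?thesis using r(1) that by blast
qed

lemma sum_Kronecker: "k < n \<Longrightarrow> (\<Sum>i<n. (if i = k then c else 0) * f i) = c * f k" for f :: "nat \<Rightarrow> complex"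
  by (simp add: if_distrib[of "\<lambda>x. x * _"] sum.delta cong: if_cong)

lemma strict_diff_coord_poly:
  assumes j: "j < p" and i: "i < n" and c: "z0 \<in> Cn n" "x0 \<in> Cn p"
  shows "strict_diff n p (\<lambda>z x. x j * poly L (z i)) (\<lambda>k. if k = i then x0 j * poly (pderiv L) (z0 i) else 0)
    (\<lambda>k. if k = j then poly L (z0 i) else 0) z0 x0"
  unfolding strict_diff_def sum_Kronecker[OF i] sum_Kronecker[OF j]
proof (intro allI impI)
  fix e :: real assume e: "e > 0"
  define D where "D = poly (pderiv L) (z0 i)"
  define A where "A = cmod (x0 j) + 1"
  have A: "A > 0" by (simp add: A_def add_nonneg_pos)
  then have "e / 2 / A > 0" using e by simp
  from poly_strict_diff[OF this, of "z0 i" L] obtain r1 where r1: "r1 > 0"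
    "\<And>z z'. cmod (z - z0 i) < r1 \<Longrightarrow> cmod (z' - z0 i) < r1 \<Longrightarrow>
    cmod (poly L z - poly L z' - D * (z - z')) \<le> e / 2 / A * cmod (z - z')"
    unfolding D_def by blast
  have "isCont (poly L) (z0 i)" by simp
  then obtain r2 where r2: "r2 > 0" "\<And>z. dist z (z0 i) < r2 \<Longrightarrow> dist (poly L z) (poly L (z0 i)) < e"
    unfolding continuous_at_eps_delta using e by blast
  define r3 where "r3 = e / (2 * (cmod D + 1))"
  have r3: "r3 > 0" unfolding r3_def using e by (intro divide_pos_pos) (auto simp: add_nonneg_pos)
  have "2 * (cmod D + 1) > 0" by (simp add: add_nonneg_pos)
  then have "r3 * (cmod D + 1) = e / 2" unfolding r3_def by (simp add: field_simps)
  then have r3D: "r3 * cmod D \<le> e / 2" using r3 by (simp add: algebra_simps)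
  define r where "r = Min {r1, r2, r3, 1}"
  have r: "r > 0" "r \<le> r1" "r \<le> r2" "r \<le> r3" "r \<le> 1" unfolding r_def using r1(1) r2(1) r3 by auto
  show "\<exists>r>0. \<forall>z\<in>polydisc n z0 r. \<forall>z'\<in>polydisc n z0 r. \<forall>x\<in>polydisc p x0 r. \<forall>x'\<in>polydisc p x0 r.
        cmod (x j * poly L (z i) - x' j * poly L (z' i) - x0 j * poly (pderiv L) (z0 i) * (z i - z' i)
          - poly L (z0 i) * (x j - x' j)) \<le> e * (l1 n z z' + l1 p x x')"
  proof (intro exI[of _ r] conjI ballI)
    fix z z' x x' assume h: "z \<in> polydisc n z0 r" "z' \<in> polydisc n z0 r" "x \<in> polydisc p x0 r" "x' \<in> polydisc p x0 r"
    have zz: "cmod (z i - z0 i) < r" "cmod (z' i - z0 i) < r" "cmod (x j - x0 j) < r"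
      using h i j by (auto simp: polydisc_def)
    have "cmod (x j) \<le> A" using zz(3) r(5) norm_triangle_ineq2[of "x j" "x0 j"] by (simp add: A_def)
    moreover have "cmod (poly L (z i) - poly L (z' i) - D * (z i - z' i)) \<le> e / 2 / A * cmod (z i - z' i)"
      using zz r by (intro r1(2)) auto
    ultimately have "cmod (x j * (poly L (z i) - poly L (z' i) - D * (z i - z' i))) \<le> A * (e / 2 / A * cmod (z i - z' i))"
      unfolding norm_mult using A by (intro mult_mono) auto
    then have 1: "cmod (x j * (poly L (z i) - poly L (z' i) - D * (z i - z' i))) \<le> e / 2 * cmod (z i - z' i)"
      using A by simp
    have "cmod (x j - x0 j) * cmod D \<le> e / 2"
      using zz(3) r(4) r3D mult_right_mono[of "cmod (x j - x0 j)" r3 "cmod D"] by simp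
    then have 2: "cmod ((x j - x0 j) * D * (z i - z' i)) \<le> e / 2 * cmod (z i - z' i)"
      unfolding norm_mult by (intro mult_right_mono) auto
    have "cmod (poly L (z' i) - poly L (z0 i)) \<le> e"
      using r2(2)[of "z' i"] zz(2) r(3) by (simp add: dist_norm less_imp_le)
    then have 3: "cmod ((x j - x' j) * (poly L (z' i) - poly L (z0 i))) \<le> e * cmod (x j - x' j)"
      unfolding norm_mult by (subst mult.commute) (intro mult_right_mono, auto)
    have "x j * poly L (z i) - x' j * poly L (z' i) - x0 j * poly (pderiv L) (z0 i) * (z i - z' i)
          - poly L (z0 i) * (x j - x' j) =
        x j * (poly L (z i) - poly L (z' i) - D * (z i - z' i)) + (x j - x0 j) * D * (z i - z' i)
          + (x j - x' j) * (poly L (z' i) - poly L (z0 i))"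
      unfolding D_def by (simp add: algebra_simps)
    also have "cmod \<dots> \<le> e / 2 * cmod (z i - z' i) + e / 2 * cmod (z i - z' i) + e * cmod (x j - x' j)"
      by (intro norm_triangle_mono 1 2 3)
    also have "\<dots> = e * (cmod (z i - z' i) + cmod (x j - x' j))" by (simp add: algebra_simps)
    also have "\<dots> \<le> e * (l1 n z z' + l1 p x x')"
      using e l1_ge[OF i, of z z'] l1_ge[OF j, of x x'] by (intro mult_left_mono add_mono) auto
    finally show "cmod (x j * poly L (z i) - x' j * poly L (z' i) - x0 j * poly (pderiv L) (z0 i) * (z i - z' i)
          - poly L (z0 i) * (x j - x' j)) \<le> e * (l1 n z z' + l1 p x x')" .
  qed (rule r(1))
qed

lemma strict_diff_linear:
  "strict_diff n p (\<lambda>z x. (\<Sum>i<n. a i * z i) + (\<Sum>j<p. b j * x j)) a b z0 x0"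
proof -
  have "(\<Sum>i<n. a i * z i) + (\<Sum>j<p. b j * x j) - ((\<Sum>i<n. a i * z' i) + (\<Sum>j<p. b j * x' j))
      - (\<Sum>i<n. a i * (z i - z' i)) - (\<Sum>j<p. b j * (x j - x' j)) = 0" for z z' x x'
    by (simp add: algebra_simps sum_subtractf)
  then show ?thesis
    unfolding strict_diff_def by (auto intro!: exI[of _ 1] mult_nonneg_nonneg add_nonneg_nonneg l1_nonneg)
qed

lemma strict_diff_cmult:
  assumes F: "strict_diff n p F a b z0 x0"
  shows "strict_diff n p (\<lambda>z x. c * F z x) (\<lambda>i. c * a i) (\<lambda>j. c * b j) z0 x0"
  unfolding strict_diff_def
proof (intro allI impI)
  fix e :: real assume e: "e > 0"
  have c: "cmod c + 1 > 0" by (simp add: add_nonneg_pos)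
  then have e': "e / (cmod c + 1) > 0" using e by simp
  obtain r where r: "r > 0" "\<And>z z' x x'. z \<in> polydisc n z0 r \<Longrightarrow> z' \<in> polydisc n z0 r \<Longrightarrow> x \<in> polydisc p x0 r \<Longrightarrow> x' \<in> polydisc p x0 r \<Longrightarrow>
        cmod (F z x - F z' x' - (\<Sum>i<n. a i * (z i - z' i)) - (\<Sum>j<p. b j * (x j - x' j)))
          \<le> e / (cmod c + 1) * (l1 n z z' + l1 p x x')"
    using strict_diffE[OF F e'] by blast
  show "\<exists>r>0. \<forall>z\<in>polydisc n z0 r. \<forall>z'\<in>polydisc n z0 r. \<forall>x\<in>polydisc p x0 r. \<forall>x'\<in>polydisc p x0 r.
        cmod (c * F z x - c * F z' x' - (\<Sum>i<n. c * a i * (z i - z' i)) - (\<Sum>j<p. c * b j * (x j - x' j)))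
          \<le> e * (l1 n z z' + l1 p x x')"
  proof (intro exI[of _ r] conjI ballI)
    fix z z' x x' assume h: "z \<in> polydisc n z0 r" "z' \<in> polydisc n z0 r" "x \<in> polydisc p x0 r" "x' \<in> polydisc p x0 r"
    let ?Q = "F z x - F z' x' - (\<Sum>i<n. a i * (z i - z' i)) - (\<Sum>j<p. b j * (x j - x' j))"
    have "c * F z x - c * F z' x' - (\<Sum>i<n. c * a i * (z i - z' i)) - (\<Sum>j<p. c * b j * (x j - x' j)) = c * ?Q"
      by (simp add: algebra_simps sum_distrib_left sum_subtractf)
    also have "cmod \<dots> \<le> (cmod c + 1) * (e / (cmod c + 1) * (l1 n z z' + l1 p x x'))"
      unfolding norm_mult using c r(2)[OF h] by (intro mult_mono) auto
    also have "\<dots> = e * (l1 n z z' + l1 p x x')" using c by simp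
    finally show "cmod (c * F z x - c * F z' x' - (\<Sum>i<n. c * a i * (z i - z' i)) - (\<Sum>j<p. c * b j * (x j - x' j)))
          \<le> e * (l1 n z z' + l1 p x x')" .
  qed (rule r(1))
qed

lemma l1_triangle: "l1 n u w \<le> l1 n u v + l1 n v w"
proof -
  have "cmod (u i - w i) \<le> cmod (u i - v i) + cmod (v i - w i)" for i
    using norm_triangle_ineq[of "u i - v i" "v i - w i"] by simp
  then show ?thesis by (simp add: l1_def sum.distrib[symmetric] sum_mono)
qed

text \<open>The systems below are arranged so that their derivative in the unknowns is the identity at
  the base point; \<open>z \<mapsto> z - H z x\<close> is then a contraction for the \<open>l\<^sup>1\<close> distance.\<close>

context
  fixes n p :: nat and H :: "nat \<Rightarrow> (nat \<Rightarrow> complex) \<Rightarrow> (nat \<Rightarrow> complex) \<Rightarrow> complex"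
    and b :: "nat \<Rightarrow> nat \<Rightarrow> complex" and z0 x0 :: "nat \<Rightarrow> complex"
  assumes z0: "z0 \<in> Cn n" and x0: "x0 \<in> Cn p"
    and H: "\<And>i. i < n \<Longrightarrow> strict_diff n p (H i) (\<lambda>k. if k = i then 1 else 0) (b i) z0 x0"
    and H0: "\<And>i. i < n \<Longrightarrow> H i z0 x0 = 0"
begin

lemma implicit_strict_bound:
  assumes "e > 0"
  obtains r where "r > 0" "\<And>i z z' x x'. i < n \<Longrightarrow> z \<in> polydisc n z0 r \<Longrightarrow> z' \<in> polydisc n z0 r \<Longrightarrow> x \<in> polydisc p x0 r \<Longrightarrow> x' \<in> polydisc p x0 r \<Longrightarrow>
        cmod (H i z x - H i z' x' - (z i - z' i) - (\<Sum>j<p. b i j * (x j - x' j))) \<le> e * (l1 n z z' + l1 p x x')"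
proof -
  have "\<forall>i\<in>{..<n}. \<exists>r>0. \<forall>z\<in>polydisc n z0 r. \<forall>z'\<in>polydisc n z0 r. \<forall>x\<in>polydisc p x0 r. \<forall>x'\<in>polydisc p x0 r.
        cmod (H i z x - H i z' x' - (z i - z' i) - (\<Sum>j<p. b i j * (x j - x' j))) \<le> e * (l1 n z z' + l1 p x x')"
  proof
    fix i assume "i \<in> {..<n}"
    then have i: "i < n" by simp
    show "\<exists>r>0. \<forall>z\<in>polydisc n z0 r. \<forall>z'\<in>polydisc n z0 r. \<forall>x\<in>polydisc p x0 r. \<forall>x'\<in>polydisc p x0 r.
        cmod (H i z x - H i z' x' - (z i - z' i) - (\<Sum>j<p. b i j * (x j - x' j))) \<le> e * (l1 n z z' + l1 p x x')"
      using H[OF i] assms unfolding strict_diff_def sum_Kronecker[OF i] by simp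
  qed
  from bchoice[OF this] obtain r where "\<forall>i\<in>{..<n}. r i > 0 \<and> (\<forall>z\<in>polydisc n z0 (r i). \<forall>z'\<in>polydisc n z0 (r i).
      \<forall>x\<in>polydisc p x0 (r i). \<forall>x'\<in>polydisc p x0 (r i).
        cmod (H i z x - H i z' x' - (z i - z' i) - (\<Sum>j<p. b i j * (x j - x' j))) \<le> e * (l1 n z z' + l1 p x x'))"
    by blast
  then have r: "\<And>i. i < n \<Longrightarrow> r i > 0"
      "\<And>i z z' x x'. i < n \<Longrightarrow> z \<in> polydisc n z0 (r i) \<Longrightarrow> z' \<in> polydisc n z0 (r i) \<Longrightarrow> x \<in> polydisc p x0 (r i) \<Longrightarrow> x' \<in> polydisc p x0 (r i) \<Longrightarrow>
        cmod (H i z x - H i z' x' - (z i - z' i) - (\<Sum>j<p. b i j * (x j - x' j))) \<le> e * (l1 n z z' + l1 p x x')"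
    by auto
  define s where "s = Min (insert 1 (r ` {..<n}))"
  have s: "s > 0" "\<And>i. i < n \<Longrightarrow> s \<le> r i" using r(1) by (auto simp: s_def)
  show ?thesis
  proof (rule that[OF s(1)])
    fix i z z' x x' assume i: "i < n" and "z \<in> polydisc n z0 s" "z' \<in> polydisc n z0 s" "x \<in> polydisc p x0 s" "x' \<in> polydisc p x0 s"
    then show "cmod (H i z x - H i z' x' - (z i - z' i) - (\<Sum>j<p. b i j * (x j - x' j))) \<le> e * (l1 n z z' + l1 p x x')"
      using polydisc_mono[OF s(2)[OF i]] by (intro r(2)) auto
  qed
qed

lemma implicit_contraction:
  obtains r where "r > 0" "\<And>z z' x. z \<in> polydisc n z0 r \<Longrightarrow> z' \<in> polydisc n z0 r \<Longrightarrow> x \<in> polydisc p x0 r \<Longrightarrow>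
    l1 n (\<lambda>i. z i - H i z x) (\<lambda>i. z' i - H i z' x) \<le> l1 n z z' / 2"
proof -
  define e where "e = 1 / (2 * (real n + 1))"
  have e: "e > 0" by (simp add: e_def)
  have ne: "real n * e \<le> 1 / 2" by (simp add: e_def field_simps)
  from implicit_strict_bound[OF e] obtain r where r: "r > 0" "\<And>i z z' x x'. i < n \<Longrightarrow> z \<in> polydisc n z0 r \<Longrightarrow> z' \<in> polydisc n z0 r \<Longrightarrow> x \<in> polydisc p x0 r \<Longrightarrow> x' \<in> polydisc p x0 r \<Longrightarrow>
        cmod (H i z x - H i z' x' - (z i - z' i) - (\<Sum>j<p. b i j * (x j - x' j))) \<le> e * (l1 n z z' + l1 p x x')" by blast
  show ?thesis
  proof (rule that[OF r(1)])
    fix z z' x assume h: "z \<in> polydisc n z0 r" "z' \<in> polydisc n z0 r" "x \<in> polydisc p x0 r"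
    have "l1 n (\<lambda>i. z i - H i z x) (\<lambda>i. z' i - H i z' x) \<le> (\<Sum>i<n. e * l1 n z z')"
      unfolding l1_def[of n "\<lambda>i. z i - H i z x"]
    proof (rule sum_mono)
      fix i assume "i \<in> {..<n}"
      then have i: "i < n" by simp
      have "cmod (H i z x - H i z' x - (z i - z' i)) \<le> e * l1 n z z'"
        using r(2)[OF i h(1,2,3,3)] by (simp add: l1_def)
      then show "cmod (z i - H i z x - (z' i - H i z' x)) \<le> e * l1 n z z'"
        by (metis (no_types, lifting) diff_diff_eq2 diff_add_eq minus_diff_eq norm_minus_cancel add_diff_eq diff_add_eq_diff_diff_swap diff_diff_add)
    qed
    also have "\<dots> = (real n * e) * l1 n z z'" by simp
    also have "\<dots> \<le> 1 / 2 * l1 n z z'" using ne by (intro mult_right_mono l1_nonneg)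
    finally show "l1 n (\<lambda>i. z i - H i z x) (\<lambda>i. z' i - H i z' x) \<le> l1 n z z' / 2" by simp
  qed
qed

lemma implicit_unique:
  obtains r where "r > 0" "\<And>z z' x. z \<in> polydisc n z0 r \<Longrightarrow> z' \<in> polydisc n z0 r \<Longrightarrow> x \<in> polydisc p x0 r \<Longrightarrow>
    (\<And>i. i < n \<Longrightarrow> H i z x = 0) \<Longrightarrow> (\<And>i. i < n \<Longrightarrow> H i z' x = 0) \<Longrightarrow> z = z'"
proof -
  from implicit_contraction obtain r where r: "r > 0" "\<And>z z' x. z \<in> polydisc n z0 r \<Longrightarrow> z' \<in> polydisc n z0 r \<Longrightarrow> x \<in> polydisc p x0 r \<Longrightarrow>
    l1 n (\<lambda>i. z i - H i z x) (\<lambda>i. z' i - H i z' x) \<le> l1 n z z' / 2" by blast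
  show ?thesis
  proof (rule that[OF r(1)])
    fix z z' x assume h: "z \<in> polydisc n z0 r" "z' \<in> polydisc n z0 r" "x \<in> polydisc p x0 r"
      "\<And>i. i < n \<Longrightarrow> H i z x = 0" "\<And>i. i < n \<Longrightarrow> H i z' x = 0"
    have "l1 n z z' \<le> l1 n z z' / 2" using r(2)[OF h(1-3)] h(4,5) by (simp add: l1_def)
    then have "\<not> l1 n z z' > 0" by simp
    then show "z = z'" using l1_pos[of z n z'] h(1,2) by (auto simp: polydisc_def)
  qed
qed

lemma implicit_value_tendsto: "i < n \<Longrightarrow> ((\<lambda>x. H i z0 x) \<longlongrightarrow> 0) (near p x0)"
proof -
  assume i: "i < n"
  obtain r where r: "r > 0" "\<And>i z z' x x'. i < n \<Longrightarrow> z \<in> polydisc n z0 r \<Longrightarrow> z' \<in> polydisc n z0 r \<Longrightarrow> x \<in> polydisc p x0 r \<Longrightarrow> x' \<in> polydisc p x0 r \<Longrightarrow>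
        cmod (H i z x - H i z' x' - (z i - z' i) - (\<Sum>j<p. b i j * (x j - x' j))) \<le> 1 * (l1 n z z' + l1 p x x')"
    using implicit_strict_bound[OF zero_less_one] by blast
  define B where "B = (\<Sum>j<p. cmod (b i j)) + 1"
  have "eventually (\<lambda>x. cmod (H i z0 x) \<le> B * l1 p x x0) (near p x0)"
    using eventually_polydisc_near[OF r(1), of p x0]
  proof (rule eventually_mono)
    fix x assume x: "x \<in> polydisc p x0 r"
    have "cmod (H i z0 x - (\<Sum>j<p. b i j * (x j - x0 j))) \<le> l1 p x x0"
      using r(2)[OF i _ _ x, of z0 z0 x0] H0[OF i] centre_in_polydisc[OF z0 r(1)] centre_in_polydisc[OF x0 r(1)]
      by (simp add: l1_def)
    then have "cmod (H i z0 x) \<le> l1 p x x0 + cmod (\<Sum>j<p. b i j * (x j - x0 j))"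
      using norm_triangle_ineq2[of "H i z0 x" "\<Sum>j<p. b i j * (x j - x0 j)"] by linarith
    then show "cmod (H i z0 x) \<le> B * l1 p x x0"
      using cmod_linear_le[of "b i" x x0 p] by (simp add: B_def algebra_simps)
  qed
  moreover have "((\<lambda>x. B * l1 p x x0) \<longlongrightarrow> B * 0) (near p x0)" by (intro tendsto_mult tendsto_const l1_tendsto)
  ultimately show ?thesis using Lim_null_comparison by fastforce
qed

text \<open>The iterates of \<open>z \<mapsto> z - H z x\<close> from \<open>z0\<close> stay in the polydisc, because the first step is small
  and every further step is at most half of the previous one.\<close>

lemma implicit_exists:
  assumes "s > 0"
  shows "eventually (\<lambda>x. \<exists>z\<in>polydisc n z0 s. \<forall>i<n. H i z x = 0) (near p x0)"
proof -
  from implicit_contraction obtain r where r: "r > 0" "\<And>z z' x. z \<in> polydisc n z0 r \<Longrightarrow> z' \<in> polydisc n z0 r \<Longrightarrow> x \<in> polydisc p x0 r \<Longrightarrow>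
    l1 n (\<lambda>i. z i - H i z x) (\<lambda>i. z' i - H i z' x) \<le> l1 n z z' / 2" by blast
  define t where "t = min r s"
  have t: "t > 0" "t \<le> r" "t \<le> s" using r(1) assms by (auto simp: t_def)
  define c where "c x = (\<Sum>i<n. cmod (H i z0 x))" for x
  have "((\<lambda>x. c x) \<longlongrightarrow> (\<Sum>i<n. cmod 0)) (near p x0)"
    unfolding c_def by (intro tendsto_sum tendsto_norm implicit_value_tendsto) auto
  then have "eventually (\<lambda>x. c x < t / 2) (near p x0)"
    using t(1) by (intro order_tendstoD(2)[of c 0]) auto
  with eventually_polydisc_near[OF r(1), of p x0]
  show ?thesis
  proof eventually_elim
    case (elim x)
    define T where "T z = (\<lambda>i. if i < n then z i - H i z x else 0)" for z :: "nat \<Rightarrow> complex"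
    define Z where "Z k = (T ^^ k) z0" for k :: nat
    have ZS: "Z (Suc k) = T (Z k)" for k by (simp add: Z_def)
    have TT: "l1 n (T z) (T z') \<le> l1 n z z' / 2" if "z \<in> polydisc n z0 r" "z' \<in> polydisc n z0 r" for z z'
      using r(2)[OF that elim(1)] by (simp add: l1_def T_def)
    have c0: "c x \<ge> 0" by (simp add: c_def sum_nonneg)
    have inP: "z \<in> polydisc n z0 t" if "z \<in> Cn n" "l1 n z z0 \<le> 2 * c x" for z
      using that l1_ge[of _ n z z0] elim(2) by (force simp: polydisc_def)
    have Zk: "Z k \<in> Cn n \<and> l1 n (Z k) z0 \<le> 2 * c x - 2 * c x / 2 ^ k \<and> l1 n (Z (Suc k)) (Z k) \<le> c x / 2 ^ k" for k
    proof (induction k)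
      case 0
      show ?case using z0 by (auto simp: Z_def T_def l1_def c_def)
    next
      case (Suc k)
      have nn: "2 * c x / 2 ^ j \<ge> 0" for j :: nat using c0 by simp
      have C: "Z (Suc k) \<in> Cn n" by (simp add: ZS T_def Cn_def)
      have "l1 n (Z (Suc k)) z0 \<le> l1 n (Z (Suc k)) (Z k) + l1 n (Z k) z0" by (rule l1_triangle)
      also have "\<dots> \<le> c x / 2 ^ k + (2 * c x - 2 * c x / 2 ^ k)" using Suc by linarith
      also have "\<dots> = 2 * c x - 2 * c x / 2 ^ Suc k" by simp
      finally have l: "l1 n (Z (Suc k)) z0 \<le> 2 * c x - 2 * c x / 2 ^ Suc k" .
      have "Z (Suc k) \<in> polydisc n z0 r" "Z k \<in> polydisc n z0 r"
        using inP[OF C] inP[of "Z k"] Suc l nn[of k] nn[of "Suc k"] polydisc_mono[OF t(2)] by (auto simp del: power_Suc)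
      from TT[OF this] have "l1 n (Z (Suc (Suc k))) (Z (Suc k)) \<le> l1 n (Z (Suc k)) (Z k) / 2" by (simp add: ZS)
      then have "l1 n (Z (Suc (Suc k))) (Z (Suc k)) \<le> c x / 2 ^ Suc k" using Suc by simp
      then show ?case using C l by blast
    qed
    have Zle: "l1 n (Z k) z0 \<le> 2 * c x" for k
    proof -
      have "2 * c x / 2 ^ k \<ge> 0" using c0 by simp
      then show ?thesis using Zk[of k] by linarith
    qed
    have "\<exists>y. (\<lambda>k. Z k i) \<longlonglongrightarrow> y" if i: "i < n" for i
    proof -
      have "summable (\<lambda>k. Z (Suc k) i - Z k i)"
      proof (rule summable_comparison_test')
        show "summable (\<lambda>k. c x * (1/2) ^ k)" by (intro summable_mult summable_geometric) auto
        show "norm (Z (Suc k) i - Z k i) \<le> c x * (1/2) ^ k" if "k \<ge> 0" for k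
        proof -
          have "c x * (1/2) ^ k = c x / 2 ^ k" by (simp add: power_divide)
          then show ?thesis using order_trans[OF l1_ge[OF i, of "Z (Suc k)" "Z k"]] Zk[of k] by simp
        qed
      qed
      then have "(\<lambda>m. \<Sum>k<m. Z (Suc k) i - Z k i) \<longlonglongrightarrow> (\<Sum>k. Z (Suc k) i - Z k i)" by (rule summable_LIMSEQ)
      moreover have "(\<Sum>k<m. Z (Suc k) i - Z k i) = Z m i - Z 0 i" for m by (rule sum_lessThan_telescope)
      ultimately have "(\<lambda>m. Z m i - Z 0 i) \<longlonglongrightarrow> (\<Sum>k. Z (Suc k) i - Z k i)" by simp
      from tendsto_add[OF this tendsto_const[of "Z 0 i"]] show ?thesis by auto
    qed
    then obtain y where y: "\<And>i. i < n \<Longrightarrow> (\<lambda>k. Z k i) \<longlonglongrightarrow> y i" by metis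
    define z where "z = (\<lambda>i. if i < n then y i else 0)"
    have zlim: "(\<lambda>k. Z k i) \<longlonglongrightarrow> z i" if "i < n" for i using y that by (simp add: z_def)
    have zC: "z \<in> Cn n" by (simp add: z_def Cn_def)
    have "(\<lambda>k. l1 n (Z k) z0) \<longlonglongrightarrow> l1 n z z0"
      unfolding l1_def by (intro tendsto_intros zlim) auto
    then have "l1 n z z0 \<le> 2 * c x" by (rule LIMSEQ_le_const2) (use Zle in auto)
    then have zP: "z \<in> polydisc n z0 t" using zC inP by blast
    have "H i z x = 0" if i: "i < n" for i
    proof -
      have "(\<lambda>k. l1 n (Z k) z) \<longlonglongrightarrow> (\<Sum>i<n. cmod (z i - z i))"
        unfolding l1_def by (intro tendsto_intros zlim) auto
      then have "(\<lambda>k. l1 n (Z k) z / 2) \<longlonglongrightarrow> 0 / 2" by (intro tendsto_divide) auto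
      moreover have "cmod (Z (Suc k) i - T z i) \<le> l1 n (Z k) z / 2" for k
      proof -
        have "Z k \<in> polydisc n z0 r" "z \<in> polydisc n z0 r"
          using zP inP[of "Z k"] Zle[of k] Zk[of k] polydisc_mono[OF t(2)] by auto
        from TT[OF this] show ?thesis using l1_ge[OF i, of "T (Z k)" "T z"] by (simp add: ZS)
      qed
      ultimately have "(\<lambda>k. Z (Suc k) i - T z i) \<longlonglongrightarrow> 0"
        by (intro Lim_null_comparison[of "\<lambda>k. Z (Suc k) i - T z i" "\<lambda>k. l1 n (Z k) z / 2"]) auto
      then have "(\<lambda>k. Z (Suc k) i) \<longlonglongrightarrow> T z i" by (simp add: LIM_zero_iff)
      moreover have "(\<lambda>k. Z (Suc k) i) \<longlonglongrightarrow> z i" using zlim[OF i] by (rule LIMSEQ_Suc)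
      ultimately have "T z i = z i" by (rule LIMSEQ_unique)
      then show ?thesis using i by (simp add: T_def)
    qed
    then show ?case using zP polydisc_mono[OF t(3)] by blast
  qed
qed

text \<open>At a solution the linear parts cancel up to an error relative to the increments of both \<open>z\<close> and
  \<open>x\<close>; absorbing the former first gives a Lipschitz bound of \<open>z\<close> in \<open>x\<close>, and then the derivative.\<close>

lemma implicit_derivative:
  assumes e: "e > 0"
  obtains s where "s > 0" "\<And>x z i. x \<in> polydisc p x0 s \<Longrightarrow> z \<in> polydisc n z0 s \<Longrightarrow> (\<And>i. i < n \<Longrightarrow> H i z x = 0) \<Longrightarrow> i < n \<Longrightarrow>
    cmod (z i - z0 i - (\<Sum>j<p. - b i j * (x j - x0 j))) \<le> e * l1 p x x0"
proof -
  define B where "B = (\<Sum>i<n. \<Sum>j<p. cmod (b i j))"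
  have B: "B \<ge> 0" by (simp add: B_def sum_nonneg)
  define e1 where "e1 = min (1 / (2 * (real n + 1))) (e / (2 * B + 3))"
  have e1: "e1 > 0" "real n * e1 \<le> 1 / 2"
  proof -
    show "e1 > 0" using e B by (simp add: e1_def)
    have "real n * e1 \<le> real n * (1 / (2 * (real n + 1)))" by (intro mult_left_mono) (auto simp: e1_def)
    also have "\<dots> \<le> 1 / 2" by (simp add: field_simps)
    finally show "real n * e1 \<le> 1 / 2" .
  qed
  have e1e: "e1 * (2 * B + 3) \<le> e"
  proof -
    have "e1 * (2 * B + 3) \<le> e / (2 * B + 3) * (2 * B + 3)" using B by (intro mult_right_mono) (auto simp: e1_def)
    then show ?thesis using B by simp
  qed
  from implicit_strict_bound[OF e1(1)] obtain r where r: "r > 0" "\<And>i z z' x x'. i < n \<Longrightarrow> z \<in> polydisc n z0 r \<Longrightarrow> z' \<in> polydisc n z0 r \<Longrightarrow> x \<in> polydisc p x0 r \<Longrightarrow> x' \<in> polydisc p x0 r \<Longrightarrow>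
        cmod (H i z x - H i z' x' - (z i - z' i) - (\<Sum>j<p. b i j * (x j - x' j))) \<le> e1 * (l1 n z z' + l1 p x x')" by blast
  show ?thesis
  proof (rule that[OF r(1)])
    fix x z i assume h: "x \<in> polydisc p x0 r" "z \<in> polydisc n z0 r" "\<And>i. i < n \<Longrightarrow> H i z x = 0" "i < n"
    let ?l = "\<lambda>i. \<Sum>j<p. b i j * (x j - x0 j)"
    have bd: "cmod (z i - z0 i + ?l i) \<le> e1 * (l1 n z z0 + l1 p x x0)" if i: "i < n" for i
    proof -
      have "cmod (- (z i - z0 i) - ?l i) \<le> e1 * (l1 n z z0 + l1 p x x0)"
        using r(2)[OF i h(2) centre_in_polydisc[OF z0 r(1)] h(1) centre_in_polydisc[OF x0 r(1)]] h(3)[OF i] H0[OF i] by simp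
      moreover have "- (z i - z0 i) - ?l i = - (z i - z0 i + ?l i)" by simp
      ultimately show ?thesis by (metis norm_minus_cancel)
    qed
    have "l1 n z z0 \<le> (\<Sum>i<n. (\<Sum>j<p. cmod (b i j)) * l1 p x x0 + e1 * (l1 n z z0 + l1 p x x0))"
    proof -
      have "cmod (z i - z0 i) \<le> (\<Sum>j<p. cmod (b i j)) * l1 p x x0 + e1 * (l1 n z z0 + l1 p x x0)" if "i < n" for i
        using bd[OF that] cmod_linear_le[of "b i" x x0 p] norm_triangle_ineq4[of "z i - z0 i + ?l i" "?l i"] by simp
      then have "(\<Sum>i<n. cmod (z i - z0 i)) \<le> (\<Sum>i<n. (\<Sum>j<p. cmod (b i j)) * l1 p x x0 + e1 * (l1 n z z0 + l1 p x x0))"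
        by (intro sum_mono) auto
      then show "l1 n z z0 \<le> (\<Sum>i<n. (\<Sum>j<p. cmod (b i j)) * l1 p x x0 + e1 * (l1 n z z0 + l1 p x x0))"
        by (simp only: l1_def[of n z z0, symmetric])
    qed
    also have "\<dots> = B * l1 p x x0 + (real n * e1) * (l1 n z z0 + l1 p x x0)"
      by (simp add: B_def sum.distrib sum_distrib_right)
    also have "\<dots> \<le> B * l1 p x x0 + 1 / 2 * (l1 n z z0 + l1 p x x0)"
      using e1(2) by (intro add_left_mono mult_right_mono) (auto simp: l1_nonneg)
    finally have lz: "l1 n z z0 \<le> (2 * B + 1) * l1 p x x0" by (simp add: algebra_simps)
    have "cmod (z i - z0 i - (\<Sum>j<p. - b i j * (x j - x0 j))) = cmod (z i - z0 i + ?l i)"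
      by (simp add: sum_negf)
    also have "\<dots> \<le> e1 * (l1 n z z0 + l1 p x x0)" by (rule bd[OF h(4)])
    also have "\<dots> \<le> e1 * ((2 * B + 2) * l1 p x x0)"
      using e1(1) lz by (intro mult_left_mono) (auto simp: algebra_simps)
    also have "\<dots> \<le> (e1 * (2 * B + 3)) * l1 p x x0"
      using e1(1) l1_nonneg[of p x x0] by (simp add: algebra_simps)
    also have "\<dots> \<le> e * l1 p x x0" using e1e by (intro mult_right_mono l1_nonneg)
    finally show "cmod (z i - z0 i - (\<Sum>j<p. - b i j * (x j - x0 j))) \<le> e * l1 p x x0" .
  qed
qed

end

text \<open>The hypothesis provides equations normalised at each solution. The equations at the base point
  give a unique section over a whole polydisc; to differentiate it at another point \<open>x1\<close>, the implicit
  function theorem is applied again with the equations that belong to \<open>(S x1, x1)\<close>, and uniqueness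
  identifies the two sections near \<open>x1\<close>.\<close>

lemma etale_section:
  fixes P :: "(nat \<Rightarrow> complex) \<Rightarrow> (nat \<Rightarrow> complex) \<Rightarrow> bool"
  assumes PC: "\<And>z x. P z x \<Longrightarrow> z \<in> Cn n \<and> x \<in> Cn p"
    and loc: "\<And>z x. P z x \<Longrightarrow> \<exists>H b r. r > 0 \<and>
       (\<forall>i<n. strict_diff n p (H i) (\<lambda>k. if k = i then 1 else 0) (b i) z x) \<and>
       (\<forall>z'\<in>polydisc n z r. \<forall>x'\<in>polydisc p x r. P z' x' \<longleftrightarrow> (\<forall>i<n. H i z' x' = 0))"
    and P0: "P z0 x0"
  obtains r0 where "r0 > 0"
    "\<And>r. 0 < r \<Longrightarrow> r \<le> r0 \<Longrightarrow> \<exists>\<delta>>0. \<exists>S. \<forall>x\<in>polydisc p x0 \<delta>. S x \<in> polydisc n z0 r \<and> P (S x) x \<and>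
       (\<forall>z\<in>polydisc n z0 r. P z x \<longrightarrow> z = S x) \<and> (\<forall>i<n. cdiff p (\<lambda>x. S x i) x)"
proof -
  have C: "z0 \<in> Cn n" "x0 \<in> Cn p" using PC[OF P0] by auto
  obtain H b r1 where r1: "r1 > 0" and H: "\<And>i. i < n \<Longrightarrow> strict_diff n p (H i) (\<lambda>k. if k = i then 1 else 0) (b i) z0 x0"
    and PH: "\<And>z x. z \<in> polydisc n z0 r1 \<Longrightarrow> x \<in> polydisc p x0 r1 \<Longrightarrow> P z x \<longleftrightarrow> (\<forall>i<n. H i z x = 0)"
    using loc[OF P0] by blast
  have H0: "H i z0 x0 = 0" if "i < n" for i
    using PH[OF centre_in_polydisc centre_in_polydisc, OF C(1) r1 C(2) r1] P0 that by blast
  obtain r2 where r2: "r2 > 0" "\<And>z z' x. z \<in> polydisc n z0 r2 \<Longrightarrow> z' \<in> polydisc n z0 r2 \<Longrightarrow> x \<in> polydisc p x0 r2 \<Longrightarrow>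
    (\<And>i. i < n \<Longrightarrow> H i z x = 0) \<Longrightarrow> (\<And>i. i < n \<Longrightarrow> H i z' x = 0) \<Longrightarrow> z = z'"
    using implicit_unique[OF C H H0] by blast
  define r0 where "r0 = min r1 r2"
  have r0: "r0 > 0" "r0 \<le> r1" "r0 \<le> r2" using r1 r2(1) by (auto simp: r0_def)
  show ?thesis
  proof (rule that[OF r0(1)])
    fix r :: real assume r: "0 < r" "r \<le> r0"
    have "eventually (\<lambda>x. x \<in> polydisc p x0 r0 \<and> (\<exists>z\<in>polydisc n z0 r. \<forall>i<n. H i z x = 0)) (near p x0)"
      by (intro eventually_conj eventually_polydisc_near r0(1) implicit_exists[OF C H H0] r(1))
    then obtain \<delta> where \<delta>: "\<delta> > 0" "\<And>x. x \<in> polydisc p x0 \<delta> \<Longrightarrow> x \<in> polydisc p x0 r0"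
        "\<And>x. x \<in> polydisc p x0 \<delta> \<Longrightarrow> \<exists>z\<in>polydisc n z0 r. \<forall>i<n. H i z x = 0"
      unfolding eventually_near by blast
    \<comment> \<open>the choice is unique by \<open>r2\<close>\<close>
    define S where "S x = (SOME z. z \<in> polydisc n z0 r \<and> (\<forall>i<n. H i z x = 0))" for x
    have S: "S x \<in> polydisc n z0 r \<and> (\<forall>i<n. H i (S x) x = 0)" if "x \<in> polydisc p x0 \<delta>" for x
      unfolding S_def using someI_ex[of "\<lambda>z. z \<in> polydisc n z0 r \<and> (\<forall>i<n. H i z x = 0)"] \<delta>(3)[OF that] by blast
    have rr: "z \<in> polydisc n z0 r1" "z \<in> polydisc n z0 r2" if "z \<in> polydisc n z0 r" for z
      using that subsetD[OF polydisc_mono[of r r1 n z0]] subsetD[OF polydisc_mono[of r r2 n z0]] r r0 by auto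
    have xx: "x \<in> polydisc p x0 r1" "x \<in> polydisc p x0 r2" if "x \<in> polydisc p x0 \<delta>" for x
      using \<delta>(2)[OF that] subsetD[OF polydisc_mono[of r0 r1 p x0]] subsetD[OF polydisc_mono[of r0 r2 p x0]] r0 by auto
    have PS: "P (S x) x" if "x \<in> polydisc p x0 \<delta>" for x
      using PH S rr xx that by blast
    have uniq: "z = S x" if "x \<in> polydisc p x0 \<delta>" "z \<in> polydisc n z0 r" "P z x" for x z
      using r2(2)[of z "S x" x] S[OF that(1)] PH[of z x] rr[of z] rr[of "S x"] xx[of x] that by blast
    have "cdiff p (\<lambda>x. S x i) x1" if x1: "x1 \<in> polydisc p x0 \<delta>" and i: "i < n" for x1 i
    proof -
      obtain H' b' r' where r': "r' > 0" and H': "\<And>i. i < n \<Longrightarrow> strict_diff n p (H' i) (\<lambda>k. if k = i then 1 else 0) (b' i) (S x1) x1"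
        and PH': "\<And>z x. z \<in> polydisc n (S x1) r' \<Longrightarrow> x \<in> polydisc p x1 r' \<Longrightarrow> P z x \<longleftrightarrow> (\<forall>i<n. H' i z x = 0)"
        using loc[OF PS[OF x1]] by blast
      have C': "S x1 \<in> Cn n" "x1 \<in> Cn p" using PC[OF PS[OF x1]] by auto
      have H'0: "H' i (S x1) x1 = 0" if "i < n" for i
        using PH'[OF centre_in_polydisc centre_in_polydisc, OF C'(1) r' C'(2) r'] PS[OF x1] that by blast
      obtain t where t: "t > 0" "polydisc n (S x1) t \<subseteq> polydisc n z0 r"
        using polydisc_near[of "S x1" n z0 r] S[OF x1] unfolding eventually_near by blast
      have cont: "eventually (\<lambda>x. S x \<in> polydisc n (S x1) s \<and> (\<forall>i<n. H' i (S x) x = 0)) (near p x1)" if s: "s > 0" for s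
      proof -
        define s' where "s' = Min {s, t, r'}"
        have s': "s' > 0" "s' \<le> s" "s' \<le> t" "s' \<le> r'" using s t r' by (auto simp: s'_def)
        have "eventually (\<lambda>x. \<exists>z\<in>polydisc n (S x1) s'. \<forall>i<n. H' i z x = 0) (near p x1)"
          by (rule implicit_exists[OF C' H' H'0 s'(1)])
        moreover have "eventually (\<lambda>x. x \<in> polydisc p x1 r') (near p x1)" by (rule eventually_polydisc_near[OF r'])
        moreover have "eventually (\<lambda>x. x \<in> polydisc p x0 \<delta>) (near p x1)" by (rule polydisc_near[OF x1])
        ultimately show ?thesis
        proof eventually_elim
          case (elim x)
          then obtain z where z: "z \<in> polydisc n (S x1) s'" "\<forall>i<n. H' i z x = 0" by blast
          then have "P z x" using PH'[of z x] elim(2) polydisc_mono[OF s'(4)] by blast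
          moreover have "z \<in> polydisc n z0 r" using z(1) polydisc_mono[OF s'(3)] t(2) by blast
          ultimately have "z = S x" using uniq elim(3) by blast
          then show ?case using z polydisc_mono[OF s'(2)] by blast
        qed
      qed
      show ?thesis
        unfolding cdiff_def
      proof (intro exI[of _ "\<lambda>j. - b' i j"] allI impI)
        fix e :: real assume "e > 0"
        from implicit_derivative[OF C' H' H'0 this] obtain s where s: "s > 0"
          "\<And>x z i. x \<in> polydisc p x1 s \<Longrightarrow> z \<in> polydisc n (S x1) s \<Longrightarrow> (\<And>i. i < n \<Longrightarrow> H' i z x = 0) \<Longrightarrow> i < n \<Longrightarrow>
            cmod (z i - S x1 i - (\<Sum>j<p. - b' i j * (x j - x1 j))) \<le> e * l1 p x x1" by blast
        from cont[OF s(1)] eventually_polydisc_near[OF s(1), of p x1]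
        show "eventually (\<lambda>x. cmod (S x i - S x1 i - (\<Sum>j<p. - b' i j * (x j - x1 j))) \<le> e * l1 p x x1) (near p x1)"
          by eventually_elim (use s(2) i in blast)
      qed
    qed
    then show "\<exists>\<delta>>0. \<exists>S. \<forall>x\<in>polydisc p x0 \<delta>. S x \<in> polydisc n z0 r \<and> P (S x) x \<and>
       (\<forall>z\<in>polydisc n z0 r. P z x \<longrightarrow> z = S x) \<and> (\<forall>i<n. cdiff p (\<lambda>x. S x i) x)"
      using \<delta>(1) S PS uniq by (intro exI[of _ \<delta>] conjI exI[of _ S]) auto
  qed
qed

section \<open>Residues and fixed points\<close>

definition Res :: "nat \<Rightarrow> (nat \<Rightarrow> complex) set" where
  "Res d = {m \<in> Cn d. (\<Sum>i<d. m i) = 0 \<and> (\<forall>i<d. m i \<noteq> 0)}"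

definition residues :: "nat \<Rightarrow> (nat \<Rightarrow> complex) \<Rightarrow> nat \<Rightarrow> complex" where
  "residues d l = (\<lambda>i. if i < d then 1 / (1 - l i) else 0)"

definition multipliers :: "nat \<Rightarrow> (nat \<Rightarrow> complex) \<Rightarrow> nat \<Rightarrow> complex" where
  "multipliers d m = (\<lambda>i. if i < d then 1 - 1 / m i else 0)"

text \<open>The normalised configurations of fixed points with residues \<open>m\<close>. For residues with sum zero the
  equations hold for constants \<open>g\<close> anyway. Testing only with \<open>g\<close> vanishing at 0 makes them independent
  equations that have solutions also for residues off this hyperplane, so that the parameter \<open>m\<close> may
  range over an open subset of \<open>C\<^sup>d\<close>.\<close>

definition config :: "nat \<Rightarrow> (nat \<Rightarrow> complex) \<Rightarrow> (nat \<Rightarrow> complex) set" where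
  "config d m = {z \<in> Cn d. inj_on z {..<d} \<and> z 0 = 0 \<and> z 1 = 1 \<and>
     (\<forall>g. degree g + 2 \<le> d \<and> poly g 0 = 0 \<longrightarrow> (\<Sum>i<d. m i * poly g (z i)) = 0)}"

definition normalise :: "nat \<Rightarrow> (nat \<Rightarrow> complex) \<Rightarrow> nat \<Rightarrow> complex" where
  "normalise d z = (\<lambda>i. if i < d then (z i - z 0) / (z 1 - z 0) else 0)"

text \<open>The polynomial of degree \<open>d\<close> with fixed points \<open>z\<close>; its leading coefficient is the one for which
  the label 0 has residue \<open>m 0\<close>. By \<open>residue_product_const\<close> every other label would give the same.\<close>

definition fixed_poly :: "nat \<Rightarrow> (nat \<Rightarrow> complex) \<Rightarrow> (nat \<Rightarrow> complex) \<Rightarrow> complex poly" where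
  "fixed_poly d m z = [:0, 1:] + smult (- 1 / (m 0 * (\<Prod>j\<in>{..<d} - {0}. z 0 - z j))) (\<Prod>j<d. [:- z j, 1:])"

definition labels :: "nat \<Rightarrow> complex poly \<Rightarrow> (nat \<Rightarrow> complex) \<Rightarrow> bool" where
  "labels d f z \<longleftrightarrow> z \<in> Cn d \<and> inj_on z {..<d} \<and> (\<forall>i<d. poly f (z i) = z i)"

definition fp_residues :: "nat \<Rightarrow> complex poly \<Rightarrow> (nat \<Rightarrow> complex) \<Rightarrow> nat \<Rightarrow> complex" where
  "fp_residues d f z = residues d (\<lambda>i. poly (pderiv f) (z i))"

definition config_class :: "nat \<Rightarrow> (nat \<Rightarrow> complex) \<Rightarrow> (nat \<Rightarrow> complex) \<Rightarrow> complex poly set" where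
  "config_class d m z = moduli_class d (fixed_poly d m z)"

lemma Lambda_iff_residues:
  assumes "l \<in> Cn d" "\<And>i. i < d \<Longrightarrow> l i \<noteq> 1"
  shows "l \<in> Lambda d \<longleftrightarrow> (\<Sum>i<d. residues d l i) = 0"
proof -
  have nz: "(\<Prod>j<d. 1 - l j) \<noteq> 0" using assms(2) by fastforce
  have "(\<Prod>j\<in>{..<d} - {i}. 1 - l j) = (\<Prod>j<d. 1 - l j) * residues d l i" if "i \<in> {..<d}" for i
    using that assms(2)[of i] by (subst prod.remove[of "{..<d}" i]) (auto simp: residues_def)
  then have "(\<Sum>i<d. \<Prod>j\<in>{..<d} - {i}. (1 - l j)) = (\<Prod>j<d. 1 - l j) * (\<Sum>i<d. residues d l i)"
    by (simp add: sum_distrib_left)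
  then show ?thesis using assms(1) nz by (simp add: Lambda_def)
qed

lemma residues_in_Res: "l \<in> V d \<Longrightarrow> residues d l \<in> Res d"
  using Lambda_iff_residues[of l d] by (auto simp: V_def Lambda_def Res_def residues_def Cn_def)

lemma multipliers_residues: "l \<in> V d \<Longrightarrow> multipliers d (residues d l) = l"
  by (auto simp: V_def Lambda_def residues_def Cn_def multipliers_def fun_eq_iff)

lemma residues_multipliers: "m \<in> Cn d \<Longrightarrow> residues d (multipliers d m) = m"
  by (auto simp: residues_def Cn_def multipliers_def fun_eq_iff)

lemma multipliers_in_V: "m \<in> Res d \<Longrightarrow> multipliers d m \<in> V d"
proof -
  assume m: "m \<in> Res d"
  then have C: "multipliers d m \<in> Cn d" and n: "\<And>i. i < d \<Longrightarrow> multipliers d m i \<noteq> 1"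
    by (auto simp: Res_def multipliers_def Cn_def)
  have "m \<in> Cn d" using m by (simp add: Res_def)
  then have "(\<Sum>i<d. residues d (multipliers d m) i) = 0" using m by (simp add: residues_multipliers Res_def)
  then show ?thesis using Lambda_iff_residues[OF C n] n by (simp add: V_def)
qed

lemma pr_eq_iff:
  assumes "l \<in> Cn d" "l' \<in> Cn d"
  shows "pr d l = pr d l' \<longleftrightarrow> (\<exists>s. s permutes {..<d} \<and> l' = l \<circ> s)"
proof
  assume "pr d l = pr d l'"
  then have "image_mset l' (mset_set {..<d}) = image_mset l (mset_set {..<d})" by (simp add: pr_def)
  then obtain s where s: "s permutes {..<d}" "\<forall>x\<in>{..<d}. l' x = l (s x)"
    by (rule image_mset_eq_implies_permutes[rotated]) auto
  have "l' x = l (s x)" for x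
  proof (cases "x < d")
    case False
    then have "s x = x" using permutes_not_in[OF s(1)] by auto
    then show ?thesis using False assms by (auto simp: Cn_def)
  qed (use s in auto)
  then show "\<exists>s. s permutes {..<d} \<and> l' = l \<circ> s" using s(1) by (auto simp: fun_eq_iff)
next
  assume "\<exists>s. s permutes {..<d} \<and> l' = l \<circ> s"
  then obtain s where s: "s permutes {..<d}" "l' = l \<circ> s" by blast
  have "image_mset s (mset_set {..<d}) = mset_set {..<d}"
    using image_mset_mset_set[OF permutes_inj_on[OF s(1)], of "{..<d}"] permutes_image[OF s(1)] by simp
  then have "image_mset l (image_mset s (mset_set {..<d})) = image_mset l (mset_set {..<d})" by simp
  then show "pr d l = pr d l'" by (simp add: pr_def s(2) multiset.map_comp)
qed

lemma comp_permutes_Cn: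
  assumes "s permutes {..<d}" "z \<in> Cn d" shows "z \<circ> s \<in> Cn d"
  using assms permutes_not_in[OF assms(1)] by (auto simp: Cn_def)

lemma comp_permutes_Res:
  assumes "s permutes {..<d}" "m \<in> Res d" shows "m \<circ> s \<in> Res d"
proof -
  have "(\<Sum>i<d. m (s i)) = (\<Sum>i<d. m i)" by (rule sum.permute[OF assms(1), symmetric, unfolded o_def])
  moreover have "\<forall>i<d. s i < d" using permutes_in_image[OF assms(1)] by auto
  ultimately show ?thesis using assms comp_permutes_Cn[of s d m] by (auto simp: Res_def)
qed

lemma multipliers_comp_permutes:
  assumes "s permutes {..<d}" shows "multipliers d (m \<circ> s) = multipliers d m \<circ> s"
  using permutes_in_image[OF assms] permutes_not_in[OF assms]
  by (auto simp: multipliers_def fun_eq_iff)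

lemma residues_comp_permutes:
  assumes "s permutes {..<d}" shows "residues d (m \<circ> s) = residues d m \<circ> s"
  using permutes_in_image[OF assms] permutes_not_in[OF assms]
  by (auto simp: residues_def fun_eq_iff)

lemma pr_multipliers_eq_iff:
  assumes "m \<in> Res d" "m' \<in> Res d"
  shows "pr d (multipliers d m) = pr d (multipliers d m') \<longleftrightarrow> (\<exists>s. s permutes {..<d} \<and> m' = m \<circ> s)"
proof -
  have C: "m \<in> Cn d" "m' \<in> Cn d" "multipliers d m \<in> Cn d" "multipliers d m' \<in> Cn d"
    using assms by (auto simp: Res_def multipliers_def Cn_def)
  have "multipliers d m' = multipliers d m \<circ> s \<longleftrightarrow> m' = m \<circ> s" if s: "s permutes {..<d}" for s
    using multipliers_comp_permutes[OF s, of m] residues_multipliers[OF C(2)]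
      residues_multipliers[OF comp_permutes_Cn[OF s C(1)]] by metis
  then show ?thesis unfolding pr_eq_iff[OF C(3,4)] by blast
qed

lemma config_Cn: "z \<in> config d m \<Longrightarrow> z \<in> Cn d" by (simp add: config_def)

lemma config_annihilates:
  assumes "m \<in> Res d" "z \<in> config d m" "degree g + 2 \<le> d"
  shows "(\<Sum>i<d. m i * poly g (z i)) = 0"
proof -
  have "degree (g - [:poly g 0:]) + 2 \<le> d"
    using assms(3) degree_diff_le_max[of g "[:poly g 0:]"] by simp
  then have "(\<Sum>i<d. m i * poly (g - [:poly g 0:]) (z i)) = 0"
    using assms(2) by (auto simp: config_def)
  then have "(\<Sum>i<d. m i * poly g (z i)) = (\<Sum>i<d. m i) * poly g 0"
    by (simp add: right_diff_distrib sum_subtractf sum_distrib_right)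
  then show ?thesis using assms(1) by (simp add: Res_def)
qed

lemma poly_antiderivative: "\<exists>L :: complex poly. pderiv L = p \<and> poly L 0 = 0 \<and> degree L \<le> degree p + 1"
proof -
  define L where "L = (\<Sum>k\<le>degree p. monom (coeff p k / of_nat (Suc k)) (Suc k))"
  have "pderiv (\<Sum>k\<in>A. F k) = (\<Sum>k\<in>A. pderiv (F k))" for F :: "nat \<Rightarrow> complex poly" and A
    using higher_pderiv_sum[of 1] by simp
  then have "pderiv L = (\<Sum>k\<le>degree p. monom (coeff p k) k)"
    unfolding L_def by (simp add: pderiv_monom del: of_nat_Suc)
  then have "pderiv L = p" by (simp add: poly_as_sum_of_monoms)
  moreover have "poly L 0 = 0" by (simp add: L_def poly_sum poly_monom)
  moreover have "degree L \<le> degree p + 1"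
    unfolding L_def by (intro degree_sum_le) (auto intro: order_trans[OF degree_monom_le])
  ultimately show ?thesis by blast
qed

lemma Lagrange_basis:
  assumes "inj_on z A" "finite A" "i \<in> A"
  shows "\<exists>q :: complex poly. degree q + 1 = card A \<and> (\<forall>k\<in>A. poly q (z k) = (if k = i then 1 else 0))"
proof -
  define c where "c = (\<Prod>k\<in>A - {i}. z i - z k)"
  have c: "c \<noteq> 0" using assms unfolding c_def by (auto simp: inj_on_def)
  define q where "q = smult (1 / c) (\<Prod>k\<in>A - {i}. [:- z k, 1:])"
  have "degree q = card (A - {i})" using c by (simp add: q_def degree_prod_sum_eq)
  moreover have "card (A - {i}) + 1 = card A" using card_Suc_Diff1[OF assms(2,3)] by simp
  moreover have "poly q (z k) = (if k = i then 1 else 0)" if k: "k \<in> A" for k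
  proof (cases "k = i")
    case True
    then show ?thesis using c by (simp add: q_def poly_prod c_def)
  next
    case False
    then have "(\<Prod>j\<in>A - {i}. z k - z j) = 0" using k assms(2) by (intro prod_zero) auto
    then show ?thesis using False by (simp add: q_def poly_prod)
  qed
  ultimately show ?thesis by (intro exI[of _ q]) auto
qed

lemma eventually_inj_on_near:
  assumes "inj_on z0 {..<n}"
  shows "eventually (\<lambda>z. inj_on z {..<n}) (near n z0)"
proof -
  have "eventually (\<lambda>z. \<forall>i\<in>{..<n}. \<forall>j\<in>{..<n}. i \<noteq> j \<longrightarrow> z i \<noteq> z j) (near n z0)"
  proof (intro eventually_ball_finite ballI)
    fix i j assume ij: "i \<in> {..<n}" "j \<in> {..<n}"
    show "eventually (\<lambda>z. i \<noteq> j \<longrightarrow> z i \<noteq> z j) (near n z0)"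
    proof (cases "i = j")
      case False
      then have "z0 i - z0 j \<noteq> 0" using assms ij by (auto simp: inj_on_def)
      moreover have "((\<lambda>z. z i - z j) \<longlongrightarrow> z0 i - z0 j) (near n z0)"
        using ij by (intro tendsto_diff tendsto_coord_near) auto
      ultimately have "eventually (\<lambda>z. z i - z j \<noteq> 0) (near n z0)" by (rule tendsto_imp_eventually_ne[rotated])
      then show ?thesis by (rule eventually_mono) auto
    qed auto
  qed auto
  then show ?thesis by (rule eventually_mono) (auto simp: inj_on_def)
qed

lemma eventually_nonzero_near:
  assumes "\<And>i. i < n \<Longrightarrow> m0 i \<noteq> 0"
  shows "eventually (\<lambda>m. \<forall>i<n. m i \<noteq> 0) (near n m0)"
proof -
  have "eventually (\<lambda>m. \<forall>i\<in>{..<n}. m i \<noteq> 0) (near n m0)"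
    using assms by (intro eventually_ball_finite ballI tendsto_imp_eventually_ne[OF tendsto_coord_near]) auto
  then show ?thesis by (rule eventually_mono) auto
qed

text \<open>For fixed residues \<open>m\<close> the equations of \<open>config\<close> have derivative \<open>dz \<mapsto> (\<Sum>j. m j g'(z j) dz j)\<close>.
  Choosing for \<open>g\<close> the antiderivatives of the Lagrange basis at the points \<open>z0 2, \<dots>, z0 (d - 1)\<close> makes
  this derivative diagonal: the map from configurations to residues is etale.\<close>

lemma config_local_equations:
  assumes d: "d \<ge> 2" and m0: "m0 \<in> Cn d" "\<And>i. i < d \<Longrightarrow> m0 i \<noteq> 0" and z0: "z0 \<in> config d m0"
  shows "\<exists>H b r. r > 0 \<and>
       (\<forall>i<d. strict_diff d d (H i) (\<lambda>k. if k = i then 1 else 0) (b i) z0 m0) \<and>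
       (\<forall>z\<in>polydisc d z0 r. \<forall>m\<in>polydisc d m0 r.
          ((m \<in> Cn d \<and> (\<forall>i<d. m i \<noteq> 0) \<and> z \<in> config d m) \<longleftrightarrow> (\<forall>i<d. H i z m = 0)))"
proof -
  let ?A = "{2..<d}"
  have z0C: "z0 \<in> Cn d" and inj0: "inj_on z0 {..<d}" using z0 by (auto simp: config_def)
  have "\<exists>L :: complex poly. i \<in> ?A \<longrightarrow> poly L 0 = 0 \<and> degree L + 2 \<le> d \<and> degree (pderiv L) + 3 \<le> d \<and>
      (\<forall>k\<in>?A. poly (pderiv L) (z0 k) = (if k = i then 1 else 0))" for i
  proof (cases "i \<in> ?A")
    case True
    have "inj_on z0 ?A" using inj0 by (rule inj_on_subset) auto
    then obtain q where q: "degree q + 1 = card ?A" "\<forall>k\<in>?A. poly q (z0 k) = (if k = i then 1 else 0)"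
      using Lagrange_basis[of z0 ?A i] True by auto
    obtain L where "pderiv L = q" "poly L 0 = 0" "degree L \<le> degree q + 1" using poly_antiderivative by blast
    then show ?thesis using q True by (intro exI[of _ L]) auto
  qed auto
  then obtain L where L: "\<And>i. i \<in> ?A \<Longrightarrow> poly (L i) 0 = 0" "\<And>i. i \<in> ?A \<Longrightarrow> degree (L i) + 2 \<le> d"
      "\<And>i. i \<in> ?A \<Longrightarrow> degree (pderiv (L i)) + 3 \<le> d"
      "\<And>i k. i \<in> ?A \<Longrightarrow> k \<in> ?A \<Longrightarrow> poly (pderiv (L i)) (z0 k) = (if k = i then 1 else 0)"
    by metis
  \<comment> \<open>In the equations with index at least 2 the points with labels 0 and 1 are replaced by their
    normalised values, so that the derivative involves the remaining points only.\<close>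
  define G where "G i j z m = (if j \<in> ?A then m j * poly (L i) (z j) else m j * poly (L i) (of_nat j))"
    for i j and z m :: "nat \<Rightarrow> complex"
  define H where "H i z m = (if i = 0 then z 0 else if i = 1 then z 1 - 1 else 1 / m0 i * (\<Sum>j<d. G i j z m))"
    for i and z m :: "nat \<Rightarrow> complex"
  have sdG: "\<exists>b. strict_diff d d (G i j) (\<lambda>k. if k = j \<and> i = j then m0 j else 0) b z0 m0"
    if "i \<in> ?A" "j < d" for i j
  proof (cases "j \<in> ?A")
    case True
    have eq: "(if k = j then m0 j * poly (pderiv (L i)) (z0 j) else 0) = (if k = j \<and> i = j then m0 j else 0)" for k
      using L(4)[OF that(1) True] by auto
    show ?thesis
      using strict_diff_coord_poly[OF that(2) that(2) z0C m0(1), of "L i"] True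
      unfolding eq G_def by auto
  next
    case False
    let ?b = "\<lambda>k. if k = j then poly (L i) (of_nat j) else 0"
    have "(\<lambda>z x. (\<Sum>i<d. (0::complex) * z i) + (\<Sum>k<d. ?b k * x k)) = G i j"
    proof (intro ext)
      fix z x :: "nat \<Rightarrow> complex"
      have "G i j z x = x j * poly (L i) (of_nat j)" unfolding G_def by (rule if_not_P[OF False])
      then show "(\<Sum>i<d. (0::complex) * z i) + (\<Sum>k<d. ?b k * x k) = G i j z x"
        using sum_Kronecker[OF that(2)] by (simp add: mult.commute)
    qed
    moreover have "(\<lambda>k. if k = j \<and> i = j then m0 j else 0) = (\<lambda>k. 0)" using False that by auto
    ultimately show ?thesis using strict_diff_linear[of d d "\<lambda>_. 0" ?b z0 m0] by auto
  qed
  have "\<exists>b. i < d \<longrightarrow> strict_diff d d (H i) (\<lambda>k. if k = i then 1 else 0) b z0 m0" for i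
  proof (cases "i < d \<and> i \<in> ?A")
    case True
    then have "\<forall>j\<in>{..<d}. \<exists>b. strict_diff d d (G i j) (\<lambda>k. if k = j \<and> i = j then m0 j else 0) b z0 m0"
      using sdG by auto
    from bchoice[OF this] obtain b where "\<forall>j\<in>{..<d}. strict_diff d d (G i j) (\<lambda>k. if k = j \<and> i = j then m0 j else 0) (b j) z0 m0"
      by blast
    then have "strict_diff d d (\<lambda>z m. \<Sum>j<d. G i j z m) (\<lambda>k. \<Sum>j<d. if k = j \<and> i = j then m0 j else 0) (\<lambda>k. \<Sum>j<d. b j k) z0 m0"
      by (intro strict_diff_sum) auto
    from strict_diff_cmult[OF this, of "1 / m0 i"]
    have 1: "strict_diff d d (H i) (\<lambda>k. 1 / m0 i * (\<Sum>j<d. if k = j \<and> i = j then m0 j else 0)) (\<lambda>j. 1 / m0 i * (\<Sum>ja<d. b ja j)) z0 m0"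
      using True unfolding H_def by simp
    have "(\<Sum>j<d. if k = j \<and> i = j then m0 j else 0) = (if k = i then m0 i else 0)" for k
    proof -
      have "(\<Sum>j<d. if k = j \<and> i = j then m0 j else 0) = (\<Sum>j<d. if i = j then (if k = i then m0 i else 0) else 0)"
        by (intro sum.cong) auto
      then show ?thesis using True by simp
    qed
    then have "1 / m0 i * (\<Sum>j<d. if k = j \<and> i = j then m0 j else 0) = (if k = i then 1 else 0)" for k
      using True m0(2)[of i] by simp
    with 1 show ?thesis by auto
  next
    case False
    show ?thesis
    proof (cases "i < d")
      case True
      with False have i: "i = 0 \<or> i = 1" by auto
      have "H i = (\<lambda>z x. ((\<Sum>k<d. (if k = i then 1 else 0) * z k) + (\<Sum>k<d. 0 * x k)) + (if i = 0 then 0 else -1))"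
        using i True sum_Kronecker[OF True, of 1] by (auto simp: H_def fun_eq_iff)
      then show ?thesis
        using strict_diff_add[OF strict_diff_linear[of d d "\<lambda>k. if k = i then 1 else 0" "\<lambda>_. 0" z0 m0] strict_diff_const[of d d "if i = 0 then 0 else -1" z0 m0]]
        by (auto intro!: exI[of _ "\<lambda>_. 0"])
    qed auto
  qed
  then obtain b where b: "\<And>i. i < d \<Longrightarrow> strict_diff d d (H i) (\<lambda>k. if k = i then 1 else 0) (b i) z0 m0" by metis
  obtain r1 where r1: "r1 > 0" "\<And>z. z \<in> polydisc d z0 r1 \<Longrightarrow> inj_on z {..<d}"
    using eventually_inj_on_near[OF inj0] by (auto simp: eventually_near)
  obtain r2 where r2: "r2 > 0" "\<And>m. m \<in> polydisc d m0 r2 \<Longrightarrow> \<forall>i<d. m i \<noteq> 0"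
    using eventually_nonzero_near[of d m0] m0(2) by (auto simp: eventually_near)
  define r where "r = min r1 r2"
  have r: "r > 0" "r \<le> r1" "r \<le> r2" using r1(1) r2(1) by (auto simp: r_def)
  have equiv: "(m \<in> Cn d \<and> (\<forall>i<d. m i \<noteq> 0) \<and> z \<in> config d m) \<longleftrightarrow> (\<forall>i<d. H i z m = 0)"
    if h: "z \<in> polydisc d z0 r" "m \<in> polydisc d m0 r" for z m
  proof -
    have mC: "m \<in> Cn d" and zC: "z \<in> Cn d" using h by (auto simp: polydisc_def)
    have mn: "\<forall>i<d. m i \<noteq> 0" using r2(2)[of m] subsetD[OF polydisc_mono[OF r(3)] h(2)] by blast
    have injz: "inj_on z {..<d}" using r1(2)[of z] subsetD[OF polydisc_mono[OF r(2)] h(1)] by blast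
    have sumG: "(\<Sum>j<d. G i j z m) = (\<Sum>j<d. m j * poly (L i) (z j))" if "z 0 = 0" "z 1 = 1" for i
    proof (intro sum.cong refl)
      fix j assume "j \<in> {..<d}"
      then have "j \<in> ?A \<or> j = 0 \<or> j = 1" by auto
      then show "G i j z m = m j * poly (L i) (z j)" using that by (auto simp: G_def)
    qed
    show ?thesis
    proof
      assume L1: "m \<in> Cn d \<and> (\<forall>i<d. m i \<noteq> 0) \<and> z \<in> config d m"
      then have z01: "z 0 = 0" "z 1 = 1" by (auto simp: config_def)
      show "\<forall>i<d. H i z m = 0"
      proof (intro allI impI)
        fix i assume "i < d"
        then have "i = 0 \<or> i = 1 \<or> i \<in> ?A" by auto
        then show "H i z m = 0"
        proof (elim disjE)
          assume i: "i \<in> ?A"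
          then have "(\<Sum>j<d. m j * poly (L i) (z j)) = 0" using L1 L(1,2)[OF i] by (auto simp: config_def)
          then show ?thesis using i sumG[OF z01] by (auto simp: H_def)
        qed (auto simp: H_def z01 simp del: One_nat_def)
      qed
    next
      assume R1: "\<forall>i<d. H i z m = 0"
      have z0': "z 0 = 0" using R1[rule_format, of 0] d by (simp add: H_def)
      have z1': "z 1 = 1" using R1[rule_format, of 1] d by (simp add: H_def)
      have SL: "(\<Sum>j<d. m j * poly (L i) (z j)) = 0" if "i \<in> ?A" for i
      proof -
        have "H i z m = 1 / m0 i * (\<Sum>j<d. m j * poly (L i) (z j))"
          using that sumG[OF z0' z1'] by (auto simp: H_def)
        then show ?thesis using R1 that m0(2)[of i] by auto
      qed
      have "(\<Sum>i<d. m i * poly g (z i)) = 0" if g: "degree g + 2 \<le> d" "poly g 0 = 0" for g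
      proof -
        define Q where "Q = (\<Sum>i\<in>?A. smult (poly (pderiv g) (z0 i)) (L i))"
        have pdQ: "pderiv Q = (\<Sum>i\<in>?A. smult (poly (pderiv g) (z0 i)) (pderiv (L i)))"
        proof -
          have "pderiv (\<Sum>k\<in>A. F k) = (\<Sum>k\<in>A. pderiv (F k))" for F :: "nat \<Rightarrow> complex poly" and A
            using higher_pderiv_sum[of 1] by simp
          then show ?thesis by (simp add: Q_def pderiv_smult)
        qed
        \<comment> \<open>Every admissible \<open>g\<close> is a combination of the test polynomials \<open>L i\<close>: the derivatives agree
          at \<open>d - 2\<close> points, and both sides vanish at 0.\<close>
        have "pderiv g = pderiv Q"
        proof (cases "d = 2")
          case True
          then show ?thesis using g by (simp add: pdQ pderiv_eq_0_iff)
        next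
          case False
          with d have d3: "d \<ge> 3" by simp
          have inA: "inj_on z0 ?A" using inj0 by (rule inj_on_subset) auto
          show ?thesis
          proof (rule poly_eqI_degree[of "z0 ` ?A"])
            show "poly (pderiv g) x = poly (pderiv Q) x" if "x \<in> z0 ` ?A" for x
            proof -
              obtain k where k: "k \<in> ?A" "x = z0 k" using \<open>x \<in> z0 ` ?A\<close> by blast
              have "poly (pderiv Q) x = (\<Sum>i\<in>?A. poly (pderiv g) (z0 i) * (if k = i then 1 else 0))"
                unfolding pdQ poly_sum k(2) using L(4) k(1) by (intro sum.cong) auto
              also have "\<dots> = poly (pderiv g) x" using k by (simp add: if_distrib[of "\<lambda>x. _ * x"] cong: if_cong)
              finally show ?thesis ..
            qed
            have c: "card (z0 ` ?A) = d - 2" using card_image[OF inA] by simp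
            show "degree (pderiv g) < card (z0 ` ?A)" using g(1) d3 c by (simp add: degree_pderiv)
            have "degree (pderiv Q) \<le> d - 3"
              unfolding pdQ
            proof (rule degree_sum_le)
              fix i assume "i \<in> ?A"
              then show "degree (smult (poly (pderiv g) (z0 i)) (pderiv (L i))) \<le> d - 3"
                using L(3)[of i] degree_smult_le[of "poly (pderiv g) (z0 i)" "pderiv (L i)"] by linarith
            qed simp
            then show "degree (pderiv Q) < card (z0 ` ?A)" using c d3 by simp
          qed
        qed
        then have "pderiv (g - Q) = 0" by (simp add: pderiv_diff)
        then obtain c where "g - Q = [:c:]" by (auto simp: pderiv_eq_0_iff elim: degree_eq_zeroE)
        moreover have "poly (g - Q) 0 = 0" using g(2) L(1) by (simp add: Q_def poly_sum)
        ultimately have gQ: "g = Q" by simp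
        have "poly Q w = (\<Sum>k\<in>?A. poly (pderiv g) (z0 k) * poly (L k) w)" for w
          by (simp add: Q_def poly_sum)
        then have gw: "poly g w = (\<Sum>k\<in>?A. poly (pderiv g) (z0 k) * poly (L k) w)" for w
          using arg_cong[OF gQ, of "\<lambda>p. poly p w"] by (rule trans[rotated])
        have "(\<Sum>i<d. m i * poly g (z i)) = (\<Sum>i<d. \<Sum>k\<in>?A. poly (pderiv g) (z0 k) * (m i * poly (L k) (z i)))"
          unfolding gw sum_distrib_left by (simp only: mult.left_commute)
        also have "\<dots> = (\<Sum>k\<in>?A. poly (pderiv g) (z0 k) * (\<Sum>i<d. m i * poly (L k) (z i)))"
          by (subst sum.swap) (simp add: sum_distrib_left)
        finally show ?thesis using SL by simp
      qed
      then show "m \<in> Cn d \<and> (\<forall>i<d. m i \<noteq> 0) \<and> z \<in> config d m"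
        using mC mn zC injz z0' z1' by (auto simp: config_def)
    qed
  qed
  show ?thesis
    by (intro exI[of _ H] exI[of _ b] exI[of _ r]) (use r(1) b equiv in blast)
qed

text \<open>The condition \<open>m i \<noteq> 0\<close> enters the predicate to which \<open>etale_section\<close> is applied, because the
  equations have to be renormalised at nearby residues.\<close>

lemma config_section:
  assumes d: "d \<ge> 2" and m0: "m0 \<in> Cn d" "\<And>i. i < d \<Longrightarrow> m0 i \<noteq> 0" and z0: "z0 \<in> config d m0"
  obtains r0 where "r0 > 0"
    "\<And>r. 0 < r \<Longrightarrow> r \<le> r0 \<Longrightarrow> \<exists>\<delta>>0. \<exists>S. \<forall>m\<in>polydisc d m0 \<delta>. S m \<in> polydisc d z0 r \<and> S m \<in> config d m \<and>
       (\<forall>z\<in>polydisc d z0 r. z \<in> config d m \<longrightarrow> z = S m) \<and> (\<forall>i<d. cdiff d (\<lambda>m. S m i) m)"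
proof -
  let ?P = "\<lambda>z m. m \<in> Cn d \<and> (\<forall>i<d. m i \<noteq> 0) \<and> z \<in> config d m"
  have P0: "?P z0 m0" using assms by auto
  obtain r0 where r0: "r0 > 0"
    "\<And>r. 0 < r \<Longrightarrow> r \<le> r0 \<Longrightarrow> \<exists>\<delta>>0. \<exists>S. \<forall>x\<in>polydisc d m0 \<delta>. S x \<in> polydisc d z0 r \<and> ?P (S x) x \<and>
       (\<forall>z\<in>polydisc d z0 r. ?P z x \<longrightarrow> z = S x) \<and> (\<forall>i<d. cdiff d (\<lambda>x. S x i) x)"
  proof (rule etale_section[of ?P d d z0 m0, OF _ _ P0])
    fix z x assume P: "?P z x"
    show "z \<in> Cn d \<and> x \<in> Cn d" using P by (auto simp: config_def)
    show "\<exists>H b r. r > 0 \<and> (\<forall>i<d. strict_diff d d (H i) (\<lambda>k. if k = i then 1 else 0) (b i) z x) \<and>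
       (\<forall>z'\<in>polydisc d z r. \<forall>x'\<in>polydisc d x r. ?P z' x' \<longleftrightarrow> (\<forall>i<d. H i z' x' = 0))"
      by (rule config_local_equations[OF d]) (use P in auto)
  qed blast
  show ?thesis
  proof (rule that[OF r0(1)])
    fix r assume "0 < r" "r \<le> r0"
    from r0(2)[OF this] obtain \<delta> S where *: "\<delta> > 0" "\<forall>x\<in>polydisc d m0 \<delta>. S x \<in> polydisc d z0 r \<and> ?P (S x) x \<and>
       (\<forall>z\<in>polydisc d z0 r. ?P z x \<longrightarrow> z = S x) \<and> (\<forall>i<d. cdiff d (\<lambda>x. S x i) x)" by blast
    show "\<exists>\<delta>>0. \<exists>S. \<forall>m\<in>polydisc d m0 \<delta>. S m \<in> polydisc d z0 r \<and> S m \<in> config d m \<and>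
       (\<forall>z\<in>polydisc d z0 r. z \<in> config d m \<longrightarrow> z = S m) \<and> (\<forall>i<d. cdiff d (\<lambda>m. S m i) m)"
      by (intro exI[of _ \<delta>] conjI exI[of _ S]) (use * in blast)+
  qed
qed

definition poly_of :: "nat \<Rightarrow> (nat \<Rightarrow> complex) \<Rightarrow> complex poly" where
  "poly_of d x = (\<Sum>k\<le>d. monom (x k) k)"

lemma poly_of_coeff: "degree f \<le> d \<Longrightarrow> poly_of d (coeff f) = f"
  by (simp add: poly_of_def poly_as_sum_of_monoms')

lemma poly_poly_of: "poly (poly_of d x) z = (\<Sum>k<d+1. x k * z ^ k)"
  by (simp add: poly_of_def poly_sum poly_monom lessThan_Suc_atMost)

lemma poly_pderiv_poly_of: "poly (pderiv (poly_of d x)) z = (\<Sum>k<d+1. x k * (of_nat k * z ^ (k - 1)))"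
proof -
  have "pderiv (\<Sum>k\<in>A. F k) = (\<Sum>k\<in>A. pderiv (F k))" for F :: "nat \<Rightarrow> complex poly" and A
    using higher_pderiv_sum[of 1] by simp
  then show ?thesis by (simp add: poly_of_def pderiv_monom poly_sum poly_monom lessThan_Suc_atMost mult_ac)
qed

text \<open>Simple fixed points are holomorphic functions of the coefficients. Simplicity is part of the
  predicate for \<open>etale_section\<close>, so that the equations can be normalised at every nearby solution.\<close>

lemma fixed_point_section:
  assumes f: "degree f \<le> d" and z0: "labels d f z0" and simple: "\<And>i. i < d \<Longrightarrow> poly (pderiv f) (z0 i) \<noteq> 1"
    and R: "R > 0"
  obtains \<delta> S where "\<delta> > 0" "\<And>x. x \<in> polydisc (d + 1) (coeff f) \<delta> \<Longrightarrow> S x \<in> polydisc d z0 R \<and> S x \<in> Cn d \<and>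
     (\<forall>i<d. poly (poly_of d x) (S x i) = S x i \<and> poly (pderiv (poly_of d x)) (S x i) \<noteq> 1 \<and> cdiff (d + 1) (\<lambda>x. S x i) x)"
    "S (coeff f) = z0"
proof -
  let ?P = "\<lambda>z x. z \<in> Cn d \<and> x \<in> Cn (d + 1) \<and> (\<forall>i<d. poly (poly_of d x) (z i) = z i \<and> poly (pderiv (poly_of d x)) (z i) \<noteq> 1)"
  have fC: "coeff f \<in> Cn (d + 1)" using f by (auto simp: Cn_def intro: coeff_eq_0)
  have P0: "?P z0 (coeff f)" using z0 simple fC by (auto simp: labels_def poly_of_coeff[OF f])
  obtain r0 where r0: "r0 > 0"
    "\<And>r. 0 < r \<Longrightarrow> r \<le> r0 \<Longrightarrow> \<exists>\<delta>>0. \<exists>S. \<forall>x\<in>polydisc (d + 1) (coeff f) \<delta>. S x \<in> polydisc d z0 r \<and> ?P (S x) x \<and>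
       (\<forall>z\<in>polydisc d z0 r. ?P z x \<longrightarrow> z = S x) \<and> (\<forall>i<d. cdiff (d + 1) (\<lambda>x. S x i) x)"
  proof (rule etale_section[of ?P d "d + 1" z0 "coeff f", OF _ _ P0])
    fix z x assume P: "?P z x"
    then have C: "z \<in> Cn d" "x \<in> Cn (d + 1)" by auto
    show "z \<in> Cn d \<and> x \<in> Cn (d + 1)" using C by auto
    define c where "c i = poly (pderiv (poly_of d x)) (z i) - 1" for i
    have c: "c i \<noteq> 0" if "i < d" for i using P that by (simp add: c_def)
    define H where "H i z x = (1 / c i) * (poly (poly_of d x) (z i) - z i)" for i z x
    have "\<exists>b. strict_diff d (d + 1) (H i) (\<lambda>k. if k = i then 1 else 0) b z x" if i: "i < d" for i
    proof -
      have 1: "strict_diff d (d + 1) (\<lambda>z x. x k * poly (monom 1 k) (z i)) (\<lambda>j. if j = i then x k * poly (pderiv (monom 1 k)) (z i) else 0)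
          (\<lambda>j. if j = k then poly (monom 1 k) (z i) else 0) z x" if "k \<in> {..<d + 1}" for k
        using that by (intro strict_diff_coord_poly i C) auto
      have 2: "strict_diff d (d + 1) (\<lambda>z x. \<Sum>k<d+1. x k * poly (monom 1 k) (z i)) (\<lambda>j. \<Sum>k<d+1. if j = i then x k * poly (pderiv (monom 1 k)) (z i) else 0)
          (\<lambda>j. \<Sum>k<d+1. if j = k then poly (monom 1 k) (z i) else 0) z x"
        by (intro strict_diff_sum 1) auto
      have 3: "strict_diff d (d + 1) (\<lambda>z x. (\<Sum>k<d. (if k = i then -1 else 0) * z k) + (\<Sum>j<d + 1. 0 * x j)) (\<lambda>k. if k = i then -1 else 0) (\<lambda>_. 0) z x"
        by (rule strict_diff_linear)
      from strict_diff_cmult[OF strict_diff_add[OF 2 3], of "1 / c i"]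
      obtain b where 4: "strict_diff d (d + 1) (\<lambda>z x. 1 / c i * ((\<Sum>k<d+1. x k * poly (monom 1 k) (z i)) + ((\<Sum>k<d. (if k = i then -1 else 0) * z k) + (\<Sum>j<d + 1. 0 * x j))))
         (\<lambda>j. 1 / c i * ((\<Sum>k<d+1. if j = i then x k * poly (pderiv (monom 1 k)) (z i) else 0) + (if j = i then -1 else 0))) b z x" by blast
      have Heq: "(\<lambda>z x. 1 / c i * ((\<Sum>k<d+1. x k * poly (monom 1 k) (z i)) + ((\<Sum>k<d. (if k = i then -1 else 0) * z k) + (\<Sum>j<d + 1. 0 * x j)))) = H i"
        by (simp add: H_def fun_eq_iff poly_poly_of poly_monom sum_Kronecker[OF i])
      have "(\<Sum>k<d+1. x k * poly (pderiv (monom 1 k)) (z i)) - 1 = c i"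
        unfolding c_def poly_pderiv_poly_of by (simp add: pderiv_monom poly_monom)
      then have "1 / c i * ((\<Sum>k<d+1. if j = i then x k * poly (pderiv (monom 1 k)) (z i) else 0) + (if j = i then -1 else 0)) = (if j = i then 1 else 0)" for j
        using c[OF i] by (cases "j = i") auto
      with 4 show ?thesis unfolding Heq by auto
    qed
    then obtain b where b: "\<And>i. i < d \<Longrightarrow> strict_diff d (d + 1) (H i) (\<lambda>k. if k = i then 1 else 0) (b i) z x" by metis
    \<comment> \<open>the pair of configuration and coefficients is treated as one vector of length \<open>d + (d + 1)\<close>\<close>
    have "eventually (\<lambda>u. \<forall>i\<in>{..<d}. poly (pderiv (poly_of d (\<lambda>j. u (d + j)))) (u i) \<noteq> 1) (near (d + (d + 1)) (\<lambda>j. if j < d then z j else x (j - d)))"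
      (is "eventually _ (near _ ?u)")
    proof (intro eventually_ball_finite ballI)
      fix i assume "i \<in> {..<d}"
      then have i: "i < d" by simp
      have "((\<lambda>u. poly (pderiv (poly_of d (\<lambda>j. u (d + j)))) (u i)) \<longlongrightarrow> (\<Sum>k<d+1. ?u (d + k) * (of_nat k * ?u i ^ (k - 1)))) (near (d + (d + 1)) ?u)"
        unfolding poly_pderiv_poly_of using i by (intro tendsto_sum tendsto_mult tendsto_const tendsto_power tendsto_coord_near) auto
      moreover have "(\<Sum>k<d+1. ?u (d + k) * (of_nat k * ?u i ^ (k - 1))) \<noteq> 1"
      proof -
        have "(\<Sum>k<d+1. ?u (d + k) * (of_nat k * ?u i ^ (k - 1))) = poly (pderiv (poly_of d x)) (z i)"
          using i by (simp add: poly_pderiv_poly_of)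
        then show ?thesis using P i by simp
      qed
      ultimately show "eventually (\<lambda>u. poly (pderiv (poly_of d (\<lambda>j. u (d + j)))) (u i) \<noteq> 1) (near (d + (d + 1)) ?u)"
        by (rule tendsto_imp_eventually_ne)
    qed auto
    then obtain r where r: "r > 0" "\<And>u i. u \<in> polydisc (d + (d + 1)) ?u r \<Longrightarrow> i < d \<Longrightarrow> poly (pderiv (poly_of d (\<lambda>j. u (d + j)))) (u i) \<noteq> 1"
      by (auto simp: eventually_near)
    have ne: "poly (pderiv (poly_of d x')) (z' i) \<noteq> 1" if "z' \<in> polydisc d z r" "x' \<in> polydisc (d + 1) x r" "i < d" for z' x' i
    proof -
      let ?u' = "\<lambda>j. if j < d then z' j else x' (j - d)"
      have "?u' \<in> polydisc (d + (d + 1)) ?u r"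
        using that(1,2) by (auto simp: polydisc_def Cn_def)
      from r(2)[OF this that(3)] that(3) show ?thesis by simp
    qed
    show "\<exists>H b r. r > 0 \<and> (\<forall>i<d. strict_diff d (d + 1) (H i) (\<lambda>k. if k = i then 1 else 0) (b i) z x) \<and>
       (\<forall>z'\<in>polydisc d z r. \<forall>x'\<in>polydisc (d + 1) x r. ?P z' x' \<longleftrightarrow> (\<forall>i<d. H i z' x' = 0))"
    proof (intro exI[of _ H] exI[of _ b] exI[of _ r] conjI ballI)
      fix z' x' assume h: "z' \<in> polydisc d z r" "x' \<in> polydisc (d + 1) x r"
      then have "z' \<in> Cn d" "x' \<in> Cn (d + 1)" by (auto simp: polydisc_def)
      moreover have "H i z' x' = 0 \<longleftrightarrow> poly (poly_of d x') (z' i) = z' i" if "i < d" for i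
        using c[OF that] by (simp add: H_def)
      ultimately show "?P z' x' \<longleftrightarrow> (\<forall>i<d. H i z' x' = 0)" using ne[OF h] by blast
    qed (use r(1) b in auto)
  qed blast
  have "0 < min R r0" "min R r0 \<le> r0" using R r0(1) by auto
  from r0(2)[OF this] obtain \<delta> S where S: "\<delta> > 0" "\<forall>x\<in>polydisc (d + 1) (coeff f) \<delta>. S x \<in> polydisc d z0 (min R r0) \<and> ?P (S x) x \<and>
       (\<forall>z\<in>polydisc d z0 (min R r0). ?P z x \<longrightarrow> z = S x) \<and> (\<forall>i<d. cdiff (d + 1) (\<lambda>x. S x i) x)" by blast
  have "z0 = S (coeff f)"
    using S(2)[rule_format, OF centre_in_polydisc[OF fC S(1)]] P0
      centre_in_polydisc[of z0 d "min R r0", OF conjunct1[OF P0] \<open>0 < min R r0\<close>] by blast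
  show ?thesis
  proof (rule that[of \<delta> S])
    show "0 < \<delta>" "S (coeff f) = z0" using S(1) \<open>z0 = S (coeff f)\<close> by auto
    fix x assume "x \<in> polydisc (d + 1) (coeff f) \<delta>"
    from S(2)[rule_format, OF this] subsetD[OF polydisc_mono[of "min R r0" R d z0]]
    show "S x \<in> polydisc d z0 R \<and> S x \<in> Cn d \<and>
     (\<forall>i<d. poly (poly_of d x) (S x i) = S x i \<and> poly (pderiv (poly_of d x)) (S x i) \<noteq> 1 \<and> cdiff (d + 1) (\<lambda>x. S x i) x)"
      by simp
  qed
qed

section \<open>Classes of polynomials as normalised configurations\<close>

lemma degree_prod_linear: "finite A \<Longrightarrow> degree (\<Prod>j\<in>A. [:- z j, 1:] :: complex poly) = card A"
  by (simp add: degree_prod_sum_eq)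

lemma coeff_prod_linear: "finite A \<Longrightarrow> coeff (\<Prod>j\<in>A. [:- z j, 1:] :: complex poly) (card A) = 1"
  using lead_coeff_prod[of "\<lambda>j. [:- z j, 1:]" A] by (simp add: degree_prod_linear)

lemma poly_pderiv_prod_linear:
  assumes "finite A" "i \<in> A"
  shows "poly (pderiv (\<Prod>j\<in>A. [:- z j, 1:])) (z i) = (\<Prod>j\<in>A - {i}. z i - (z j :: complex))"
proof -
  have "(\<Prod>j\<in>A. [:- z j, 1:]) = [:- z i, 1:] * (\<Prod>j\<in>A - {i}. [:- z j, 1:])"
    by (rule prod.remove[OF assms])
  then show ?thesis by (simp add: pderiv_mult pderiv_pCons poly_prod del: mult_pCons_left)
qed

lemma prod_diff_nonzero:
  assumes "inj_on z A" "finite A" "i \<in> A" shows "(\<Prod>j\<in>A - {i}. z i - (z j :: complex)) \<noteq> 0"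
  using assms by (auto simp: inj_on_def)

text \<open>The sum is the coefficient of degree \<open>d - 1\<close> of the interpolation polynomial of \<open>g\<close>, which is \<open>g\<close>.\<close>

lemma Lagrange_sum_zero:
  assumes inj: "inj_on z {..<d}" and g: "degree g + 2 \<le> d"
  shows "(\<Sum>i<d. poly g (z i) / (\<Prod>j\<in>{..<d} - {i}. z i - z j)) = (0::complex)"
proof -
  let ?c = "\<lambda>i. poly g (z i) / (\<Prod>j\<in>{..<d} - {i}. z i - z j)"
  define Q where "Q = (\<Sum>i<d. smult (?c i) (\<Prod>j\<in>{..<d} - {i}. [:- z j, 1:]))"
  have card: "card ({..<d} - {i}) = d - 1" if "i < d" for i using that by simp
  have "Q = g"
  proof (rule poly_eqI_degree[of "z ` {..<d}"])
    fix w assume "w \<in> z ` {..<d}"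
    then obtain k where k: "k < d" "w = z k" by auto
    have "poly Q w = (\<Sum>i<d. ?c i * (\<Prod>j\<in>{..<d} - {i}. z k - z j))"
      by (simp add: Q_def poly_sum poly_prod k(2))
    also have "\<dots> = (\<Sum>i<d. if i = k then poly g (z k) else 0)"
    proof (intro sum.cong refl)
      fix i assume i: "i \<in> {..<d}"
      show "?c i * (\<Prod>j\<in>{..<d} - {i}. z k - z j) = (if i = k then poly g (z k) else 0)"
      proof (cases "i = k")
        case True
        then show ?thesis using prod_diff_nonzero[OF inj _ i] by simp
      next
        case False
        then have "(\<Prod>j\<in>{..<d} - {i}. z k - z j) = 0" using k(1) by (intro prod_zero) auto
        then show ?thesis using False by simp
      qed
    qed
    also have "\<dots> = poly g w" using k by simp
    finally show "poly Q w = poly g w" .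
  next
    have c: "card (z ` {..<d}) = d" using card_image[OF inj] by simp
    show "degree g < card (z ` {..<d})" using g c by simp
    have "degree Q \<le> d - 1"
      unfolding Q_def
    proof (rule degree_sum_le)
      fix i assume i: "i \<in> {..<d}"
      show "degree (smult (?c i) (\<Prod>j\<in>{..<d} - {i}. [:- z j, 1:])) \<le> d - 1"
        using degree_smult_le[of "?c i" "\<Prod>j\<in>{..<d} - {i}. [:- z j, 1:]"] degree_prod_linear[of "{..<d} - {i}" z] i by simp
    qed simp
    then show "degree Q < card (z ` {..<d})" using g c by simp
  qed
  have "coeff Q (d - 1) = (\<Sum>i<d. ?c i)"
    unfolding Q_def coeff_sum coeff_smult
  proof (intro sum.cong refl)
    fix i assume i: "i \<in> {..<d}"
    have "coeff (\<Prod>j\<in>{..<d} - {i}. [:- z j, 1:]) (d - 1) = 1"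
      using coeff_prod_linear[of "{..<d} - {i}" z] card i by simp
    then show "?c i * coeff (\<Prod>j\<in>{..<d} - {i}. [:- z j, 1:]) (d - 1) = ?c i" by simp
  qed
  moreover have "coeff g (d - 1) = 0" using g by (intro coeff_eq_0) auto
  ultimately show ?thesis using \<open>Q = g\<close> by simp
qed

text \<open>Test with the product of the linear factors of all labels other than \<open>i\<close> and \<open>l\<close>.\<close>

lemma residue_product_const:
  assumes ann: "\<And>g. degree g + 2 \<le> d \<Longrightarrow> (\<Sum>i<d. m i * poly g (z i)) = (0::complex)"
    and i: "i < d" and l: "l < d"
  shows "m i * (\<Prod>j\<in>{..<d} - {i}. z i - z j) = m l * (\<Prod>j\<in>{..<d} - {l}. z l - z j)"
proof (cases "i = l")
  case False
  let ?A = "{..<d} - {i} - {l}" and ?B = "{..<d} - {i, l}"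
  have AB: "{..<d} - {i} - {l} = ?B" "{..<d} - {l} - {i} = ?B" by auto
  define g where "g = (\<Prod>j\<in>?B. [:- z j, 1:])"
  have d2: "d \<ge> 2" using False i l by linarith
  have "card ?B = d - 2" using False i l by (subst card_Diff_subset) auto
  then have "degree g + 2 \<le> d" using d2 by (simp add: g_def degree_prod_linear)
  then have "(\<Sum>k<d. m k * poly g (z k)) = 0" by (rule ann)
  also have "(\<Sum>k<d. m k * poly g (z k)) = (\<Sum>k\<in>{i, l}. m k * poly g (z k))"
  proof (rule sum.mono_neutral_right)
    show "\<forall>k\<in>{..<d} - {i, l}. m k * poly g (z k) = 0"
    proof
      fix k assume "k \<in> {..<d} - {i, l}"
      then have "poly g (z k) = 0" unfolding g_def poly_prod by (intro prod_zero) auto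
      then show "m k * poly g (z k) = 0" by simp
    qed
  qed (use i l in auto)
  finally have "m i * poly g (z i) + m l * poly g (z l) = 0" using False by simp
  then have e: "m i * (\<Prod>j\<in>?B. z i - z j) = - (m l * (\<Prod>j\<in>?B. z l - z j))"
    by (simp add: g_def poly_prod add_eq_0_iff2)
  have "m i * (\<Prod>j\<in>{..<d} - {i}. z i - z j) = (z i - z l) * (m i * (\<Prod>j\<in>?B. z i - z j))"
    using l False by (subst prod.remove[of "{..<d} - {i}" l]) (auto simp: AB)
  also have "\<dots> = (z l - z i) * (m l * (\<Prod>j\<in>?B. z l - z j))" unfolding e by (simp add: algebra_simps)
  also have "\<dots> = m l * (\<Prod>j\<in>{..<d} - {l}. z l - z j)"
    using i False by (subst prod.remove[of "{..<d} - {l}" i]) (auto simp: AB)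
  finally show ?thesis .
qed simp

context
  fixes d :: nat assumes d: "d \<ge> 2"
begin

lemma labels_decomp:
  assumes f: "f \<in> Poly_deg d" and l: "labels d f z"
  shows "f = [:0, 1:] + smult (lead_coeff f) (\<Prod>j<d. [:- z j, 1:])"
proof (rule poly_eqI_degree_lead_coeff[of _ d _ "z ` {..<d}"])
  have df: "degree f = d" using f by (simp add: Poly_deg_def)
  have x0: "coeff [:0, 1 :: complex:] d = 0" using d by (intro coeff_eq_0) auto
  show "coeff f d = coeff ([:0, 1:] + smult (lead_coeff f) (\<Prod>j<d. [:- z j, 1:])) d"
    using coeff_prod_linear[of "{..<d}" z] df x0 by simp
  show "d \<le> card (z ` {..<d})" using l card_image[of z "{..<d}"] by (simp add: labels_def)
  show "degree f \<le> d" using df by simp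
  show "degree ([:0, 1:] + smult (lead_coeff f) (\<Prod>j<d. [:- z j, 1:])) \<le> d"
  proof (rule degree_add_le)
    show "degree (smult (lead_coeff f) (\<Prod>j<d. [:- z j, 1:])) \<le> d"
      using degree_smult_le[of "lead_coeff f" "\<Prod>j<d. [:- z j, 1:]"] degree_prod_linear[of "{..<d}" z] by simp
  qed (use d in auto)
  fix w assume "w \<in> z ` {..<d}"
  then obtain i where i: "i < d" "w = z i" by auto
  then have "(\<Prod>j<d. w - z j) = 0" by (intro prod_zero) auto
  then show "poly f w = poly ([:0, 1:] + smult (lead_coeff f) (\<Prod>j<d. [:- z j, 1:])) w"
    using l i by (simp add: labels_def poly_prod)
qed

lemma labels_multiplier:
  assumes f: "f \<in> Poly_deg d" and l: "labels d f z" and i: "i < d"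
  shows "poly (pderiv f) (z i) = 1 + lead_coeff f * (\<Prod>j\<in>{..<d} - {i}. z i - z j)"
proof -
  have "pderiv f = pderiv ([:0, 1:] + smult (lead_coeff f) (\<Prod>j<d. [:- z j, 1:]))"
    using arg_cong[OF labels_decomp[OF f l], of pderiv] .
  then have "poly (pderiv f) (z i) = poly (pderiv ([:0, 1:] + smult (lead_coeff f) (\<Prod>j<d. [:- z j, 1:]))) (z i)"
    by (rule arg_cong[of _ _ "\<lambda>p. poly p (z i)"])
  then show ?thesis
    using poly_pderiv_prod_linear[of "{..<d}" i z] i by (simp add: pderiv_add pderiv_smult pderiv_pCons)
qed

lemma labels_prod_nonzero:
  assumes f: "f \<in> Poly_deg d" and l: "labels d f z" and i: "i < d"
  shows "lead_coeff f * (\<Prod>j\<in>{..<d} - {i}. z i - z j) \<noteq> 0"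
proof -
  have "(\<Prod>j\<in>{..<d} - {i}. z i - z j) \<noteq> 0" using l i by (intro prod_diff_nonzero) (auto simp: labels_def)
  moreover have "f \<noteq> 0" using f d by (auto simp: Poly_deg_def)
  ultimately show ?thesis by simp
qed

lemma fp_residues_labels:
  assumes f: "f \<in> Poly_deg d" and l: "labels d f z" and i: "i < d"
  shows "fp_residues d f z i = - 1 / (lead_coeff f * (\<Prod>j\<in>{..<d} - {i}. z i - z j))"
  using labels_multiplier[OF assms] i by (simp add: fp_residues_def residues_def)

lemma Fix_labels:
  assumes f: "f \<in> Poly_deg d" and l: "labels d f z"
  shows "Fix f = image_mset z (mset_set {..<d})"
proof -
  have "f - [:0, 1:] = smult (lead_coeff f) (\<Prod>j<d. [:- z j, 1:])"
    using labels_decomp[OF f l] by (metis add_diff_cancel_left')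
  also have "(\<Prod>j<d. [:- z j, 1:]) = (\<Prod>x\<in>#image_mset z (mset_set {..<d}). [:- x, 1:])"
    by (simp add: prod_unfold_prod_mset image_mset.compositionality o_def)
  finally have "Fix f = proots (smult (lead_coeff f) (\<Prod>x\<in>#image_mset z (mset_set {..<d}). [:- x, 1:]))"
    by (simp add: Fix_def)
  moreover have "lead_coeff f \<noteq> 0" using f d by (auto simp: Poly_deg_def)
  ultimately show ?thesis using proots_prod_linear by (simp only: proots_smult) simp
qed

lemma fixed_multipliers_labels:
  assumes "f \<in> Poly_deg d" "labels d f z"
  shows "fixed_multipliers f = pr d (\<lambda>i. if i < d then poly (pderiv f) (z i) else 0)"
proof -
  have "fixed_multipliers f = image_mset (\<lambda>i. poly (pderiv f) (z i)) (mset_set {..<d})"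
    by (simp add: fixed_multipliers_def Fix_labels[OF assms] image_mset.compositionality o_def)
  also have "\<dots> = image_mset (\<lambda>i. if i < d then poly (pderiv f) (z i) else 0) (mset_set {..<d})"
    by (intro image_mset_cong) auto
  finally show ?thesis by (simp add: pr_def)
qed

lemma labels_unique:
  assumes "f \<in> Poly_deg d" "labels d f z" "labels d f z'"
  shows "\<exists>s. s permutes {..<d} \<and> z' = z \<circ> s"
  using Fix_labels[OF assms(1,2)] Fix_labels[OF assms(1,3)] pr_eq_iff[of z d z'] assms(2,3)
  by (simp add: labels_def pr_def)

lemma labels_permute: "labels d f z \<Longrightarrow> s permutes {..<d} \<Longrightarrow> labels d f (z \<circ> s)"
  using comp_permutes_Cn[of s d z] permutes_in_image[of s "{..<d}"] permutes_inj_on[of s "{..<d}" "{..<d}"]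
  by (auto simp: labels_def inj_on_def)

lemma fp_residues_permute: "s permutes {..<d} \<Longrightarrow> fp_residues d f (z \<circ> s) = fp_residues d f z \<circ> s"
  using residues_comp_permutes[of s d "\<lambda>i. poly (pderiv f) (z i)"] by (simp add: fp_residues_def o_def)

text \<open>A fixed point with multiplier different from 1 is simple, so the multipliers of a point over
  \<open>V d\<close> label the fixed points.\<close>

lemma labels_exist:
  assumes f: "f \<in> Poly_deg d" and l: "fixed_multipliers f = pr d l" and n1: "\<And>i. i < d \<Longrightarrow> l i \<noteq> 1"
  shows "\<exists>z. labels d f z \<and> (\<forall>i<d. poly (pderiv f) (z i) = l i)"
proof -
  let ?p = "f - [:0, 1:]"
  have p0: "?p \<noteq> 0" using f d by (auto simp: Poly_deg_def)
  have degp: "degree ?p = d" unfolding diff_conv_add_uminus using degree_add_eq_left[of "- [:0, 1:]" f] f d by (simp add: Poly_deg_def)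
  have mult: "poly (pderiv f) x \<noteq> 1" if "poly ?p x = 0" for x
  proof -
    have "x \<in># Fix f" unfolding Fix_def set_count_proots[OF p0] using that by simp
    then have "poly (pderiv f) x \<in># pr d l" unfolding l[symmetric] fixed_multipliers_def by auto
    then show ?thesis using n1 by (auto simp: pr_def)
  qed
  have ord: "order x ?p = 1" if "poly ?p x = 0" for x
  proof (rule ccontr)
    assume "order x ?p \<noteq> 1"
    moreover have "order x ?p \<noteq> 0" using that p0 order_root[of ?p x] by blast
    ultimately have "2 \<le> order x ?p" by linarith
    then have "[:- x, 1:] ^ 2 dvd ?p" by (simp add: order_divides)
    then obtain q where "?p = [:- x, 1:] ^ 2 * q" by (elim dvdE)
    then have "?p = [:- x, 1:] * ([:- x, 1:] * q)" by (simp only: power2_eq_square mult.assoc)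
    then have "poly (pderiv ?p) x = 0" by (simp add: pderiv_mult pderiv_pCons del: mult_pCons_left)
    then show False using mult[OF that] by (simp add: pderiv_diff pderiv_pCons)
  qed
  define A where "A = {x. poly ?p x = 0}"
  have finA: "finite A" unfolding A_def using p0 by (rule poly_roots_finite)
  have FixA: "Fix f = mset_set A"
  proof (rule multiset_eqI)
    fix x show "count (Fix f) x = count (mset_set A) x"
      unfolding Fix_def count_proots[OF p0]
      using ord[of x] finA order_root[of ?p x] by (cases "x \<in> A") (auto simp: A_def)
  qed
  have "card A = d" using size_proots_complex[of ?p] FixA degp by (simp add: Fix_def)
  then obtain z where z: "bij_betw z {..<d} A"
    using finA finite_same_card_bij[of "{..<d}" A] by auto
  have "image_mset l (mset_set {..<d}) = image_mset (poly (pderiv f)) (mset_set A)"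
    using l by (simp add: fixed_multipliers_def FixA pr_def)
  also have "mset_set A = image_mset z (mset_set {..<d})"
    using image_mset_mset_set[of z "{..<d}"] z by (simp add: bij_betw_def)
  finally have "image_mset l (mset_set {..<d}) = image_mset (\<lambda>i. poly (pderiv f) (z i)) (mset_set {..<d})"
    by (simp add: image_mset.compositionality o_def)
  then obtain s where s: "s permutes {..<d}" "\<forall>i\<in>{..<d}. l i = poly (pderiv f) (z (s i))"
    by (rule image_mset_eq_implies_permutes[rotated]) auto
  have bz: "bij_betw (z \<circ> s) {..<d} A" using permutes_imp_bij[OF s(1)] z by (rule bij_betw_trans)
  define y where "y i = (if i < d then z (s i) else 0)" for i
  have "labels d f y"
    unfolding labels_def
  proof (intro conjI allI impI)
    show "y \<in> Cn d" by (simp add: y_def Cn_def)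
    show "inj_on y {..<d}" using bij_betw_imp_inj_on[OF bz] by (auto simp: inj_on_def y_def)
    fix i assume "i < d"
    then have "y i \<in> A" using bij_betwE[OF bz] by (auto simp: y_def)
    then show "poly f (y i) = y i" by (simp add: A_def)
  qed
  moreover have "\<forall>i<d. poly (pderiv f) (y i) = l i" using s(2) by (simp add: y_def)
  ultimately show ?thesis by blast
qed

lemma fp_residues_in_Res:
  assumes f: "f \<in> Poly_deg d" and l: "labels d f z"
  shows "fp_residues d f z \<in> Res d"
proof -
  have "(\<Sum>i<d. poly 1 (z i) / (\<Prod>j\<in>{..<d} - {i}. z i - z j)) = 0"
    by (rule Lagrange_sum_zero) (use l d in \<open>auto simp: labels_def\<close>)
  then have "- 1 / lead_coeff f * (\<Sum>i<d. 1 / (\<Prod>j\<in>{..<d} - {i}. z i - z j)) = 0" by simp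
  then have "(\<Sum>i<d. fp_residues d f z i) = 0"
    unfolding sum_distrib_left by (simp add: fp_residues_labels[OF f l])
  moreover have "fp_residues d f z i \<noteq> 0" if "i < d" for i
    using labels_prod_nonzero[OF f l that] fp_residues_labels[OF f l that] by simp
  moreover have "fp_residues d f z \<in> Cn d" by (simp add: fp_residues_def residues_def Cn_def)
  ultimately show ?thesis by (simp add: Res_def)
qed

lemma inj_label_01: "inj_on z {..<d} \<Longrightarrow> z 1 - z 0 \<noteq> (0::complex)"
  using inj_onD[of z "{..<d}" 1 0] d by auto

text \<open>By \<open>fp_residues_labels\<close> the equations for the residues are those of \<open>Lagrange_sum_zero\<close>.\<close>

lemma normalise_in_config:
  assumes f: "f \<in> Poly_deg d" and l: "labels d f z"
  shows "normalise d z \<in> config d (fp_residues d f z)"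
proof -
  define a where "a = z 1 - z 0"
  define b where "b = z 0"
  have inj: "inj_on z {..<d}" using l by (simp add: labels_def)
  have a: "a \<noteq> 0" using inj_label_01[OF inj] by (simp add: a_def)
  have nz: "normalise d z i = (z i - b) / a" if "i < d" for i using that by (simp add: normalise_def a_def b_def)
  have "(\<Sum>i<d. fp_residues d f z i * poly g (normalise d z i)) = 0" if g: "degree g + 2 \<le> d" for g
  proof -
    define h where "h = g \<circ>\<^sub>p [:- b / a, 1 / a:]"
    have "degree h + 2 \<le> d" using g a by (simp add: h_def degree_pcompose)
    then have L: "(\<Sum>i<d. poly h (z i) / (\<Prod>j\<in>{..<d} - {i}. z i - z j)) = 0" by (rule Lagrange_sum_zero[OF inj])
    have "(\<Sum>i<d. fp_residues d f z i * poly g (normalise d z i)) =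
        (\<Sum>i<d. - 1 / lead_coeff f * (poly h (z i) / (\<Prod>j\<in>{..<d} - {i}. z i - z j)))"
    proof (intro sum.cong refl)
      fix i assume "i \<in> {..<d}"
      then have i: "i < d" by simp
      have "poly h (z i) = poly g (normalise d z i)"
        by (simp add: h_def poly_pcompose nz[OF i] diff_divide_distrib)
      then show "fp_residues d f z i * poly g (normalise d z i) =
          - 1 / lead_coeff f * (poly h (z i) / (\<Prod>j\<in>{..<d} - {i}. z i - z j))"
        by (simp add: fp_residues_labels[OF f l i])
    qed
    also have "\<dots> = 0" unfolding sum_distrib_left[symmetric] L by simp
    finally show ?thesis .
  qed
  moreover have "inj_on (normalise d z) {..<d}"
    using inj a by (auto simp: inj_on_def nz)
  moreover have "normalise d z 0 = 0" "normalise d z 1 = 1" "normalise d z \<in> Cn d"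
    using a d by (auto simp: normalise_def a_def Cn_def)
  ultimately show ?thesis by (simp add: config_def)
qed

lemma prod_scale: "finite A \<Longrightarrow> (\<Prod>j\<in>A. F j / (a::complex)) = (\<Prod>j\<in>A. F j) / a ^ card A"
  by (simp add: prod_dividef)

text \<open>Both sides have the same fixed points, and the residue of label 0 determines the leading
  coefficient.\<close>

lemma aff_act_fixed_poly:
  assumes f: "f \<in> Poly_deg d" and l: "labels d f z"
  shows "f = aff_act (z 1 - z 0) (z 0) (fixed_poly d (fp_residues d f z) (normalise d z))"
proof (rule poly_ext)
  fix w
  define a where "a = z 1 - z 0"
  define b where "b = z 0"
  have inj: "inj_on z {..<d}" using l by (simp add: labels_def)
  have a: "a \<noteq> 0" using inj_label_01[OF inj] by (simp add: a_def)
  have nz: "normalise d z i = (z i - b) / a" if "i < d" for i using that by (simp add: normalise_def a_def b_def)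
  define P0 where "P0 = (\<Prod>j\<in>{..<d} - {0}. z 0 - z j)"
  define P where "P = (\<Prod>j<d. w - z j)"
  have ne: "lead_coeff f * P0 \<noteq> 0" using labels_prod_nonzero[OF f l, of 0] d by (simp add: P0_def)
  have "(\<Prod>j\<in>{..<d} - {0}. normalise d z 0 - normalise d z j) = (\<Prod>j\<in>{..<d} - {0}. (z 0 - z j) / a)"
    using d by (intro prod.cong) (auto simp: nz diff_divide_distrib)
  also have "\<dots> = P0 / a ^ (d - 1)"
    using d by (simp add: prod_scale P0_def)
  finally have 1: "(\<Prod>j\<in>{..<d} - {0}. normalise d z 0 - normalise d z j) = P0 / a ^ (d - 1)" .
  have "(\<Prod>j<d. (w - b) / a - normalise d z j) = (\<Prod>j<d. (w - z j) / a)"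
    by (intro prod.cong) (auto simp: nz diff_divide_distrib)
  also have "\<dots> = P / a ^ d" by (simp add: prod_scale P_def)
  finally have 2: "(\<Prod>j<d. (w - b) / a - normalise d z j) = P / a ^ d" .
  have m0: "fp_residues d f z 0 = - 1 / (lead_coeff f * P0)"
    using fp_residues_labels[OF f l, of 0] d by (simp add: P0_def)
  have ad: "a ^ d = a * a ^ (d - 1)" using d by (cases d) auto
  have "poly (aff_act a b (fixed_poly d (fp_residues d f z) (normalise d z))) w =
     a * ((w - b) / a + - 1 / (fp_residues d f z 0 * (P0 / a ^ (d - 1))) * (P / a ^ d)) + b"
    unfolding poly_aff_act fixed_poly_def 1[symmetric] 2[symmetric] by (simp add: poly_prod)
  also have "- 1 / (fp_residues d f z 0 * (P0 / a ^ (d - 1))) * (P / a ^ d) = lead_coeff f * P / a"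
    using ne a unfolding m0 ad by (simp add: field_simps)
  also have "a * ((w - b) / a + lead_coeff f * P / a) + b = w + lead_coeff f * P"
    using a by (simp add: field_simps)
  also have "\<dots> = poly ([:0, 1:] + smult (lead_coeff f) (\<Prod>j<d. [:- z j, 1:])) w"
    by (simp add: poly_prod P_def)
  also have "\<dots> = poly f w" using labels_decomp[OF f l] by simp
  finally show "poly f w = poly (aff_act (z 1 - z 0) (z 0) (fixed_poly d (fp_residues d f z) (normalise d z))) w"
    by (simp add: a_def b_def)
qed

lemma normalise_config: "z \<in> config d m \<Longrightarrow> normalise d z = z"
  by (auto simp: normalise_def config_def Cn_def fun_eq_iff)

lemma fixed_poly_props:
  assumes m: "m \<in> Res d" and z: "z \<in> config d m"
  shows "fixed_poly d m z \<in> Poly_deg d" "labels d (fixed_poly d m z) z" "fp_residues d (fixed_poly d m z) z = m"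
proof -
  let ?f = "fixed_poly d m z"
  define k where "k = m 0 * (\<Prod>j\<in>{..<d} - {0}. z 0 - z j)"
  have inj: "inj_on z {..<d}" using z by (simp add: config_def)
  have k: "k \<noteq> 0" using prod_diff_nonzero[OF inj, of 0] m d by (simp add: k_def Res_def)
  have kk: "k = m i * (\<Prod>j\<in>{..<d} - {i}. z i - z j)" if "i < d" for i
    unfolding k_def by (rule residue_product_const[OF config_annihilates[OF m z]]) (use d that in auto)
  have f: "?f = [:0, 1:] + smult (- 1 / k) (\<Prod>j<d. [:- z j, 1:])" by (simp add: fixed_poly_def k_def)
  have "degree (smult (- 1 / k) (\<Prod>j<d. [:- z j, 1:])) = d" using k by (simp add: degree_prod_linear)
  then have "degree ?f = d" unfolding f using d by (subst degree_add_eq_right) auto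
  then show fP: "?f \<in> Poly_deg d" by (simp add: Poly_deg_def)
  have "poly ?f (z i) = z i" if "i < d" for i
  proof -
    have "(\<Prod>j<d. z i - z j) = 0" using that by (intro prod_zero) auto
    then show ?thesis by (simp add: f poly_prod)
  qed
  then show "labels d ?f z" using inj config_Cn[OF z] by (simp add: labels_def)
  show "fp_residues d ?f z = m"
  proof
    fix i
    show "fp_residues d ?f z i = m i"
    proof (cases "i < d")
      case True
      have P: "(\<Prod>j\<in>{..<d} - {i}. z i - z j) = k / m i" using kk[OF True] m True by (simp add: Res_def)
      have "poly (pderiv ?f) (z i) = 1 - 1 / k * (\<Prod>j\<in>{..<d} - {i}. z i - z j)"
        unfolding f using poly_pderiv_prod_linear[of "{..<d}" i z] True
        by (simp add: pderiv_add pderiv_diff pderiv_smult pderiv_pCons)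
      then have "poly (pderiv ?f) (z i) = 1 - 1 / m i" unfolding P using k by simp
      then show ?thesis using True by (simp add: fp_residues_def residues_def)
    next
      case False
      then show ?thesis using m by (simp add: fp_residues_def residues_def Res_def Cn_def)
    qed
  qed
qed

lemma labels_aff:
  fixes a b :: complex
  assumes l: "labels d f z" and a: "a \<noteq> 0"
  defines "y \<equiv> \<lambda>i. if i < d then a * z i + b else 0"
  shows "labels d (aff_act a b f) y" "fp_residues d (aff_act a b f) y = fp_residues d f z"
    "s permutes {..<d} \<Longrightarrow> normalise d (y \<circ> s) = normalise d (z \<circ> s)"
proof -
  show "labels d (aff_act a b f) y"
    using l a by (auto simp: labels_def y_def Cn_def inj_on_def poly_aff_act)
  have "poly (pderiv (aff_act a b f)) (a * w + b) = poly (pderiv f) w" for w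
  proof -
    have "- (b / a) + (a * w + b) / a = w" using a by (simp add: field_simps)
    then show ?thesis using a by (simp add: aff_act_def pderiv_pcompose poly_pcompose pderiv_pCons)
  qed
  then show "fp_residues d (aff_act a b f) y = fp_residues d f z"
    by (auto simp: fp_residues_def residues_def y_def fun_eq_iff)
  assume s: "s permutes {..<d}"
  have lt: "s i < d" if "i < d" for i using permutes_in_image[OF s] that by auto
  have "(a * z (s i) + b - (a * z (s 0) + b)) / (a * z (s 1) + b - (a * z (s 0) + b)) =
      (z (s i) - z (s 0)) / (z (s 1) - z (s 0))" for i
  proof -
    have "(a * z (s i) + b - (a * z (s 0) + b)) = a * (z (s i) - z (s 0))"
      "(a * z (s 1) + b - (a * z (s 0) + b)) = a * (z (s 1) - z (s 0))" by (simp_all add: algebra_simps)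
    then show ?thesis using a by simp
  qed
  moreover have "0 < d" "1 < d" using d by auto
  ultimately show "normalise d (y \<circ> s) = normalise d (z \<circ> s)"
    using lt by (simp add: normalise_def y_def fun_eq_iff)
qed

lemma moduli_class_eq_iff:
  assumes "f \<in> Poly_deg d" "g \<in> Poly_deg d"
  shows "moduli_class d f = moduli_class d g \<longleftrightarrow> (\<exists>a b. a \<noteq> 0 \<and> g = aff_act a b f)"
  using eq_equiv_class_iff[OF equiv_aff_conj assms] assms by (auto simp: moduli_class_def aff_conj_def)

lemma moduli_class_labels:
  assumes f: "f \<in> Poly_deg d" and l: "labels d f z"
  shows "moduli_class d f = config_class d (fp_residues d f z) (normalise d z)"
proof -
  have "z 1 - z 0 \<noteq> 0" using l by (intro inj_label_01) (auto simp: labels_def)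
  moreover have "fixed_poly d (fp_residues d f z) (normalise d z) \<in> Poly_deg d"
    by (rule fixed_poly_props(1)[OF fp_residues_in_Res[OF f l] normalise_in_config[OF f l]])
  ultimately show ?thesis
    unfolding config_class_def using moduli_class_eq_iff[of "fixed_poly d (fp_residues d f z) (normalise d z)" f] f
      aff_act_fixed_poly[OF f l] by metis
qed

lemma config_class_in_MP: "m \<in> Res d \<Longrightarrow> z \<in> config d m \<Longrightarrow> config_class d m z \<in> MP d"
  using fixed_poly_props(1) unfolding config_class_def moduli_class_def MP_def by (blast intro: quotientI)

lemma multipliers_fp_residues:
  "labels d f z \<Longrightarrow> multipliers d (fp_residues d f z) = (\<lambda>i. if i < d then poly (pderiv f) (z i) else 0)"
  by (auto simp: multipliers_def fp_residues_def residues_def fun_eq_iff)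

lemma Phi_moduli_class_labels:
  assumes "f \<in> Poly_deg d" "labels d f z"
  shows "Phi (moduli_class d f) = pr d (multipliers d (fp_residues d f z))"
  using Phi_class[OF d assms(1)] fixed_multipliers_labels[OF assms] multipliers_fp_residues[OF assms(2)] by simp

lemma Phi_config_class:
  assumes "m \<in> Res d" "z \<in> config d m"
  shows "Phi (config_class d m z) = pr d (multipliers d m)"
  unfolding config_class_def
  using Phi_moduli_class_labels[OF fixed_poly_props(1,2)[OF assms]] fixed_poly_props(3)[OF assms] by simp

lemma config_permute:
  assumes "m \<in> Res d" "z \<in> config d m" "s permutes {..<d}"
  shows "normalise d (z \<circ> s) \<in> config d (m \<circ> s)"
  using normalise_in_config[OF fixed_poly_props(1)[OF assms(1,2)] labels_permute[OF fixed_poly_props(2)[OF assms(1,2)] assms(3)]]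
  by (simp add: fp_residues_permute[OF assms(3)] fixed_poly_props(3)[OF assms(1,2)])

lemma config_class_permute:
  assumes "m \<in> Res d" "z \<in> config d m" "s permutes {..<d}"
  shows "config_class d (m \<circ> s) (normalise d (z \<circ> s)) = config_class d m z"
  using moduli_class_labels[OF fixed_poly_props(1)[OF assms(1,2)] labels_permute[OF fixed_poly_props(2)[OF assms(1,2)] assms(3)]]
  by (simp add: fp_residues_permute[OF assms(3)] fixed_poly_props(3)[OF assms(1,2)] config_class_def[of d m z])

text \<open>An affine conjugation carries labels to labels, keeps the residues and disappears under
  normalisation.\<close>

lemma labels_of_class:
  assumes f: "f \<in> Poly_deg d" and m: "m \<in> Res d" "z \<in> config d m" and eq: "moduli_class d f = config_class d m z"
  shows "\<exists>y. labels d f y \<and> fp_residues d f y = m \<and> normalise d y = z"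
proof -
  let ?F = "fixed_poly d m z"
  note F = fixed_poly_props[OF m]
  obtain a b where ab: "a \<noteq> 0" "f = aff_act a b ?F"
    using eq moduli_class_eq_iff[OF F(1) f] unfolding config_class_def by auto
  let ?y = "\<lambda>i. if i < d then a * z i + b else 0"
  have "labels d f ?y" "fp_residues d f ?y = m"
    using labels_aff(1,2)[OF F(2) ab(1), of b] F(3) ab(2) by auto
  moreover have "normalise d ?y = z"
    using labels_aff(3)[OF F(2) ab(1) permutes_id, of b] normalise_config[OF m(2)] by simp
  ultimately show ?thesis by blast
qed

text \<open>Two labellings of one polynomial differ by a permutation; the converse is \<open>config_class_permute\<close>.
  So \<open>config_class\<close> identifies exactly the orbits of the symmetric group.\<close>

lemma config_class_eqD:
  assumes m: "m \<in> Res d" "z \<in> config d m" and m': "m' \<in> Res d" "z' \<in> config d m'" and eq: "config_class d m z = config_class d m' z'"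
  shows "\<exists>s. s permutes {..<d} \<and> m' = m \<circ> s \<and> z' = normalise d (z \<circ> s)"
proof -
  note F' = fixed_poly_props[OF m']
  obtain a b where ab: "a \<noteq> 0" "fixed_poly d m' z' = aff_act a b (fixed_poly d m z)"
    using eq moduli_class_eq_iff[OF fixed_poly_props(1)[OF m] F'(1)] unfolding config_class_def by auto
  note F = fixed_poly_props[OF m]
  let ?y = "\<lambda>i. if i < d then a * z i + b else 0"
  have y: "labels d (fixed_poly d m' z') ?y" "fp_residues d (fixed_poly d m' z') ?y = m"
    using labels_aff(1,2)[OF F(2) ab(1), of b] F(3) ab(2) by auto
  obtain s where s: "s permutes {..<d}" "z' = ?y \<circ> s" using labels_unique[OF F'(1) y(1) F'(2)] by blast
  have "m' = m \<circ> s" using F'(3) fp_residues_permute[OF s(1), of "fixed_poly d m' z'" ?y] y(2) s(2) by simp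
  moreover have "z' = normalise d (z \<circ> s)"
    using labels_aff(3)[OF F(2) ab(1) s(1), of b] normalise_config[OF m'(2)] s(2) by simp
  ultimately show ?thesis using s(1) by blast
qed

lemma class_over_V:
  assumes c: "c \<in> MP d" and m: "m \<in> Res d" and eq: "Phi c = pr d (multipliers d m)"
  shows "\<exists>z\<in>config d m. c = config_class d m z"
proof -
  obtain f where f: "f \<in> Poly_deg d" "c = moduli_class d f"
    using c unfolding MP_def moduli_class_def by (auto elim: quotientE)
  have "fixed_multipliers f = pr d (multipliers d m)" using Phi_class[OF d f(1)] f(2) eq by simp
  moreover have "multipliers d m i \<noteq> 1" if "i < d" for i using m that by (simp add: multipliers_def Res_def)
  ultimately obtain z where z: "labels d f z" "\<forall>i<d. poly (pderiv f) (z i) = multipliers d m i"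
    using labels_exist[OF f(1)] by blast
  have "fp_residues d f z = m"
    using z(2) m by (auto simp: fp_residues_def residues_def multipliers_def Res_def Cn_def fun_eq_iff)
  then show ?thesis using normalise_in_config[OF f(1) z(1)] moduli_class_labels[OF f(1) z(1)] f(2) by auto
qed

end

section \<open>Compactness of configurations\<close>

lemma underdetermined_system:
  fixes A :: "'e \<Rightarrow> 'u \<Rightarrow> complex"
  assumes "finite E" "finite U" "card E < card U"
  shows "\<exists>c. (\<exists>u\<in>U. c u \<noteq> 0) \<and> (\<forall>e\<in>E. (\<Sum>u\<in>U. A e u * c u) = 0)"
  using assms
proof (induction E arbitrary: U A rule: finite_induct)
  case empty
  then have "U \<noteq> {}" by auto
  then show ?case by (intro exI[of _ "\<lambda>_. 1"]) auto
next
  case (insert e E)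
  show ?case
  proof (cases "\<forall>u\<in>U. A e u = 0")
    case True
    have "card E < card U" using insert by simp
    then obtain c where "\<exists>u\<in>U. c u \<noteq> 0" "\<forall>e\<in>E. (\<Sum>u\<in>U. A e u * c u) = 0"
      using insert.IH[of U A] insert.prems by auto
    then show ?thesis using True by (intro exI[of _ c]) auto
  next
    case False
    then obtain v where v: "v \<in> U" "A e v \<noteq> 0" by blast
    define B where "B f u = A f u - A f v * A e u / A e v" for f u
    have "card E < card (U - {v})" using insert v by simp
    then obtain c where c: "\<exists>u\<in>U - {v}. c u \<noteq> 0" "\<forall>f\<in>E. (\<Sum>u\<in>U - {v}. B f u * c u) = 0"
      using insert.IH[of "U - {v}" B] insert.prems by auto
    define s where "s = (\<Sum>u\<in>U - {v}. A e u * c u)"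
    define c' where "c' = c(v := - s / A e v)"
    have sum': "(\<Sum>u\<in>U. A f u * c' u) = A f v * (- s / A e v) + (\<Sum>u\<in>U - {v}. A f u * c u)" for f
      using v(1) insert.prems by (subst sum.remove[of U v]) (auto simp: c'_def intro!: sum.cong)
    have "(\<Sum>u\<in>U. A f u * c' u) = 0" if f: "f \<in> insert e E" for f
    proof (cases "f = e")
      case True
      then show ?thesis using sum'[of f] v(2) by (simp add: s_def)
    next
      case False
      have "(\<Sum>u\<in>U - {v}. B f u * c u) = (\<Sum>u\<in>U - {v}. A f u * c u) - A f v / A e v * s"
      proof -
        have "B f u * c u = A f u * c u - A f v / A e v * (A e u * c u)" for u
          by (simp add: B_def algebra_simps)
        then show ?thesis by (simp only: sum_subtractf sum_distrib_left[symmetric] s_def)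
      qed
      then show ?thesis using sum'[of f] c(2) f False by (simp add: mult_ac)
    qed
    moreover have "\<exists>u\<in>U. c' u \<noteq> 0" using c(1) by (auto simp: c'_def)
    ultimately show ?thesis by blast
  qed
qed

lemma bounded_coordinates_subseq:
  fixes u :: "nat \<Rightarrow> 'i \<Rightarrow> complex"
  assumes "finite I" "\<And>k i. i \<in> I \<Longrightarrow> cmod (u k i) \<le> B"
  shows "\<exists>r. strict_mono r \<and> (\<forall>i\<in>I. convergent (\<lambda>k. u (r k) i))"
  using assms
proof (induction I rule: finite_induct)
  case empty
  show ?case by (intro exI[of _ id]) (auto simp: strict_mono_def)
next
  case (insert i I)
  then obtain r where r: "strict_mono r" "\<forall>i\<in>I. convergent (\<lambda>k. u (r k) i)" by auto
  have "bounded (range (\<lambda>k. u (r k) i))" using insert.prems by (auto simp: bounded_iff)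
  then obtain l s where s: "strict_mono s" "((\<lambda>k. u (r k) i) \<circ> s) \<longlonglongrightarrow> l"
    using bounded_imp_convergent_subsequence by blast
  have "convergent (\<lambda>k. u ((r \<circ> s) k) j)" if "j \<in> insert i I" for j
  proof (cases "j = i")
    case True
    then show ?thesis using s(2) by (auto simp: convergent_def o_def)
  next
    case False
    then have "convergent (\<lambda>k. u (r k) j)" using r(2) that by auto
    from convergent_subseq_convergent[OF this s(1)] show ?thesis by (simp add: o_def)
  qed
  moreover have "strict_mono (r \<circ> s)" using r(1) s(1) by (rule strict_mono_o)
  ultimately show ?case by blast
qed

lemma tendsto_poly_coeffs:
  fixes p :: "nat \<Rightarrow> complex poly"
  assumes "\<And>k. degree (p k) \<le> N" "degree P \<le> N" "\<And>j. (\<lambda>k. coeff (p k) j) \<longlonglongrightarrow> coeff P j" "y \<longlonglongrightarrow> w"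
  shows "(\<lambda>k. poly (p k) (y k)) \<longlonglongrightarrow> poly P w"
proof -
  have eq: "poly q x = (\<Sum>j\<le>N. coeff q j * x ^ j)" if "degree q \<le> N" for q :: "complex poly" and x
    using poly_as_sum_of_monoms'[OF that] by (metis (no_types, lifting) poly_monom poly_sum sum.cong)
  have "(\<lambda>k. \<Sum>j\<le>N. coeff (p k) j * y k ^ j) \<longlonglongrightarrow> (\<Sum>j\<le>N. coeff P j * w ^ j)"
    by (intro tendsto_sum tendsto_mult tendsto_power assms)
  then show ?thesis by (simp add: eq assms(1,2))
qed

text \<open>Roots that merge in the limit produce a multiple root: divide by one linear factor at a time,
  the quotients converging as well.\<close>

lemma merging_roots_power_dvd:
  fixes p :: "nat \<Rightarrow> complex poly"
  assumes "finite I" "\<And>k. degree (p k) \<le> N" "degree P \<le> N" "\<And>j. (\<lambda>k. coeff (p k) j) \<longlonglongrightarrow> coeff P j"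
    and "\<And>k i. i \<in> I \<Longrightarrow> poly (p k) (y k i) = 0" "\<And>k. inj_on (y k) I" "\<And>i. i \<in> I \<Longrightarrow> (\<lambda>k. y k i) \<longlonglongrightarrow> w"
  shows "[:- w, 1:] ^ card I dvd P"
  using assms
proof (induction I arbitrary: p P rule: finite_induct)
  case (insert i I)
  define q where "q k = synthetic_div (p k) (y k i)" for k
  define Q where "Q = synthetic_div P w"
  have yi: "(\<lambda>k. y k i) \<longlonglongrightarrow> w" using insert.prems by auto
  have pq: "p k = [:- y k i, 1:] * q k" for k
    using synthetic_div_correct'[of "y k i" "p k"] insert.prems(4)[of i k] by (simp add: q_def)
  have "(\<lambda>k. poly (p k) (y k i)) \<longlonglongrightarrow> poly P w"
    by (rule tendsto_poly_coeffs[OF insert.prems(1,2,3) yi])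
  then have "poly P w = 0" using insert.prems(4)[of i] by (simp add: LIMSEQ_const_iff)
  then have PQ: "P = [:- w, 1:] * Q" using synthetic_div_correct'[of w P] by (simp add: Q_def)
  have degq: "degree (q k) \<le> N" "degree Q \<le> N" for k
    using insert.prems(1)[of k] insert.prems(2) by (auto simp: q_def Q_def degree_synthetic_div)
  have rec: "coeff (synthetic_div f c) j = coeff f (Suc j) + c * coeff (synthetic_div f c) (Suc j)" for f :: "complex poly" and c j
    using arg_cong[OF synthetic_div_correct'[of c f], of "\<lambda>p. coeff p (Suc j)"] by (simp add: algebra_simps)
  have coq: "(\<lambda>k. coeff (q k) j) \<longlonglongrightarrow> coeff Q j" for j
  proof (cases "j \<le> N")
    case True
    then show ?thesis
    proof (induction rule: inc_induct)
      case base
      have "q k = 0 \<or> degree (q k) < N" for k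
        using insert.prems(1)[of k] synthetic_div_eq_0_iff[of "p k" "y k i"] by (cases "degree (p k)") (auto simp: q_def degree_synthetic_div)
      then have "coeff (q k) N = 0" for k by (metis coeff_0 coeff_eq_0)
      moreover have "Q = 0 \<or> degree Q < N"
        using insert.prems(2) synthetic_div_eq_0_iff[of P w] by (cases "degree P") (auto simp: Q_def degree_synthetic_div)
      then have "coeff Q N = 0" by (metis coeff_0 coeff_eq_0)
      ultimately show ?case by simp
    next
      case (step j)
      have "(\<lambda>k. coeff (p k) (Suc j) + y k i * coeff (q k) (Suc j)) \<longlonglongrightarrow> coeff P (Suc j) + w * coeff Q (Suc j)"
        by (intro tendsto_add tendsto_mult yi step.IH insert.prems(3))
      then show ?case unfolding q_def Q_def rec[symmetric] .
    qed
  next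
    case False
    then have "coeff (q k) j = 0" "coeff Q j = 0" for k
      using degq(1)[of k] degq(2) by (auto intro!: coeff_eq_0)
    then show ?thesis by simp
  qed
  have "poly (q k) (y k j) = 0" if "j \<in> I" for k j
  proof -
    have "y k j \<noteq> y k i" using insert.prems(5)[of k] insert.hyps(2) that by (auto simp: inj_on_def)
    moreover have "poly (p k) (y k j) = 0" using insert.prems(4)[of j k] that by auto
    ultimately show ?thesis unfolding pq by simp
  qed
  moreover have "inj_on (y k) I" for k using insert.prems(5)[of k] by (rule inj_on_subset) auto
  ultimately have "[:- w, 1:] ^ card I dvd Q"
    using insert.prems(6) by (intro insert.IH[of q Q] degq coq) auto
  then show ?case unfolding PQ using insert.hyps by (simp add: mult_dvd_mono del: mult_pCons_left)
qed simp

text \<open>A value taken with multiplicity \<open>n w\<close> at \<open>w\<close> is a zero of order at least \<open>n w - 1\<close> of the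
  derivative, whose degree is one less than that of \<open>G\<close>.\<close>

lemma poly_strict_cluster_bound:
  fixes G :: "complex poly"
  assumes "finite A" "\<And>w. w \<in> A \<Longrightarrow> n w > 0" "\<And>w. w \<in> A \<Longrightarrow> [:- w, 1:] ^ n w dvd G - [:poly G w:]"
    and G: "degree G > 0"
  shows "(\<Sum>w\<in>A. n w - 1) < degree G"
proof -
  have nz: "pderiv G \<noteq> 0" using G by (simp add: pderiv_eq_0_iff)
  have "n w - 1 \<le> order w (pderiv G)" if w: "w \<in> A" for w
  proof -
    obtain q where q: "G - [:poly G w:] = [:- w, 1:] ^ n w * q" using assms(3)[OF w] by (elim dvdE)
    obtain k where k: "n w = Suc k" using assms(2)[OF w] by (cases "n w") auto
    have "pderiv G = pderiv (G - [:poly G w:])" by (simp add: pderiv_diff pderiv_pCons)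
    also have "\<dots> = [:- w, 1:] ^ k * (smult (of_nat (Suc k)) q + [:- w, 1:] * pderiv q)"
    proof -
      have "pderiv [:- w, 1:] = 1" by (simp add: pderiv_pCons one_pCons)
      then show ?thesis
        unfolding q k pderiv_mult pderiv_power_Suc by (simp add: algebra_simps del: mult_pCons_left mult_pCons_right)
    qed
    finally have "[:- w, 1:] ^ k dvd pderiv G" by (rule dvdI)
    then show ?thesis using nz k by (simp add: order_divides)
  qed
  then have "(\<Sum>w\<in>A. n w - 1) \<le> (\<Sum>w\<in>A. order w (pderiv G))" by (rule sum_mono)
  also have "\<dots> \<le> (\<Sum>w\<in>A \<union> {w. poly (pderiv G) w = 0}. order w (pderiv G))"
    using assms(1) poly_roots_finite[OF nz] by (intro sum_mono2) auto
  also have "\<dots> = (\<Sum>w | poly (pderiv G) w = 0. order w (pderiv G))"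
    using assms(1) poly_roots_finite[OF nz] by (intro sum.mono_neutral_right) (auto simp: order_0I)
  also have "\<dots> \<le> degree (pderiv G)" by (rule sum_order_le_degree[OF nz])
  also have "\<dots> < degree G" using G by (simp add: degree_pderiv)
  finally show ?thesis .
qed

text \<open>Suppose that the limit has only \<open>r < d\<close> distinct points. The annihilation equations for the limit
  show that the residues of each cluster of merging labels sum to zero; by hypothesis the same holds along
  the sequence. Polynomials of degree at most \<open>d - r\<close> without constant term have \<open>d - r\<close>
  coefficients, and to be constant on each cluster amounts to \<open>d - r\<close> conditions. One of them follows
  from the others by the annihilation equation of the sequence, since the cluster sums vanish. So there
  is a nonzero solution at every stage; scaled to norm one, the solutions have a nonzero limit \<open>G\<close>, and
  \<open>G\<close> takes a value with multiplicity at least the cluster size at each of the \<open>r\<close> limit points.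
  The sizes minus one add up to \<open>d - r\<close>, against \<open>poly_strict_cluster_bound\<close>.\<close>

lemma limit_configuration_injective:
  fixes x :: "nat \<Rightarrow> nat \<Rightarrow> complex"
  assumes m: "\<And>k. ms k \<in> Res d" and m0: "m0 \<in> Res d" and mlim: "\<And>i. i < d \<Longrightarrow> (\<lambda>k. ms k i) \<longlonglongrightarrow> m0 i"
    and hered: "\<And>k J. J \<subset> {..<d} \<Longrightarrow> J \<noteq> {} \<Longrightarrow> sum m0 J = 0 \<Longrightarrow> sum (ms k) J = 0"
    and inj: "\<And>k. inj_on (x k) {..<d}"
    and ann: "\<And>k g. degree g + 2 \<le> d \<Longrightarrow> (\<Sum>i<d. ms k i * poly g (x k i)) = 0"
    and xlim: "\<And>i. i < d \<Longrightarrow> (\<lambda>k. x k i) \<longlonglongrightarrow> X i"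
    and two: "a < d" "b < d" "X a \<noteq> X b"
  shows "inj_on X {..<d}"
proof (rule ccontr)
  assume ninj: "\<not> inj_on X {..<d}"
  define A where "A = X ` {..<d}"
  define r where "r = card A"
  have finA: "finite A" by (simp add: A_def)
  have r_le: "r \<le> d" using card_image_le[of "{..<d}" X] by (simp add: r_def A_def)
  have "r \<noteq> d" using ninj eq_card_imp_inj_on[of "{..<d}" X] by (auto simp: r_def A_def)
  with r_le have rd: "r < d" by simp
  have "card {X a, X b} \<le> r" unfolding r_def using two by (intro card_mono finA) (auto simp: A_def)
  then have r2: "2 \<le> r" using two(3) by simp
  define C where "C w = {i \<in> {..<d}. X i = w}" for w
  have lim_ann: "(\<Sum>i<d. m0 i * poly g (X i)) = 0" if g: "degree g + 2 \<le> d" for g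
  proof -
    have "isCont (poly g) (X i)" for i by simp
    then have "(\<lambda>k. \<Sum>i<d. ms k i * poly g (x k i)) \<longlonglongrightarrow> (\<Sum>i<d. m0 i * poly g (X i))"
      using mlim xlim by (intro tendsto_sum tendsto_mult isCont_tendsto_compose[of _ "poly g"]) auto
    then show ?thesis using ann[OF g] by (simp add: LIMSEQ_const_iff)
  qed
  \<comment> \<open>test with a polynomial that vanishes on all other limit points\<close>
  have C_sum0: "sum m0 (C w) = 0" if w: "w \<in> A" for w
  proof -
    define g where "g = (\<Prod>v\<in>A - {w}. [:- v, 1:])"
    have "degree g = r - 1" using degree_prod_linear[of "A - {w}" id] finA w by (simp add: g_def r_def)
    then have "(\<Sum>i<d. m0 i * poly g (X i)) = 0" using rd r2 by (intro lim_ann) auto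
    also have "(\<Sum>i<d. m0 i * poly g (X i)) = (\<Sum>i\<in>C w. m0 i * poly g (X i))"
    proof (rule sum.mono_neutral_right)
      show "\<forall>i\<in>{..<d} - C w. m0 i * poly g (X i) = 0"
      proof
        fix i assume "i \<in> {..<d} - C w"
        then have "X i \<in> A - {w}" by (auto simp: A_def C_def)
        then have "poly g (X i) = 0" unfolding g_def poly_prod using finA by (intro prod_zero) auto
        then show "m0 i * poly g (X i) = 0" by simp
      qed
    qed (auto simp: C_def)
    also have "\<dots> = sum m0 (C w) * poly g w" by (simp add: sum_distrib_right C_def)
    finally have "sum m0 (C w) * poly g w = 0" .
    moreover have "poly g w \<noteq> 0" using finA by (simp add: g_def poly_prod)
    ultimately show ?thesis by simp
  qed
  have C_prop: "C w \<subset> {..<d}" "C w \<noteq> {}" if w: "w \<in> A" for w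
  proof -
    have "X a \<noteq> w \<or> X b \<noteq> w" using two(3) by auto
    then show "C w \<subset> {..<d}" using two by (auto simp: C_def)
    show "C w \<noteq> {}" using w by (auto simp: A_def C_def)
  qed
  have C_sum: "sum (ms k) (C w) = 0" if w: "w \<in> A" for k w
    using hered[OF C_prop[OF w] C_sum0[OF w]] .
  \<comment> \<open>One label is chosen in each cluster; \<open>N\<close> collects the others, and \<open>i0\<close> is the one whose
    condition is implied by the remaining ones.\<close>
  define rep where "rep i = inv_into {..<d} X (X i)" for i
  have rep: "rep i < d" "X (rep i) = X i" if "i < d" for i
    using that inv_into_into[of "X i" X "{..<d}"] f_inv_into_f[of "X i" X "{..<d}"] by (auto simp: rep_def)
  have rep_eq: "rep i = rep j" if "X i = X j" for i j using that by (simp add: rep_def)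
  define R where "R = inv_into {..<d} X ` A"
  have "card R = r" unfolding R_def r_def by (intro card_image inj_on_inv_into) (simp add: A_def)
  have Rd: "R \<subseteq> {..<d}" using inv_into_into[of _ X "{..<d}"] by (auto simp: R_def A_def)
  have repR: "rep i = i" if "i \<in> R" for i
    using that by (auto simp: R_def rep_def A_def f_inv_into_f)
  define N where "N = {..<d} - R"
  have cN: "card N = d - r" using \<open>card R = r\<close> Rd by (simp add: N_def card_Diff_subset finite_subset)
  then obtain i0 where i0: "i0 \<in> N" using rd by (metis card.empty equals0I zero_less_diff less_irrefl)
  let ?U = "{1..d - r}"
  have "\<exists>c. (\<exists>u\<in>?U. c u \<noteq> 0) \<and> (\<forall>i\<in>N - {i0}. (\<Sum>u\<in>?U. (x k i ^ u - x k (rep i) ^ u) * c u) = 0)" for k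
  proof (rule underdetermined_system)
    show "card (N - {i0}) < card ?U" using cN i0 rd by (simp add: N_def)
  qed (auto simp: N_def)
  then obtain c where c: "\<And>k. \<exists>u\<in>?U. c k u \<noteq> 0"
      "\<And>k i. i \<in> N - {i0} \<Longrightarrow> (\<Sum>u\<in>?U. (x k i ^ u - x k (rep i) ^ u) * c k u) = 0" by metis
  define S where "S k = (\<Sum>u\<in>?U. cmod (c k u))" for k
  have S: "S k > 0" for k
  proof -
    obtain u where "u \<in> ?U" "c k u \<noteq> 0" using c(1) by blast
    then show ?thesis unfolding S_def by (intro sum_pos2[of _ u]) auto
  qed
  define e where "e k u = c k u / of_real (S k)" for k u
  have e1: "(\<Sum>u\<in>?U. cmod (e k u)) = 1" for k
  proof -
    have "(\<Sum>u\<in>?U. cmod (e k u)) = (\<Sum>u\<in>?U. cmod (c k u) / S k)"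
      using S[of k] by (intro sum.cong) (auto simp: e_def norm_divide)
    also have "\<dots> = S k / S k" unfolding S_def by (rule sum_divide_distrib[symmetric])
    finally show ?thesis using S[of k] by simp
  qed
  have "cmod (e k u) \<le> 1" if "u \<in> ?U" for k u
    using member_le_sum[of u ?U "\<lambda>u. cmod (e k u)"] that e1[of k] by simp
  then obtain t where t: "strict_mono t" "\<forall>u\<in>?U. convergent (\<lambda>k. e (t k) u)"
    using bounded_coordinates_subseq[of ?U e 1] by blast
  then obtain el where el: "\<And>u. u \<in> ?U \<Longrightarrow> (\<lambda>k. e (t k) u) \<longlonglongrightarrow> el u" unfolding convergent_def by metis
  define g where "g k = (\<Sum>u\<in>?U. monom (e (t k) u) u)" for k
  define G where "G = (\<Sum>u\<in>?U. monom (el u) u)"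
  have dg: "degree (g k) \<le> d - r" "degree G \<le> d - r" for k
    unfolding g_def G_def by (auto intro!: degree_sum_le order_trans[OF degree_monom_le])
  have cg: "coeff (g k) j = (if j \<in> ?U then e (t k) j else 0)" "coeff G j = (if j \<in> ?U then el j else 0)" for k j
    by (auto simp: g_def G_def coeff_sum)
  have glim: "(\<lambda>k. coeff (g k) j) \<longlonglongrightarrow> coeff G j" for j
    using el[of j] by (auto simp: cg)
  have gx: "poly (g k) (x (t k) i) = poly (g k) (x (t k) (rep i))" if i: "i < d" for k i
  proof -
    let ?m = "ms (t k)" and ?x = "x (t k)"
    have 1: "poly (g k) (?x i) = poly (g k) (?x (rep i))" if "i < d" "i \<noteq> i0" for i
    proof (cases "i \<in> R")
      case True
      then show ?thesis by (simp add: repR)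
    next
      case False
      then have "i \<in> N - {i0}" using that by (auto simp: N_def)
      from c(2)[OF this, of "t k"]
      have "(\<Sum>u\<in>?U. (?x i ^ u - ?x (rep i) ^ u) * c (t k) u) / of_real (S (t k)) = 0" by simp
      then have "(\<Sum>u\<in>?U. e (t k) u * (?x i ^ u - ?x (rep i) ^ u)) = 0"
        unfolding e_def sum_divide_distrib by (simp add: mult_ac)
      then show ?thesis by (simp add: g_def poly_sum poly_monom right_diff_distrib sum_subtractf)
    qed
    show ?thesis
    proof (cases "i = i0")
      case True
      have i0d: "i0 < d" using i0 by (auto simp: N_def)
      have "degree (g k) + 2 \<le> d" using dg(1)[of k] r2 rd by linarith
      then have "(\<Sum>i<d. ?m i * poly (g k) (?x i)) = 0" by (rule ann)
      moreover have "(\<Sum>i<d. ?m i * poly (g k) (?x (rep i))) = 0"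
      proof -
        have "(\<Sum>i<d. ?m i * poly (g k) (?x (rep i))) = (\<Sum>w\<in>A. \<Sum>i\<in>C w. ?m i * poly (g k) (?x (rep i)))"
          unfolding A_def C_def by (rule sum.image_gen) simp
        also have "\<dots> = (\<Sum>w\<in>A. 0)"
        proof (intro sum.cong refl)
          fix w assume w: "w \<in> A"
          then obtain j where j: "j < d" "X j = w" by (auto simp: A_def)
          have "(\<Sum>i\<in>C w. ?m i * poly (g k) (?x (rep i))) = (\<Sum>i\<in>C w. ?m i * poly (g k) (?x (rep j)))"
            by (intro sum.cong refl) (use j in \<open>auto simp: C_def dest!: rep_eq\<close>)
          then show "(\<Sum>i\<in>C w. ?m i * poly (g k) (?x (rep i))) = 0"
            using C_sum[OF w] by (simp add: sum_distrib_right[symmetric])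
        qed
        finally show ?thesis by simp
      qed
      ultimately have "(\<Sum>i<d. ?m i * (poly (g k) (?x i) - poly (g k) (?x (rep i)))) = 0"
        by (simp add: right_diff_distrib sum_subtractf)
      also have "(\<Sum>i<d. ?m i * (poly (g k) (?x i) - poly (g k) (?x (rep i)))) =
          (\<Sum>i<d. if i = i0 then ?m i * (poly (g k) (?x i) - poly (g k) (?x (rep i))) else 0)"
        by (intro sum.cong refl) (use 1 in auto)
      also have "\<dots> = ?m i0 * (poly (g k) (?x i0) - poly (g k) (?x (rep i0)))" using i0d by simp
      finally show ?thesis using m[of "t k"] i0d True by (auto simp: Res_def)
    qed (use 1 i in auto)
  qed
  have "\<exists>u\<in>?U. el u \<noteq> 0"
  proof (rule ccontr)
    assume "\<not> (\<exists>u\<in>?U. el u \<noteq> 0)"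
    then have "(\<lambda>k. \<Sum>u\<in>?U. cmod (e (t k) u)) \<longlonglongrightarrow> (\<Sum>u\<in>?U. cmod 0)"
      using el by (intro tendsto_sum tendsto_norm) auto
    then show False using e1 by (simp add: LIMSEQ_const_iff)
  qed
  then obtain u where u: "u \<in> ?U" "el u \<noteq> 0" by blast
  have "u \<le> degree G" using u by (intro le_degree) (simp add: cg)
  then have degG: "degree G > 0" using u by simp
  have dvd: "[:- w, 1:] ^ card (C w) dvd G - [:poly G w:]" if w: "w \<in> A" for w
  proof -
    obtain j where j: "j < d" "X j = w" using w by (auto simp: A_def)
    have xl: "(\<lambda>k. x (t k) i) \<longlonglongrightarrow> X i" if "i < d" for i
      using LIMSEQ_subseq_LIMSEQ[OF xlim[OF that] t(1)] by (simp add: o_def)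
    define p where "p k = g k - [:poly (g k) (x (t k) (rep j)):]" for k
    have vl: "(\<lambda>k. poly (g k) (x (t k) (rep j))) \<longlonglongrightarrow> poly G w"
      using tendsto_poly_coeffs[OF dg glim xl[OF rep(1)[OF j(1)]]] rep(2)[OF j(1)] j(2) by simp
    show ?thesis
    proof (rule merging_roots_power_dvd[of "C w" p "d - r" _ "\<lambda>k. x (t k)"])
      show "finite (C w)" by (simp add: C_def)
      show "degree (p k) \<le> d - r" for k
        using degree_diff_le_max[of "g k" "[:poly (g k) (x (t k) (rep j)):]"] dg(1)[of k] by (simp add: p_def)
      show "degree (G - [:poly G w:]) \<le> d - r"
        using degree_diff_le_max[of G "[:poly G w:]"] dg(2) by simp
      show "(\<lambda>k. coeff (p k) n) \<longlonglongrightarrow> coeff (G - [:poly G w:]) n" for n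
        unfolding p_def coeff_diff using vl by (intro tendsto_diff glim) (cases n; simp)
      show "poly (p k) (x (t k) i) = 0" if "i \<in> C w" for k i
        using that gx[of i k] rep_eq[of i j] j by (auto simp: p_def C_def)
      show "inj_on (x (t k)) (C w)" for k using inj[of "t k"] by (rule inj_on_subset) (auto simp: C_def)
      show "(\<lambda>k. x (t k) i) \<longlonglongrightarrow> w" if "i \<in> C w" for i using that xl by (auto simp: C_def)
    qed
  qed
  have "(\<Sum>w\<in>A. card (C w) - 1) < degree G"
    using C_prop by (intro poly_strict_cluster_bound finA dvd degG) (auto simp: C_def card_gt_0_iff)
  moreover have "(\<Sum>w\<in>A. card (C w) - 1) = d - r"
  proof -
    have "(\<Sum>w\<in>A. card (C w)) = d"
      using sum.image_gen[of "{..<d}" "\<lambda>_. 1::nat" X] by (simp add: A_def C_def)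
    moreover have "(\<Sum>w\<in>A. card (C w) - 1) = (\<Sum>w\<in>A. card (C w)) - (\<Sum>w\<in>A. 1)"
      using C_prop by (intro sum_subtractf_nat) (auto simp: C_def Suc_le_eq card_gt_0_iff)
    ultimately show ?thesis by (simp add: r_def)
  qed
  ultimately show False using dg(2) by simp
qed

text \<open>Scale the configurations to \<open>l\<^sup>1\<close> norm one, so that a subsequence converges to a limit that is not
  constant, as the point with label 0 stays at 0. The limit is injective, so the points with labels 0
  and 1 do not merge, the scaling factors stay bounded and can be undone.\<close>

lemma config_sequentially_compact:
  assumes d: "d \<ge> 2" and m: "\<And>k. ms k \<in> Res d" and m0: "m0 \<in> Res d"
    and mlim: "\<And>i. i < d \<Longrightarrow> (\<lambda>k. ms k i) \<longlonglongrightarrow> m0 i"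
    and hered: "\<And>k J. J \<subset> {..<d} \<Longrightarrow> J \<noteq> {} \<Longrightarrow> sum m0 J = 0 \<Longrightarrow> sum (ms k) J = 0"
    and z: "\<And>k. zs k \<in> config d (ms k)"
  shows "\<exists>t z0. strict_mono t \<and> z0 \<in> config d m0 \<and> filterlim (\<lambda>k. zs (t k)) (near d z0) sequentially"
proof -
  define M where "M k = (\<Sum>i<d. cmod (zs k i))" for k
  have z01: "zs k 0 = 0" "zs k 1 = 1" and inj: "inj_on (zs k) {..<d}" for k
    using z[of k] by (auto simp: config_def)
  have M: "M k \<ge> 1" for k
    unfolding M_def using member_le_sum[of 1 "{..<d}" "\<lambda>i. cmod (zs k i)"] z01(2)[of k] d by simp
  have M0: "complex_of_real (M k) \<noteq> 0" for k using M[of k] by simp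
  define y where "y k i = zs k i / of_real (M k)" for k i
  have y1: "(\<Sum>i<d. cmod (y k i)) = 1" for k
  proof -
    have "(\<Sum>i<d. cmod (y k i)) = (\<Sum>i<d. cmod (zs k i) / M k)"
      using M[of k] by (intro sum.cong) (auto simp: y_def norm_divide)
    also have "\<dots> = M k / M k" unfolding M_def by (rule sum_divide_distrib[symmetric])
    finally show ?thesis using M[of k] by simp
  qed
  have "cmod (y k i) \<le> 1" if "i \<in> {..<d}" for k i
    using member_le_sum[of i "{..<d}" "\<lambda>i. cmod (y k i)"] that y1[of k] by simp
  then obtain t where t: "strict_mono t" "\<forall>i\<in>{..<d}. convergent (\<lambda>k. y (t k) i)"
    using bounded_coordinates_subseq[of "{..<d}" y 1] by blast
  then obtain X where X: "\<And>i. i < d \<Longrightarrow> (\<lambda>k. y (t k) i) \<longlonglongrightarrow> X i" unfolding convergent_def by (metis lessThan_iff)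
  have mtlim: "(\<lambda>k. ms (t k) i) \<longlonglongrightarrow> m0 i" if "i < d" for i
    using LIMSEQ_subseq_LIMSEQ[OF mlim[OF that] t(1)] by (simp add: o_def)
  have X0: "X 0 = 0"
  proof -
    have "(\<lambda>k. y (t k) 0) \<longlonglongrightarrow> X 0" using X d by simp
    then show ?thesis by (simp add: y_def z01 LIMSEQ_const_iff)
  qed
  have "(\<lambda>k. \<Sum>i<d. cmod (y (t k) i)) \<longlonglongrightarrow> (\<Sum>i<d. cmod (X i))" using X by (intro tendsto_sum tendsto_norm) auto
  then have "(\<Sum>i<d. cmod (X i)) = 1" by (simp add: y1 LIMSEQ_const_iff)
  then have "\<exists>i\<in>{..<d}. cmod (X i) \<noteq> 0" by (metis sum.neutral zero_neq_one)
  then obtain b where b: "b < d" "X b \<noteq> 0" by auto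
  have injX: "inj_on X {..<d}"
  proof (rule limit_configuration_injective[of "\<lambda>k. ms (t k)" d m0 "\<lambda>k. y (t k)"])
    show "0 < d" using d by simp
    show "X 0 \<noteq> X b" using b X0 by simp
    show "inj_on (y (t k)) {..<d}" for k using inj[of "t k"] M0 by (auto simp: inj_on_def y_def)
    fix k and g :: "complex poly" assume g: "degree g + 2 \<le> d"
    define h where "h = g \<circ>\<^sub>p [:0, 1 / of_real (M (t k)):]"
    have "degree h + 2 \<le> d" using g M0 by (simp add: h_def degree_pcompose)
    then have "(\<Sum>i<d. ms (t k) i * poly h (zs (t k) i)) = 0" by (rule config_annihilates[OF m z])
    then show "(\<Sum>i<d. ms (t k) i * poly g (y (t k) i)) = 0"
      by (simp add: h_def poly_pcompose y_def)
  qed (use m m0 mtlim hered X b in auto)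
  then have X1: "X 1 \<noteq> 0" using X0 d inj_onD[of X "{..<d}" 1 0] by auto
  define z0 where "z0 i = (if i < d then X i / X 1 else 0)" for i
  have lim: "(\<lambda>k. zs (t k) i) \<longlonglongrightarrow> z0 i" if "i < d" for i
  proof -
    have "(\<lambda>k. y (t k) i / y (t k) 1) \<longlonglongrightarrow> X i / X 1" using X that d X1 by (intro tendsto_divide) auto
    moreover have "y (t k) i / y (t k) 1 = zs (t k) i" for k using M0[of "t k"] z01[of "t k"] by (simp add: y_def)
    ultimately show ?thesis using that by (simp add: z0_def)
  qed
  have "z0 \<in> config d m0"
    unfolding config_def
  proof (intro CollectI conjI allI impI)
    show "z0 \<in> Cn d" by (simp add: z0_def Cn_def)
    show "inj_on z0 {..<d}" using injX X1 by (auto simp: inj_on_def z0_def)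
    show "z0 0 = 0" "z0 1 = 1" using X0 X1 d by (auto simp: z0_def)
    fix g :: "complex poly" assume g: "degree g + 2 \<le> d \<and> poly g 0 = 0"
    have "isCont (poly g) (z0 i)" for i by simp
    then have "(\<lambda>k. \<Sum>i<d. ms (t k) i * poly g (zs (t k) i)) \<longlonglongrightarrow> (\<Sum>i<d. m0 i * poly g (z0 i))"
      using mtlim lim by (intro tendsto_sum tendsto_mult isCont_tendsto_compose[of _ "poly g"]) auto
    moreover have "(\<Sum>i<d. ms (t k) i * poly g (zs (t k) i)) = 0" for k
      using config_annihilates[OF m z] g by blast
    ultimately show "(\<Sum>i<d. m0 i * poly g (z0 i)) = 0" by (simp add: LIMSEQ_const_iff)
  qed
  moreover have "filterlim (\<lambda>k. zs (t k)) (near d z0) sequentially"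
    unfolding filterlim_near using lim config_Cn[OF z] by auto
  ultimately show ?thesis using t(1) by blast
qed

section \<open>Neighbourhoods in the quotient spaces\<close>

definition multiplier_class :: "nat \<Rightarrow> (nat \<Rightarrow> complex) \<Rightarrow> complex multiset" where
  "multiplier_class d m = pr d (multipliers d m)"

lemma Lambda_subset_Cn: "(\<lambda>l. l) ` Lambda d \<subseteq> Cn d"
  by (auto simp: Lambda_def)

lemma Poly_deg_coeff_Cn: "coeff ` Poly_deg d \<subseteq> Cn (d + 1)"
  by (auto simp: Poly_deg_def Cn_def intro!: coeff_eq_0)

lemma topspace_Lambda_space: "topspace (cs_top (Lambda_space d)) = Lambda d"
  unfolding Lambda_space_def by (rule topspace_embedded_space[OF Lambda_subset_Cn])

lemma topspace_Poly_space: "topspace (cs_top (Poly_space d)) = Poly_deg d"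
  unfolding Poly_space_def by (rule topspace_embedded_space[OF Poly_deg_coeff_Cn])

lemma topspace_Lambda_tilde_space: "topspace (cs_top (Lambda_tilde_space d)) = pr d ` Lambda d"
  by (simp add: Lambda_tilde_space_def topspace_quotient_space topspace_Lambda_space)

lemma topspace_MP_space: "topspace (cs_top (MP_space d)) = MP d"
  by (auto simp: MP_space_def topspace_quotient_space topspace_Poly_space MP_def moduli_class_def quotient_def)

lemma openin_Lambda_space:
  "openin (cs_top (Lambda_space d)) W \<longleftrightarrow> W \<subseteq> Lambda d \<and> (\<forall>l\<in>W. eventually (\<lambda>w. w \<in> Lambda d \<longrightarrow> w \<in> W) (near d l))"
  unfolding Lambda_space_def openin_embedded_space[OF Lambda_subset_Cn] by simp

lemma openin_Lambda_tilde_space: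
  "openin (cs_top (Lambda_tilde_space d)) W \<longleftrightarrow> W \<subseteq> pr d ` Lambda d \<and>
     (\<forall>l\<in>Lambda d. pr d l \<in> W \<longrightarrow> eventually (\<lambda>w. w \<in> Lambda d \<longrightarrow> pr d w \<in> W) (near d l))"
  unfolding Lambda_tilde_space_def openin_quotient_space topspace_Lambda_space openin_Lambda_space
  by (auto elim!: eventually_mono)

lemma openin_MP_space:
  "openin (cs_top (MP_space d)) W \<longleftrightarrow> W \<subseteq> MP d \<and>
     (\<forall>f\<in>Poly_deg d. moduli_class d f \<in> W \<longrightarrow>
        eventually (\<lambda>w. \<forall>g\<in>Poly_deg d. coeff g = w \<longrightarrow> moduli_class d g \<in> W) (near (d + 1) (coeff f)))"
proof -
  have MP: "moduli_class d ` Poly_deg d = MP d"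
    using topspace_MP_space by (simp add: MP_space_def topspace_quotient_space topspace_Poly_space)
  have "openin (cs_top (Poly_space d)) S \<longleftrightarrow> S \<subseteq> Poly_deg d \<and>
      (\<forall>f\<in>S. eventually (\<lambda>w. \<forall>g\<in>Poly_deg d. coeff g = w \<longrightarrow> g \<in> S) (near (d + 1) (coeff f)))" for S
    unfolding Poly_space_def by (rule openin_embedded_space[OF Poly_deg_coeff_Cn])
  then show ?thesis
    unfolding MP_space_def openin_quotient_space topspace_Poly_space MP
    by (auto elim!: eventually_mono)
qed

lemma Res_Cn: "m \<in> Res d \<Longrightarrow> m \<in> Cn d" by (simp add: Res_def)

lemma Lambda_lift_cases:
  assumes "l \<in> Lambda d" "pr d l = multiplier_class d m" "m \<in> Res d"
  shows "\<exists>s. s permutes {..<d} \<and> l = multipliers d (m \<circ> s) \<and> m \<circ> s \<in> Res d"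
proof -
  have "multipliers d m \<in> Cn d" "l \<in> Cn d" using assms by (auto simp: multipliers_def Cn_def Lambda_def)
  then obtain s where s: "s permutes {..<d}" "l = multipliers d m \<circ> s"
    using assms(2) pr_eq_iff[of "multipliers d m" d l] by (auto simp: multiplier_class_def)
  then show ?thesis using multipliers_comp_permutes[OF s(1), of m] comp_permutes_Res[OF s(1) assms(3)] by auto
qed

lemma multiplier_class_permute:
  assumes "s permutes {..<d}" "m \<in> Res d" shows "multiplier_class d (m \<circ> s) = multiplier_class d m"
  using pr_multipliers_eq_iff[OF assms(2) comp_permutes_Res[OF assms]] assms(1) by (auto simp: multiplier_class_def)

lemma multipliers_Lambda: "m \<in> Res d \<Longrightarrow> multipliers d m \<in> Lambda d"
  using multipliers_in_V by (auto simp: V_def)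

lemma V_tilde_eq: "V_tilde d = multiplier_class d ` Res d"
proof
  show "V_tilde d \<subseteq> multiplier_class d ` Res d"
  proof
    fix x assume "x \<in> V_tilde d"
    then obtain l where "l \<in> V d" "x = pr d l" by (auto simp: V_tilde_def)
    then show "x \<in> multiplier_class d ` Res d"
      using residues_in_Res[of l d] multipliers_residues[of l d] by (auto simp: multiplier_class_def intro!: image_eqI[of _ _ "residues d l"])
  qed
  show "multiplier_class d ` Res d \<subseteq> V_tilde d" using multipliers_in_V by (auto simp: multiplier_class_def V_tilde_def)
qed

lemma tendsto_comp_permutes_near:
  assumes s: "s permutes {..<d}" and f: "filterlim f (near d z) F"
  shows "filterlim (\<lambda>x. f x \<circ> s) (near d (z \<circ> s)) F"
  using f permutes_in_image[OF s] unfolding filterlim_near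
  by (auto elim!: eventually_mono intro: comp_permutes_Cn[OF s])

lemma residues_near:
  assumes "m \<in> Res d" "l = multipliers d m"
  shows "filterlim (residues d) (near d m) (near d l)"
  unfolding filterlim_near
proof (intro conjI allI impI)
  show "eventually (\<lambda>x. residues d x \<in> Cn d) (near d l)" by (simp add: residues_def Cn_def)
  fix i assume i: "i < d"
  have "((\<lambda>x. 1 / (1 - x i)) \<longlongrightarrow> 1 / (1 - l i)) (near d l)"
    using i assms by (intro tendsto_intros tendsto_coord_near) (auto simp: multipliers_def Res_def)
  then show "((\<lambda>x. residues d x i) \<longlongrightarrow> m i) (near d l)"
    using i assms by (simp add: residues_def multipliers_def Res_def)
qed

lemma multipliers_near:
  assumes "m \<in> Res d" shows "filterlim (multipliers d) (near d (multipliers d m)) (near d m)"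
  unfolding filterlim_near
proof (intro conjI allI impI)
  show "eventually (\<lambda>x. multipliers d x \<in> Cn d) (near d m)" by (simp add: multipliers_def Cn_def)
  fix i assume i: "i < d"
  then show "((\<lambda>x. multipliers d x i) \<longlongrightarrow> multipliers d m i) (near d m)"
    using assms unfolding multipliers_def
    by (auto intro!: tendsto_intros tendsto_coord_near simp: Res_def)
qed

text \<open>Off the hyperplanes \<open>l i = 1\<close>, a point of \<open>Lambda d\<close> is determined by its residues.\<close>

lemma eventually_residues_near:
  assumes m: "m \<in> Res d"
  shows "eventually (\<lambda>l. l \<in> Lambda d \<longrightarrow> residues d l \<in> Res d \<and> multipliers d (residues d l) = l) (near d (multipliers d m))"
proof -
  have "eventually (\<lambda>l. \<forall>i\<in>{..<d}. l i \<noteq> 1) (near d (multipliers d m))"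
    using m by (intro eventually_ball_finite ballI tendsto_imp_eventually_ne[OF tendsto_coord_near])
      (auto simp: multipliers_def Res_def)
  then show ?thesis
    by (rule eventually_mono) (auto simp: V_def intro: residues_in_Res multipliers_residues)
qed

lemma openin_multiplier_class_image:
  assumes D: "D \<subseteq> Res d" "\<And>m. m \<in> D \<Longrightarrow> eventually (\<lambda>w. w \<in> Res d \<longrightarrow> w \<in> D) (near d m)"
  shows "openin (cs_top (Lambda_tilde_space d)) (multiplier_class d ` D)"
  unfolding openin_Lambda_tilde_space
proof (intro conjI ballI impI)
  show "multiplier_class d ` D \<subseteq> pr d ` Lambda d" using D(1) multipliers_Lambda by (auto simp: multiplier_class_def)
  fix l assume l: "l \<in> Lambda d" "pr d l \<in> multiplier_class d ` D"
  then obtain m where m: "m \<in> D" "pr d l = multiplier_class d m" by auto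
  then obtain s where s: "s permutes {..<d}" "l = multipliers d (m \<circ> s)" "m \<circ> s \<in> Res d"
    using Lambda_lift_cases[OF l(1)] D(1) by blast
  have si: "inv s permutes {..<d}" by (rule permutes_inv[OF s(1)])
  have "filterlim (\<lambda>x. residues d x \<circ> inv s) (near d (m \<circ> s \<circ> inv s)) (near d l)"
    by (rule tendsto_comp_permutes_near[OF si residues_near[OF s(3,2)]])
  moreover have "m \<circ> s \<circ> inv s = m" using permutes_inv_o(1)[OF s(1)] by (simp add: comp_assoc)
  ultimately have "eventually (\<lambda>x. residues d x \<circ> inv s \<in> Res d \<longrightarrow> residues d x \<circ> inv s \<in> D) (near d l)"
    using eventually_compose_filterlim[OF D(2)[OF m(1)]] by simp
  moreover have "eventually (\<lambda>l. l \<in> Lambda d \<longrightarrow> residues d l \<in> Res d \<and> multipliers d (residues d l) = l) (near d l)"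
    unfolding s(2) by (rule eventually_residues_near[OF s(3)])
  ultimately show "eventually (\<lambda>w. w \<in> Lambda d \<longrightarrow> pr d w \<in> multiplier_class d ` D) (near d l)"
  proof eventually_elim
    case (elim x)
    show ?case
    proof
      assume x: "x \<in> Lambda d"
      then have r: "residues d x \<in> Res d" "multipliers d (residues d x) = x" using elim by auto
      have "residues d x \<circ> inv s \<in> D" using elim(1) comp_permutes_Res[OF si r(1)] by simp
      moreover have "multiplier_class d (residues d x \<circ> inv s) = pr d x"
        using multiplier_class_permute[OF si r(1)] r(2) by (simp add: multiplier_class_def)
      ultimately show "pr d x \<in> multiplier_class d ` D" by (metis imageI)
    qed
  qed
qed

lemma openin_multiplier_class_polydisc: "openin (cs_top (Lambda_tilde_space d)) (multiplier_class d ` (Res d \<inter> polydisc d m r))"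
  by (rule openin_multiplier_class_image) (auto intro: eventually_mono[OF polydisc_near])

lemma Lambda_tilde_open_near:
  assumes "openin (cs_top (Lambda_tilde_space d)) W" "m \<in> Res d" "multiplier_class d m \<in> W"
  shows "eventually (\<lambda>w. w \<in> Res d \<longrightarrow> multiplier_class d w \<in> W) (near d m)"
proof -
  have "eventually (\<lambda>w. w \<in> Lambda d \<longrightarrow> pr d w \<in> W) (near d (multipliers d m))"
    using assms multipliers_Lambda[OF assms(2)] by (auto simp: openin_Lambda_tilde_space multiplier_class_def)
  from eventually_compose_filterlim[OF this multipliers_near[OF assms(2)]]
  show ?thesis by (rule eventually_mono) (auto simp: multiplier_class_def multipliers_Lambda)
qed

lemma coeff_linear_mult: "coeff ([:- a, 1:] * p) k = - a * coeff p k + (if k = 0 then 0 else coeff p (k - 1))" for a :: complex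
  by (cases k) (auto simp: algebra_simps)

lemma tendsto_coeff_prod_linear:
  assumes "finite A" "\<And>j. j \<in> A \<Longrightarrow> ((\<lambda>t. y t j) \<longlongrightarrow> z j) F"
  shows "((\<lambda>t. coeff (\<Prod>j\<in>A. [:- y t j, 1:]) k) \<longlongrightarrow> coeff (\<Prod>j\<in>A. [:- z j, 1 :: complex:]) k) F"
  using assms
proof (induction A arbitrary: k rule: finite_induct)
  case (insert j A)
  have "((\<lambda>t. - y t j * coeff (\<Prod>j\<in>A. [:- y t j, 1:]) k + (if k = 0 then 0 else coeff (\<Prod>j\<in>A. [:- y t j, 1:]) (k - 1)))
     \<longlongrightarrow> - z j * coeff (\<Prod>j\<in>A. [:- z j, 1:]) k + (if k = 0 then 0 else coeff (\<Prod>j\<in>A. [:- z j, 1:]) (k - 1))) F"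
    using insert by (intro tendsto_add tendsto_mult tendsto_minus) (auto split: if_splits)
  then show ?case unfolding prod.insert[OF insert.hyps] coeff_linear_mult .
qed simp

lemma cdiff_coeff_prod_linear:
  assumes "finite A" "\<And>j. j \<in> A \<Longrightarrow> cdiff n (\<lambda>t. y t j) x"
  shows "cdiff n (\<lambda>t. coeff (\<Prod>j\<in>A. [:- y t j, 1:]) k) x"
  using assms
proof (induction A arbitrary: k rule: finite_induct)
  case empty
  then show ?case by (simp add: cdiff_const)
next
  case (insert j A)
  have "cdiff n (\<lambda>t. - 1 * (y t j * coeff (\<Prod>j\<in>A. [:- y t j, 1:]) k) + (if k = 0 then 0 else coeff (\<Prod>j\<in>A. [:- y t j, 1:]) (k - 1))) x"
    using insert by (cases "k = 0"; simp only: if_True if_False; intro cdiff_add cdiff_cmult cdiff_mult)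
      (auto intro: cdiff_const)
  then show ?case unfolding prod.insert[OF insert.hyps] coeff_linear_mult by simp
qed

lemma coeff_fixed_poly:
  "coeff (fixed_poly d m z) k = coeff [:0, 1:] k + (- 1 / (m 0 * (\<Prod>j\<in>{..<d} - {0}. z 0 - z j))) * coeff (\<Prod>j<d. [:- z j, 1:]) k"
  by (simp add: fixed_poly_def)

context
  fixes d :: nat assumes d: "d \<ge> 2"
begin

lemma fixed_poly_denominator:
  assumes "m \<in> Res d" "z \<in> config d m"
  shows "m 0 * (\<Prod>j\<in>{..<d} - {0}. z 0 - z j) \<noteq> 0"
  using assms d prod_diff_nonzero[of z "{..<d}" 0] by (simp add: Res_def config_def)

lemma cdiff_coeff_fixed_poly:
  assumes "\<And>i. i < d \<Longrightarrow> cdiff n (\<lambda>t. M t i) x" "\<And>i. i < d \<Longrightarrow> cdiff n (\<lambda>t. Z t i) x"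
    and "M x \<in> Res d" "Z x \<in> config d (M x)"
  shows "cdiff n (\<lambda>t. coeff (fixed_poly d (M t) (Z t)) k) x"
  unfolding coeff_fixed_poly
  using assms(1,2) d fixed_poly_denominator[OF assms(3,4)]
  by (intro cdiff_add cdiff_mult cdiff_divide cdiff_coeff_prod_linear cdiff_prod cdiff_diff cdiff_const) auto

lemma fixed_poly_near:
  assumes m: "m \<in> Res d" "z \<in> config d m" and M: "filterlim M (near d m) F" and Z: "filterlim Z (near d z) F"
    and ev: "eventually (\<lambda>t. M t \<in> Res d \<and> Z t \<in> config d (M t)) F"
  shows "filterlim (\<lambda>t. coeff (fixed_poly d (M t) (Z t))) (near (d + 1) (coeff (fixed_poly d m z))) F"
  unfolding filterlim_near
proof (intro conjI allI impI)
  show "eventually (\<lambda>t. coeff (fixed_poly d (M t) (Z t)) \<in> Cn (d + 1)) F"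
    using ev
  proof (rule eventually_mono)
    fix t assume t: "M t \<in> Res d \<and> Z t \<in> config d (M t)"
    then have "fixed_poly d (M t) (Z t) \<in> Poly_deg d" using fixed_poly_props(1)[OF d] by blast
    then show "coeff (fixed_poly d (M t) (Z t)) \<in> Cn (d + 1)" using Poly_deg_coeff_Cn by blast
  qed
  fix k
  have Mi: "((\<lambda>t. M t i) \<longlongrightarrow> m i) F" and Zi: "((\<lambda>t. Z t i) \<longlongrightarrow> z i) F" if "i < d" for i
    using M Z that by (auto simp: filterlim_near)
  show "((\<lambda>t. coeff (fixed_poly d (M t) (Z t)) k) \<longlongrightarrow> coeff (fixed_poly d m z) k) F"
    unfolding coeff_fixed_poly
    using Mi Zi d fixed_poly_denominator[OF m]
    by (intro tendsto_add tendsto_mult tendsto_divide tendsto_coeff_prod_linear tendsto_prod tendsto_diff tendsto_const) auto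
qed

text \<open>Continuity of \<open>config_class\<close>, expressed along an arbitrary filter so that it serves for sequences,
  paths and neighbourhoods.\<close>

lemma MP_open_near:
  assumes W: "openin (cs_top (MP_space d)) W" and m: "m \<in> Res d" "z \<in> config d m" and c: "config_class d m z \<in> W"
    and M: "filterlim M (near d m) F" and Z: "filterlim Z (near d z) F"
    and ev: "eventually (\<lambda>t. M t \<in> Res d \<and> Z t \<in> config d (M t)) F"
  shows "eventually (\<lambda>t. config_class d (M t) (Z t) \<in> W) F"
proof -
  have "eventually (\<lambda>w. \<forall>g\<in>Poly_deg d. coeff g = w \<longrightarrow> moduli_class d g \<in> W) (near (d + 1) (coeff (fixed_poly d m z)))"
    using W c fixed_poly_props(1)[OF d m] by (auto simp: openin_MP_space config_class_def)
  from eventually_compose_filterlim[OF this fixed_poly_near[OF m M Z ev]] ev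
  show ?thesis
    by eventually_elim (use fixed_poly_props(1)[OF d] in \<open>auto simp: config_class_def\<close>)
qed

text \<open>Label the fixed points of the polynomials near \<open>f\<close> by \<open>fixed_point_section\<close>: residues and normalised
  configuration become holomorphic functions of the coefficients.\<close>

lemma local_labels:
  assumes f: "f \<in> Poly_deg d" and y: "labels d f y"
  obtains M Z where "M (coeff f) = fp_residues d f y" "Z (coeff f) = normalise d y"
    "eventually (\<lambda>x. (\<forall>i<d. cdiff (d + 1) (\<lambda>x. M x i) x \<and> cdiff (d + 1) (\<lambda>x. Z x i) x) \<and> M x \<in> Res d \<and> Z x \<in> config d (M x) \<and>
       (\<forall>g\<in>Poly_deg d. coeff g = x \<longrightarrow> moduli_class d g = config_class d (M x) (Z x))) (near (d + 1) (coeff f))"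
proof -
  have df: "degree f = d" using f by (simp add: Poly_deg_def)
  have fC: "coeff f \<in> Cn (d + 1)" using f Poly_deg_coeff_Cn by blast
  have simple: "poly (pderiv f) (y i) \<noteq> 1" if "i < d" for i
    using labels_multiplier[OF d f y that] labels_prod_nonzero[OF d f y that] by simp
  obtain \<delta> S where \<delta>: "\<delta> > 0" and S: "\<And>x. x \<in> polydisc (d + 1) (coeff f) \<delta> \<Longrightarrow> S x \<in> polydisc d y 1 \<and> S x \<in> Cn d \<and>
     (\<forall>i<d. poly (poly_of d x) (S x i) = S x i \<and> poly (pderiv (poly_of d x)) (S x i) \<noteq> 1 \<and> cdiff (d + 1) (\<lambda>x. S x i) x)"
    and S0: "S (coeff f) = y"
    using fixed_point_section[of f d y 1] df y simple by auto
  define M where "M x = fp_residues d (poly_of d x) (S x)" for x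
  define Z where "Z x = normalise d (S x)" for x
  have "filterlim S (near d y) (near (d + 1) (coeff f))"
    unfolding filterlim_near
  proof (intro conjI allI impI)
    show "eventually (\<lambda>x. S x \<in> Cn d) (near (d + 1) (coeff f))"
      using eventually_polydisc_near[OF \<delta>, of "d + 1" "coeff f"] by (rule eventually_mono) (use S in blast)
    fix i assume i: "i < d"
    have "cdiff (d + 1) (\<lambda>x. S x i) (coeff f)" using S[OF centre_in_polydisc[OF fC \<delta>]] i by blast
    from cdiff_tendsto[OF this] show "((\<lambda>x. S x i) \<longlongrightarrow> y i) (near (d + 1) (coeff f))" by (simp add: S0)
  qed
  moreover have "inj_on y {..<d}" using y by (simp add: labels_def)
  ultimately have evinj: "eventually (\<lambda>x. inj_on (S x) {..<d}) (near (d + 1) (coeff f))"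
    using eventually_compose_filterlim[OF eventually_inj_on_near] by blast
  have "coeff f d \<noteq> 0" using df d by (metis leading_coeff_0_iff degree_0 not_numeral_le_zero)
  then have "eventually (\<lambda>x. x d \<noteq> 0) (near (d + 1) (coeff f))"
    by (intro tendsto_imp_eventually_ne[OF tendsto_coord_near]) auto
  with evinj eventually_polydisc_near[OF \<delta>, of "d + 1" "coeff f"]
  have "eventually (\<lambda>x. (\<forall>i<d. cdiff (d + 1) (\<lambda>x. M x i) x \<and> cdiff (d + 1) (\<lambda>x. Z x i) x) \<and> M x \<in> Res d \<and> Z x \<in> config d (M x) \<and>
       (\<forall>g\<in>Poly_deg d. coeff g = x \<longrightarrow> moduli_class d g = config_class d (M x) (Z x))) (near (d + 1) (coeff f))"
  proof eventually_elim
    case (elim x)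
    note Sx = S[OF elim(2)]
    have xC: "x \<in> Cn (d + 1)" using elim(2) by (simp add: polydisc_def)
    have cpol: "coeff (poly_of d x) k = x k" for k
      using xC coeff_sum_monom[of k d x] by (cases "k \<le> d") (auto simp: poly_of_def Cn_def coeff_sum)
    have "degree (poly_of d x) \<le> d" unfolding poly_of_def by (intro degree_sum_le) (auto intro: order_trans[OF degree_monom_le])
    moreover have "d \<le> degree (poly_of d x)" using elim(3) by (intro le_degree) (simp add: cpol)
    ultimately have P: "poly_of d x \<in> Poly_deg d" by (simp add: Poly_deg_def)
    have l: "labels d (poly_of d x) (S x)" using elim(1) Sx by (simp add: labels_def)
    have cS: "cdiff (d + 1) (\<lambda>x. S x i) x" if "i < d" for i using Sx that by blast
    have cM: "cdiff (d + 1) (\<lambda>x. M x i) x" if i: "i < d" for i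
    proof -
      have "M x i = 1 / (1 - (\<Sum>k<d+1. x k * (of_nat k * S x i ^ (k - 1))))" for x
        using i by (simp add: M_def fp_residues_def residues_def poly_pderiv_poly_of)
      moreover have "1 - (\<Sum>k<d+1. x k * (of_nat k * S x i ^ (k - 1))) \<noteq> 0"
        using Sx i by (simp add: poly_pderiv_poly_of)
      ultimately show ?thesis
        using cS[OF i] by (auto intro!: cdiff_inverse cdiff_diff cdiff_const cdiff_sum cdiff_mult cdiff_power cdiff_coord simp del: sum.lessThan_Suc)
    qed
    have cZ: "cdiff (d + 1) (\<lambda>x. Z x i) x" if i: "i < d" for i
    proof -
      have "S x 1 - S x 0 \<noteq> 0" using inj_label_01[OF d elim(1)] .
      then show ?thesis
        using cS i d by (auto simp: Z_def normalise_def intro!: cdiff_divide cdiff_diff simp del: One_nat_def)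
    qed
    have "moduli_class d g = config_class d (M x) (Z x)" if "g \<in> Poly_deg d" "coeff g = x" for g
    proof -
      have "g = poly_of d x" using that poly_of_coeff[of g d] by (auto simp: Poly_deg_def)
      then show ?thesis using moduli_class_labels[OF d P l] by (simp add: M_def Z_def)
    qed
    moreover have "M x \<in> Res d" "Z x \<in> config d (M x)"
      using fp_residues_in_Res[OF d P l] normalise_in_config[OF d P l] by (auto simp: M_def Z_def)
    ultimately show ?case using cM cZ by blast
  qed
  moreover have "M (coeff f) = fp_residues d f y" "Z (coeff f) = normalise d y"
    using poly_of_coeff[of f d] df S0 by (auto simp: M_def Z_def)
  ultimately show ?thesis using that by blast
qed

text \<open>Openness in \<open>MP d\<close> has to be tested at all polynomials of the class. Each of them admits labels
  with the given residues and normalised configuration, and by \<open>local_labels\<close> these vary continuously.\<close>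

lemma openin_config_class_image:
  assumes D: "\<And>m z. (m, z) \<in> D \<Longrightarrow> m \<in> Res d \<and> z \<in> config d m"
    and op: "\<And>m z. (m, z) \<in> D \<Longrightarrow> \<exists>r>0. \<forall>w\<in>Res d \<inter> polydisc d m r. \<forall>y\<in>config d w \<inter> polydisc d z r. (w, y) \<in> D"
  shows "openin (cs_top (MP_space d)) ((\<lambda>(m, z). config_class d m z) ` D)"
  unfolding openin_MP_space
proof (intro conjI ballI impI)
  show "(\<lambda>(m, z). config_class d m z) ` D \<subseteq> MP d" using D config_class_in_MP[OF d] by auto
  fix f assume f: "f \<in> Poly_deg d" "moduli_class d f \<in> (\<lambda>(m, z). config_class d m z) ` D"
  then obtain m z where mz: "(m, z) \<in> D" "moduli_class d f = config_class d m z" by auto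
  then obtain y where y: "labels d f y" "fp_residues d f y = m" "normalise d y = z"
    using labels_of_class[OF d f(1), of m z] D[OF mz(1)] by auto
  obtain r where r: "r > 0" "\<And>w y. w \<in> Res d \<Longrightarrow> w \<in> polydisc d m r \<Longrightarrow> y \<in> config d w \<Longrightarrow> y \<in> polydisc d z r \<Longrightarrow> (w, y) \<in> D"
    using op[OF mz(1)] by auto
  obtain M Z where MZ: "M (coeff f) = m" "Z (coeff f) = z"
    "eventually (\<lambda>x. (\<forall>i<d. cdiff (d + 1) (\<lambda>x. M x i) x \<and> cdiff (d + 1) (\<lambda>x. Z x i) x) \<and> M x \<in> Res d \<and> Z x \<in> config d (M x) \<and>
       (\<forall>g\<in>Poly_deg d. coeff g = x \<longrightarrow> moduli_class d g = config_class d (M x) (Z x))) (near (d + 1) (coeff f))"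
    using local_labels[OF f(1) y(1), unfolded y(2,3)] by blast
  have fC: "coeff f \<in> Cn (d + 1)" using f(1) Poly_deg_coeff_Cn by blast
  note c = eventually_near_centre[OF MZ(3) fC]
  have "eventually (\<lambda>x. M x \<in> Cn d) (near (d + 1) (coeff f))" "eventually (\<lambda>x. Z x \<in> Cn d) (near (d + 1) (coeff f))"
    by (rule eventually_mono[OF MZ(3)], meson Res_Cn config_Cn)+
  moreover have "((\<lambda>x. M x i) \<longlongrightarrow> m i) (near (d + 1) (coeff f))" "((\<lambda>x. Z x i) \<longlongrightarrow> z i) (near (d + 1) (coeff f))" if "i < d" for i
    using cdiff_tendsto[of "d + 1" "\<lambda>x. M x i" "coeff f"] cdiff_tendsto[of "d + 1" "\<lambda>x. Z x i" "coeff f"] c that MZ(1,2) by auto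
  ultimately have "filterlim M (near d m) (near (d + 1) (coeff f))" "filterlim Z (near d z) (near (d + 1) (coeff f))"
    by (auto simp: filterlim_near)
  then have "eventually (\<lambda>x. M x \<in> polydisc d m r) (near (d + 1) (coeff f))" "eventually (\<lambda>x. Z x \<in> polydisc d z r) (near (d + 1) (coeff f))"
    using eventually_compose_filterlim[OF eventually_polydisc_near[OF r(1)]] by blast+
  with MZ(3) show "eventually (\<lambda>w. \<forall>g\<in>Poly_deg d. coeff g = w \<longrightarrow> moduli_class d g \<in> (\<lambda>(m, z). config_class d m z) ` D) (near (d + 1) (coeff f))"
  proof eventually_elim
    case (elim x)
    then have "(M x, Z x) \<in> D" using r(2) by blast
    then have "config_class d (M x) (Z x) \<in> (\<lambda>(m, z). config_class d m z) ` D" by force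
    then show ?case using elim(1) by auto
  qed
qed

lemma openin_config_class_polydisc:
  "openin (cs_top (MP_space d)) ((\<lambda>(w, y). config_class d w y) ` {(w, y). w \<in> Res d \<inter> polydisc d m r \<and> y \<in> config d w \<inter> polydisc d z r'})"
proof (rule openin_config_class_image)
  fix w y assume "(w, y) \<in> {(w, y). w \<in> Res d \<inter> polydisc d m r \<and> y \<in> config d w \<inter> polydisc d z r'}"
  then have wy: "w \<in> polydisc d m r" "y \<in> polydisc d z r'" by auto
  obtain a where a: "a > 0" "\<forall>v\<in>polydisc d w a. v \<in> polydisc d m r"
    using polydisc_near[OF wy(1)] by (auto simp: eventually_near)
  obtain b where b: "b > 0" "\<forall>v\<in>polydisc d y b. v \<in> polydisc d z r'"
    using polydisc_near[OF wy(2)] by (auto simp: eventually_near)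
  show "\<exists>r0>0. \<forall>v\<in>Res d \<inter> polydisc d w r0. \<forall>x\<in>config d v \<inter> polydisc d y r0.
      (v, x) \<in> {(w, y). w \<in> Res d \<inter> polydisc d m r \<and> y \<in> config d w \<inter> polydisc d z r'}"
    using a b by (intro exI[of _ "min a b"]) (auto simp: polydisc_def)
qed auto

end

section \<open>Strata\<close>

definition set_form :: "nat set \<Rightarrow> nat \<Rightarrow> complex" where
  "set_form J = (\<lambda>i. if i \<in> J then 1 else 0)"

definition diff_form :: "nat \<Rightarrow> nat \<Rightarrow> nat \<Rightarrow> complex" where
  "diff_form j k = (\<lambda>i. (if i = j then 1 else 0) - (if i = k then 1 else 0))"

text \<open>The linear forms that decide the sets \<open>\<I>\<close> and \<open>\<K>\<close>, together with those that decide membership in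
  \<open>Res\<close>: the full set and the singletons are included.\<close>

definition forms :: "nat \<Rightarrow> (nat \<Rightarrow> complex) set" where
  "forms d = set_form ` {J. J \<subseteq> {..<d} \<and> J \<noteq> {}} \<union> (\<lambda>(j, k). diff_form j k) ` ({..<d} \<times> {..<d})"

definition lin :: "nat \<Rightarrow> (nat \<Rightarrow> complex) \<Rightarrow> (nat \<Rightarrow> complex) \<Rightarrow> complex" where
  "lin d a m = (\<Sum>i<d. a i * m i)"

definition zero_forms :: "nat \<Rightarrow> (nat \<Rightarrow> complex) \<Rightarrow> (nat \<Rightarrow> complex) set" where
  "zero_forms d m = {a \<in> forms d. lin d a m = 0}"

lemma finite_forms: "finite (forms d)"
proof -
  have "{J. J \<subseteq> {..<d} \<and> J \<noteq> {}} \<subseteq> Pow {..<d}" by auto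
  then have "finite {J. J \<subseteq> {..<d} \<and> J \<noteq> {}}" by (rule finite_subset) simp
  then show ?thesis by (simp add: forms_def)
qed

lemma form_norm_le: "a \<in> forms d \<Longrightarrow> cmod (a i) \<le> 1"
  by (auto simp: forms_def set_form_def diff_form_def split: if_splits)

lemma lin_set_form: "J \<subseteq> {..<d} \<Longrightarrow> lin d (set_form J) m = sum m J"
proof -
  assume J: "J \<subseteq> {..<d}"
  have "(\<Sum>i<d. (if i \<in> J then 1 else 0) * m i) = (\<Sum>i<d. if i \<in> J then m i else 0)"
    by (intro sum.cong) auto
  also have "\<dots> = sum m ({..<d} \<inter> J)" by (simp add: sum.inter_restrict)
  finally show ?thesis using J by (simp add: lin_def set_form_def Int_absorb1)
qed

lemma lin_diff_form: "j < d \<Longrightarrow> k < d \<Longrightarrow> lin d (diff_form j k) m = m j - m k"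
  using sum_Kronecker[of j d 1 m] sum_Kronecker[of k d 1 m]
  by (simp add: lin_def diff_form_def left_diff_distrib sum_subtractf)

lemma set_form_zero_forms: "J \<subseteq> {..<d} \<Longrightarrow> J \<noteq> {} \<Longrightarrow> set_form J \<in> zero_forms d m \<longleftrightarrow> sum m J = 0"
  using lin_set_form[of J d m] by (auto simp: zero_forms_def forms_def)

lemma diff_form_zero_forms: "j < d \<Longrightarrow> k < d \<Longrightarrow> diff_form j k \<in> zero_forms d m \<longleftrightarrow> m j = m k"
  using lin_diff_form[of j d k m] by (auto simp: zero_forms_def forms_def)

lemma zero_forms_eq_iff:
  "zero_forms d m = zero_forms d m' \<longleftrightarrow> (\<forall>J. J \<subseteq> {..<d} \<longrightarrow> J \<noteq> {} \<longrightarrow> (sum m J = 0 \<longleftrightarrow> sum m' J = 0)) \<and>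
     (\<forall>j<d. \<forall>k<d. m j = m k \<longleftrightarrow> m' j = m' k)" (is "?L \<longleftrightarrow> ?R")
proof
  assume ?L
  then show ?R using set_form_zero_forms diff_form_zero_forms by metis
next
  assume R: ?R
  have "a \<in> zero_forms d m \<longleftrightarrow> a \<in> zero_forms d m'" for a
  proof (cases "a \<in> forms d")
    case True
    then consider J where "J \<subseteq> {..<d}" "J \<noteq> {}" "a = set_form J" | j k where "j < d" "k < d" "a = diff_form j k"
      by (auto simp: forms_def)
    then show ?thesis using R by cases (auto simp: set_form_zero_forms diff_form_zero_forms)
  qed (simp add: zero_forms_def)
  then show ?L by blast
qed

lemma Res_iff_zero_forms:
  assumes "d > 0" "m \<in> Cn d"
  shows "m \<in> Res d \<longleftrightarrow> set_form {..<d} \<in> zero_forms d m \<and> (\<forall>i<d. set_form {i} \<notin> zero_forms d m)"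
proof -
  have "set_form {..<d} \<in> zero_forms d m \<longleftrightarrow> sum m {..<d} = 0" using assms by (intro set_form_zero_forms) auto
  moreover have "set_form {i} \<in> zero_forms d m \<longleftrightarrow> m i = 0" if "i < d" for i
    using that by (subst set_form_zero_forms) auto
  ultimately show ?thesis using assms(2) by (auto simp: Res_def)
qed

lemma zero_forms_Res: "d > 0 \<Longrightarrow> m \<in> Res d \<Longrightarrow> m' \<in> Cn d \<Longrightarrow> zero_forms d m' = zero_forms d m \<Longrightarrow> m' \<in> Res d"
  using Res_iff_zero_forms[of d m] Res_iff_zero_forms[of d m'] Res_Cn by auto

lemma I_set_multipliers: "I_set d (multipliers d m) = {I. I \<subset> {..<d} \<and> I \<noteq> {} \<and> sum m I = 0}"
proof -
  have "(\<Sum>i\<in>I. 1 / (1 - multipliers d m i)) = sum m I" if "I \<subset> {..<d}" for I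
    using that by (intro sum.cong) (auto simp: multipliers_def)
  then show ?thesis unfolding I_set_def by (intro Collect_cong conj_cong refl) simp
qed

lemma K_set_multipliers:
  "K_set d (multipliers d m) = {K. K \<subseteq> {..<d} \<and> K \<noteq> {} \<and> (\<forall>i\<in>K. \<forall>j\<in>K. m i = m j)}"
proof -
  have "multipliers d m i = multipliers d m j \<longleftrightarrow> m i = m j" if "i < d" "j < d" for i j
    using that by (simp add: multipliers_def)
  then show ?thesis unfolding K_set_def by (intro Collect_cong conj_cong refl ball_cong) blast
qed

lemma zero_forms_eq_iff_IK:
  assumes "m \<in> Res d" "m' \<in> Res d"
  shows "zero_forms d m = zero_forms d m' \<longleftrightarrow>
    I_set d (multipliers d m) = I_set d (multipliers d m') \<and> K_set d (multipliers d m) = K_set d (multipliers d m')"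
proof
  assume L: "zero_forms d m = zero_forms d m'"
  then have 1: "sum m J = 0 \<longleftrightarrow> sum m' J = 0" if "J \<subseteq> {..<d}" "J \<noteq> {}" for J
    using that unfolding zero_forms_eq_iff by blast
  have 2: "m j = m k \<longleftrightarrow> m' j = m' k" if "j < d" "k < d" for j k using L that unfolding zero_forms_eq_iff by blast
  show "I_set d (multipliers d m) = I_set d (multipliers d m') \<and> K_set d (multipliers d m) = K_set d (multipliers d m')"
    unfolding I_set_multipliers K_set_multipliers
  proof (intro conjI Collect_cong conj_cong refl ball_cong)
    fix J assume "J \<subset> {..<d}" "J \<noteq> {}"
    then show "(sum m J = 0) = (sum m' J = 0)" by (intro 1) auto
  next
    fix K i j assume "K \<subseteq> {..<d}" "i \<in> K" "j \<in> K"
    then show "(m i = m j) = (m' i = m' j)" by (intro 2) auto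
  qed
next
  assume R: "I_set d (multipliers d m) = I_set d (multipliers d m') \<and> K_set d (multipliers d m) = K_set d (multipliers d m')"
  show "zero_forms d m = zero_forms d m'"
    unfolding zero_forms_eq_iff
  proof (intro conjI allI impI)
    fix J assume J: "J \<subseteq> {..<d}" "J \<noteq> {}"
    show "sum m J = 0 \<longleftrightarrow> sum m' J = 0"
    proof (cases "J = {..<d}")
      case True
      then show ?thesis using assms by (simp add: Res_def)
    next
      case False
      then have "J \<in> {I. I \<subset> {..<d} \<and> I \<noteq> {} \<and> sum m I = 0} \<longleftrightarrow> J \<in> {I. I \<subset> {..<d} \<and> I \<noteq> {} \<and> sum m' I = 0}"
        using R unfolding I_set_multipliers by blast
      then show ?thesis using J False by auto
    qed
  next
    fix j k assume "j < d" "k < d"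
    moreover have "{j, k} \<in> K_set d (multipliers d m) \<longleftrightarrow> {j, k} \<in> K_set d (multipliers d m')" using R by blast
    ultimately show "m j = m k \<longleftrightarrow> m' j = m' k" unfolding K_set_multipliers by auto
  qed
qed

lemma lin_close: "a \<in> forms d \<Longrightarrow> cmod (lin d a m - lin d a m') \<le> l1 d m m'"
proof -
  assume a: "a \<in> forms d"
  have "lin d a m - lin d a m' = (\<Sum>i<d. a i * (m i - m' i))" by (simp add: lin_def right_diff_distrib sum_subtractf)
  also have "cmod \<dots> \<le> (\<Sum>i<d. cmod (a i) * cmod (m i - m' i))" by (rule order_trans[OF norm_sum]) (simp add: norm_mult)
  also have "\<dots> \<le> l1 d m m'" unfolding l1_def using form_norm_le[OF a] by (intro sum_mono) (simp add: mult_left_le_one_le)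
  finally show ?thesis .
qed

lemma lin_shift: "lin d a (\<lambda>i. m i + c * w i) = lin d a m + c * lin d a w"
  by (simp add: lin_def sum.distrib sum_distrib_left algebra_simps)

text \<open>Translating along a path in a stratum does not change the stratum of nearby points:
  the forms vanishing at the centre also vanish on the translations, and by compactness of the path
  the other forms stay away from zero.\<close>

lemma stratum_tube:
  assumes d: "d > 0" and p: "continuous_on {0..1} p" "p 0 = (0::complex)"
    and z: "\<And>t. t \<in> {0..1::real} \<Longrightarrow> zero_forms d (\<lambda>i. m0 i + p t * w i) = zero_forms d m0"
  obtains e where "e > 0" "\<And>m t. m \<in> polydisc d m0 e \<Longrightarrow> t \<in> {0..1} \<Longrightarrow> zero_forms d (\<lambda>i. m i + p t * w i) = zero_forms d m"
    "\<And>t j k. t \<in> {0..1} \<Longrightarrow> j < d \<Longrightarrow> k < d \<Longrightarrow> m0 j \<noteq> m0 k \<Longrightarrow> 2 * e \<le> cmod ((m0 j + p t * w j) - (m0 k + p t * w k))"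
    "\<And>t i. t \<in> {0..1} \<Longrightarrow> i < d \<Longrightarrow> m0 i \<noteq> 0 \<Longrightarrow> e \<le> cmod (m0 i + p t * w i)"
proof -
  have "\<exists>c>0. a \<in> forms d - zero_forms d m0 \<longrightarrow> (\<forall>t\<in>{0..1}. c \<le> cmod (lin d a m0 + p t * lin d a w))" for a
  proof (cases "a \<in> forms d - zero_forms d m0")
    case True
    have "continuous_on {0..1} (\<lambda>t. cmod (lin d a m0 + p t * lin d a w))" by (intro continuous_intros p)
    then obtain t0 where t0: "t0 \<in> {0..1}" "\<And>t. t \<in> {0..1} \<Longrightarrow> cmod (lin d a m0 + p t0 * lin d a w) \<le> cmod (lin d a m0 + p t * lin d a w)"
      using continuous_attains_inf[of "{0..1::real}" "\<lambda>t. cmod (lin d a m0 + p t * lin d a w)"] by auto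
    have "lin d a (\<lambda>i. m0 i + p t0 * w i) \<noteq> 0" using z[OF t0(1)] True by (auto simp: zero_forms_def)
    then show ?thesis using t0 by (intro exI[of _ "cmod (lin d a m0 + p t0 * lin d a w)"]) (auto simp: lin_shift)
  qed (auto intro: zero_less_one)
  then obtain c where c: "\<And>a. c a > 0" "\<And>a t. a \<in> forms d - zero_forms d m0 \<Longrightarrow> t \<in> {0..1} \<Longrightarrow> c a \<le> cmod (lin d a m0 + p t * lin d a w)"
    by metis
  define e where "e = Min (insert 1 ((\<lambda>a. c a / (2 * real d)) ` forms d))"
  have e: "e > 0" using c(1) d finite_forms[of d] by (auto simp: e_def)
  have ec: "2 * real d * e \<le> c a" if "a \<in> forms d" for a
  proof -
    have "e \<le> c a / (2 * real d)" unfolding e_def using that finite_forms[of d] by (intro Min_le) auto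
    then show ?thesis using d by (simp add: field_simps)
  qed
  show ?thesis
  proof (rule that[OF e])
    fix m t assume m: "m \<in> polydisc d m0 e" and t: "t \<in> {0..1::real}"
    have lt: "l1 d m m0 \<le> real d * e"
      unfolding l1_def using m sum_bounded_above[of "{..<d}" "\<lambda>i. cmod (m i - m0 i)" e] by (auto simp: polydisc_def less_imp_le)
    have "lin d a (\<lambda>i. m i + p t * w i) = 0 \<longleftrightarrow> lin d a m = 0" if a: "a \<in> forms d" for a
    proof (cases "a \<in> zero_forms d m0")
      case True
      then have "a \<in> zero_forms d (\<lambda>i. m0 i + p t * w i)" by (simp only: z[OF t])
      then have "lin d a m0 = 0" "lin d a m0 + p t * lin d a w = 0"
        using True by (auto simp: zero_forms_def lin_shift)
      then have "p t * lin d a w = 0" by (simp only: add_0)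
      then show ?thesis by (simp only: lin_shift add_0_right)
    next
      case False
      then have aF: "a \<in> forms d - zero_forms d m0" using a by simp
      have ne: "lin d a m + p s * lin d a w \<noteq> 0" if s: "s \<in> {0..1}" for s
      proof
        assume 0: "lin d a m + p s * lin d a w = 0"
        have "c a \<le> cmod (lin d a m0 + p s * lin d a w)" by (rule c(2)[OF aF s])
        also have "lin d a m0 + p s * lin d a w = - (lin d a m - lin d a m0)" using 0 by (simp add: algebra_simps)
        also have "cmod \<dots> \<le> real d * e" unfolding norm_minus_cancel using lin_close[OF a, of m m0] lt by linarith
        also have "\<dots> < 2 * real d * e" using d e by simp
        finally show False using ec[OF a] by simp
      qed
      show ?thesis using ne[OF t] ne[of 0] p(2) by (simp add: lin_shift)
    qed
    then show "zero_forms d (\<lambda>i. m i + p t * w i) = zero_forms d m" by (auto simp: zero_forms_def)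
  next
    fix t :: real and j k assume h: "t \<in> {0..1}" "j < d" "k < d" "m0 j \<noteq> m0 k"
    have a: "diff_form j k \<in> forms d" using h by (auto simp: forms_def)
    have "diff_form j k \<in> forms d - zero_forms d m0" using a h diff_form_zero_forms[of j d k m0] by auto
    from c(2)[OF this h(1)] have "c (diff_form j k) \<le> cmod ((m0 j + p t * w j) - (m0 k + p t * w k))"
      using h by (simp add: lin_diff_form algebra_simps)
    moreover have "2 * e \<le> 2 * real d * e" using d e by simp
    ultimately show "2 * e \<le> cmod ((m0 j + p t * w j) - (m0 k + p t * w k))" using ec[OF a] by linarith
  next
    fix t :: real and i assume h: "t \<in> {0..1}" "i < d" "m0 i \<noteq> 0"
    have lin_i: "lin d (set_form {i}) x = x i" for x using h(2) by (subst lin_set_form) auto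
    have a: "set_form {i} \<in> forms d" using h by (auto simp: forms_def)
    then have "set_form {i} \<in> forms d - zero_forms d m0" using h by (auto simp: zero_forms_def lin_i)
    from c(2)[OF this h(1)] have "c (set_form {i}) \<le> cmod (m0 i + p t * w i)" by (simp only: lin_i)
    moreover have "e \<le> 2 * real d * e" using d e by simp
    ultimately show "e \<le> cmod (m0 i + p t * w i)" using ec[OF a] by linarith
  qed
qed

text \<open>Two points of a stratum lie on a complex line of its linear span, and the line leaves the
  stratum in finitely many points only.\<close>

lemma stratum_path:
  assumes "zero_forms d m = zero_forms d m'"
  obtains p where "continuous_on {0..1::real} p" "p 0 = (0::complex)" "p 1 = 1"
    "\<And>t. t \<in> {0..1} \<Longrightarrow> zero_forms d (\<lambda>i. m i + p t * (m' i - m i)) = zero_forms d m"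
proof -
  define B where "B = (\<lambda>a. - lin d a m / (lin d a m' - lin d a m)) ` forms d - {0, 1}"
  have linw: "lin d a (\<lambda>i. m' i - m i) = lin d a m' - lin d a m" for a
    by (simp add: lin_def right_diff_distrib sum_subtractf)
  have "finite B" using finite_forms[of d] by (simp add: B_def)
  then have "path_connected (- B)" by (intro path_connected_complement_countable countable_finite) auto
  moreover have "0 \<in> - B" "1 \<in> - B" by (auto simp: B_def)
  ultimately obtain g where g: "path g" "path_image g \<subseteq> - B" "pathstart g = 0" "pathfinish g = 1"
    unfolding path_connected_def by blast
  show ?thesis
  proof (rule that[of g])
    show "continuous_on {0..1} g" "g 0 = 0" "g 1 = 1" using g by (auto simp: path_def pathstart_def pathfinish_def)
    fix t :: real assume t: "t \<in> {0..1}"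
    have "g t \<in> path_image g" using t by (simp add: path_image_def)
    then have gB: "g t \<notin> B" using g(2) by blast
    have "lin d a m + g t * (lin d a m' - lin d a m) = 0 \<longleftrightarrow> lin d a m = 0" if a: "a \<in> forms d" for a
    proof -
      have iff: "lin d a m = 0 \<longleftrightarrow> lin d a m' = 0" using assms a by (auto simp: zero_forms_def)
      show ?thesis
      proof
        assume 0: "lin d a m + g t * (lin d a m' - lin d a m) = 0"
        show "lin d a m = 0"
        proof (rule ccontr)
          assume n: "lin d a m \<noteq> 0"
          then have "lin d a m' - lin d a m \<noteq> 0" using 0 by auto
          then have gt: "g t = - lin d a m / (lin d a m' - lin d a m)" using 0 by (simp add: field_simps add_eq_0_iff)
          have "g t \<noteq> 0" using 0 n by auto
          moreover have "g t \<noteq> 1" using 0 n iff by auto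
          ultimately have "g t \<in> B" unfolding B_def using gt a by blast
          then show False using gB by simp
        qed
      qed (use iff in auto)
    qed
    then show "zero_forms d (\<lambda>i. m i + g t * (m' i - m i)) = zero_forms d m"
      unfolding zero_forms_def lin_shift linw by auto
  qed
qed

section \<open>Transport along a stratum\<close>

text \<open>Besides being a section, \<open>S\<close> is the only configuration in the polydisc of radius \<open>r\<close>.\<close>

definition local_section ::
  "nat \<Rightarrow> (nat \<Rightarrow> complex) \<Rightarrow> (nat \<Rightarrow> complex) \<Rightarrow> real \<Rightarrow> real \<Rightarrow> ((nat \<Rightarrow> complex) \<Rightarrow> nat \<Rightarrow> complex) \<Rightarrow> bool" where
  "local_section d m z r e S \<longleftrightarrow> r > 0 \<and> e > 0 \<and>
     (\<forall>x\<in>polydisc d m e. S x \<in> polydisc d z r \<and> S x \<in> config d x \<and>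
        (\<forall>y\<in>polydisc d z r. y \<in> config d x \<longrightarrow> y = S x) \<and> (\<forall>i<d. cdiff d (\<lambda>x. S x i) x))"

lemma local_section_exists:
  assumes "d \<ge> 2" "m \<in> Res d" "z \<in> config d m" "R > 0"
  shows "\<exists>r e S. r \<le> R \<and> local_section d m z r e S"
proof -
  have "m \<in> Cn d" "\<And>i. i < d \<Longrightarrow> m i \<noteq> 0" using assms(2) by (auto simp: Res_def)
  from config_section[OF assms(1) this assms(3)] obtain r0 where r0: "r0 > 0"
    "\<And>r. 0 < r \<Longrightarrow> r \<le> r0 \<Longrightarrow> \<exists>\<delta>>0. \<exists>S. \<forall>m\<in>polydisc d m \<delta>. S m \<in> polydisc d z r \<and> S m \<in> config d m \<and>
       (\<forall>y\<in>polydisc d z r. y \<in> config d m \<longrightarrow> y = S m) \<and> (\<forall>i<d. cdiff d (\<lambda>m. S m i) m)" by blast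
  have R: "0 < min R r0" "min R r0 \<le> r0" using r0(1) assms(4) by auto
  from r0(2)[OF this] obtain \<delta> S where "\<delta> > 0" "\<forall>x\<in>polydisc d m \<delta>. S x \<in> polydisc d z (min R r0) \<and> S x \<in> config d x \<and>
       (\<forall>y\<in>polydisc d z (min R r0). y \<in> config d x \<longrightarrow> y = S x) \<and> (\<forall>i<d. cdiff d (\<lambda>m. S m i) x)" by blast
  then show ?thesis
    unfolding local_section_def using R(1) by (intro exI[of _ "min R r0"] exI[of _ \<delta>] exI[of _ S]) auto
qed

lemma local_sectionD:
  assumes "local_section d m z r e S" "x \<in> polydisc d m e"
  shows "S x \<in> polydisc d z r" "S x \<in> config d x" "\<And>y. y \<in> polydisc d z r \<Longrightarrow> y \<in> config d x \<Longrightarrow> y = S x"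
    "\<And>i. i < d \<Longrightarrow> cdiff d (\<lambda>x. S x i) x"
  using assms unfolding local_section_def by blast+

lemma local_section_near:
  assumes "local_section d m z r e S" "x \<in> polydisc d m e"
  shows "filterlim S (near d (S x)) (near d x)"
  unfolding filterlim_near
proof (intro conjI allI impI)
  show "eventually (\<lambda>x. S x \<in> Cn d) (near d x)"
    by (rule eventually_mono[OF polydisc_near[OF assms(2)]]) (use local_sectionD(2)[OF assms(1)] config_Cn in blast)
  show "((\<lambda>x. S x i) \<longlongrightarrow> S x i) (near d x)" if "i < d" for i
    using cdiff_tendsto[OF local_sectionD(4)[OF assms that]] .
qed

lemma local_section_centre:
  assumes "local_section d m z r e S" "m \<in> Cn d" "z \<in> config d m"
  shows "S m = z"
proof -
  have "r > 0" "e > 0" using assms(1) by (auto simp: local_section_def)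
  then show ?thesis
    using local_sectionD(3)[OF assms(1) centre_in_polydisc[OF assms(2)] centre_in_polydisc[OF config_Cn[OF assms(3)]] assms(3)] by simp
qed

lemma eventually_within_openin:
  assumes "eventually P (at a within T)" "P a" "a \<in> T"
  shows "\<exists>U. openin (top_of_set T) U \<and> a \<in> U \<and> (\<forall>x\<in>U. P x)"
proof -
  obtain S where "open S" "a \<in> S" "\<forall>x\<in>S. x \<noteq> a \<longrightarrow> x \<in> T \<longrightarrow> P x"
    using assms(1) unfolding eventually_at_topological by blast
  then show ?thesis using assms(2,3) by (intro exI[of _ "T \<inter> S"]) (auto simp: openin_open)
qed

text \<open>A polydisc around \<open>m0\<close> all of whose points stay in their own stratum when they are translated by
  \<open>p t\<close> times \<open>w\<close>. The radius is so small that a permutation either fixes the centre or moves the polydisc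
  off itself (\<open>sep\<close>), and that the residues in the polydisc are nonzero (\<open>nz\<close>), which makes its part in \<open>Res\<close>
  star-shaped. Both conditions are imposed at both ends, so that the reversed path satisfies
  the assumptions again. As \<open>p 1 \<noteq> 0\<close>, a permutation that fixes both ends fixes \<open>w\<close>.\<close>

locale transport =
  fixes d :: nat and m0 :: "nat \<Rightarrow> complex" and eps :: real and w :: "nat \<Rightarrow> complex" and p :: "real \<Rightarrow> complex"
  assumes d: "d \<ge> 2" and m0: "m0 \<in> Res d" and eps: "eps > 0" and w: "w \<in> Cn d"
    and p_cont: "continuous_on {0..1} p" and p0: "p 0 = 0" and p1: "p 1 \<noteq> 0"
    and tube: "\<And>m t. m \<in> polydisc d m0 eps \<Longrightarrow> t \<in> {0..1} \<Longrightarrow> zero_forms d (\<lambda>i. m i + p t * w i) = zero_forms d m"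
    and sep: "\<And>j k. j < d \<Longrightarrow> k < d \<Longrightarrow> m0 j \<noteq> m0 k \<Longrightarrow> 2 * eps \<le> cmod (m0 j - m0 k)"
    and sep': "\<And>j k. j < d \<Longrightarrow> k < d \<Longrightarrow> m0 j \<noteq> m0 k \<Longrightarrow>
       2 * eps \<le> cmod ((m0 j + p 1 * w j) - (m0 k + p 1 * w k))"
    and nz: "\<And>i. i < d \<Longrightarrow> eps \<le> cmod (m0 i)" and nz': "\<And>i. i < d \<Longrightarrow> eps \<le> cmod (m0 i + p 1 * w i)"
begin

definition shift :: "(nat \<Rightarrow> complex) \<Rightarrow> real \<Rightarrow> nat \<Rightarrow> complex" where
  "shift m t = (\<lambda>i. m i + p t * w i)"

definition base :: "(nat \<Rightarrow> complex) set" where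
  "base = Res d \<inter> polydisc d m0 eps"

definition is_lift :: "(nat \<Rightarrow> complex) \<Rightarrow> real set \<Rightarrow> (real \<Rightarrow> nat \<Rightarrow> complex) \<Rightarrow> bool" where
  "is_lift m T g \<longleftrightarrow> (\<forall>t\<in>T. g t \<in> config d (shift m t)) \<and> (\<forall>i<d. continuous_on T (\<lambda>t. g t i))"

definition transported :: "(nat \<Rightarrow> complex) \<Rightarrow> (nat \<Rightarrow> complex) \<Rightarrow> (nat \<Rightarrow> complex) \<Rightarrow> bool" where
  "transported m z z' \<longleftrightarrow> (\<exists>g. is_lift m {0..1} g \<and> g 0 = z \<and> g 1 = z')"

lemma shift_0: "shift m 0 = m" by (simp add: shift_def p0)

lemma m0_base: "m0 \<in> base"
  using m0 eps centre_in_polydisc[OF Res_Cn[OF m0] eps] by (simp add: base_def)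

lemma shift_Cn: "m \<in> Cn d \<Longrightarrow> shift m t \<in> Cn d"
  using w by (auto simp: Cn_def shift_def)

lemma zero_forms_shift: "m \<in> base \<Longrightarrow> t \<in> {0..1} \<Longrightarrow> zero_forms d (shift m t) = zero_forms d m"
  using tube by (simp add: base_def shift_def)

lemma shift_Res: "m \<in> base \<Longrightarrow> t \<in> {0..1} \<Longrightarrow> shift m t \<in> Res d"
  using zero_forms_Res[of d m "shift m t"] zero_forms_shift[of m t] d shift_Cn[of m t] by (auto simp: base_def Res_def)

lemma shift_hereditary:
  assumes "m \<in> base" "s \<in> {0..1}" "t \<in> {0..1}" "J \<subset> {..<d}" "J \<noteq> {}" "sum (shift m s) J = 0"
  shows "sum (shift m t) J = 0"
proof -
  have "J \<subseteq> {..<d}" using assms by auto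
  then show ?thesis
    using set_form_zero_forms[of J d "shift m s"] set_form_zero_forms[of J d "shift m t"] zero_forms_shift[OF assms(1)] assms by auto
qed

lemma shift_near:
  assumes "m \<in> Cn d" "T \<subseteq> {0..1}" "a \<in> T"
  shows "filterlim (shift m) (near d (shift m a)) (at a within T)"
  unfolding filterlim_near
proof (intro conjI allI impI)
  show "eventually (\<lambda>x. shift m x \<in> Cn d) (at a within T)" using shift_Cn[OF assms(1)] by simp
  have "continuous_on T p" using p_cont assms(2) continuous_on_subset by blast
  then have "(p \<longlongrightarrow> p a) (at a within T)" using assms(3) by (simp add: continuous_on_def)
  then show "((\<lambda>x. shift m x i) \<longlongrightarrow> shift m a i) (at a within T)" for i
    unfolding shift_def by (intro tendsto_intros)
qed

lemma shift_near_base: "filterlim (\<lambda>m. shift m t) (near d (shift m1 t)) (near d m1)"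
  unfolding filterlim_near
proof (intro conjI allI impI)
  show "eventually (\<lambda>x. shift x t \<in> Cn d) (near d m1)"
    using eventually_polydisc_near[OF zero_less_one, of d m1]
    by (rule eventually_mono) (auto simp: polydisc_def intro: shift_Cn)
  show "((\<lambda>x. shift x t i) \<longlongrightarrow> shift m1 t i) (near d m1)" if "i < d" for i
    unfolding shift_def using that by (intro tendsto_intros tendsto_coord_near)
qed

lemma lift_near:
  assumes "is_lift m T g" "a \<in> T"
  shows "filterlim g (near d (g a)) (at a within T)"
  unfolding filterlim_near
proof (intro conjI allI impI)
  show "eventually (\<lambda>t. g t \<in> Cn d) (at a within T)"
    using assms(1) unfolding eventually_at_filter is_lift_def by (auto intro!: always_eventually dest: config_Cn)
  show "((\<lambda>t. g t i) \<longlongrightarrow> g a i) (at a within T)" if "i < d" for i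
    using assms that by (auto simp: is_lift_def continuous_on_def)
qed

lemma lift_subset: "is_lift m T g \<Longrightarrow> S \<subseteq> T \<Longrightarrow> is_lift m S g"
  by (auto simp: is_lift_def intro: continuous_on_subset)

text \<open>The times at which two lifts agree form an open set by uniqueness of local sections, and so do the
  times at which they differ.\<close>

lemma lift_unique:
  assumes m: "m \<in> base" and T: "connected T" "T \<subseteq> {0..1}"
    and g: "is_lift m T g" and h: "is_lift m T h" and s: "s \<in> T" "g s = h s" and t: "t \<in> T"
  shows "g t = h t"
proof -
  have "g s = h s \<longleftrightarrow> g t = h t"
  proof (rule connected_equivalence_relation[OF T(1) s(1) t, of "\<lambda>a b. g a = h a \<longleftrightarrow> g b = h b"])
    fix a assume a: "a \<in> T"
    then have gh: "g a \<in> config d (shift m a)" "h a \<in> config d (shift m a)" using g h by (auto simp: is_lift_def)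
    have mC: "m \<in> Cn d" using m by (simp add: base_def Res_def)
    show "\<exists>U. openin (top_of_set T) U \<and> a \<in> U \<and> (\<forall>x\<in>U. (g a = h a) = (g x = h x))"
    proof (rule eventually_within_openin[OF _ _ a])
      show "eventually (\<lambda>x. (g a = h a) = (g x = h x)) (at a within T)"
      proof (cases "g a = h a")
        case True
        obtain r e S where S: "local_section d (shift m a) (g a) r e S"
          using local_section_exists[OF d shift_Res[OF m] gh(1) zero_less_one] a T(2) by blast
        have re: "r > 0" "e > 0" using S by (auto simp: local_section_def)
        have "eventually (\<lambda>x. shift m x \<in> polydisc d (shift m a) e) (at a within T)"
          by (rule eventually_compose_filterlim[OF eventually_polydisc_near[OF re(2)] shift_near[OF mC T(2) a]])
        moreover have "eventually (\<lambda>x. g x \<in> polydisc d (g a) r) (at a within T)"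
          by (rule eventually_compose_filterlim[OF eventually_polydisc_near[OF re(1)] lift_near[OF g a]])
        moreover have "eventually (\<lambda>x. h x \<in> polydisc d (g a) r) (at a within T)"
          unfolding True by (rule eventually_compose_filterlim[OF eventually_polydisc_near[OF re(1)] lift_near[OF h a]])
        moreover have "eventually (\<lambda>x. x \<in> T) (at a within T)" by (simp add: eventually_at_filter)
        ultimately show ?thesis
        proof eventually_elim
          case (elim x)
          then have "g x \<in> config d (shift m x)" "h x \<in> config d (shift m x)" using g h by (auto simp: is_lift_def)
          then have "g x = S (shift m x)" "h x = S (shift m x)"
            using local_sectionD(3)[OF S elim(1) elim(2)] local_sectionD(3)[OF S elim(1) elim(3)] by blast+
          then show ?case using True by simp
        qed
      next
        case False
        then obtain i where i: "g a i \<noteq> h a i" by auto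
        have "i < d" using i config_Cn[OF gh(1)] config_Cn[OF gh(2)] by (auto simp: Cn_def) (metis linorder_not_le)
        then have "((\<lambda>x. g x i - h x i) \<longlongrightarrow> g a i - h a i) (at a within T)"
          using lift_near[OF g a] lift_near[OF h a] by (intro tendsto_diff) (auto simp: filterlim_near)
        then have "eventually (\<lambda>x. g x i - h x i \<noteq> 0) (at a within T)" using i by (intro tendsto_imp_eventually_ne) auto
        then show ?thesis by (rule eventually_mono) (use False in auto)
      qed
    qed simp
  qed auto
  then show ?thesis using s(2) by simp
qed

lemma section_is_lift:
  assumes m: "m \<in> base" and S: "local_section d x z r e S" and T: "T \<subseteq> {0..1}"
    and sub: "\<And>t. t \<in> T \<Longrightarrow> shift m t \<in> polydisc d x e"
  shows "is_lift m T (\<lambda>t. S (shift m t))"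
  unfolding is_lift_def
proof (intro conjI ballI allI impI)
  fix t assume t: "t \<in> T"
  show "S (shift m t) \<in> config d (shift m t)" using local_sectionD(2)[OF S sub[OF t]] .
next
  fix i assume i: "i < d"
  have mC: "m \<in> Cn d" using m by (simp add: base_def Res_def)
  show "continuous_on T (\<lambda>t. S (shift m t) i)"
    unfolding continuous_on_def
  proof
    fix t assume t: "t \<in> T"
    show "((\<lambda>t. S (shift m t) i) \<longlongrightarrow> S (shift m t) i) (at t within T)"
      by (rule filterlim_compose[OF cdiff_tendsto[OF local_sectionD(4)[OF S sub[OF t] i]] shift_near[OF mC T t]])
  qed
qed

text \<open>A lift over \<open>[0, s]\<close> extends to the right as long as its points neither run off to infinity
  nor collide, which is excluded by compactness over a fixed stratum.\<close>

lemma lift_exists: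
  assumes m: "m \<in> base" and z: "z \<in> config d m"
  shows "\<exists>g. is_lift m {0..1} g \<and> g 0 = z"
proof -
  define A where "A = {t \<in> {0..1}. \<exists>g. is_lift m {0..t} g \<and> g 0 = z}"
  have mC: "m \<in> Cn d" using m by (simp add: base_def Res_def)
  have A0: "0 \<in> A" unfolding A_def using z by (auto simp: is_lift_def shift_0 intro!: exI[of _ "\<lambda>_. z"])
  define s where "s = Sup A"
  have Abdd: "bdd_above A" by (auto simp: A_def bdd_above_def)
  have "0 \<le> s" unfolding s_def by (rule cSup_upper[OF A0 Abdd])
  moreover have "s \<le> 1" unfolding s_def
  proof (rule cSup_least)
    show "A \<noteq> {}" using A0 by blast
  qed (simp add: A_def)
  ultimately have s01: "s \<in> {0..1}" by simp
  have "\<exists>a\<in>A. s - 1 / real (Suc n) < a" for n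
  proof -
    have "s - 1 / real (Suc n) < Sup A" by (simp add: s_def)
    then show ?thesis using less_cSup_iff[of A "s - 1 / real (Suc n)"] A0 Abdd by blast
  qed
  then obtain a where a: "\<And>n. a n \<in> A" "\<And>n. s - 1 / real (Suc n) < a n" by metis
  have as: "a n \<le> s" for n unfolding s_def by (rule cSup_upper[OF a(1) Abdd])
  have a01: "a n \<in> {0..1}" for n using a(1)[of n] by (auto simp: A_def)
  have "(\<lambda>n. s - 1 / real (Suc n)) \<longlonglongrightarrow> s - 0" by (intro tendsto_diff tendsto_const LIMSEQ_inverse_real_of_nat[unfolded inverse_eq_divide])
  then have alim: "a \<longlonglongrightarrow> s"
    using tendsto_sandwich[of "\<lambda>n. s - 1 / real (Suc n)" a sequentially "\<lambda>_. s" s] a(2) as by (auto simp: less_imp_le)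
  have "\<forall>n. \<exists>g. is_lift m {0..a n} g \<and> g 0 = z" using a(1) by (auto simp: A_def)
  then obtain g where g: "\<And>n. is_lift m {0..a n} (g n)" "\<And>n. g n 0 = z" by metis
  have gc: "g n (a n) \<in> config d (shift m (a n))" for n using g(1)[of n] a01[of n] by (auto simp: is_lift_def)
  have plim: "(\<lambda>n. p (a n)) \<longlonglongrightarrow> p s"
    by (rule continuous_on_tendsto_compose[OF p_cont alim s01]) (use a01 in auto)
  have shlim: "(\<lambda>n. shift m (a n) i) \<longlonglongrightarrow> shift m s i" for i
    unfolding shift_def by (intro tendsto_intros plim)
  obtain t zs where t: "strict_mono t" "zs \<in> config d (shift m s)" "filterlim (\<lambda>n. g (t n) (a (t n))) (near d zs) sequentially"
    using config_sequentially_compact[OF d, of "\<lambda>n. shift m (a n)" "shift m s" "\<lambda>n. g n (a n)"]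
      shift_Res[OF m] a01 s01 shlim gc shift_hereditary[OF m s01 a01] by blast
  obtain r e S where S: "local_section d (shift m s) zs r e S"
    using local_section_exists[OF d shift_Res[OF m s01] t(2) zero_less_one] by blast
  have re: "r > 0" "e > 0" using S by (auto simp: local_section_def)
  have "eventually (\<lambda>x. shift m x \<in> polydisc d (shift m s) e) (at s within {0..1})"
    by (rule eventually_compose_filterlim[OF eventually_polydisc_near[OF re(2)] shift_near[OF mC order_refl s01]])
  then obtain b where b: "b > 0" "\<And>x. x \<in> {0..1} \<Longrightarrow> dist x s < b \<Longrightarrow> shift m x \<in> polydisc d (shift m s) e"
    unfolding eventually_at using centre_in_polydisc[OF shift_Cn[OF mC] re(2)] by (metis dist_self)
  have "eventually (\<lambda>n. g (t n) (a (t n)) \<in> polydisc d zs r) sequentially"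
    by (rule eventually_compose_filterlim[OF eventually_polydisc_near[OF re(1)] t(3)])
  moreover have "eventually (\<lambda>n. dist (a (t n)) s < b) sequentially"
    using LIMSEQ_subseq_LIMSEQ[OF alim t(1)] b(1) by (simp add: tendsto_iff o_def)
  ultimately have "eventually (\<lambda>n. g (t n) (a (t n)) \<in> polydisc d zs r \<and> dist (a (t n)) s < b) sequentially"
    by (rule eventually_conj)
  then obtain n where "g (t n) (a (t n)) \<in> polydisc d zs r" "dist (a (t n)) s < b"
    by (auto simp: eventually_sequentially)
  then obtain n where n: "g n (a n) \<in> polydisc d zs r" "dist (a n) s < b" by blast
  define u where "u = min 1 (s + b / 2)"
  have u: "u \<in> {0..1}" "s \<le> u" "u < s + b" using s01 b(1) by (auto simp: u_def)
  have near_s: "shift m x \<in> polydisc d (shift m s) e" if "x \<in> {a n..u}" for x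
    using b(2)[of x] that a01[of n] u n(2) as[of n] by (auto simp: dist_real_def)
  define G where "G x = (if x \<le> a n then g n x else S (shift m x))" for x
  have "is_lift m {0..u} G"
    unfolding is_lift_def
  proof (intro conjI ballI allI impI)
    fix x assume x: "x \<in> {0..u}"
    show "G x \<in> config d (shift m x)"
    proof (cases "x \<le> a n")
      case True
      then show ?thesis using g(1)[of n] x by (auto simp: G_def is_lift_def)
    next
      case False
      then show ?thesis using local_sectionD(2)[OF S near_s[of x]] x by (auto simp: G_def)
    qed
  next
    fix i assume i: "i < d"
    have eq: "g n (a n) = S (shift m (a n))"
      by (rule local_sectionD(3)[OF S near_s n(1) gc]) (use as[of n] u in auto)
    have "continuous_on ({0..a n} \<union> {a n..u}) (\<lambda>x. if x \<le> a n then g n x i else S (shift m x) i)"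
    proof (rule continuous_on_If)
      show "continuous_on {0..a n} (\<lambda>x. g n x i)" using g(1)[of n] i by (simp add: is_lift_def)
      have "is_lift m {a n..u} (\<lambda>t. S (shift m t))"
        by (rule section_is_lift[OF m S _ near_s]) (use a01[of n] u in auto)
      then show "continuous_on {a n..u} (\<lambda>x. S (shift m x) i)" using i by (simp add: is_lift_def)
    qed (use eq in auto)
    moreover have "{0..a n} \<union> {a n..u} = {0..u}" using a01[of n] as[of n] u by auto
    ultimately show "continuous_on {0..u} (\<lambda>x. G x i)" by (simp add: G_def if_distrib[of "\<lambda>f. f i"])
  qed
  moreover have "G 0 = z" using a01[of n] g(2) by (simp add: G_def)
  ultimately have "u \<in> A" using u(1) by (auto simp: A_def)
  then have "u \<le> s" unfolding s_def by (rule cSup_upper[OF _ Abdd])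
  then have "u = 1" using b(1) by (auto simp: u_def min_def split: if_splits)
  then show ?thesis using \<open>u \<in> A\<close> by (auto simp: A_def)
qed

lemma transported_exists: "m \<in> base \<Longrightarrow> z \<in> config d m \<Longrightarrow> \<exists>z'. transported m z z'"
  using lift_exists by (auto simp: transported_def)

lemma transported_unique: "m \<in> base \<Longrightarrow> transported m z z' \<Longrightarrow> transported m z z'' \<Longrightarrow> z' = z''"
proof -
  assume m: "m \<in> base" and "transported m z z'" "transported m z z''"
  then obtain g h where "is_lift m {0..1} g" "g 0 = z" "g 1 = z'" "is_lift m {0..1} h" "h 0 = z" "h 1 = z''"
    by (auto simp: transported_def)
  then show "z' = z''" using lift_unique[OF m, of "{0..1}" g h 0 1] by auto
qed

lemma transported_config: "transported m z z' \<Longrightarrow> z \<in> config d m \<and> z' \<in> config d (shift m 1)"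
  by (auto simp: transported_def is_lift_def shift_0 dest: bspec[of "{0..1}" _ 0])

text \<open>The end point of transport is locally given by a single section composed with the translation,
  hence is holomorphic in the starting point.\<close>

lemma transported_local_section:
  assumes m1: "m1 \<in> base" and tr: "transported m1 z1 z1'"
  obtains r e S \<rho> where "local_section d (shift m1 1) z1' r e S" "\<rho> > 0"
    "\<And>m z. m \<in> base \<Longrightarrow> m \<in> polydisc d m1 \<rho> \<Longrightarrow> z \<in> config d m \<Longrightarrow> z \<in> polydisc d z1 \<rho> \<Longrightarrow>
      shift m 1 \<in> polydisc d (shift m1 1) e \<and> transported m z (S (shift m 1))"
proof -
  obtain g where g: "is_lift m1 {0..1} g" "g 0 = z1" "g 1 = z1'" using tr by (auto simp: transported_def)
  have m1C: "m1 \<in> Cn d" using m1 by (simp add: base_def Res_def)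
  have "\<forall>t\<in>{0..1}. \<exists>X. local_section d (shift m1 t) (g t) (fst X) (fst (snd X)) (snd (snd X))"
  proof
    fix t :: real assume t: "t \<in> {0..1}"
    then have "g t \<in> config d (shift m1 t)" using g(1) by (auto simp: is_lift_def)
    then obtain r e S where "local_section d (shift m1 t) (g t) r e S"
      using local_section_exists[OF d shift_Res[OF m1 t] _ zero_less_one] by blast
    then show "\<exists>X. local_section d (shift m1 t) (g t) (fst X) (fst (snd X)) (snd (snd X))"
      by (intro exI[of _ "(r, e, S)"]) simp
  qed
  from bchoice[OF this] obtain X where X: "\<And>t. t \<in> {0..1} \<Longrightarrow> local_section d (shift m1 t) (g t) (fst (X t)) (fst (snd (X t))) (snd (snd (X t)))"
    by blast
  define r where "r t = fst (X t)" for t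
  define e where "e t = fst (snd (X t))" for t
  define S where "S t = snd (snd (X t))" for t
  have LS: "local_section d (shift m1 t) (g t) (r t) (e t) (S t)" if "t \<in> {0..1}" for t
    using X[OF that] by (simp add: r_def e_def S_def)
  have re: "r t > 0" "e t > 0" if "t \<in> {0..1}" for t using LS[OF that] by (auto simp: local_section_def)
  have Sg: "S t (shift m1 t) = g t" if "t \<in> {0..1}" for t
    by (rule local_section_centre[OF LS[OF that] shift_Cn[OF m1C]]) (use g(1) that in \<open>auto simp: is_lift_def\<close>)
  \<comment> \<open>Along a lift that starts near \<open>z1\<close>, agreement with the local section at one time is
    equivalent to agreement with the local section at any other time.\<close>
  define R where "R s t \<longleftrightarrow> eventually (\<lambda>m. m \<in> base \<longrightarrow> (\<forall>h. is_lift m {0..1} h \<longrightarrow>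
      (h s = S s (shift m s) \<longleftrightarrow> h t = S t (shift m t)))) (near d m1)" for s t
  have "R 0 1"
  proof (rule connected_equivalence_relation[of "{0..1::real}" 0 1 R])
    fix x y assume "R x y"
    then show "R y x" unfolding R_def by (rule eventually_mono) blast
  next
    fix x y z assume "R x y" "R y z"
    then show "R x z" unfolding R_def by (rule eventually_elim2) blast
  next
    fix a :: real assume a: "a \<in> {0..1}"
    have "eventually (\<lambda>x. g x \<in> polydisc d (g a) (r a)) (at a within {0..1})"
      by (rule eventually_compose_filterlim[OF eventually_polydisc_near[OF re(1)[OF a]] lift_near[OF g(1) a]])
    then obtain b1 where b1: "b1 > 0" "\<And>x. x \<in> {0..1} \<Longrightarrow> dist x a < b1 \<Longrightarrow> g x \<in> polydisc d (g a) (r a)"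
    proof -
      have "g a \<in> polydisc d (g a) (r a)"
        using g(1) a re(1)[OF a] by (intro centre_in_polydisc) (auto simp: is_lift_def dest: config_Cn)
      then show ?thesis using that \<open>eventually _ _\<close> unfolding eventually_at by (metis dist_self)
    qed
    \<comment> \<open>half of the radius for the variation of the base point, half for the variation of time\<close>
    have "eventually (\<lambda>x. shift m1 x \<in> polydisc d (shift m1 a) (e a / 2)) (at a within {0..1})"
      by (rule eventually_compose_filterlim[OF eventually_polydisc_near shift_near[OF m1C order_refl a]]) (use re(2)[OF a] in simp)
    then obtain b2 where b2: "b2 > 0" "\<And>x. x \<in> {0..1} \<Longrightarrow> dist x a < b2 \<Longrightarrow> shift m1 x \<in> polydisc d (shift m1 a) (e a / 2)"
      unfolding eventually_at using centre_in_polydisc[OF shift_Cn[OF m1C], of "e a / 2"] re(2)[OF a] by (metis dist_self half_gt_zero)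
    define b where "b = min b1 b2"
    have b: "b > 0" using b1(1) b2(1) by (simp add: b_def)
    have inE: "shift m x \<in> polydisc d (shift m1 a) (e a)" if "x \<in> {0..1}" "dist x a < b" "m \<in> polydisc d m1 (e a / 2)" for x m
    proof -
      have "cmod (shift m x i - shift m1 a i) < e a" if i: "i < d" for i
      proof -
        have "cmod (shift m1 x i - shift m1 a i) < e a / 2" using b2(2)[of x] \<open>x \<in> {0..1}\<close> \<open>dist x a < b\<close> i by (auto simp: b_def polydisc_def)
        moreover have "cmod (shift m x i - shift m1 x i) < e a / 2" using \<open>m \<in> polydisc d m1 (e a / 2)\<close> i by (simp add: shift_def polydisc_def)
        ultimately show ?thesis using norm_triangle_ineq[of "shift m x i - shift m1 x i" "shift m1 x i - shift m1 a i"] by simp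
      qed
      then show ?thesis using shift_Cn[of m x] that(3) by (auto simp: polydisc_def)
    qed
    show "\<exists>T. openin (top_of_set {0..1}) T \<and> a \<in> T \<and> (\<forall>x\<in>T. R a x)"
    proof (intro exI[of _ "{0..1} \<inter> ball a b"] conjI ballI)
      show "openin (top_of_set {0..1}) ({0..1} \<inter> ball a b)" by (auto simp: openin_open)
      show "a \<in> {0..1} \<inter> ball a b" using a b by simp
      fix x assume xx: "x \<in> {0..1} \<inter> ball a b"
      then have x: "x \<in> {0..1}" "dist x a < b" by (auto simp: dist_commute)
      have m1e: "m1 \<in> polydisc d m1 (e a / 2)" using centre_in_polydisc[OF m1C] re(2)[OF a] by simp
      have "g x = S a (shift m1 x)"
        by (rule local_sectionD(3)[OF LS[OF a] inE[OF x m1e]]) (use b1(2)[OF x(1)] x g(1) in \<open>auto simp: b_def is_lift_def\<close>)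
      then have "filterlim (\<lambda>m. S a (shift m x)) (near d (g x)) (near d m1)"
        using filterlim_compose[OF local_section_near[OF LS[OF a] inE[OF x m1e]] shift_near_base[of x m1]] by simp
      then have "eventually (\<lambda>m. S a (shift m x) \<in> polydisc d (g x) (r x)) (near d m1)"
        by (rule eventually_compose_filterlim[OF eventually_polydisc_near[OF re(1)[OF x(1)]]])
      moreover have "eventually (\<lambda>m. shift m x \<in> polydisc d (shift m1 x) (e x)) (near d m1)"
        by (rule eventually_compose_filterlim[OF eventually_polydisc_near[OF re(2)[OF x(1)]] shift_near_base])
      moreover have "eventually (\<lambda>m. m \<in> polydisc d m1 (e a / 2)) (near d m1)"
        using re(2)[OF a] by (intro eventually_polydisc_near) simp
      ultimately show "R a x"
        unfolding R_def
      proof eventually_elim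
        case (elim m)
        show ?case
        proof (intro impI allI)
          fix h assume m: "m \<in> base" and h: "is_lift m {0..1} h"
          have eq: "S a (shift m x) = S x (shift m x)"
            by (rule local_sectionD(3)[OF LS[OF x(1)] elim(2) elim(1) local_sectionD(2)[OF LS[OF a] inE[OF x elim(3)]]])
          let ?T = "{0..1} \<inter> ball a b"
          have k: "is_lift m ?T (\<lambda>t. S a (shift m t))"
            by (rule section_is_lift[OF m LS[OF a]]) (auto intro!: inE elim(3) simp: dist_commute)
          have h': "is_lift m ?T h" by (rule lift_subset[OF h]) auto
          have cT: "connected ?T" by (intro convex_connected convex_Int) auto
          have aT: "a \<in> ?T" using a b by simp
          show "h a = S a (shift m a) \<longleftrightarrow> h x = S x (shift m x)"
            unfolding eq[symmetric] using lift_unique[OF m cT _ h' k aT _ xx] lift_unique[OF m cT _ h' k xx _ aT] by auto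
        qed
      qed
    qed
  qed auto
  have ev: "eventually (\<lambda>m. (m \<in> base \<longrightarrow> (\<forall>h. is_lift m {0..1} h \<longrightarrow> (h 0 = S 0 (shift m 0) \<longleftrightarrow> h 1 = S 1 (shift m 1)))) \<and>
      m \<in> polydisc d m1 (e 0) \<and> shift m 1 \<in> polydisc d (shift m1 1) (e 1)) (near d m1)"
    using \<open>R 0 1\<close> unfolding R_def
    by (intro eventually_conj eventually_polydisc_near re eventually_compose_filterlim[OF eventually_polydisc_near shift_near_base]) auto
  then obtain \<rho> where \<rho>: "\<rho> > 0" "\<And>m. m \<in> polydisc d m1 \<rho> \<Longrightarrow> (m \<in> base \<longrightarrow> (\<forall>h. is_lift m {0..1} h \<longrightarrow> (h 0 = S 0 (shift m 0) \<longleftrightarrow> h 1 = S 1 (shift m 1)))) \<and>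
      m \<in> polydisc d m1 (e 0) \<and> shift m 1 \<in> polydisc d (shift m1 1) (e 1)"
    unfolding eventually_near by blast
  have z: "0 \<in> {0..1::real}" "1 \<in> {0..1::real}" by auto
  show ?thesis
  proof (rule that[of "r 1" "e 1" "S 1" "min \<rho> (r 0)"])
    show "local_section d (shift m1 1) z1' (r 1) (e 1) (S 1)" using LS[OF z(2)] g(3) by simp
    show "0 < min \<rho> (r 0)" using \<rho>(1) re(1)[OF z(1)] by simp
    fix m y assume m: "m \<in> base" "m \<in> polydisc d m1 (min \<rho> (r 0))" and y: "y \<in> config d m" "y \<in> polydisc d z1 (min \<rho> (r 0))"
    have mr: "m \<in> polydisc d m1 \<rho>" using m(2) polydisc_mono[of "min \<rho> (r 0)" \<rho> d m1] by auto
    have yr: "y \<in> polydisc d (g 0) (r 0)" using y(2) polydisc_mono[of "min \<rho> (r 0)" "r 0" d z1] g(2) by auto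
    have me: "m \<in> polydisc d (shift m1 0) (e 0)" using \<rho>(2)[OF mr] by (simp add: shift_0)
    have "y = S 0 m" by (rule local_sectionD(3)[OF LS[OF z(1)] me yr y(1)])
    moreover obtain h where h: "is_lift m {0..1} h" "h 0 = y" using lift_exists[OF m(1) y(1)] by blast
    ultimately have "h 1 = S 1 (shift m 1)" using \<rho>(2)[OF mr] m(1) by (auto simp: shift_0)
    then show "shift m 1 \<in> polydisc d (shift m1 1) (e 1) \<and> transported m y (S 1 (shift m 1))"
      using \<rho>(2)[OF mr] h by (auto simp: transported_def)
  qed
qed

lemma centre_stabiliser:
  assumes s: "s permutes {..<d}" and m: "m \<in> polydisc d m0 eps" "m \<circ> s \<in> polydisc d m0 eps"
  shows "m0 \<circ> s = m0"
proof
  fix i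
  show "(m0 \<circ> s) i = m0 i"
  proof (cases "i < d")
    case True
    then have si: "s i < d" using permutes_in_image[OF s] by auto
    have "cmod (m (s i) - m0 i) < eps" "cmod (m (s i) - m0 (s i)) < eps"
      using m True si by (auto simp: polydisc_def)
    then have "cmod (m0 i - m0 (s i)) < 2 * eps"
      using norm_triangle_ineq4[of "m (s i) - m0 (s i)" "m (s i) - m0 i"] by simp
    then have "m0 i = m0 (s i)" using sep[OF True si] by force
    then show ?thesis by simp
  next
    case False
    then show ?thesis using permutes_not_in[OF s] by simp
  qed
qed

text \<open>Such a permutation fixes \<open>m0\<close>; the coincidences among the entries of \<open>m0\<close> persist along the path.\<close>

lemma stabiliser:
  assumes s: "s permutes {..<d}" and m: "m \<in> polydisc d m0 eps" "m \<circ> s \<in> polydisc d m0 eps"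
  shows "w \<circ> s = w"
proof
  fix i
  show "(w \<circ> s) i = w i"
  proof (cases "i < d")
    case True
    then have si: "s i < d" using permutes_in_image[OF s] by auto
    have eq: "m0 i = m0 (s i)" using fun_cong[OF centre_stabiliser[OF assms], of i] by simp
    then have "diff_form i (s i) \<in> zero_forms d m0" using True si by (simp add: diff_form_zero_forms)
    then have "diff_form i (s i) \<in> zero_forms d (shift m0 1)" using zero_forms_shift[OF m0_base] by simp
    then have "m0 i + p 1 * w i = m0 (s i) + p 1 * w (s i)" using True si by (simp add: diff_form_zero_forms shift_def)
    then show ?thesis using eq p1 by simp
  next
    case False
    then show ?thesis using permutes_not_in[OF s] by simp
  qed
qed

lemma transported_permute:
  assumes m: "m \<in> base" and s: "s permutes {..<d}" and ws: "w \<circ> s = w" and tr: "transported m z z'"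
  shows "transported (m \<circ> s) (normalise d (z \<circ> s)) (normalise d (z' \<circ> s))"
proof -
  obtain g where g: "is_lift m {0..1} g" "g 0 = z" "g 1 = z'" using tr by (auto simp: transported_def)
  have shs: "shift (m \<circ> s) t = shift m t \<circ> s" for t
    using ws by (auto simp: shift_def fun_eq_iff)
  have "is_lift (m \<circ> s) {0..1} (\<lambda>t. normalise d (g t \<circ> s))"
    unfolding is_lift_def
  proof (intro conjI ballI allI impI)
    fix t :: real assume "t \<in> {0..1}"
    then show "normalise d (g t \<circ> s) \<in> config d (shift (m \<circ> s) t)"
      unfolding shs using g(1) by (intro config_permute[OF d shift_Res[OF m] _ s]) (auto simp: is_lift_def)
  next
    fix i assume i: "i < d"
    have "g t (s 1) - g t (s 0) \<noteq> 0" if "t \<in> {0..1}" for t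
    proof -
      have "inj_on (g t) {..<d}" using g(1) that by (auto simp: is_lift_def config_def)
      moreover have "s 1 < d" "s 0 < d" using permutes_in_image[OF s] d by auto
      moreover have "s 1 \<noteq> s 0" using permutes_inj[OF s] by (auto simp: inj_def)
      ultimately show ?thesis by (auto simp: inj_on_def)
    qed
    moreover have "s j < d" if "j < d" for j using permutes_in_image[OF s] that by auto
    ultimately show "continuous_on {0..1} (\<lambda>t. normalise d (g t \<circ> s) i)"
      using g(1) i d unfolding normalise_def is_lift_def by (auto intro!: continuous_intros simp del: One_nat_def)
  qed
  then show ?thesis unfolding transported_def using g by (intro exI[of _ "\<lambda>t. normalise d (g t \<circ> s)"]) auto
qed

lemma reverse: "transport d (shift m0 1) eps w (\<lambda>t. p (1 - t) - p 1)"
proof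
  show "d \<ge> 2" by (rule d)
  show "shift m0 1 \<in> Res d" by (rule shift_Res[OF m0_base]) simp
  show "eps > 0" by (rule eps)
  show "w \<in> Cn d" by (rule w)
  show "continuous_on {0..1} (\<lambda>t. p (1 - t) - p 1)"
    by (intro continuous_intros continuous_on_compose2[OF p_cont]) auto
  show "p (1 - 0) - p 1 = 0" "p (1 - 1) - p 1 \<noteq> 0" using p0 p1 by auto
  have in_disc: "(\<lambda>i. m i - p 1 * w i) \<in> polydisc d m0 eps" if "m \<in> polydisc d (shift m0 1) eps" for m
    using that w by (auto simp: polydisc_def shift_def Cn_def algebra_simps)
  fix m and t :: real assume m: "m \<in> polydisc d (shift m0 1) eps" and t: "t \<in> {0..1}"
  let ?m = "\<lambda>i. m i - p 1 * w i"
  have "zero_forms d (\<lambda>i. ?m i + p (1 - t) * w i) = zero_forms d ?m" by (rule tube[OF in_disc[OF m]]) (use t in auto)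
  moreover have "zero_forms d (\<lambda>i. ?m i + p 1 * w i) = zero_forms d ?m" by (rule tube[OF in_disc[OF m]]) auto
  ultimately show "zero_forms d (\<lambda>i. m i + (p (1 - t) - p 1) * w i) = zero_forms d m" by (simp add: algebra_simps)
next
  fix j k assume jk: "j < d" "k < d" "shift m0 1 j \<noteq> shift m0 1 k"
  then have "m0 j \<noteq> m0 k"
    using diff_form_zero_forms[OF jk(1,2), of m0] diff_form_zero_forms[OF jk(1,2), of "shift m0 1"] zero_forms_shift[OF m0_base, of 1] by simp
  then show "2 * eps \<le> cmod (shift m0 1 j - shift m0 1 k)"
    "2 * eps \<le> cmod (shift m0 1 j + (p (1 - 1) - p 1) * w j - (shift m0 1 k + (p (1 - 1) - p 1) * w k))"
    using sep[OF jk(1,2)] sep'[OF jk(1,2)] p0 by (auto simp: shift_def algebra_simps)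
next
  fix i assume "i < d"
  then show "eps \<le> cmod (shift m0 1 i)" "eps \<le> cmod (shift m0 1 i + (p (1 - 1) - p 1) * w i)"
    using nz[of i] nz'[of i] p0 by (auto simp: shift_def algebra_simps)
qed

end

section \<open>The local isomorphism\<close>

lemma eventually_eventually_near:
  assumes "eventually P (near n z)"
  shows "eventually (\<lambda>x. eventually P (near n x)) (near n z)"
proof -
  obtain r where r: "r > 0" "\<And>x. x \<in> polydisc n z r \<Longrightarrow> P x" using assms by (auto simp: eventually_near)
  show ?thesis
    using eventually_polydisc_near[OF r(1), of n z]
    by (rule eventually_mono) (auto intro: eventually_mono[OF polydisc_near] r(2))
qed

lemma continuous_map_eventuallyI:
  assumes "\<And>a. a \<in> S \<Longrightarrow> f a \<in> topspace X"
    and "\<And>a W. a \<in> S \<Longrightarrow> openin X W \<Longrightarrow> f a \<in> W \<Longrightarrow> eventually (\<lambda>t. f t \<in> W) (at a within S)"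
  shows "continuous_map (top_of_set S) X f"
  unfolding continuous_map_def
proof (intro conjI allI impI)
  show "f \<in> topspace (top_of_set S) \<rightarrow> topspace X" using assms(1) by auto
  fix W assume W: "openin X W"
  show "openin (top_of_set S) {x \<in> topspace (top_of_set S). f x \<in> W}"
  proof (subst openin_subopen, intro ballI)
    fix a assume a: "a \<in> {x \<in> topspace (top_of_set S). f x \<in> W}"
    then have a': "a \<in> S" "f a \<in> W" by auto
    obtain U where "openin (top_of_set S) U" "a \<in> U" "\<forall>x\<in>U. f x \<in> W"
      using eventually_within_openin[OF assms(2)[OF a'(1) W a'(2)] a'(2,1)] by blast
    then show "\<exists>T. openin (top_of_set S) T \<and> a \<in> T \<and> T \<subseteq> {x \<in> topspace (top_of_set S). f x \<in> W}"
      by (intro exI[of _ U]) (auto dest: openin_imp_subset)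
  qed
qed

lemma connectedin_star_image:
  fixes D :: "(nat \<Rightarrow> complex) set"
  assumes D: "D \<subseteq> Res d" "m \<in> D"
    and path: "\<And>u. u \<in> D \<Longrightarrow> \<exists>p. continuous_on {0..1::real} p \<and> p 0 = 0 \<and> p 1 = 1 \<and>
       (\<forall>t\<in>{0..1}. (\<lambda>i. m i + p t * (u i - m i)) \<in> D)"
    and h: "\<And>u W. u \<in> D \<Longrightarrow> openin X W \<Longrightarrow> h u \<in> W \<Longrightarrow> eventually (\<lambda>v. v \<in> Res d \<longrightarrow> h v \<in> W) (near d u)"
    and hX: "\<And>u. u \<in> D \<Longrightarrow> h u \<in> topspace X"
  shows "connectedin X (h ` D)"
proof -
  have "\<exists>C. connectedin X C \<and> h m \<in> C \<and> h u \<in> C \<and> C \<subseteq> h ` D" if u: "u \<in> D" for u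
  proof -
    obtain p where p: "continuous_on {0..1::real} p" "p 0 = 0" "p 1 = 1"
      "\<And>t. t \<in> {0..1} \<Longrightarrow> (\<lambda>i. m i + p t * (u i - m i)) \<in> D" using path[OF u] by auto
    define g where "g t = (\<lambda>i. m i + p t * (u i - m i))" for t
    have gD: "g t \<in> D" if "t \<in> {0..1}" for t using p(4)[OF that] by (simp add: g_def)
    have "continuous_map (top_of_set {0..1}) X (\<lambda>t. h (g t))"
    proof (rule continuous_map_eventuallyI)
      fix a :: real and W assume a: "a \<in> {0..1}" and W: "openin X W" "h (g a) \<in> W"
      have ev: "eventually (\<lambda>t. g t \<in> Res d) (at a within {0..1})"
        using gD D(1) by (auto simp: eventually_at_filter intro!: always_eventually)
      have "(p \<longlongrightarrow> p a) (at a within {0..1})" using p(1) a by (simp add: continuous_on_def)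
      then have "filterlim g (near d (g a)) (at a within {0..1})"
        unfolding filterlim_near using ev
        by (auto simp: g_def intro!: tendsto_intros elim: eventually_mono dest: Res_Cn)
      from eventually_compose_filterlim[OF h[OF gD[OF a] W] this] ev
      show "eventually (\<lambda>t. h (g t) \<in> W) (at a within {0..1})" by eventually_elim simp
    qed (use gD hX in auto)
    moreover have "connectedin (top_of_set {0..1}) {0..1::real}" by (simp add: connectedin_subtopology)
    ultimately have "connectedin X ((\<lambda>t. h (g t)) ` {0..1})" by (rule connectedin_continuous_map_image)
    moreover have "h m \<in> (\<lambda>t. h (g t)) ` {0..1}" using p(2) by (intro image_eqI[of _ _ 0]) (auto simp: g_def)
    moreover have "h u \<in> (\<lambda>t. h (g t)) ` {0..1}" using p(3) by (intro image_eqI[of _ _ 1]) (auto simp: g_def)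
    moreover have "(\<lambda>t. h (g t)) ` {0..1} \<subseteq> h ` D" using gD by auto
    ultimately show ?thesis by blast
  qed
  then obtain C where C: "\<And>u. u \<in> D \<Longrightarrow> connectedin X (C u) \<and> h m \<in> C u \<and> h u \<in> C u \<and> C u \<subseteq> h ` D" by metis
  have "connectedin X (\<Union>(C ` D))" using C D(2) by (intro connectedin_Union) auto
  moreover have "\<Union>(C ` D) = h ` D" using C by fastforce
  ultimately show ?thesis by simp
qed

lemma openin_multipliers_image:
  assumes D: "D \<subseteq> Res d" "\<And>m. m \<in> D \<Longrightarrow> eventually (\<lambda>w. w \<in> Res d \<longrightarrow> w \<in> D) (near d m)"
  shows "openin (cs_top (Lambda_space d)) (multipliers d ` D)"
  unfolding openin_Lambda_space
proof (intro conjI ballI)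
  show "multipliers d ` D \<subseteq> Lambda d" using D(1) multipliers_Lambda by auto
  fix l assume "l \<in> multipliers d ` D"
  then obtain m where m: "m \<in> D" "l = multipliers d m" by auto
  have mR: "m \<in> Res d" using D(1) m(1) by auto
  have "eventually (\<lambda>x. residues d x \<in> Res d \<longrightarrow> residues d x \<in> D) (near d l)"
    using eventually_compose_filterlim[OF D(2)[OF m(1)] residues_near[OF mR m(2)]] .
  moreover have "eventually (\<lambda>l. l \<in> Lambda d \<longrightarrow> residues d l \<in> Res d \<and> multipliers d (residues d l) = l) (near d l)"
    unfolding m(2) by (rule eventually_residues_near[OF mR])
  ultimately show "eventually (\<lambda>w. w \<in> Lambda d \<longrightarrow> w \<in> multipliers d ` D) (near d l)"
    by eventually_elim (metis imageI)
qed

lemma Lambda_open_near: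
  assumes "openin (cs_top (Lambda_space d)) W" "m \<in> Res d" "multipliers d m \<in> W"
  shows "eventually (\<lambda>w. w \<in> Res d \<longrightarrow> multipliers d w \<in> W) (near d m)"
proof -
  have "eventually (\<lambda>w. w \<in> Lambda d \<longrightarrow> w \<in> W) (near d (multipliers d m))"
    using assms by (auto simp: openin_Lambda_space)
  from eventually_compose_filterlim[OF this multipliers_near[OF assms(2)]]
  show ?thesis by (rule eventually_mono) (auto simp: multipliers_Lambda)
qed

context transport
begin

lemma base_subset: "base \<subseteq> Res d" "base \<subseteq> polydisc d m0 eps" by (auto simp: base_def)

lemma base_open: "m \<in> base \<Longrightarrow> eventually (\<lambda>w. w \<in> Res d \<longrightarrow> w \<in> base) (near d m)"
  unfolding base_def by (auto intro: eventually_mono[OF polydisc_near])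

lemma base_permute_stable:
  assumes "s permutes {..<d}" "m0 \<circ> s = m0" "m \<in> base" shows "m \<circ> s \<in> base"
proof -
  have "cmod (m (s i) - m0 i) < eps" if "i < d" for i
  proof -
    have "s i < d" using permutes_in_image[OF assms(1)] that by auto
    then have "cmod (m (s i) - m0 (s i)) < eps" using assms(3) by (auto simp: base_def polydisc_def)
    then show ?thesis using fun_cong[OF assms(2), of i] by simp
  qed
  then show ?thesis using comp_permutes_Res[OF assms(1), of m] assms(3) comp_permutes_Cn[OF assms(1), of m]
    by (auto simp: base_def polydisc_def)
qed

lemma base_line:
  assumes m: "m \<in> base" and t: "t \<in> {0..1::real}"
  shows "(\<lambda>i. m0 i + of_real t * (m i - m0 i)) \<in> base"
proof -
  let ?g = "\<lambda>i. m0 i + of_real t * (m i - m0 i)"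
  have gd: "cmod (?g i - m0 i) < eps" if "i < d" for i
  proof -
    have "cmod (?g i - m0 i) = t * cmod (m i - m0 i)" using t by (simp add: norm_mult)
    also have "\<dots> \<le> 1 * cmod (m i - m0 i)" using t by (intro mult_right_mono) auto
    also have "\<dots> < eps" using m that by (simp add: base_def polydisc_def)
    finally show ?thesis .
  qed
  have C: "?g \<in> Cn d" using m m0 by (auto simp: base_def Res_def Cn_def)
  have "(\<Sum>i<d. ?g i) = 0" using m m0
    by (simp add: base_def Res_def sum.distrib sum_distrib_left[symmetric] sum_subtractf)
  moreover have "?g i \<noteq> 0" if "i < d" for i
  proof
    assume "?g i = 0"
    then have "cmod (m0 i) < eps" using gd[OF that] by (simp add: norm_minus_commute)
    then show False using nz[OF that] by simp
  qed
  ultimately show ?thesis using C gd by (simp add: base_def Res_def polydisc_def)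
qed

text \<open>The copies of the polydisc under permutations are pairwise equal or disjoint, so each of them is
  a connected component of the preimage of their common image.\<close>

lemma component_base:
  "connected_component_of_set (subtopology (cs_top (Lambda_space d)) (pr_preimage d (multiplier_class d ` base))) (multipliers d m0)
     = multipliers d ` base"
proof -
  let ?X = "cs_top (Lambda_space d)" and ?P = "pr_preimage d (multiplier_class d ` base)"
  let ?T = "subtopology ?X ?P"
  have sub: "multipliers d ` base \<subseteq> ?P"
    using base_subset(1) multipliers_Lambda by (auto simp: pr_preimage_def multiplier_class_def)
  have con: "connectedin ?X (multipliers d ` base)"
  proof (rule connectedin_star_image[OF base_subset(1) m0_base])
    fix u assume u: "u \<in> base"
    have "continuous_on {0..1::real} (\<lambda>t. complex_of_real t)" by (intro continuous_intros)
    then show "\<exists>p. continuous_on {0..1::real} p \<and> p 0 = 0 \<and> p 1 = 1 \<and> (\<forall>t\<in>{0..1}. (\<lambda>i. m0 i + p t * (u i - m0 i)) \<in> base)"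
      using base_line[OF u] by (intro exI[of _ "\<lambda>t. complex_of_real t"]) auto
  qed (use base_subset Lambda_open_near multipliers_Lambda in \<open>auto simp: topspace_Lambda_space\<close>)
  have con': "connectedin ?T (multipliers d ` base)" using con sub by (simp add: connectedin_subtopology)
  have "openin ?X (multipliers d ` base)"
    by (rule openin_multipliers_image[OF base_subset(1) base_open])
  then have op: "openin ?T (multipliers d ` base)"
    using sub by (metis openin_subtopology_Int2 Int_absorb1)
  \<comment> \<open>the complement is covered by the translates of the polydisc under permutations\<close>
  have cl: "closedin ?T (multipliers d ` base)"
    unfolding closedin_def
  proof (intro conjI)
    show "multipliers d ` base \<subseteq> topspace ?T" using sub base_subset multipliers_Lambda by (auto simp: topspace_Lambda_space)
    show "openin ?T (topspace ?T - multipliers d ` base)"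
    proof (subst openin_subopen, intro ballI)
      fix l assume l: "l \<in> topspace ?T - multipliers d ` base"
      then obtain m where m: "l \<in> Lambda d" "m \<in> base" "pr d l = multiplier_class d m"
        by (auto simp: topspace_Lambda_space pr_preimage_def)
      then obtain s where s: "s permutes {..<d}" "l = multipliers d (m \<circ> s)"
        using Lambda_lift_cases[OF m(1,3)] base_subset(1) by blast
      let ?D = "(\<lambda>u. u \<circ> s) ` base"
      have DR: "?D \<subseteq> Res d" using comp_permutes_Res[OF s(1)] base_subset(1) by auto
      have si: "inv s permutes {..<d}" by (rule permutes_inv[OF s(1)])
      have "openin ?X (multipliers d ` ?D)"
      proof (rule openin_multipliers_image[OF DR])
        fix u assume "u \<in> ?D"
        then obtain v where v: "v \<in> base" "u = v \<circ> s" by auto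
        have uv: "u \<circ> inv s = v" using permutes_inv_o(1)[OF s(1)] by (simp add: v(2) comp_assoc)
        have "eventually (\<lambda>x. x \<circ> inv s \<in> Res d \<longrightarrow> x \<circ> inv s \<in> base) (near d u)"
          using eventually_compose_filterlim[OF base_open[OF v(1)], of "\<lambda>x. x \<circ> inv s"]
            tendsto_comp_permutes_near[OF si filterlim_ident[of "near d u"]] uv by simp
        then show "eventually (\<lambda>w. w \<in> Res d \<longrightarrow> w \<in> ?D) (near d u)"
        proof (rule eventually_mono, intro impI)
          fix x assume x: "x \<circ> inv s \<in> Res d \<longrightarrow> x \<circ> inv s \<in> base" "x \<in> Res d"
          then have "x \<circ> inv s \<in> base" using comp_permutes_Res[OF si] by blast
          moreover have "x = x \<circ> inv s \<circ> s" using permutes_inv_o(2)[OF s(1)] by (simp add: comp_assoc)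
          ultimately show "x \<in> ?D" by blast
        qed
      qed
      then have "openin ?T (?P \<inter> multipliers d ` ?D)" by (rule openin_subtopology_Int2)
      moreover have "l \<in> ?P \<inter> multipliers d ` ?D" using l s(2) m(2) by auto
      moreover have "multipliers d ` ?D \<inter> multipliers d ` base = {}"
      proof (rule ccontr)
        assume "multipliers d ` ?D \<inter> multipliers d ` base \<noteq> {}"
        then obtain u v where uv: "u \<in> base" "v \<in> base" "multipliers d (u \<circ> s) = multipliers d v" by auto
        have "u \<circ> s \<in> Cn d" "v \<in> Cn d" using uv base_subset(1) comp_permutes_Cn[OF s(1)] by (auto simp: Res_def)
        then have "u \<circ> s = v" using uv(3) by (metis residues_multipliers)
        then have "m0 \<circ> s = m0" using centre_stabiliser[OF s(1)] uv base_subset(2) by blast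
        then have "m \<circ> s \<in> base" by (rule base_permute_stable[OF s(1) _ m(2)])
        then show False using l s(2) by auto
      qed
      ultimately show "\<exists>T. openin ?T T \<and> l \<in> T \<and> T \<subseteq> topspace ?T - multipliers d ` base"
        using openin_subset by (intro exI[of _ "?P \<inter> multipliers d ` ?D"] conjI) (auto dest!: openin_subset)
    qed
  qed
  have x: "multipliers d m0 \<in> multipliers d ` base" using m0_base by auto
  let ?C = "connected_component_of_set ?T (multipliers d m0)"
  have "multipliers d ` base \<subseteq> ?C" by (rule connected_component_of_maximal[OF con' x])
  moreover have "?C \<subseteq> multipliers d ` base"
  proof -
    have "multipliers d m0 \<in> ?C" using calculation x by blast
    then have "\<not> disjnt ?C (multipliers d ` base)" using x by (auto simp: disjnt_def)
    then show ?thesis using connectedin_clopen_cases[OF connectedin_connected_component_of cl op] by blast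
  qed
  ultimately show ?thesis by blast
qed

definition transport_class :: "complex poly set \<Rightarrow> complex poly set" where
  "transport_class c = (THE c'. \<exists>m z z'. m \<in> base \<and> c = config_class d m z \<and> transported m z z' \<and> c' = config_class d (shift m 1) z')"

text \<open>Two representatives differ by a permutation that moves a point of the polydisc to another one. It
  fixes \<open>w\<close>, so transport commutes with it.\<close>

lemma transport_class_eq:
  assumes m: "m \<in> base" and tr: "transported m z z'"
  shows "transport_class (config_class d m z) = config_class d (shift m 1) z'"
  unfolding transport_class_def
proof (rule the_equality)
  show "\<exists>ma za z'a. ma \<in> base \<and> config_class d m z = config_class d ma za \<and> transported ma za z'a \<and> config_class d (shift m 1) z' = config_class d (shift ma 1) z'a"
    using assms by blast
  fix c' assume "\<exists>ma za z'a. ma \<in> base \<and> config_class d m z = config_class d ma za \<and> transported ma za z'a \<and> c' = config_class d (shift ma 1) z'a"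
  then obtain u y y' where u: "u \<in> base" "config_class d m z = config_class d u y" "transported u y y'" "c' = config_class d (shift u 1) y'" by blast
  have mR: "m \<in> Res d" "u \<in> Res d" using m u(1) base_subset by auto
  obtain s where s: "s permutes {..<d}" "u = m \<circ> s" "y = normalise d (z \<circ> s)"
    using config_class_eqD[OF d mR(1) _ mR(2) _ u(2)] transported_config[OF tr] transported_config[OF u(3)] by blast
  have ws: "w \<circ> s = w" by (rule stabiliser[OF s(1)]) (use m u(1) s(2) base_subset in auto)
  have "y' = normalise d (z' \<circ> s)"
    using transported_unique[OF u(1) u(3)] transported_permute[OF m s(1) ws tr] s(2,3) by blast
  moreover have "shift u 1 = shift m 1 \<circ> s" using ws by (auto simp: shift_def s(2) fun_eq_iff)
  ultimately show "c' = config_class d (shift m 1) z'"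
    using config_class_permute[OF d shift_Res[OF m] _ s(1), of 1 z'] transported_config[OF tr] u(4) by simp
qed

lemma class_over_base:
  assumes "c \<in> Phi_preimage d (multiplier_class d ` base)"
  obtains m z z' where "m \<in> base" "z \<in> config d m" "transported m z z'" "c = config_class d m z"
proof -
  obtain m where m: "c \<in> MP d" "m \<in> base" "Phi c = multiplier_class d m" using assms by (auto simp: Phi_preimage_def)
  then obtain z where "z \<in> config d m" "c = config_class d m z"
    using class_over_V[OF d m(1), of m] base_subset(1) by (auto simp: multiplier_class_def)
  then show ?thesis using transported_exists[OF m(2)] that m(2) by blast
qed

text \<open>The lift sends coefficients to labelled fixed points (\<open>local_labels\<close>), transports these by a local
  section, and returns to coefficients by \<open>fixed_poly\<close>.\<close>

lemma transport_class_local_lift: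
  "local_lift (d + 1) coeff (Poly_deg d) (moduli_class d) (d + 1) coeff (Poly_deg d) (moduli_class d)
     (Phi_preimage d (multiplier_class d ` base)) transport_class"
  unfolding local_lift_def
proof (intro ballI impI)
  fix f assume f: "f \<in> Poly_deg d" "moduli_class d f \<in> Phi_preimage d (multiplier_class d ` base)"
  obtain m1 z1 z1' where m1: "m1 \<in> base" "z1 \<in> config d m1" "transported m1 z1 z1'" "moduli_class d f = config_class d m1 z1"
    using class_over_base[OF f(2)] by blast
  have m1R: "m1 \<in> Res d" using m1(1) base_subset by auto
  obtain y where y: "labels d f y" "fp_residues d f y = m1" "normalise d y = z1"
    using labels_of_class[OF d f(1) m1R m1(2,4)] by blast
  let ?F = "near (d + 1) (coeff f)"
  obtain M Z where MZ: "M (coeff f) = m1" "Z (coeff f) = z1"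
    "eventually (\<lambda>x. (\<forall>i<d. cdiff (d + 1) (\<lambda>x. M x i) x \<and> cdiff (d + 1) (\<lambda>x. Z x i) x) \<and> M x \<in> Res d \<and> Z x \<in> config d (M x) \<and>
       (\<forall>g\<in>Poly_deg d. coeff g = x \<longrightarrow> moduli_class d g = config_class d (M x) (Z x))) ?F"
    using local_labels[OF d f(1) y(1), unfolded y(2,3)] by blast
  obtain r e S \<rho> where S: "local_section d (shift m1 1) z1' r e S" "\<rho> > 0"
    "\<And>m z. m \<in> base \<Longrightarrow> m \<in> polydisc d m1 \<rho> \<Longrightarrow> z \<in> config d m \<Longrightarrow> z \<in> polydisc d z1 \<rho> \<Longrightarrow>
      shift m 1 \<in> polydisc d (shift m1 1) e \<and> transported m z (S (shift m 1))"
    using transported_local_section[OF m1(1,3)] by blast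
  have fC: "coeff f \<in> Cn (d + 1)" using f(1) Poly_deg_coeff_Cn by blast
  note c = eventually_near_centre[OF MZ(3) fC]
  have evM: "eventually (\<lambda>x. M x \<in> Cn d) ?F" and evZ: "eventually (\<lambda>x. Z x \<in> Cn d) ?F"
    by (rule eventually_mono[OF MZ(3)], meson Res_Cn config_Cn)+
  have "((\<lambda>x. M x i) \<longlongrightarrow> m1 i) ?F" "((\<lambda>x. Z x i) \<longlongrightarrow> z1 i) ?F" if "i < d" for i
    using cdiff_tendsto[of "d + 1" "\<lambda>x. M x i" "coeff f"] cdiff_tendsto[of "d + 1" "\<lambda>x. Z x i" "coeff f"] c that MZ(1,2) by auto
  then have lim: "filterlim M (near d m1) ?F" "filterlim Z (near d z1) ?F"
    using evM evZ by (auto simp: filterlim_near)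
  have ev: "eventually (\<lambda>x. M x \<in> polydisc d m1 \<rho>) ?F" "eventually (\<lambda>x. Z x \<in> polydisc d z1 \<rho>) ?F"
    using eventually_compose_filterlim[OF eventually_polydisc_near[OF S(2)]] lim by blast+
  have ev2: "eventually (\<lambda>x. M x \<in> Res d \<longrightarrow> M x \<in> base) ?F"
    using eventually_compose_filterlim[OF base_open[OF m1(1)] lim(1)] .
  define \<Psi> where "\<Psi> x = coeff (fixed_poly d (shift (M x) 1) (S (shift (M x) 1)))" for x
  show "\<exists>\<Psi>. eventually (\<lambda>x. \<Psi> x \<in> Cn (d + 1) \<and> (\<forall>j<d + 1. cdiff (d + 1) (\<lambda>x. \<Psi> x j) x) \<and>
       (\<forall>g\<in>Poly_deg d. coeff g = x \<longrightarrow> moduli_class d g \<in> Phi_preimage d (multiplier_class d ` base) \<and>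
          (\<exists>g'\<in>Poly_deg d. coeff g' = \<Psi> x \<and> moduli_class d g' = transport_class (moduli_class d g)))) ?F"
  proof (intro exI[of _ \<Psi>])
    show "eventually (\<lambda>x. \<Psi> x \<in> Cn (d + 1) \<and> (\<forall>j<d + 1. cdiff (d + 1) (\<lambda>x. \<Psi> x j) x) \<and>
       (\<forall>g\<in>Poly_deg d. coeff g = x \<longrightarrow> moduli_class d g \<in> Phi_preimage d (multiplier_class d ` base) \<and>
          (\<exists>g'\<in>Poly_deg d. coeff g' = \<Psi> x \<and> moduli_class d g' = transport_class (moduli_class d g)))) ?F"
      using MZ(3) ev(1) ev(2) ev2 eventually_eventually_near[OF evM]
    proof eventually_elim
      case (elim x)
      have Mb: "M x \<in> base" using elim(1,4) by blast
      have Zc: "Z x \<in> config d (M x)" using elim(1) by blast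
      from S(3)[OF Mb elim(2) Zc elim(3)]
      have she: "shift (M x) 1 \<in> polydisc d (shift m1 1) e" and tr: "transported (M x) (Z x) (S (shift (M x) 1))" by auto
      have shR: "shift (M x) 1 \<in> Res d" by (rule shift_Res[OF Mb]) simp
      have Sc: "S (shift (M x) 1) \<in> config d (shift (M x) 1)" using transported_config[OF tr] by blast
      note fp = fixed_poly_props[OF d shR Sc]
      have csh: "cdiff (d + 1) (\<lambda>x. shift (M x) 1 i) x" if "i < d" for i
        unfolding shift_def using elim(1) that by (intro cdiff_add cdiff_const) auto
      have cS: "cdiff (d + 1) (\<lambda>x. S (shift (M x) 1) i) x" if i: "i < d" for i
      proof (rule cdiff_compose[of d "\<lambda>v. S v i" "\<lambda>x. shift (M x) 1" x])
        show "cdiff d (\<lambda>v. S v i) (shift (M x) 1)" by (rule local_sectionD(4)[OF S(1) she i])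
        show "cdiff (d + 1) (\<lambda>x. shift (M x) 1 j) x" if "j < d" for j by (rule csh[OF that])
        have "eventually (\<lambda>y. M y \<in> Cn d) (near (d + 1) x)" by (rule elim(5))
        then show "eventually (\<lambda>x. shift (M x) 1 \<in> Cn d) (near (d + 1) x)"
          by (auto elim: eventually_mono intro: shift_Cn)
      qed
      have 1: "\<Psi> x \<in> Cn (d + 1)" unfolding \<Psi>_def using fp(1) Poly_deg_coeff_Cn by blast
      have 2: "cdiff (d + 1) (\<lambda>x. \<Psi> x j) x" for j
        unfolding \<Psi>_def by (rule cdiff_coeff_fixed_poly[OF d csh cS shR Sc])
      have "moduli_class d g \<in> Phi_preimage d (multiplier_class d ` base) \<and>
          (\<exists>g'\<in>Poly_deg d. coeff g' = \<Psi> x \<and> moduli_class d g' = transport_class (moduli_class d g))"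
        if g: "g \<in> Poly_deg d" "coeff g = x" for g
      proof
        have eq: "moduli_class d g = config_class d (M x) (Z x)" using elim(1) g by blast
        have MR: "M x \<in> Res d" using elim(1) by blast
        show "moduli_class d g \<in> Phi_preimage d (multiplier_class d ` base)"
          using config_class_in_MP[OF d MR Zc] Phi_config_class[OF d MR Zc] Mb by (auto simp: Phi_preimage_def eq multiplier_class_def)
        show "\<exists>g'\<in>Poly_deg d. coeff g' = \<Psi> x \<and> moduli_class d g' = transport_class (moduli_class d g)"
          unfolding eq transport_class_eq[OF Mb tr] using fp(1)
          by (intro bexI[of _ "fixed_poly d (shift (M x) 1) (S (shift (M x) 1))"]) (auto simp: \<Psi>_def config_class_def)
      qed
      then show ?case using 1 2 by blast
    qed
  qed
qed

definition transport_tilde :: "complex multiset \<Rightarrow> complex multiset" where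
  "transport_tilde x = (THE y. \<exists>m\<in>base. x = multiplier_class d m \<and> y = multiplier_class d (shift m 1))"

lemma transport_tilde_eq:
  assumes m: "m \<in> base" shows "transport_tilde (multiplier_class d m) = multiplier_class d (shift m 1)"
  unfolding transport_tilde_def
proof (rule the_equality)
  show "\<exists>ma\<in>base. multiplier_class d m = multiplier_class d ma \<and> multiplier_class d (shift m 1) = multiplier_class d (shift ma 1)" using m by blast
  fix y assume "\<exists>ma\<in>base. multiplier_class d m = multiplier_class d ma \<and> y = multiplier_class d (shift ma 1)"
  then obtain u where u: "u \<in> base" "multiplier_class d m = multiplier_class d u" "y = multiplier_class d (shift u 1)" by blast
  then obtain s where s: "s permutes {..<d}" "u = m \<circ> s"
    using pr_multipliers_eq_iff[of m d u] m base_subset by (auto simp: multiplier_class_def)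
  have ws: "w \<circ> s = w" by (rule stabiliser[OF s(1)]) (use m u(1) s(2) base_subset in auto)
  have "shift u 1 = shift m 1 \<circ> s" using ws by (auto simp: shift_def s(2) fun_eq_iff)
  then show "y = multiplier_class d (shift m 1)" using multiplier_class_permute[OF s(1) shift_Res[OF m]] u(3) by simp
qed

definition transport_lambda :: "(nat \<Rightarrow> complex) \<Rightarrow> nat \<Rightarrow> complex" where
  "transport_lambda l = multipliers d (shift (residues d l) 1)"

text \<open>In the relabelling of the polydisc by \<open>s\<close> the translation has direction \<open>w \<circ> s\<close>. This gives local
  formulas for the translation at all points over the image of the polydisc.\<close>

lemma residue_shift_near:
  assumes m: "m \<in> base" and s: "s permutes {..<d}"
  defines "\<Psi> \<equiv> \<lambda>x. multipliers d (\<lambda>i. residues d x i + p 1 * w (s i))"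
  shows "eventually (\<lambda>x. \<Psi> x \<in> Cn d \<and> (\<forall>j<d. cdiff d (\<lambda>x. \<Psi> x j) x) \<and>
     (x \<in> Lambda d \<longrightarrow> residues d x \<circ> inv s \<in> base \<and> x = multipliers d (residues d x) \<and>
        \<Psi> x = multipliers d (shift (residues d x \<circ> inv s) 1 \<circ> s))) (near d (multipliers d (m \<circ> s)))"
proof -
  let ?l = "multipliers d (m \<circ> s)"
  have mR: "m \<in> Res d" using m base_subset by auto
  have msR: "m \<circ> s \<in> Res d" by (rule comp_permutes_Res[OF s mR])
  have si: "inv s permutes {..<d}" by (rule permutes_inv[OF s])
  have lt: "s i < d" if "i < d" for i using permutes_in_image[OF s] that by auto
  have R0: "residues d ?l = m \<circ> s" using residues_multipliers[OF Res_Cn[OF msR]] .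
  have rlim: "filterlim (residues d) (near d (m \<circ> s)) (near d ?l)" by (rule residues_near[OF msR refl])
  have mm: "m \<circ> s \<circ> inv s = m" using permutes_inv_o(1)[OF s] by (simp add: comp_assoc)
  have e1: "eventually (\<lambda>x. residues d x \<circ> inv s \<in> Res d \<longrightarrow> residues d x \<circ> inv s \<in> base) (near d ?l)"
    using eventually_compose_filterlim[OF base_open[OF m], of "\<lambda>x. residues d x \<circ> inv s"]
      tendsto_comp_permutes_near[OF si rlim] mm by simp
  have e2: "eventually (\<lambda>x. \<forall>i\<in>{..<d}. residues d x i + p 1 * w (s i) \<noteq> 0) (near d ?l)"
  proof (intro eventually_ball_finite ballI)
    fix i assume "i \<in> {..<d}"
    then have i: "i < d" by simp
    have "((\<lambda>x. residues d x i + p 1 * w (s i)) \<longlongrightarrow> (m \<circ> s) i + p 1 * w (s i)) (near d ?l)"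
      using rlim i by (intro tendsto_intros) (auto simp: filterlim_near)
    moreover have "(m \<circ> s) i + p 1 * w (s i) \<noteq> 0"
      using shift_Res[OF m, of 1] lt[OF i] by (auto simp: shift_def Res_def)
    ultimately show "eventually (\<lambda>x. residues d x i + p 1 * w (s i) \<noteq> 0) (near d ?l)"
      by (rule tendsto_imp_eventually_ne)
  qed auto
  have e3: "eventually (\<lambda>x. \<forall>i\<in>{..<d}. x i \<noteq> 1) (near d ?l)"
    using msR by (intro eventually_ball_finite ballI tendsto_imp_eventually_ne[OF tendsto_coord_near])
      (auto simp: multipliers_def Res_def)
  have e4: "eventually (\<lambda>l. l \<in> Lambda d \<longrightarrow> residues d l \<in> Res d \<and> multipliers d (residues d l) = l) (near d ?l)"
    by (rule eventually_residues_near[OF msR])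
  show ?thesis using e1 e2 e3 e4
  proof eventually_elim
    case (elim x)
    have "\<Psi> x \<in> Cn d" by (simp add: \<Psi>_def multipliers_def Cn_def)
    moreover have "cdiff d (\<lambda>x. \<Psi> x j) x" if j: "j < d" for j
    proof -
      have "1 - x j \<noteq> 0" using elim(3) j by auto
      moreover have "1 / (1 - x j) + p 1 * w (s j) \<noteq> 0" using elim(2) j by (auto simp: residues_def)
      ultimately have "cdiff d (\<lambda>x. 1 - 1 / (1 / (1 - x j) + p 1 * w (s j))) x"
        using j by (intro cdiff_diff cdiff_inverse cdiff_add cdiff_const cdiff_coord) auto
      then show ?thesis using j by (simp add: \<Psi>_def multipliers_def residues_def)
    qed
    moreover have "residues d x \<circ> inv s \<in> base \<and> x = multipliers d (residues d x) \<and>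
        \<Psi> x = multipliers d (shift (residues d x \<circ> inv s) 1 \<circ> s)" if x: "x \<in> Lambda d"
    proof -
      have "residues d x \<circ> inv s \<in> base" using elim(1,4) comp_permutes_Res[OF si] x by blast
      moreover have "(\<lambda>i. residues d x i + p 1 * w (s i)) = shift (residues d x \<circ> inv s) 1 \<circ> s"
        using permutes_inverses(2)[OF s] by (auto simp: shift_def fun_eq_iff)
      ultimately show ?thesis using elim(4) x by (simp add: \<Psi>_def)
    qed
    ultimately show ?case by blast
  qed
qed

lemma transport_tilde_local_lift:
  "local_lift d (\<lambda>l. l) (Lambda d) (pr d) d (\<lambda>l. l) (Lambda d) (pr d) (multiplier_class d ` base) transport_tilde"
  unfolding local_lift_def
proof (intro ballI impI)
  fix l assume l: "l \<in> Lambda d" "pr d l \<in> multiplier_class d ` base"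
  then obtain m where m: "m \<in> base" "pr d l = multiplier_class d m" by auto
  then obtain s where s: "s permutes {..<d}" "l = multipliers d (m \<circ> s)"
    using Lambda_lift_cases[OF l(1)] base_subset by blast
  let ?\<Psi> = "\<lambda>x. multipliers d (\<lambda>i. residues d x i + p 1 * w (s i))"
  have si: "inv s permutes {..<d}" by (rule permutes_inv[OF s(1)])
  have "eventually (\<lambda>x. ?\<Psi> x \<in> Cn d \<and> (\<forall>j<d. cdiff d (\<lambda>x. ?\<Psi> x j) x) \<and>
      (\<forall>y\<in>Lambda d. y = x \<longrightarrow> pr d y \<in> multiplier_class d ` base \<and> (\<exists>y'\<in>Lambda d. y' = ?\<Psi> x \<and> pr d y' = transport_tilde (pr d y)))) (near d l)"
    unfolding s(2) using residue_shift_near[OF m(1) s(1)]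
  proof (rule eventually_mono)
    fix x assume x: "?\<Psi> x \<in> Cn d \<and> (\<forall>j<d. cdiff d (\<lambda>x. ?\<Psi> x j) x) \<and>
     (x \<in> Lambda d \<longrightarrow> residues d x \<circ> inv s \<in> base \<and> x = multipliers d (residues d x) \<and>
        ?\<Psi> x = multipliers d (shift (residues d x \<circ> inv s) 1 \<circ> s))"
    have "pr d x \<in> multiplier_class d ` base \<and> (\<exists>y'\<in>Lambda d. y' = ?\<Psi> x \<and> pr d y' = transport_tilde (pr d x))" if xL: "x \<in> Lambda d"
    proof -
      let ?u = "residues d x \<circ> inv s"
      have u: "?u \<in> base" "x = multipliers d (residues d x)" "?\<Psi> x = multipliers d (shift ?u 1 \<circ> s)" using x xL by auto
      have uR: "?u \<in> Res d" using u(1) base_subset by auto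
      have shR: "shift ?u 1 \<in> Res d" by (rule shift_Res[OF u(1)]) simp
      have "?u \<circ> s = residues d x" using permutes_inv_o(2)[OF s(1)] by (simp add: comp_assoc)
      then have "pr d x = multiplier_class d (?u \<circ> s)" using u(2) by (simp add: multiplier_class_def)
      then have pu: "pr d x = multiplier_class d ?u" using multiplier_class_permute[OF s(1) uR] by simp
      have "pr d (?\<Psi> x) = multiplier_class d (shift ?u 1)"
        using multiplier_class_permute[OF s(1) shR] u(3) by (simp add: multiplier_class_def)
      then have "pr d (?\<Psi> x) = transport_tilde (pr d x)" using transport_tilde_eq[OF u(1)] pu by simp
      moreover have "?\<Psi> x \<in> Lambda d" unfolding u(3) by (rule multipliers_Lambda[OF comp_permutes_Res[OF s(1) shR]])
      ultimately show ?thesis using pu u(1) by auto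
    qed
    then show "?\<Psi> x \<in> Cn d \<and> (\<forall>j<d. cdiff d (\<lambda>x. ?\<Psi> x j) x) \<and>
      (\<forall>y\<in>Lambda d. y = x \<longrightarrow> pr d y \<in> multiplier_class d ` base \<and> (\<exists>y'\<in>Lambda d. y' = ?\<Psi> x \<and> pr d y' = transport_tilde (pr d y)))"
      using x by blast
  qed
  then show "\<exists>\<Psi>. eventually (\<lambda>x. \<Psi> x \<in> Cn d \<and> (\<forall>j<d. cdiff d (\<lambda>x. \<Psi> x j) x) \<and>
      (\<forall>y\<in>Lambda d. y = x \<longrightarrow> pr d y \<in> multiplier_class d ` base \<and> (\<exists>y'\<in>Lambda d. y' = \<Psi> x \<and> pr d y' = transport_tilde (pr d y)))) (near d l)"
    by (rule exI[of _ ?\<Psi>])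
qed

lemma transport_lambda_local_lift:
  "local_lift d (\<lambda>l. l) (Lambda d) (\<lambda>l. l) d (\<lambda>l. l) (Lambda d) (\<lambda>l. l) (multipliers d ` base) transport_lambda"
  unfolding local_lift_def
proof (intro ballI impI)
  fix l assume l: "l \<in> Lambda d" "l \<in> multipliers d ` base"
  then obtain m where m: "m \<in> base" "l = multipliers d (m \<circ> id)" by auto
  let ?\<Psi> = "\<lambda>x. multipliers d (\<lambda>i. residues d x i + p 1 * w (id i))"
  have "eventually (\<lambda>x. ?\<Psi> x \<in> Cn d \<and> (\<forall>j<d. cdiff d (\<lambda>x. ?\<Psi> x j) x) \<and>
      (\<forall>y\<in>Lambda d. y = x \<longrightarrow> y \<in> multipliers d ` base \<and> (\<exists>y'\<in>Lambda d. y' = ?\<Psi> x \<and> y' = transport_lambda y))) (near d l)"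
    unfolding m(2) using residue_shift_near[OF m(1) permutes_id]
  proof (rule eventually_mono)
    fix x assume x: "?\<Psi> x \<in> Cn d \<and> (\<forall>j<d. cdiff d (\<lambda>x. ?\<Psi> x j) x) \<and>
     (x \<in> Lambda d \<longrightarrow> residues d x \<circ> inv id \<in> base \<and> x = multipliers d (residues d x) \<and>
        ?\<Psi> x = multipliers d (shift (residues d x \<circ> inv id) 1 \<circ> id))"
    have "x \<in> multipliers d ` base \<and> ?\<Psi> x \<in> Lambda d \<and> ?\<Psi> x = transport_lambda x" if xL: "x \<in> Lambda d"
    proof -
      have u: "residues d x \<in> base" "x = multipliers d (residues d x)" "?\<Psi> x = multipliers d (shift (residues d x) 1)"
        using x xL by auto
      then show ?thesis using multipliers_Lambda[OF shift_Res[OF u(1), of 1]] by (auto simp: transport_lambda_def)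
    qed
    then show "?\<Psi> x \<in> Cn d \<and> (\<forall>j<d. cdiff d (\<lambda>x. ?\<Psi> x j) x) \<and>
      (\<forall>y\<in>Lambda d. y = x \<longrightarrow> y \<in> multipliers d ` base \<and> (\<exists>y'\<in>Lambda d. y' = ?\<Psi> x \<and> y' = transport_lambda y))"
      using x by blast
  qed
  then show "\<exists>\<Psi>. eventually (\<lambda>x. \<Psi> x \<in> Cn d \<and> (\<forall>j<d. cdiff d (\<lambda>x. \<Psi> x j) x) \<and>
      (\<forall>y\<in>Lambda d. y = x \<longrightarrow> y \<in> multipliers d ` base \<and> (\<exists>y'\<in>Lambda d. y' = \<Psi> x \<and> y' = transport_lambda y))) (near d l)"
    by (rule exI[of _ ?\<Psi>])
qed

end

context transport
begin

lemma base_image_subset: "multiplier_class d ` base \<subseteq> pr d ` Lambda d"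
  using base_subset multipliers_Lambda by (auto simp: multiplier_class_def)

lemma transport_lambda_multipliers: "m \<in> base \<Longrightarrow> transport_lambda (multipliers d m) = multipliers d (shift m 1)"
  using residues_multipliers[of m d] base_subset Res_Cn by (auto simp: transport_lambda_def)

lemma openin_base_V_tilde: "openin (Lambda_tilde_sub d (V_tilde d)) (multiplier_class d ` base)"
proof -
  have "openin (cs_top (Lambda_tilde_space d)) (multiplier_class d ` base)"
    unfolding base_def by (rule openin_multiplier_class_polydisc)
  moreover have "multiplier_class d ` base \<subseteq> V_tilde d" using base_subset by (auto simp: V_tilde_eq)
  ultimately show ?thesis by (metis openin_subtopology_Int2 Int_absorb1)
qed

interpretation rev: transport d "shift m0 1" eps w "\<lambda>t. p (1 - t) - p 1"
  by (rule reverse)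

lemma rev_shift: "rev.shift (shift m 1) t = shift m (1 - t)"
  by (simp add: rev.shift_def shift_def fun_eq_iff algebra_simps)

lemma shift_rev_shift: "shift (rev.shift m 1) 1 = m"
  by (simp add: rev.shift_def shift_def fun_eq_iff p0)

lemma shift_in_rev_base: "m \<in> base \<Longrightarrow> shift m 1 \<in> rev.base"
proof -
  assume m: "m \<in> base"
  have "shift m 1 \<in> Res d" by (rule shift_Res[OF m]) simp
  moreover have "shift m 1 \<in> polydisc d (shift m0 1) eps"
    using m w by (auto simp: base_def polydisc_def shift_def Cn_def)
  ultimately show ?thesis by (simp add: rev.base_def)
qed

lemma rev_shift_in_base: "m \<in> rev.base \<Longrightarrow> rev.shift m 1 \<in> base"
proof -
  assume m: "m \<in> rev.base"
  have "rev.shift m 1 \<in> Res d" by (rule rev.shift_Res[OF m]) simp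
  moreover have "m \<in> polydisc d (shift m0 1) eps" using m by (simp add: rev.base_def)
  then have "rev.shift m 1 \<in> polydisc d m0 eps"
    using w p0 by (auto simp: polydisc_def rev.shift_def shift_def Cn_def algebra_simps)
  ultimately show ?thesis by (simp add: base_def)
qed

lemma continuous_on_reverse: "continuous_on {0..1::real} g \<Longrightarrow> continuous_on {0..1} (\<lambda>t. g (1 - t))"
  by (rule continuous_on_compose2[of "{0..1}" g]) (auto intro!: continuous_intros)

lemma transported_reverse: "transported m z z' \<Longrightarrow> rev.transported (shift m 1) z' z"
proof -
  assume "transported m z z'"
  then obtain g where g: "is_lift m {0..1} g" "g 0 = z" "g 1 = z'" by (auto simp: transported_def)
  have "rev.is_lift (shift m 1) {0..1} (\<lambda>t. g (1 - t))"
    unfolding rev.is_lift_def rev_shift using g(1) continuous_on_reverse by (auto simp: is_lift_def)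
  then show ?thesis unfolding rev.transported_def using g by (intro exI[of _ "\<lambda>t. g (1 - t)"]) auto
qed

lemma transported_reverse': "rev.transported m z z' \<Longrightarrow> transported (rev.shift m 1) z' z"
proof -
  assume "rev.transported m z z'"
  then obtain g where g: "rev.is_lift m {0..1} g" "g 0 = z" "g 1 = z'" by (auto simp: rev.transported_def)
  have shift: "shift (rev.shift m 1) t = rev.shift m (1 - t)" for t
    by (simp add: rev.shift_def shift_def fun_eq_iff algebra_simps p0)
  have "is_lift (rev.shift m 1) {0..1} (\<lambda>t. g (1 - t))"
    unfolding is_lift_def shift using g(1) continuous_on_reverse by (auto simp: rev.is_lift_def)
  then show ?thesis unfolding transported_def using g by (intro exI[of _ "\<lambda>t. g (1 - t)"]) auto
qed

lemma Phi_transport_class: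
  assumes "c \<in> Phi_preimage d (multiplier_class d ` base)"
  shows "Phi (transport_class c) = transport_tilde (Phi c)" "transport_class c \<in> Phi_preimage d (multiplier_class d ` rev.base)"
    "rev.transport_class (transport_class c) = c"
proof -
  obtain m z z' where m: "m \<in> base" "z \<in> config d m" "transported m z z'" "c = config_class d m z"
    using class_over_base[OF assms] by blast
  have mR: "m \<in> Res d" using m(1) base_subset by auto
  have shR: "shift m 1 \<in> Res d" by (rule shift_Res[OF m(1)]) simp
  have z': "z' \<in> config d (shift m 1)" using transported_config[OF m(3)] by blast
  have lc: "transport_class c = config_class d (shift m 1) z'" using transport_class_eq[OF m(1,3)] m(4) by simp
  have "Phi c = multiplier_class d m" unfolding m(4) multiplier_class_def by (rule Phi_config_class[OF d mR m(2)])
  moreover have "Phi (transport_class c) = multiplier_class d (shift m 1)" unfolding lc multiplier_class_def by (rule Phi_config_class[OF d shR z'])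
  ultimately show "Phi (transport_class c) = transport_tilde (Phi c)" using transport_tilde_eq[OF m(1)] by simp
  show "transport_class c \<in> Phi_preimage d (multiplier_class d ` rev.base)"
    unfolding lc using config_class_in_MP[OF d shR z'] Phi_config_class[OF d shR z'] shift_in_rev_base[OF m(1)]
    by (auto simp: Phi_preimage_def multiplier_class_def)
  show "rev.transport_class (transport_class c) = c"
    by (simp add: lc rev.transport_class_eq[OF shift_in_rev_base[OF m(1)] transported_reverse[OF m(3)]] rev_shift shift_0 m(4)[symmetric])
qed

lemma rev_transport_class:
  assumes "c \<in> Phi_preimage d (multiplier_class d ` rev.base)"
  shows "rev.transport_class c \<in> Phi_preimage d (multiplier_class d ` base)" "transport_class (rev.transport_class c) = c"
proof -
  obtain m z z' where m: "m \<in> rev.base" "z \<in> config d m" "rev.transported m z z'" "c = config_class d m z"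
    using rev.class_over_base[OF assms] by blast
  have shb: "rev.shift m 1 \<in> base" by (rule rev_shift_in_base[OF m(1)])
  have shR: "rev.shift m 1 \<in> Res d" using shb base_subset by auto
  have z': "z' \<in> config d (rev.shift m 1)" using rev.transported_config[OF m(3)] by blast
  have lc: "rev.transport_class c = config_class d (rev.shift m 1) z'" using rev.transport_class_eq[OF m(1,3)] m(4) by simp
  show "rev.transport_class c \<in> Phi_preimage d (multiplier_class d ` base)"
    unfolding lc using config_class_in_MP[OF d shR z'] Phi_config_class[OF d shR z'] shb by (auto simp: Phi_preimage_def multiplier_class_def)
  show "transport_class (rev.transport_class c) = c"
    by (simp only: lc transport_class_eq[OF shb transported_reverse'[OF m(3)]] shift_rev_shift m(4)[symmetric])
qed

lemma MP_eq_image: "MP d = moduli_class d ` Poly_deg d"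
  by (auto simp: MP_def quotient_def moduli_class_def)

lemma biholomorphic_transport_class:
  "biholomorphic_between (MP_space d) (Phi_preimage d (multiplier_class d ` base)) (MP_space d) (Phi_preimage d (multiplier_class d ` rev.base)) transport_class"
  unfolding MP_space_def Poly_space_def
  by (rule biholomorphic_between_local_lift[OF Poly_deg_coeff_Cn Poly_deg_coeff_Cn _ _
        transport_class_local_lift rev.transport_class_local_lift])
    (auto simp: Phi_transport_class rev_transport_class, auto simp: Phi_preimage_def MP_eq_image)

lemma biholomorphic_transport_tilde:
  "biholomorphic_between (Lambda_tilde_space d) (multiplier_class d ` base) (Lambda_tilde_space d) (multiplier_class d ` rev.base) transport_tilde"
  unfolding Lambda_tilde_space_def Lambda_space_def
proof (rule biholomorphic_between_local_lift[OF Lambda_subset_Cn Lambda_subset_Cn base_image_subset rev.base_image_subset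
        transport_tilde_local_lift rev.transport_tilde_local_lift])
  fix x assume "x \<in> multiplier_class d ` base"
  then obtain m where m: "m \<in> base" "x = multiplier_class d m" by auto
  show "transport_tilde x \<in> multiplier_class d ` rev.base" "rev.transport_tilde (transport_tilde x) = x"
    using transport_tilde_eq[OF m(1)] shift_in_rev_base[OF m(1)] rev.transport_tilde_eq[OF shift_in_rev_base[OF m(1)]] m(2)
    by (auto simp: rev_shift shift_0)
next
  fix x assume "x \<in> multiplier_class d ` rev.base"
  then obtain m where m: "m \<in> rev.base" "x = multiplier_class d m" by auto
  show "rev.transport_tilde x \<in> multiplier_class d ` base" "transport_tilde (rev.transport_tilde x) = x"
    using rev.transport_tilde_eq[OF m(1)] rev_shift_in_base[OF m(1)] transport_tilde_eq[OF rev_shift_in_base[OF m(1)]] m(2)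
    by (auto simp: shift_rev_shift)
qed

lemma biholomorphic_transport_lambda:
  "biholomorphic_between (Lambda_space d) (multipliers d ` base) (Lambda_space d) (multipliers d ` rev.base) transport_lambda"
  unfolding Lambda_space_def
proof (rule biholomorphic_between_quotient_id[OF Lambda_subset_Cn Lambda_subset_Cn],
    rule biholomorphic_between_local_lift[OF Lambda_subset_Cn Lambda_subset_Cn _ _ transport_lambda_local_lift rev.transport_lambda_local_lift])
  show "multipliers d ` base \<subseteq> (\<lambda>l. l) ` Lambda d" "multipliers d ` rev.base \<subseteq> (\<lambda>l. l) ` Lambda d"
    using base_subset rev.base_subset multipliers_Lambda by auto
next
  fix x assume "x \<in> multipliers d ` base"
  then obtain m where m: "m \<in> base" "x = multipliers d m" by auto
  show "transport_lambda x \<in> multipliers d ` rev.base" "rev.transport_lambda (transport_lambda x) = x"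
    using transport_lambda_multipliers[OF m(1)] shift_in_rev_base[OF m(1)] rev.transport_lambda_multipliers[OF shift_in_rev_base[OF m(1)]] m(2)
    by (auto simp: rev_shift shift_0)
next
  fix x assume "x \<in> multipliers d ` rev.base"
  then obtain m where m: "m \<in> rev.base" "x = multipliers d m" by auto
  show "rev.transport_lambda x \<in> multipliers d ` base" "transport_lambda (rev.transport_lambda x) = x"
    using rev.transport_lambda_multipliers[OF m(1)] rev_shift_in_base[OF m(1)] transport_lambda_multipliers[OF rev_shift_in_base[OF m(1)]] m(2)
    by (auto simp: shift_rev_shift)
qed

lemma transport_lambda_type:
  assumes "l \<in> multipliers d ` base"
  shows "pr d (transport_lambda l) = transport_tilde (pr d l)" "I_set d l = I_set d (transport_lambda l)" "K_set d l = K_set d (transport_lambda l)"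
proof -
  obtain m where m: "m \<in> base" "l = multipliers d m" using assms by auto
  show "pr d (transport_lambda l) = transport_tilde (pr d l)"
    using transport_lambda_multipliers[OF m(1)] transport_tilde_eq[OF m(1)] m(2) by (simp add: multiplier_class_def)
  have "m \<in> Res d" "shift m 1 \<in> Res d" using m(1) base_subset shift_Res[OF m(1), of 1] by auto
  moreover have "zero_forms d m = zero_forms d (shift m 1)" using zero_forms_shift[OF m(1), of 1] by simp
  ultimately show "I_set d l = I_set d (transport_lambda l)" "K_set d l = K_set d (transport_lambda l)"
    unfolding m(2) transport_lambda_multipliers[OF m(1)] using zero_forms_eq_iff_IK by blast+
qed

lemma local_isomorphism_of_transport:
  "\<exists>Ut Ut' U U' LL Lt L.
     openin (Lambda_tilde_sub d (V_tilde d)) Ut \<and> multiplier_class d m0 \<in> Ut \<and>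
     openin (Lambda_tilde_sub d (V_tilde d)) Ut' \<and> multiplier_class d (shift m0 1) \<in> Ut' \<and>
     U = connected_component_of_set (subtopology (cs_top (Lambda_space d)) (pr_preimage d Ut)) (multipliers d m0) \<and>
     U' = connected_component_of_set (subtopology (cs_top (Lambda_space d)) (pr_preimage d Ut')) (multipliers d (shift m0 1)) \<and>
     biholomorphic_between (MP_space d) (Phi_preimage d Ut) (MP_space d) (Phi_preimage d Ut') LL \<and>
     biholomorphic_between (Lambda_tilde_space d) Ut (Lambda_tilde_space d) Ut' Lt \<and>
     biholomorphic_between (Lambda_space d) U (Lambda_space d) U' L \<and>
     L (multipliers d m0) = multipliers d (shift m0 1) \<and>
     (\<forall>c\<in>Phi_preimage d Ut. Phi (LL c) = Lt (Phi c)) \<and>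
     (\<forall>m\<in>U. pr d (L m) = Lt (pr d m)) \<and>
     (\<forall>m\<in>U. I_set d m = I_set d (L m) \<and> K_set d m = K_set d (L m))"
  using openin_base_V_tilde rev.openin_base_V_tilde m0_base rev.m0_base component_base rev.component_base
    biholomorphic_transport_class biholomorphic_transport_tilde biholomorphic_transport_lambda
    transport_lambda_multipliers[OF m0_base] Phi_transport_class(1) transport_lambda_type
  by (intro exI[of _ "multiplier_class d ` base"] exI[of _ "multiplier_class d ` rev.base"] exI[of _ "multipliers d ` base"]
      exI[of _ "multipliers d ` rev.base"] exI[of _ transport_class] exI[of _ transport_tilde] exI[of _ transport_lambda]
      conjI ballI) auto

end

text \<open>The path of \<open>stratum_path\<close> and the radius of \<open>stratum_tube\<close> make the translation from the residues
  of \<open>l\<close> to those of \<open>l'\<close> an instance of \<open>transport\<close>.\<close>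

lemma local_isomorphism:
  assumes d: "d \<ge> 2" and l: "l \<in> V d" "l' \<in> V d" and IK: "I_set d l = I_set d l'" "K_set d l = K_set d l'"
  shows "\<exists>Ut Ut' U U' LL Lt L.
     openin (Lambda_tilde_sub d (V_tilde d)) Ut \<and> pr d l \<in> Ut \<and>
     openin (Lambda_tilde_sub d (V_tilde d)) Ut' \<and> pr d l' \<in> Ut' \<and>
     U = connected_component_of_set (subtopology (cs_top (Lambda_space d)) (pr_preimage d Ut)) l \<and>
     U' = connected_component_of_set (subtopology (cs_top (Lambda_space d)) (pr_preimage d Ut')) l' \<and>
     biholomorphic_between (MP_space d) (Phi_preimage d Ut) (MP_space d) (Phi_preimage d Ut') LL \<and>
     biholomorphic_between (Lambda_tilde_space d) Ut (Lambda_tilde_space d) Ut' Lt \<and>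
     biholomorphic_between (Lambda_space d) U (Lambda_space d) U' L \<and>
     L l = l' \<and>
     (\<forall>c\<in>Phi_preimage d Ut. Phi (LL c) = Lt (Phi c)) \<and>
     (\<forall>m\<in>U. pr d (L m) = Lt (pr d m)) \<and>
     (\<forall>m\<in>U. I_set d m = I_set d (L m) \<and> K_set d m = K_set d (L m))"
proof -
  define m where "m = residues d l"
  define m' where "m' = residues d l'"
  have mR: "m \<in> Res d" "m' \<in> Res d" using l residues_in_Res by (auto simp: m_def m'_def)
  have lm: "multipliers d m = l" "multipliers d m' = l'" using l multipliers_residues by (auto simp: m_def m'_def)
  have zt: "zero_forms d m = zero_forms d m'" using zero_forms_eq_iff_IK[OF mR] IK lm by simp
  obtain p where p: "continuous_on {0..1::real} p" "p 0 = (0::complex)" "p 1 = 1"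
    "\<And>t. t \<in> {0..1} \<Longrightarrow> zero_forms d (\<lambda>i. m i + p t * (m' i - m i)) = zero_forms d m"
    using stratum_path[OF zt] by blast
  have d0: "d > 0" using d by simp
  obtain e where e: "e > 0" "\<And>u t. u \<in> polydisc d m e \<Longrightarrow> t \<in> {0..1} \<Longrightarrow> zero_forms d (\<lambda>i. u i + p t * (m' i - m i)) = zero_forms d u"
    "\<And>t j k. t \<in> {0..1} \<Longrightarrow> j < d \<Longrightarrow> k < d \<Longrightarrow> m j \<noteq> m k \<Longrightarrow> 2 * e \<le> cmod ((m j + p t * (m' j - m j)) - (m k + p t * (m' k - m k)))"
    "\<And>t i. t \<in> {0..1} \<Longrightarrow> i < d \<Longrightarrow> m i \<noteq> 0 \<Longrightarrow> e \<le> cmod (m i + p t * (m' i - m i))"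
    using stratum_tube[OF d0 p(1,2) p(4)] by blast
  interpret transport d m e "\<lambda>i. m' i - m i" p
  proof
    show "(\<lambda>i. m' i - m i) \<in> Cn d" using mR by (auto simp: Res_def Cn_def)
    show "2 * e \<le> cmod (m j - m k)" if "j < d" "k < d" "m j \<noteq> m k" for j k
      using e(3)[of 0 j k] that p(2) by simp
    show "2 * e \<le> cmod (m j + p 1 * (m' j - m j) - (m k + p 1 * (m' k - m k)))" if "j < d" "k < d" "m j \<noteq> m k" for j k
      using e(3)[of 1 j k] that by simp
    show "e \<le> cmod (m i)" if "i < d" for i using e(4)[of 0 i] that p(2) mR(1) by (auto simp: Res_def)
    show "e \<le> cmod (m i + p 1 * (m' i - m i))" if "i < d" for i using e(4)[of 1 i] that mR(1) by (auto simp: Res_def)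
    show "zero_forms d (\<lambda>i. u i + p t * (m' i - m i)) = zero_forms d u" if "u \<in> polydisc d m e" "t \<in> {0..1}" for u t
      by (rule e(2)[OF that])
  qed (use d mR(1) e(1) p in auto)
  have "shift m 1 = m'" by (simp add: shift_def p(3))
  then show ?thesis
    using local_isomorphism_of_transport lm by (simp add: multiplier_class_def)
qed

section \<open>Proper local homeomorphisms\<close>

lemma Hausdorff_finite_disjoint_nbhds:
  assumes H: "Hausdorff_space X" and F: "finite F" "F \<subseteq> topspace X"
  obtains G where "\<And>x. x \<in> F \<Longrightarrow> openin X (G x) \<and> x \<in> G x" "\<And>x y. x \<in> F \<Longrightarrow> y \<in> F \<Longrightarrow> x \<noteq> y \<Longrightarrow> disjnt (G x) (G y)"
proof -
  have "\<exists>U V. x \<in> F \<longrightarrow> y \<in> F \<longrightarrow> x \<noteq> y \<longrightarrow> openin X U \<and> openin X V \<and> x \<in> U \<and> y \<in> V \<and> disjnt U V" for x y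
    using H F(2) unfolding Hausdorff_space_def by (metis subsetD)
  then obtain U V where UV: "\<And>x y. x \<in> F \<Longrightarrow> y \<in> F \<Longrightarrow> x \<noteq> y \<Longrightarrow>
      openin X (U x y) \<and> openin X (V x y) \<and> x \<in> U x y \<and> y \<in> V x y \<and> disjnt (U x y) (V x y)"
    by metis
  define G where "G x = topspace X \<inter> (\<Inter>y\<in>F - {x}. U x y \<inter> V y x)" for x
  show ?thesis
  proof (rule that[of G])
    fix x assume x: "x \<in> F"
    have "openin X (topspace X \<inter> (\<Inter>y\<in>F - {x}. U x y \<inter> V y x))"
    proof (cases "F - {x} = {}")
      case False
      then have "openin X (\<Inter>y\<in>F - {x}. U x y \<inter> V y x)"
        using F(1) UV x by (intro openin_INT2) (auto intro: openin_Int)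
      then show ?thesis by (intro openin_Int openin_topspace)
    next
      case True
      show ?thesis unfolding True by simp
    qed
    moreover have "x \<in> G x" using UV x F(2) by (auto simp: G_def)
    ultimately show "openin X (G x) \<and> x \<in> G x" by (simp add: G_def)
  next
    fix x y assume xy: "x \<in> F" "y \<in> F" "x \<noteq> y"
    then have "G x \<subseteq> U x y" "G y \<subseteq> V x y" by (auto simp: G_def)
    then show "disjnt (G x) (G y)" using UV[OF xy] by (meson disjnt_subset1 disjnt_subset2)
  qed
qed

lemma local_homeomorphism_open_image:
  assumes "locally_homeomorphic_map X Y f" "openin X U"
  shows "openin Y (f ` U)"
proof (subst openin_subopen, intro ballI)
  fix y assume "y \<in> f ` U"
  then obtain x where x: "x \<in> U" "y = f x" by auto
  then have "x \<in> topspace X" using assms(2) openin_subset by blast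
  then obtain W T where WT: "openin X W" "x \<in> W" "openin Y T" "homeomorphic_map (subtopology X W) (subtopology Y T) f"
    using assms(1) unfolding locally_homeomorphic_map_def by blast
  have "openin (subtopology X W) (W \<inter> U)" using assms(2) by (rule openin_subtopology_Int2)
  then have "openin (subtopology Y T) (f ` (W \<inter> U))"
    using homeomorphic_imp_open_map[OF WT(4)] by (auto simp: open_map_def)
  then have "openin Y (f ` (W \<inter> U))" using WT(3) openin_trans_full by blast
  then show "\<exists>T. openin Y T \<and> y \<in> T \<and> T \<subseteq> f ` U" using x WT(2) by (intro exI[of _ "f ` (W \<inter> U)"]) auto
qed

text \<open>A proper local homeomorphism is evenly covered: shrink the target to a connected set that misses
  the image of the closed complement of small disjoint neighbourhoods of the points of a fibre. The
  sheets are connected, so each of them lies in one component of the source.\<close>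

lemma proper_local_homeomorphism_component_covering:
  assumes cont: "continuous_map X Y f" and proper: "proper_map X Y f" and loc: "locally_homeomorphic_map X Y f"
    and H: "Hausdorff_space X" and fin: "\<And>y. y \<in> topspace Y \<Longrightarrow> finite {x \<in> topspace X. f x = y}"
    and Y: "connected_space Y"
    and Yloc: "\<And>y T. openin Y T \<Longrightarrow> y \<in> T \<Longrightarrow> \<exists>T'. openin Y T' \<and> y \<in> T' \<and> T' \<subseteq> T \<and> connectedin Y T'"
    and C: "C \<in> connected_components_of X"
  shows "covering_map (subtopology X C) Y f"
proof -
  have CX: "C \<subseteq> topspace X" using C by (rule connected_components_of_subset)
  have Ccon: "connectedin X C" using C by (rule connectedin_connected_components_of)
  have tC: "topspace (subtopology X C) = C" using CX by auto
  have even: "\<exists>T. y \<in> T \<and> openin Y T \<and> (\<exists>\<V>. \<Union>\<V> = {x \<in> C. f x \<in> T} \<and> (\<forall>W\<in>\<V>. openin (subtopology X C) W) \<and> pairwise disjnt \<V> \<and>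
             (\<forall>W\<in>\<V>. homeomorphic_map (subtopology (subtopology X C) W) (subtopology Y T) f \<and> f ` W = T))"
    if y: "y \<in> topspace Y" for y
  proof -
    define F where "F = {x \<in> topspace X. f x = y}"
    have F: "finite F" "F \<subseteq> topspace X" using fin[OF y] by (auto simp: F_def)
    obtain G0 where G0: "\<And>x. x \<in> F \<Longrightarrow> openin X (G0 x) \<and> x \<in> G0 x" "\<And>x y. x \<in> F \<Longrightarrow> y \<in> F \<Longrightarrow> x \<noteq> y \<Longrightarrow> disjnt (G0 x) (G0 y)"
      using Hausdorff_finite_disjoint_nbhds[OF H F] by blast
    have "\<forall>x\<in>F. \<exists>W. openin X W \<and> x \<in> W \<and> (\<exists>T. openin Y T \<and> homeomorphic_map (subtopology X W) (subtopology Y T) f)"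
      using loc F(2) unfolding locally_homeomorphic_map_def by blast
    from bchoice[OF this] obtain W where W: "\<And>x. x \<in> F \<Longrightarrow> openin X (W x) \<and> x \<in> W x \<and>
        (\<exists>T. openin Y T \<and> homeomorphic_map (subtopology X (W x)) (subtopology Y T) f)" by blast
    define G where "G x = W x \<inter> G0 x" for x
    have G: "openin X (G x)" "x \<in> G x" if "x \<in> F" for x using W[OF that] G0(1)[OF that] by (auto simp: G_def)
    have Gd: "disjnt (G x) (G z)" if "x \<in> F" "z \<in> F" "x \<noteq> z" for x z
      using G0(2)[OF that] by (auto simp: G_def disjnt_def)
    \<comment> \<open>\<open>N\<close> is closed and misses the fibre, so its image does not contain \<open>y\<close>\<close>
    define N where "N = topspace X - \<Union>(G ` F)"
    have "closedin X N" unfolding N_def using G(1) by (intro closedin_diff closedin_topspace openin_Union) auto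
    then have fN: "closedin Y (f ` N)" using proper by (auto simp: proper_map_def closed_map_def)
    have yN: "y \<notin> f ` N" using G(2) by (auto simp: N_def F_def)
    have "openin Y (topspace Y \<inter> \<Inter>((\<lambda>x. f ` G x) ` F))"
    proof (cases "F = {}")
      case False
      then have "openin Y (\<Inter>((\<lambda>x. f ` G x) ` F))"
        using F(1) G(1) local_homeomorphism_open_image[OF loc] by (intro openin_Inter) auto
      then show ?thesis by (intro openin_Int openin_topspace)
    qed simp
    then have o1: "openin Y ((topspace Y \<inter> \<Inter>((\<lambda>x. f ` G x) ` F)) - f ` N)" using fN by (rule openin_diff)
    have o2: "y \<in> (topspace Y \<inter> \<Inter>((\<lambda>x. f ` G x) ` F)) - f ` N"
    proof (intro DiffI IntI INT_I)
      fix x assume "x \<in> F"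
      then show "y \<in> f ` G x" using G(2)[of x] by (intro image_eqI[of _ _ x]) (auto simp: F_def)
    qed (use y yN in auto)
    obtain T where T: "openin Y T" "y \<in> T" "T \<subseteq> (topspace Y \<inter> \<Inter>((\<lambda>x. f ` G x) ` F)) - f ` N" "connectedin Y T"
      using Yloc[OF o1 o2] by blast
    define S where "S x = {u \<in> G x. f u \<in> T}" for x
    have Sopen: "openin X (S x)" if "x \<in> F" for x
    proof -
      have "S x = G x \<inter> {u \<in> topspace X. f u \<in> T}" using openin_subset[OF G(1)[OF that]] by (auto simp: S_def)
      then show ?thesis using G(1)[OF that] openin_continuous_map_preimage[OF cont T(1)] by (simp add: openin_Int)
    qed
    have Simg: "f ` S x = T" if "x \<in> F" for x
    proof -
      have "T \<subseteq> f ` G x" using T(3) that by blast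
      then show ?thesis unfolding S_def by blast
    qed
    have Shom: "homeomorphic_map (subtopology X (S x)) (subtopology Y T) f" if x: "x \<in> F" for x
    proof -
      obtain T' where T': "openin Y T'" "homeomorphic_map (subtopology X (W x)) (subtopology Y T') f" using W[OF x] by blast
      have SW: "S x \<subseteq> W x" by (auto simp: S_def G_def)
      have WX: "W x \<subseteq> topspace X" using W[OF x] openin_subset by blast
      have "f ` (topspace X \<inter> W x) = topspace Y \<inter> T'" using homeomorphic_imp_surjective_map[OF T'(2)] by simp
      then have TT: "T \<subseteq> T'" using Simg[OF x] SW WX by blast
      have "homeomorphic_map (subtopology (subtopology X (W x)) (S x)) (subtopology (subtopology Y T') T) f"
      proof (rule homeomorphic_map_subtopologies[OF T'(2)])
        show "f ` (topspace (subtopology X (W x)) \<inter> S x) = topspace (subtopology Y T') \<inter> T"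
          using Simg[OF x] SW WX TT openin_subset[OF T(1)] by (auto simp: Int_absorb1)
      qed
      moreover have "W x \<inter> S x = S x" "T' \<inter> T = T" using SW TT by auto
      ultimately show ?thesis by (simp add: subtopology_subtopology)
    qed
    have Scon: "connectedin X (S x)" if x: "x \<in> F" for x
    proof -
      have SX: "S x \<subseteq> topspace X" using openin_subset[OF Sopen[OF x]] .
      have "subtopology X (S x) homeomorphic_space subtopology Y T"
        using Shom[OF x] by (metis homeomorphic_map_imp_homeomorphic_space)
      then show ?thesis using T(4) SX openin_subset[OF T(1)] homeomorphic_connected_space by (auto simp: connectedin_def)
    qed
    have cover: "{x \<in> topspace X. f x \<in> T} = \<Union>(S ` F)"
    proof
      show "{x \<in> topspace X. f x \<in> T} \<subseteq> \<Union>(S ` F)"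
      proof
        fix u assume u: "u \<in> {x \<in> topspace X. f x \<in> T}"
        then have "u \<notin> N" using T(3) by auto
        then show "u \<in> \<Union>(S ` F)" using u by (auto simp: N_def S_def)
      qed
      show "\<Union>(S ` F) \<subseteq> {x \<in> topspace X. f x \<in> T}" using openin_subset[OF Sopen] by (auto simp: S_def)
    qed
    have SC: "S x \<subseteq> C \<or> disjnt (S x) C" if "x \<in> F" for x
      using connected_components_of_maximal[OF C Scon[OF that]] disjnt_sym by blast
    define \<V> where "\<V> = S ` {x \<in> F. S x \<subseteq> C}"
    have "\<Union>\<V> = {x \<in> C. f x \<in> T}"
    proof
      show "\<Union>\<V> \<subseteq> {x \<in> C. f x \<in> T}" by (auto simp: \<V>_def S_def)
      show "{x \<in> C. f x \<in> T} \<subseteq> \<Union>\<V>"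
      proof
        fix u assume u: "u \<in> {x \<in> C. f x \<in> T}"
        then have "u \<in> \<Union>(S ` F)" using cover CX by blast
        then obtain x where x: "x \<in> F" "u \<in> S x" by blast
        then have "S x \<subseteq> C" using SC[OF x(1)] u by (auto simp: disjnt_def)
        then show "u \<in> \<Union>\<V>" using x by (auto simp: \<V>_def)
      qed
    qed
    moreover have "\<forall>W\<in>\<V>. openin (subtopology X C) W"
    proof
      fix Q assume "Q \<in> \<V>"
      then obtain x where x: "x \<in> F" "S x \<subseteq> C" "Q = S x" by (auto simp: \<V>_def)
      have "openin (subtopology X C) (C \<inter> S x)" by (rule openin_subtopology_Int2[OF Sopen[OF x(1)]])
      then show "openin (subtopology X C) Q" using x by (simp add: Int_absorb1)
    qed
    moreover have "pairwise disjnt \<V>"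
      unfolding pairwise_def \<V>_def using Gd by (auto simp: S_def disjnt_def)
    moreover have "\<forall>W\<in>\<V>. homeomorphic_map (subtopology (subtopology X C) W) (subtopology Y T) f \<and> f ` W = T"
      using Shom Simg by (auto simp: \<V>_def subtopology_subtopology Int_absorb1)
    ultimately show ?thesis using T(1,2) by (intro exI[of _ T] conjI exI[of _ \<V>]) blast+
  qed
  have sub: "f ` C \<subseteq> topspace Y" using cont CX by (auto simp: continuous_map_def)
  have surj: "f ` C = topspace Y"
  proof (rule ccontr)
    assume ne: "f ` C \<noteq> topspace Y"
    have "openin Y (f ` C)" and "openin Y (topspace Y - f ` C)"
    proof -
      have *: "\<exists>T. y \<in> T \<and> openin Y T \<and> (T \<subseteq> f ` C \<or> disjnt T (f ` C))" if y: "y \<in> topspace Y" for y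
      proof -
        from even[OF y] obtain T where T0: "y \<in> T \<and> openin Y T \<and> (\<exists>\<V>. \<Union>\<V> = {x \<in> C. f x \<in> T} \<and>
             (\<forall>W\<in>\<V>. openin (subtopology X C) W) \<and> pairwise disjnt \<V> \<and>
             (\<forall>W\<in>\<V>. homeomorphic_map (subtopology (subtopology X C) W) (subtopology Y T) f \<and> f ` W = T))"
          by (rule exE)
        note T12 = conjunct1[OF T0] conjunct1[OF conjunct2[OF T0]] and ex = conjunct2[OF conjunct2[OF T0]]
        from ex obtain \<V> where V0: "\<Union>\<V> = {x \<in> C. f x \<in> T} \<and> (\<forall>W\<in>\<V>. openin (subtopology X C) W) \<and>
             pairwise disjnt \<V> \<and> (\<forall>W\<in>\<V>. homeomorphic_map (subtopology (subtopology X C) W) (subtopology Y T) f \<and> f ` W = T)"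
          by (rule exE)
        have T34: "\<Union>\<V> = {x \<in> C. f x \<in> T}" "\<forall>W\<in>\<V>. f ` W = T"
          by (rule conjunct1[OF V0]) (use conjunct2[OF conjunct2[OF conjunct2[OF V0]]] in blast)
        note T = T12 T34
        show ?thesis
        proof (cases "\<V> = {}")
          case True
          then have "{x \<in> C. f x \<in> T} = {}" using T(3) by simp
          then have "disjnt T (f ` C)" by (auto simp: disjnt_def)
          then show ?thesis using T(1,2) by blast
        next
          case False
          then obtain W where "W \<in> \<V>" by blast
          then have "f ` W = T" "W \<subseteq> C" using T(3,4) by auto
          then show ?thesis using T(1,2) by blast
        qed
      qed
      show "openin Y (f ` C)"
      proof (subst openin_subopen, intro ballI)
        fix y assume y: "y \<in> f ` C"
        then obtain T where "y \<in> T" "openin Y T" "T \<subseteq> f ` C \<or> disjnt T (f ` C)" using * sub by blast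
        with y have "T \<subseteq> f ` C" unfolding disjnt_def by blast
        with \<open>y \<in> T\<close> \<open>openin Y T\<close> show "\<exists>T. openin Y T \<and> y \<in> T \<and> T \<subseteq> f ` C" by (intro exI[of _ T] conjI)
      qed
      show "openin Y (topspace Y - f ` C)"
      proof (subst openin_subopen, intro ballI)
        fix y assume y: "y \<in> topspace Y - f ` C"
        then obtain T where T: "y \<in> T" "openin Y T" "T \<subseteq> f ` C \<or> disjnt T (f ` C)" using * by blast
        have "T \<subseteq> topspace Y - f ` C" using T(1,3) y openin_subset[OF T(2)] unfolding disjnt_def by blast
        then show "\<exists>T. openin Y T \<and> y \<in> T \<and> T \<subseteq> topspace Y - f ` C" using T(1,2) by (intro exI[of _ T] conjI)
      qed
    qed
    moreover have "C \<noteq> {}" using C by (rule nonempty_connected_components_of)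
    moreover have "topspace Y - f ` C \<noteq> {}" using ne sub by blast
    moreover have "topspace Y \<subseteq> f ` C \<union> (topspace Y - f ` C)" "f ` C \<inter> (topspace Y - f ` C) = {}" by blast+
    ultimately show False using Y unfolding connected_space_def by blast
  qed
  show ?thesis
    unfolding covering_map_def tC
  proof (intro conjI ballI)
    show "continuous_map (subtopology X C) Y f" using cont by (rule continuous_map_from_subtopology)
    show "f ` C = topspace Y" by (rule surj)
    fix y assume "y \<in> topspace Y"
    from even[OF this] show "\<exists>T. y \<in> T \<and> openin Y T \<and> (\<exists>\<V>. \<Union>\<V> = {x \<in> C. f x \<in> T} \<and> (\<forall>W\<in>\<V>. openin (subtopology X C) W) \<and> pairwise disjnt \<V> \<and>
             (\<forall>W\<in>\<V>. homeomorphic_map (subtopology (subtopology X C) W) (subtopology Y T) f))"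
    proof (rule ex_forward, elim conjE, intro conjI)
      fix T
      assume "\<exists>\<V>. \<Union>\<V> = {x \<in> C. f x \<in> T} \<and> (\<forall>W\<in>\<V>. openin (subtopology X C) W) \<and> pairwise disjnt \<V> \<and>
             (\<forall>W\<in>\<V>. homeomorphic_map (subtopology (subtopology X C) W) (subtopology Y T) f \<and> f ` W = T)"
      then show "\<exists>\<V>. \<Union>\<V> = {x \<in> C. f x \<in> T} \<and> (\<forall>W\<in>\<V>. openin (subtopology X C) W) \<and> pairwise disjnt \<V> \<and>
             (\<forall>W\<in>\<V>. homeomorphic_map (subtopology (subtopology X C) W) (subtopology Y T) f)"
        by (rule ex_forward) (elim conjE, intro conjI, assumption+, rule ballI, drule (1) bspec, erule conjunct1)
    qed
  qed
qed

section \<open>The map \<open>\<Phi>\<close> over the strata\<close>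

definition I_res :: "nat \<Rightarrow> (nat \<Rightarrow> complex) \<Rightarrow> nat set set" where
  "I_res d m = I_set d (multipliers d m)"

definition K_res :: "nat \<Rightarrow> (nat \<Rightarrow> complex) \<Rightarrow> nat set set" where
  "K_res d m = K_set d (multipliers d m)"

lemma K_res_pair_iff:
  assumes "i < d" "j < d"
  shows "{i, j} \<in> K_res d w \<longleftrightarrow> w i = w j"
proof
  assume "{i, j} \<in> K_res d w"
  then have "\<forall>a\<in>{i, j}. \<forall>b\<in>{i, j}. w a = w b" unfolding K_res_def K_set_multipliers by blast
  then show "w i = w j" by blast
next
  assume w: "w i = w j"
  have "w a = w j" if "a \<in> {i, j}" for a using that w by blast
  then have "\<forall>a\<in>{i, j}. \<forall>b\<in>{i, j}. w a = w b" by presburger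
  moreover have "{i, j} \<subseteq> {..<d}" "{i, j} \<noteq> {}" using assms by auto
  ultimately show "{i, j} \<in> K_res d w" unfolding K_res_def K_set_multipliers by blast
qed

lemma eventually_zero_forms_subset: "eventually (\<lambda>u. zero_forms d u \<subseteq> zero_forms d m) (near d m)"
proof -
  have "eventually (\<lambda>u. \<forall>a\<in>forms d - zero_forms d m. lin d a u \<noteq> 0) (near d m)"
  proof (intro eventually_ball_finite ballI)
    fix a assume a: "a \<in> forms d - zero_forms d m"
    have "((\<lambda>u. lin d a u) \<longlongrightarrow> lin d a m) (near d m)"
      unfolding lin_def by (intro tendsto_sum tendsto_mult tendsto_const tendsto_coord_near) auto
    moreover have "lin d a m \<noteq> 0" using a by (auto simp: zero_forms_def)
    ultimately show "eventually (\<lambda>u. lin d a u \<noteq> 0) (near d m)" by (rule tendsto_imp_eventually_ne)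
  qed (use finite_forms in auto)
  then show ?thesis by (rule eventually_mono) (auto simp: zero_forms_def)
qed

lemma I_res_subset: "zero_forms d u \<subseteq> zero_forms d m \<Longrightarrow> I_res d u \<subseteq> I_res d m"
  using set_form_zero_forms[of _ d u] set_form_zero_forms[of _ d m] unfolding I_res_def I_set_multipliers by blast

lemma K_res_subset:
  assumes "zero_forms d u \<subseteq> zero_forms d m" shows "K_res d u \<subseteq> K_res d m"
proof -
  have "m j = m k" if "j < d" "k < d" "u j = u k" for j k
    using assms diff_form_zero_forms[OF that(1,2), of u] diff_form_zero_forms[OF that(1,2), of m] that(3) by blast
  then have "\<forall>i\<in>K. \<forall>j\<in>K. m i = m j" if "K \<subseteq> {..<d}" "\<forall>i\<in>K. \<forall>j\<in>K. u i = u j" for K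
    using that by (meson lessThan_iff subsetD)
  then show ?thesis unfolding K_res_def K_set_multipliers by blast
qed

lemma I_res_permute: "s permutes {..<d} \<Longrightarrow> J \<in> I_res d (m \<circ> s) \<Longrightarrow> s ` J \<in> I_res d m"
proof -
  assume s: "s permutes {..<d}" and "J \<in> I_res d (m \<circ> s)"
  then have J: "J \<subset> {..<d}" "J \<noteq> {}" "sum (m \<circ> s) J = 0" by (auto simp: I_res_def I_set_multipliers)
  have "s ` J \<subset> s ` {..<d}" using J(1) inj_image_subset_iff[OF permutes_inj[OF s]] by (simp add: psubset_eq inj_image_eq_iff[OF permutes_inj[OF s]])
  then have "s ` J \<subset> {..<d}" by (simp add: permutes_image[OF s])
  moreover have "sum m (s ` J) = 0" using J(3) sum.reindex[OF permutes_inj_on[OF s], of m J] by simp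
  ultimately show ?thesis using J(2) by (simp add: I_res_def I_set_multipliers)
qed

lemma K_res_permute: "s permutes {..<d} \<Longrightarrow> J \<in> K_res d (m \<circ> s) \<Longrightarrow> s ` J \<in> K_res d m"
proof -
  assume s: "s permutes {..<d}" and "J \<in> K_res d (m \<circ> s)"
  then have "J \<subseteq> {..<d} \<and> J \<noteq> {} \<and> (\<forall>i\<in>J. \<forall>j\<in>J. m (s i) = m (s j))"
    unfolding K_res_def K_set_multipliers mem_Collect_eq o_apply by blast
  then have J: "J \<subseteq> {..<d}" "J \<noteq> {}" "\<forall>i\<in>J. \<forall>j\<in>J. m (s i) = m (s j)"
    by blast+
  have "s ` J \<subseteq> s ` {..<d}" using J(1) by (rule image_mono)
  then have "s ` J \<subseteq> {..<d}" by (simp only: permutes_image[OF s])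
  moreover have "\<forall>i\<in>s ` J. \<forall>j\<in>s ` J. m i = m j" using J(3) by blast
  ultimately show ?thesis using J(2) unfolding K_res_def K_set_multipliers by blast
qed

lemma finite_I_res: "finite (I_res d m)" and finite_K_res: "finite (K_res d m)"
proof -
  have "I_res d m \<subseteq> Pow {..<d}" "K_res d m \<subseteq> Pow {..<d}" by (auto simp: I_res_def I_set_def K_res_def K_set_def)
  then show "finite (I_res d m)" "finite (K_res d m)" by (auto intro: finite_subset)
qed

text \<open>Near \<open>m\<close> the type can only shrink, and it has the same cardinality for all points of an
  orbit of the symmetric group.\<close>

lemma orbit_type_eq:
  assumes perm: "\<And>s J m. s permutes {..<d} \<Longrightarrow> J \<in> T (m \<circ> s) \<Longrightarrow> s ` J \<in> T m" and fin: "\<And>m. finite (T m)"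
    and sub: "T u \<subseteq> T m" and v: "T v = T m" and s: "s permutes {..<d}" "v = u \<circ> s"
  shows "T u = T m"
proof -
  have "card (T v) \<le> card (T u)"
  proof (rule card_inj_on_le[of "\<lambda>J. s ` J"])
    show "inj_on (\<lambda>J. s ` J) (T v)" using permutes_inj[OF s(1)] by (meson inj_on_def inj_image_eq_iff)
    show "(\<lambda>J. s ` J) ` T v \<subseteq> T u" using perm[OF s(1), of _ u] s(2) by auto
    show "finite (T u)" by (rule fin)
  qed
  then show ?thesis using card_seteq[OF fin sub] v by simp
qed

lemma V_tilde_I_eq: "V_tilde_I d \<I> = multiplier_class d ` {m \<in> Res d. I_res d m = \<I>}"
proof
  show "V_tilde_I d \<I> \<subseteq> multiplier_class d ` {m \<in> Res d. I_res d m = \<I>}"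
  proof
    fix x assume "x \<in> V_tilde_I d \<I>"
    then obtain l where l: "l \<in> V d" "I_set d l = \<I>" "x = pr d l" by (auto simp: V_tilde_I_def)
    then show "x \<in> multiplier_class d ` {m \<in> Res d. I_res d m = \<I>}"
      using residues_in_Res[OF l(1)] multipliers_residues[OF l(1)]
      by (intro image_eqI[of _ _ "residues d l"]) (auto simp: multiplier_class_def I_res_def)
  qed
  show "multiplier_class d ` {m \<in> Res d. I_res d m = \<I>} \<subseteq> V_tilde_I d \<I>"
    using multipliers_in_V by (auto simp: V_tilde_I_def multiplier_class_def I_res_def)
qed

lemma V_tilde_K_eq: "V_tilde_K d \<K> = multiplier_class d ` {m \<in> Res d. K_res d m = \<K>}"
proof
  show "V_tilde_K d \<K> \<subseteq> multiplier_class d ` {m \<in> Res d. K_res d m = \<K>}"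
  proof
    fix x assume "x \<in> V_tilde_K d \<K>"
    then obtain l where l: "l \<in> V d" "K_set d l = \<K>" "x = pr d l" by (auto simp: V_tilde_K_def)
    then show "x \<in> multiplier_class d ` {m \<in> Res d. K_res d m = \<K>}"
      using residues_in_Res[OF l(1)] multipliers_residues[OF l(1)]
      by (intro image_eqI[of _ _ "residues d l"]) (auto simp: multiplier_class_def K_res_def)
  qed
  show "multiplier_class d ` {m \<in> Res d. K_res d m = \<K>} \<subseteq> V_tilde_K d \<K>"
    using multipliers_in_V by (auto simp: V_tilde_K_def multiplier_class_def K_res_def)
qed

lemma V_tilde_IK_eq: "V_tilde_IK d \<I> \<K> = multiplier_class d ` {m \<in> Res d. I_res d m = \<I> \<and> K_res d m = \<K>}"
proof
  show "V_tilde_IK d \<I> \<K> \<subseteq> multiplier_class d ` {m \<in> Res d. I_res d m = \<I> \<and> K_res d m = \<K>}"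
  proof
    fix x assume "x \<in> V_tilde_IK d \<I> \<K>"
    then obtain l where l: "l \<in> V d" "I_set d l = \<I>" "K_set d l = \<K>" "x = pr d l" by (auto simp: V_tilde_IK_def)
    then show "x \<in> multiplier_class d ` {m \<in> Res d. I_res d m = \<I> \<and> K_res d m = \<K>}"
      using residues_in_Res[OF l(1)] multipliers_residues[OF l(1)]
      by (intro image_eqI[of _ _ "residues d l"]) (auto simp: multiplier_class_def I_res_def K_res_def)
  qed
  show "multiplier_class d ` {m \<in> Res d. I_res d m = \<I> \<and> K_res d m = \<K>} \<subseteq> V_tilde_IK d \<I> \<K>"
    using multipliers_in_V by (auto simp: V_tilde_IK_def multiplier_class_def I_res_def K_res_def)
qed

lemma multiplier_class_eq_cases:
  assumes "m \<in> Res d" "u \<in> Res d" "multiplier_class d m = multiplier_class d u"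
  shows "\<exists>s. s permutes {..<d} \<and> u = m \<circ> s"
  using pr_multipliers_eq_iff[OF assms(1,2)] assms(3) by (simp add: multiplier_class_def)

text \<open>Applied with \<open>zero_forms d u \<subseteq> zero_forms d m\<close>, which holds for all \<open>u\<close> near \<open>m\<close>, this makes \<open>\<I>\<close>
  locally constant in labels: a point of the stratum carries the type in some labelling only, but near \<open>m\<close>
  it carries it in the nearby labelling.\<close>

lemma I_res_rigid:
  assumes "u \<in> Res d" "zero_forms d u \<subseteq> zero_forms d m" "multiplier_class d u \<in> V_tilde_I d (I_res d m)"
  shows "I_res d u = I_res d m"
proof -
  obtain v where v: "v \<in> Res d" "I_res d v = I_res d m" "multiplier_class d u = multiplier_class d v" using assms(3) by (auto simp: V_tilde_I_eq)
  then obtain s where "s permutes {..<d}" "v = u \<circ> s" using multiplier_class_eq_cases[OF assms(1)] by blast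
  then show ?thesis
    using orbit_type_eq[of d "I_res d" u m v s] I_res_permute finite_I_res I_res_subset[OF assms(2)] v(2) by blast
qed

lemma K_res_rigid:
  assumes "u \<in> Res d" "zero_forms d u \<subseteq> zero_forms d m" "multiplier_class d u \<in> V_tilde_K d (K_res d m)"
  shows "K_res d u = K_res d m"
proof -
  obtain v where v: "v \<in> Res d" "K_res d v = K_res d m" "multiplier_class d u = multiplier_class d v" using assms(3) by (auto simp: V_tilde_K_eq)
  then obtain s where "s permutes {..<d}" "v = u \<circ> s" using multiplier_class_eq_cases[OF assms(1)] by blast
  then show ?thesis
    using orbit_type_eq[of d "K_res d" u m v s] K_res_permute finite_K_res K_res_subset[OF assms(2)] v(2) by blast
qed

lemma V_tilde_IK_subset: "V_tilde_IK d \<I> \<K> \<subseteq> V_tilde_I d \<I>" "V_tilde_IK d \<I> \<K> \<subseteq> V_tilde_K d \<K>"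
  by (auto simp: V_tilde_IK_eq V_tilde_I_eq V_tilde_K_eq)

lemma V_tilde_I_subset: "V_tilde_I d \<I> \<subseteq> V_tilde d" and V_tilde_K_subset: "V_tilde_K d \<K> \<subseteq> V_tilde d"
  by (auto simp: V_tilde_I_eq V_tilde_K_eq V_tilde_eq)

lemma V_tilde_topspace: "V_tilde d \<subseteq> topspace (cs_top (Lambda_tilde_space d))"
  using multipliers_Lambda by (auto simp: V_tilde_eq topspace_Lambda_tilde_space multiplier_class_def)

context
  fixes d :: nat assumes d: "d \<ge> 2"
begin

lemma class_over_subset:
  assumes "VV \<subseteq> V_tilde d" "c \<in> Phi_preimage d VV"
  obtains m z where "m \<in> Res d" "z \<in> config d m" "c = config_class d m z" "Phi c = multiplier_class d m" "multiplier_class d m \<in> VV"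
proof -
  have c: "c \<in> MP d" "Phi c \<in> VV" using assms(2) by (auto simp: Phi_preimage_def)
  then obtain m where m: "m \<in> Res d" "Phi c = multiplier_class d m" using assms(1) by (auto simp: V_tilde_eq)
  then obtain z where "z \<in> config d m" "c = config_class d m z" using class_over_V[OF d c(1) m(1)] by (auto simp: multiplier_class_def)
  then show ?thesis using that m c(2) by auto
qed

lemma topspace_MP_sub: "topspace (MP_sub d (Phi_preimage d VV)) = Phi_preimage d VV"
  by (auto simp: topspace_MP_space Phi_preimage_def)

lemma topspace_Lambda_tilde_sub: "VV \<subseteq> V_tilde d \<Longrightarrow> topspace (Lambda_tilde_sub d VV) = VV"
  using V_tilde_topspace by auto

lemma config_class_Phi_preimage: "m \<in> Res d \<Longrightarrow> z \<in> config d m \<Longrightarrow> multiplier_class d m \<in> VV \<Longrightarrow> config_class d m z \<in> Phi_preimage d VV"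
  using config_class_in_MP[OF d] Phi_config_class[OF d] by (simp add: Phi_preimage_def multiplier_class_def)

lemma Phi_config_class': "m \<in> Res d \<Longrightarrow> z \<in> config d m \<Longrightarrow> Phi (config_class d m z) = multiplier_class d m"
  using Phi_config_class[OF d] by (simp add: multiplier_class_def)

lemma Phi_continuous:
  assumes VV: "VV \<subseteq> V_tilde d"
  shows "continuous_map (MP_sub d (Phi_preimage d VV)) (Lambda_tilde_sub d VV) Phi"
  unfolding continuous_map_in_subtopology
proof
  show "continuous_map (MP_sub d (Phi_preimage d VV)) (cs_top (Lambda_tilde_space d)) Phi"
    unfolding continuous_map_def topspace_MP_sub
  proof (intro conjI allI impI)
    show "Phi \<in> Phi_preimage d VV \<rightarrow> topspace (cs_top (Lambda_tilde_space d))"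
      using VV V_tilde_topspace by (auto simp: Phi_preimage_def)
    fix W assume W: "openin (cs_top (Lambda_tilde_space d)) W"
    show "openin (MP_sub d (Phi_preimage d VV)) {x \<in> Phi_preimage d VV. Phi x \<in> W}"
    proof (subst openin_subopen, intro ballI)
      fix c assume c: "c \<in> {x \<in> Phi_preimage d VV. Phi x \<in> W}"
      then obtain m z where m: "m \<in> Res d" "z \<in> config d m" "c = config_class d m z" "Phi c = multiplier_class d m"
        using class_over_subset[OF VV] by blast
      obtain r where r: "r > 0" "\<And>u. u \<in> polydisc d m r \<Longrightarrow> u \<in> Res d \<Longrightarrow> multiplier_class d u \<in> W"
        using Lambda_tilde_open_near[OF W m(1)] c m(4) by (auto simp: eventually_near)
      let ?Q = "(\<lambda>(w, y). config_class d w y) ` {(w, y). w \<in> Res d \<inter> polydisc d m r \<and> y \<in> config d w \<inter> polydisc d z 1}"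
      have "openin (MP_sub d (Phi_preimage d VV)) (Phi_preimage d VV \<inter> ?Q)"
        by (rule openin_subtopology_Int2[OF openin_config_class_polydisc[OF d]])
      moreover have "c \<in> ?Q"
        using m r(1) centre_in_polydisc[OF Res_Cn[OF m(1)] r(1)] centre_in_polydisc[OF config_Cn[OF m(2)] zero_less_one]
        by (auto intro!: image_eqI[of _ _ "(m, z)"])
      moreover have "Phi x \<in> W" if "x \<in> ?Q" for x using that r(2) Phi_config_class' by auto
      ultimately show "\<exists>T. openin (MP_sub d (Phi_preimage d VV)) T \<and> c \<in> T \<and> T \<subseteq> {x \<in> Phi_preimage d VV. Phi x \<in> W}"
        using c by (intro exI[of _ "Phi_preimage d VV \<inter> ?Q"]) auto
    qed
  qed
  show "Phi \<in> topspace (MP_sub d (Phi_preimage d VV)) \<rightarrow> VV" by (auto simp: Phi_preimage_def)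
qed

text \<open>The set is compact by \<open>config_sequentially_compact\<close> for constant residues, and discrete.\<close>

lemma finite_config:
  assumes m: "m \<in> Res d" shows "finite (config d m)"
proof (rule ccontr)
  assume "infinite (config d m)"
  then obtain f :: "nat \<Rightarrow> nat \<Rightarrow> complex" where f: "inj f" "range f \<subseteq> config d m" using infinite_countable_subset by blast
  obtain t z0 where t: "strict_mono t" "z0 \<in> config d m" "filterlim (\<lambda>k. f (t k)) (near d z0) sequentially"
  proof -
    have fc: "f k \<in> config d m" for k using f(2) by blast
    show ?thesis
      using config_sequentially_compact[OF d, of "\<lambda>_. m" m f, OF m m tendsto_const _ fc] that by blast
  qed
  obtain r e S where S: "local_section d m z0 r e S" using local_section_exists[OF d m t(2) zero_less_one] by blast
  have re: "r > 0" "e > 0" using S by (auto simp: local_section_def)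
  have "eventually (\<lambda>k. f (t k) \<in> polydisc d z0 r) sequentially"
    by (rule eventually_compose_filterlim[OF eventually_polydisc_near[OF re(1)] t(3)])
  then obtain k where k: "\<And>n. n \<ge> k \<Longrightarrow> f (t n) \<in> polydisc d z0 r" by (auto simp: eventually_sequentially)
  have "f (t n) = S m" if "n \<ge> k" for n
    using local_sectionD(3)[OF S centre_in_polydisc[OF Res_Cn[OF m] re(2)] k[OF that]] f(2) by auto
  then have "f (t k) = f (t (Suc k))" by simp
  then have "t k = t (Suc k)" using f(1) by (simp add: inj_eq)
  then show False using t(1) by (simp add: strict_mono_eq)
qed

lemma finite_fibre:
  assumes VV: "VV \<subseteq> V_tilde d" and y: "y \<in> VV"
  shows "finite {x \<in> Phi_preimage d VV. Phi x = y}"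
proof -
  obtain m where m: "m \<in> Res d" "y = multiplier_class d m" using VV y by (auto simp: V_tilde_eq)
  have "{x \<in> Phi_preimage d VV. Phi x = y} \<subseteq> config_class d m ` config d m"
    using class_over_V[OF d _ m(1)] m(2) by (auto simp: Phi_preimage_def multiplier_class_def)
  then show ?thesis using finite_config[OF m(1)] finite_surj by blast
qed

text \<open>Closedness is checked on sequences: points of a closed set over a sequence that converges in the
  base have nearby labels with constant \<open>\<I>\<close>, so their configurations subconverge.\<close>

lemma Phi_proper:
  assumes VV: "VV \<subseteq> V_tilde_I d \<I>"
  shows "proper_map (MP_sub d (Phi_preimage d VV)) (Lambda_tilde_sub d VV) Phi"
proof -
  let ?X = "MP_sub d (Phi_preimage d VV)" and ?Y = "Lambda_tilde_sub d VV"
  have VV': "VV \<subseteq> V_tilde d" using VV V_tilde_I_subset by blast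
  have tY: "topspace ?Y = VV" by (rule topspace_Lambda_tilde_sub[OF VV'])
  have "closedin ?Y (Phi ` C)" if C: "closedin ?X C" for C
    unfolding closedin_def tY
  proof (intro conjI)
    have CX: "C \<subseteq> Phi_preimage d VV" using closedin_subset[OF C] by (simp only: topspace_MP_sub)
    then show "Phi ` C \<subseteq> VV" by (auto simp: Phi_preimage_def)
    have "openin ?X (Phi_preimage d VV - C)" using C unfolding closedin_def topspace_MP_sub by blast
    then obtain O' where O': "openin (cs_top (MP_space d)) O'" "Phi_preimage d VV - C = O' \<inter> Phi_preimage d VV"
      unfolding openin_subtopology by blast
    show "openin ?Y (VV - Phi ` C)"
    proof (subst openin_subopen, intro ballI)
      fix y assume y: "y \<in> VV - Phi ` C"
      then obtain m where m: "m \<in> Res d" "I_res d m = \<I>" "y = multiplier_class d m" using VV by (auto simp: V_tilde_I_eq)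
      obtain r where r: "r > 0" "\<And>u. u \<in> polydisc d m r \<Longrightarrow> zero_forms d u \<subseteq> zero_forms d m"
        using eventually_zero_forms_subset[of d m] by (auto simp: eventually_near)
      \<comment> \<open>otherwise a sequence of points of \<open>C\<close> would have a limit over \<open>y\<close>, which lies in \<open>C\<close>\<close>
      have "\<exists>a>0. \<forall>u\<in>Res d \<inter> polydisc d m a. multiplier_class d u \<in> VV \<longrightarrow> multiplier_class d u \<notin> Phi ` C"
      proof (rule ccontr)
        assume neg: "\<not> (\<exists>a>0. \<forall>u\<in>Res d \<inter> polydisc d m a. multiplier_class d u \<in> VV \<longrightarrow> multiplier_class d u \<notin> Phi ` C)"
        define a where "a k = min r (inverse (real (Suc k)))" for k
        have a: "a k > 0" for k using r(1) by (simp add: a_def)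
        have "\<exists>u c. u \<in> Res d \<and> u \<in> polydisc d m (a k) \<and> multiplier_class d u \<in> VV \<and> c \<in> C \<and> multiplier_class d u = Phi c" for k
          using neg a[of k] by blast
        then obtain u c where uc: "\<And>k. u k \<in> Res d" "\<And>k. u k \<in> polydisc d m (a k)" "\<And>k. multiplier_class d (u k) \<in> VV"
            "\<And>k. c k \<in> C" "\<And>k. multiplier_class d (u k) = Phi (c k)" by metis
        have "\<exists>z\<in>config d (u k). c k = config_class d (u k) z" for k
          using class_over_V[OF d _ uc(1), of "c k" k] uc(4)[of k] uc(5)[of k] CX by (auto simp: Phi_preimage_def multiplier_class_def)
        then obtain z where z: "\<And>k. z k \<in> config d (u k)" "\<And>k. c k = config_class d (u k) (z k)" by metis
        have ur: "u k \<in> polydisc d m r" for k using uc(2)[of k] polydisc_mono[of "a k" r d m] by (auto simp: a_def)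
        have Imu: "I_res d (u k) = I_res d m" for k
          using I_res_rigid[OF uc(1) r(2)[OF ur]] uc(3)[of k] VV m(2) by blast
        have her: "sum (u k) J = 0" if "J \<subset> {..<d}" "J \<noteq> {}" "sum m J = 0" for k J
          using Imu[of k] that by (auto simp: I_res_def I_set_multipliers)
        have ulim: "(\<lambda>k. u k i) \<longlonglongrightarrow> m i" if i: "i < d" for i
        proof -
          have "cmod (u k i - m i) \<le> inverse (real (Suc k))" for k
            using uc(2)[of k] i by (auto simp: polydisc_def a_def)
          then have "(\<lambda>k. u k i - m i) \<longlonglongrightarrow> 0"
            by (intro Lim_null_comparison[OF _ LIMSEQ_inverse_real_of_nat]) auto
          then show ?thesis by (simp add: LIM_zero_iff)
        qed
        obtain t z0 where t: "strict_mono t" "z0 \<in> config d m" "filterlim (\<lambda>k. z (t k)) (near d z0) sequentially"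
          using config_sequentially_compact[OF d uc(1) m(1) ulim her z(1)] by blast
        have utlim: "filterlim (\<lambda>k. u (t k)) (near d m) sequentially"
          unfolding filterlim_near using Res_Cn[OF uc(1)] LIMSEQ_subseq_LIMSEQ[OF ulim t(1)] by (auto simp: o_def)
        have "config_class d m z0 \<in> Phi_preimage d VV" using config_class_Phi_preimage[OF m(1) t(2)] y m(3) by blast
        moreover have "config_class d m z0 \<notin> C" using y Phi_config_class'[OF m(1) t(2)] m(3) by (metis DiffD2 imageI)
        ultimately have "config_class d m z0 \<in> O'" using O'(2) by blast
        then have "eventually (\<lambda>k. config_class d (u (t k)) (z (t k)) \<in> O') sequentially"
          by (rule MP_open_near[OF d O'(1) m(1) t(2) _ utlim t(3)]) (use uc(1) z(1) in auto)
        then obtain k where "config_class d (u (t k)) (z (t k)) \<in> O'" by (auto simp: eventually_sequentially)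
        then have "c (t k) \<in> O'" using z(2) by simp
        then show False using uc(4)[of "t k"] CX O'(2) by blast
      qed
      then obtain a where a: "a > 0" "\<And>u. u \<in> Res d \<Longrightarrow> u \<in> polydisc d m a \<Longrightarrow> multiplier_class d u \<in> VV \<Longrightarrow> multiplier_class d u \<notin> Phi ` C" by blast
      have "openin ?Y (VV \<inter> multiplier_class d ` (Res d \<inter> polydisc d m a))"
        by (rule openin_subtopology_Int2[OF openin_multiplier_class_polydisc])
      moreover have "y \<in> multiplier_class d ` (Res d \<inter> polydisc d m a)"
        using m centre_in_polydisc[OF Res_Cn[OF m(1)] a(1)] by auto
      ultimately show "\<exists>T. openin ?Y T \<and> y \<in> T \<and> T \<subseteq> VV - Phi ` C"
        using y a(2) by (intro exI[of _ "VV \<inter> multiplier_class d ` (Res d \<inter> polydisc d m a)"]) auto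
    qed
  qed
  moreover have "compactin ?X {x \<in> topspace ?X. Phi x = y}" if "y \<in> topspace ?Y" for y
  proof (rule finite_imp_compactin)
    show "finite {x \<in> topspace ?X. Phi x = y}" unfolding topspace_MP_sub using finite_fibre[OF VV'] that tY by auto
  qed auto
  ultimately show ?thesis by (auto simp: proper_map_def closed_map_def)
qed

text \<open>Over \<open>V_tilde_K\<close> labelled points near \<open>m\<close> are determined by their classes, so a local section of the
  labelled map is also one after dividing by permutations.\<close>

lemma Phi_locally_homeomorphic:
  assumes VV: "VV \<subseteq> V_tilde_K d \<K>"
  shows "locally_homeomorphic_map (MP_sub d (Phi_preimage d VV)) (Lambda_tilde_sub d VV) Phi"
proof -
  let ?X = "MP_sub d (Phi_preimage d VV)" and ?Y = "Lambda_tilde_sub d VV"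
  have VV': "VV \<subseteq> V_tilde d" using VV V_tilde_K_subset by blast
  have tX: "topspace ?X = Phi_preimage d VV" by (rule topspace_MP_sub)
  have tY: "topspace ?Y = VV" by (rule topspace_Lambda_tilde_sub[OF VV'])
  have "\<exists>W T. openin ?X W \<and> c \<in> W \<and> openin ?Y T \<and> homeomorphic_map (subtopology ?X W) (subtopology ?Y T) Phi"
    if c: "c \<in> Phi_preimage d VV" for c
  proof -
    obtain m' z' where m': "m' \<in> Res d" "z' \<in> config d m'" "c = config_class d m' z'" "Phi c = multiplier_class d m'" "multiplier_class d m' \<in> VV"
      using class_over_subset[OF VV' c] by blast
    then obtain m where m: "m \<in> Res d" "K_res d m = \<K>" "multiplier_class d m' = multiplier_class d m" using VV by (auto simp: V_tilde_K_eq)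
    have "c \<in> MP d" using c by (simp add: Phi_preimage_def)
    then obtain z where z: "z \<in> config d m" "c = config_class d m z"
      using class_over_V[OF d _ m(1)] m'(4) m(3) by (auto simp: multiplier_class_def)
    obtain r e S where S: "local_section d m z r e S" using local_section_exists[OF d m(1) z(1) zero_less_one] by blast
    have re: "r > 0" "e > 0" using S by (auto simp: local_section_def)
    obtain a where a: "a > 0" "\<And>u. u \<in> polydisc d m a \<Longrightarrow> zero_forms d u \<subseteq> zero_forms d m"
      using eventually_zero_forms_subset[of d m] by (auto simp: eventually_near)
    define P where "P = {(j, k). j < d \<and> k < d \<and> m j \<noteq> m k}"
    have finP: "finite P" by (rule finite_subset[of _ "{..<d} \<times> {..<d}"]) (auto simp: P_def)
    define b where "b = Min (insert 1 ((\<lambda>(j, k). cmod (m j - m k) / 2) ` P))"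
    have b0: "b > 0" unfolding b_def using finP by (subst Min_gr_iff) (auto simp: P_def)
    have b: "2 * b \<le> cmod (m j - m k)" if "j < d" "k < d" "m j \<noteq> m k" for j k
    proof -
      have "cmod (m j - m k) / 2 \<in> (\<lambda>(j, k). cmod (m j - m k) / 2) ` P"
        using that by (intro image_eqI[of _ _ "(j, k)"]) (simp_all add: P_def)
      then have "b \<le> cmod (m j - m k) / 2" unfolding b_def using finP by (intro Min_le) blast+
      then show ?thesis by simp
    qed
    define \<delta> where "\<delta> = Min {a, b, e}"
    have \<delta>: "\<delta> > 0" "\<delta> \<le> a" "\<delta> \<le> b" "\<delta> \<le> e" using a(1) b0 re(2) by (simp_all add: \<delta>_def)
    define D where "D = Res d \<inter> polydisc d m \<delta>"
    have De: "u \<in> polydisc d m e" if "u \<in> D" for u using that polydisc_mono[OF \<delta>(4)] by (auto simp: D_def)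
    have DK: "K_res d u = K_res d m" if "u \<in> D" "multiplier_class d u \<in> VV" for u
      using K_res_rigid[of u d m] a(2)[of u] that polydisc_mono[OF \<delta>(2), of d m] VV m(2) by (auto simp: D_def)
    \<comment> \<open>a permutation between points of \<open>D\<close> fixes \<open>m\<close> and, as \<open>\<K>\<close> is the same, these points\<close>
    have inj: "u = v" if u: "u \<in> D" "multiplier_class d u \<in> VV" and v: "v \<in> D" "multiplier_class d u = multiplier_class d v" for u v
    proof -
      obtain s where s: "s permutes {..<d}" "v = u \<circ> s" using multiplier_class_eq_cases[of u d v] u v by (auto simp: D_def)
      have "u (s i) = u i" for i
      proof (cases "i < d")
        case True
        then have si: "s i < d" using permutes_in_image[OF s(1)] by auto
        have "cmod (u (s i) - m i) < \<delta>" "cmod (u (s i) - m (s i)) < \<delta>"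
          using u v(1) s(2) True si by (auto simp: D_def polydisc_def)
        then have "cmod (m i - m (s i)) < 2 * b"
          using norm_triangle_ineq4[of "u (s i) - m (s i)" "u (s i) - m i"] \<delta>(3) by simp
        then have mi: "m i = m (s i)" using b[of i "s i"] True si by force
        have Kiff: "{i, s i} \<in> K_res d w \<longleftrightarrow> w i = w (s i)" for w
          using K_res_pair_iff[OF True si] .
        have "{i, s i} \<in> K_res d m" unfolding Kiff by (rule mi)
        then have "{i, s i} \<in> K_res d u" unfolding DK[OF u] .
        then show ?thesis unfolding Kiff by (rule sym)
      next
        case False
        then show ?thesis using permutes_not_in[OF s(1)] by simp
      qed
      then show ?thesis using s(2) by (auto simp: fun_eq_iff)
    qed
    define W0 where "W0 = (\<lambda>(w, y). config_class d w y) ` {(w, y). w \<in> Res d \<inter> polydisc d m \<delta> \<and> y \<in> config d w \<inter> polydisc d z r}"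
    define W where "W = Phi_preimage d VV \<inter> W0"
    define T where "T = VV \<inter> multiplier_class d ` D"
    have oW: "openin ?X W" unfolding W_def W0_def by (rule openin_subtopology_Int2[OF openin_config_class_polydisc[OF d]])
    have oT: "openin ?Y T" unfolding T_def D_def by (rule openin_subtopology_Int2[OF openin_multiplier_class_polydisc])
    have Sc: "S u \<in> config d u" "S u \<in> polydisc d z r" if "u \<in> D" for u
      using local_sectionD(1,2)[OF S De[OF that]] by auto
    have W_iff: "x \<in> W \<longleftrightarrow> (\<exists>u\<in>D. multiplier_class d u \<in> VV \<and> x = config_class d u (S u))" for x
    proof
      assume "x \<in> W"
      then obtain u y where uy: "u \<in> D" "y \<in> config d u" "y \<in> polydisc d z r" "x = config_class d u y" "x \<in> Phi_preimage d VV"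
        by (auto simp: W_def W0_def D_def)
      have "y = S u" by (rule local_sectionD(3)[OF S De[OF uy(1)] uy(3,2)])
      moreover have "multiplier_class d u \<in> VV" using uy Phi_config_class'[of u y] by (auto simp: Phi_preimage_def D_def)
      ultimately show "\<exists>u\<in>D. multiplier_class d u \<in> VV \<and> x = config_class d u (S u)" using uy by blast
    next
      assume "\<exists>u\<in>D. multiplier_class d u \<in> VV \<and> x = config_class d u (S u)"
      then obtain u where u: "u \<in> D" "multiplier_class d u \<in> VV" "x = config_class d u (S u)" by blast
      then have "x \<in> Phi_preimage d VV" using config_class_Phi_preimage[of u "S u"] Sc[OF u(1)] by (auto simp: D_def)
      moreover have "x \<in> W0" unfolding W0_def using u Sc[OF u(1)] by (intro image_eqI[of _ _ "(u, S u)"]) (auto simp: D_def)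
      ultimately show "x \<in> W" by (simp add: W_def)
    qed
    have PhiS: "Phi (config_class d u (S u)) = multiplier_class d u" if "u \<in> D" for u using Phi_config_class'[of u "S u"] Sc[OF that] that by (auto simp: D_def)
    have tW: "topspace (subtopology ?X W) = W" using openin_subset[OF oW] tX by auto
    have tT: "topspace (subtopology ?Y T) = T" using openin_subset[OF oT] tY by auto
    have img: "Phi ` W = T"
    proof
      show "Phi ` W \<subseteq> T" using W_iff PhiS by (auto simp: T_def)
      show "T \<subseteq> Phi ` W"
      proof
        fix y assume "y \<in> T"
        then obtain u where u: "u \<in> D" "y = multiplier_class d u" "multiplier_class d u \<in> VV" by (auto simp: T_def)
        then have "config_class d u (S u) \<in> W" using W_iff by blast
        then show "y \<in> Phi ` W" using PhiS[OF u(1)] u(2) by (metis imageI)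
      qed
    qed
    have "homeomorphic_map (subtopology ?X W) (subtopology ?Y T) Phi"
    proof (rule bijective_open_imp_homeomorphic_map)
      show "continuous_map (subtopology ?X W) (subtopology ?Y T) Phi"
        unfolding continuous_map_in_subtopology tW
        using continuous_map_from_subtopology[OF Phi_continuous[OF VV'], of W] img
        by (auto simp: continuous_map_in_subtopology T_def)
      show "Phi ` topspace (subtopology ?X W) = topspace (subtopology ?Y T)" using img tW tT by simp
      show "inj_on Phi (topspace (subtopology ?X W))"
        unfolding tW
      proof (rule inj_onI)
        fix x y assume xy: "x \<in> W" "y \<in> W" and eq: "Phi x = Phi y"
        from xy(1) obtain u where u: "u \<in> D" "multiplier_class d u \<in> VV" "x = config_class d u (S u)" unfolding W_iff by blast
        from xy(2) obtain v where v: "v \<in> D" "y = config_class d v (S v)" unfolding W_iff by blast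
        have "multiplier_class d u = multiplier_class d v" using eq PhiS[OF u(1)] PhiS[OF v(1)] unfolding u(3) v(2) by simp
        then show "x = y" using inj[OF u(1,2) v(1)] u v by simp
      qed
      show "open_map (subtopology ?X W) (subtopology ?Y T) Phi"
        unfolding open_map_def
      proof (intro allI impI)
        fix Q assume "openin (subtopology ?X W) Q"
        then have Q: "openin ?X Q" "Q \<subseteq> W" using oW openin_open_subtopology by blast+
        obtain O' where O': "openin (cs_top (MP_space d)) O'" "Q = O' \<inter> Phi_preimage d VV"
          using Q(1) unfolding openin_subtopology by blast
        have "openin ?Y (Phi ` Q)"
        proof (subst openin_subopen, intro ballI)
          fix y assume "y \<in> Phi ` Q"
          then obtain x where x: "x \<in> Q" "y = Phi x" by blast
          then obtain u where u: "u \<in> D" "multiplier_class d u \<in> VV" "x = config_class d u (S u)" using Q(2) W_iff by blast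
          have uR: "u \<in> Res d" using u(1) by (simp add: D_def)
          let ?F = "inf (near d u) (principal D)"
          have "filterlim (\<lambda>v. v) (near d u) ?F" by (simp add: filterlim_def)
          moreover have "filterlim S (near d (S u)) ?F"
            using local_section_near[OF S De[OF u(1)]] by (rule filterlim_mono) auto
          moreover have "eventually (\<lambda>v. v \<in> Res d \<and> S v \<in> config d v) ?F"
            using Sc(1) by (auto simp: eventually_inf_principal D_def intro!: always_eventually)
          ultimately have "eventually (\<lambda>v. config_class d v (S v) \<in> O') ?F"
            using MP_open_near[OF d O'(1) uR Sc(1)[OF u(1)], of "\<lambda>v. v" ?F S] x(1) O'(2) u(3) by blast
          then have "eventually (\<lambda>v. v \<in> D \<longrightarrow> config_class d v (S v) \<in> O') (near d u)" by (simp add: eventually_inf_principal)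
          moreover have "eventually (\<lambda>v. v \<in> polydisc d m \<delta>) (near d u)" using u(1) by (intro polydisc_near) (simp add: D_def)
          ultimately have "eventually (\<lambda>v. (v \<in> D \<longrightarrow> config_class d v (S v) \<in> O') \<and> v \<in> polydisc d m \<delta>) (near d u)" by (rule eventually_conj)
          then obtain \<rho> where \<rho>: "\<rho> > 0" "\<And>v. v \<in> polydisc d u \<rho> \<Longrightarrow> (v \<in> D \<longrightarrow> config_class d v (S v) \<in> O') \<and> v \<in> polydisc d m \<delta>"
            by (auto simp: eventually_near)
          have "openin ?Y (VV \<inter> multiplier_class d ` (Res d \<inter> polydisc d u \<rho>))"
            by (rule openin_subtopology_Int2[OF openin_multiplier_class_polydisc])
          moreover have "y \<in> VV \<inter> multiplier_class d ` (Res d \<inter> polydisc d u \<rho>)"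
            using x(2) u PhiS[OF u(1)] uR centre_in_polydisc[OF Res_Cn[OF uR] \<rho>(1)] by auto
          moreover have "VV \<inter> multiplier_class d ` (Res d \<inter> polydisc d u \<rho>) \<subseteq> Phi ` Q"
          proof
            fix x assume "x \<in> VV \<inter> multiplier_class d ` (Res d \<inter> polydisc d u \<rho>)"
            then obtain v where v: "v \<in> Res d" "v \<in> polydisc d u \<rho>" "x = multiplier_class d v" "multiplier_class d v \<in> VV" by auto
            then have vD: "v \<in> D" using \<rho>(2)[OF v(2)] by (simp add: D_def)
            then have "config_class d v (S v) \<in> Q"
              using \<rho>(2)[OF v(2)] O'(2) config_class_Phi_preimage[OF v(1) Sc(1)[OF vD] v(4)] by blast
            then show "x \<in> Phi ` Q" using PhiS[OF vD] v(3) by (metis imageI)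
          qed
          ultimately show "\<exists>T. openin ?Y T \<and> y \<in> T \<and> T \<subseteq> Phi ` Q" by blast
        qed
        moreover have "Phi ` Q \<subseteq> T" using Q(2) img by blast
        ultimately show "openin (subtopology ?Y T) (Phi ` Q)" using oT openin_open_subtopology by blast
      qed
    qed
    moreover have "c \<in> W"
      unfolding W_iff
    proof (intro bexI[of _ m] conjI)
      show "m \<in> D" using m(1) centre_in_polydisc[OF Res_Cn[OF m(1)] \<delta>(1)] by (simp add: D_def)
      show "multiplier_class d m \<in> VV" using m'(5) m(3) by simp
      show "c = config_class d m (S m)" using local_section_centre[OF S Res_Cn[OF m(1)] z(1)] z(2) by simp
    qed
    ultimately show ?thesis using oW oT by blast
  qed
  then show ?thesis
    unfolding locally_homeomorphic_map_def tX tY by (auto simp: Phi_preimage_def)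
qed

lemma polydisc_separate:
  assumes "u \<in> Cn d" "v \<in> Cn d" "u \<noteq> v"
  obtains r where "r > 0" "polydisc d u r \<inter> polydisc d v r = {}"
proof -
  obtain i where i: "u i \<noteq> v i" using assms(3) by auto
  have "i < d" using i assms(1,2) by (auto simp: Cn_def) (metis linorder_not_le)
  define r where "r = cmod (u i - v i) / 2"
  have "polydisc d u r \<inter> polydisc d v r = {}"
  proof (rule ccontr)
    assume "polydisc d u r \<inter> polydisc d v r \<noteq> {}"
    then obtain x where "cmod (x i - u i) < r" "cmod (x i - v i) < r" using \<open>i < d\<close> by (auto simp: polydisc_def)
    then have "cmod (u i - v i) < 2 * r"
      using norm_triangle_ineq4[of "x i - v i" "x i - u i"] by simp
    then show False by (simp add: r_def)
  qed
  moreover have "r > 0" using i by (simp add: r_def)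
  ultimately show ?thesis using that by blast
qed

lemma normalise_near:
  assumes "y 1 \<noteq> y 0" shows "filterlim (normalise d) (near d (normalise d y)) (near d y)"
  unfolding filterlim_near
proof (intro conjI allI impI)
  show "eventually (\<lambda>x. normalise d x \<in> Cn d) (near d y)" by (simp add: normalise_def Cn_def)
  fix i assume i: "i < d"
  have "((\<lambda>x. (x i - x 0) / (x 1 - x 0)) \<longlongrightarrow> (y i - y 0) / (y 1 - y 0)) (near d y)"
    using i d assms by (intro tendsto_intros tendsto_coord_near) auto
  then show "((\<lambda>x. normalise d x i) \<longlongrightarrow> normalise d y i) (near d y)" using i by (simp add: normalise_def)
qed

text \<open>Two classes are different if for each of the finitely many permutations the relabelled first point
  differs from the second one; each of these conditions is open.\<close>

lemma MP_Hausdorff: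
  assumes VV: "VV \<subseteq> V_tilde d" shows "Hausdorff_space (MP_sub d (Phi_preimage d VV))"
  unfolding Hausdorff_space_def topspace_MP_sub
proof (intro allI impI, elim conjE)
  fix c c' assume c: "c \<in> Phi_preimage d VV" "c' \<in> Phi_preimage d VV" and ne: "c \<noteq> c'"
  obtain m z where m: "m \<in> Res d" "z \<in> config d m" "c = config_class d m z" using class_over_subset[OF VV c(1)] by blast
  obtain m' z' where m': "m' \<in> Res d" "z' \<in> config d m'" "c' = config_class d m' z'" using class_over_subset[OF VV c(2)] by blast
  have "\<exists>e>0. s permutes {..<d} \<longrightarrow> (\<forall>u\<in>polydisc d m e. \<forall>y\<in>polydisc d z e.
      u \<circ> s \<notin> polydisc d m' e \<or> normalise d (y \<circ> s) \<notin> polydisc d z' e)" for s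
  proof (cases "s permutes {..<d}")
    case s: True
    have mC: "m \<circ> s \<in> Cn d" and m'C: "m' \<in> Cn d" using comp_permutes_Cn[OF s Res_Cn[OF m(1)]] Res_Cn[OF m'(1)] by auto
    show ?thesis
    proof (cases "m \<circ> s = m'")
      case False
      obtain r where r: "r > 0" "polydisc d (m \<circ> s) r \<inter> polydisc d m' r = {}" using polydisc_separate[OF mC m'C False] by blast
      have "eventually (\<lambda>u. u \<circ> s \<in> polydisc d (m \<circ> s) r) (near d m)"
        by (rule eventually_compose_filterlim[OF eventually_polydisc_near[OF r(1)] tendsto_comp_permutes_near[OF s filterlim_ident]])
      then obtain e where e: "e > 0" "\<And>u. u \<in> polydisc d m e \<Longrightarrow> u \<circ> s \<in> polydisc d (m \<circ> s) r" by (auto simp: eventually_near)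
      have "u \<circ> s \<notin> polydisc d m' (min e r)" if "u \<in> polydisc d m (min e r)" for u
        using e(2)[of u] r(2) that polydisc_mono[of "min e r" e d m] polydisc_mono[of "min e r" r d m'] by auto
      then show ?thesis using e(1) r(1) by (intro exI[of _ "min e r"]) auto
    next
      case True
      let ?n = "normalise d (z \<circ> s)"
      have "?n \<noteq> z'" using config_class_permute[OF d m(1,2) s] True ne m(3) m'(3) by auto
      moreover have "?n \<in> Cn d" by (simp add: normalise_def Cn_def)
      ultimately obtain r where r: "r > 0" "polydisc d ?n r \<inter> polydisc d z' r = {}"
        using polydisc_separate[OF _ config_Cn[OF m'(2)]] by blast
      have "s 1 \<noteq> s 0" "s 1 < d" "s 0 < d" using permutes_inj[OF s] permutes_in_image[OF s] d by (auto simp: inj_def)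
      then have "(z \<circ> s) 1 \<noteq> (z \<circ> s) 0" using m(2) by (auto simp: config_def inj_on_def)
      from filterlim_compose[OF normalise_near[OF this] tendsto_comp_permutes_near[OF s filterlim_ident]]
      have "eventually (\<lambda>y. normalise d (y \<circ> s) \<in> polydisc d ?n r) (near d z)"
        by (rule eventually_compose_filterlim[OF eventually_polydisc_near[OF r(1)]])
      then obtain e where e: "e > 0" "\<And>y. y \<in> polydisc d z e \<Longrightarrow> normalise d (y \<circ> s) \<in> polydisc d ?n r" by (auto simp: eventually_near)
      have "normalise d (y \<circ> s) \<notin> polydisc d z' (min e r)" if "y \<in> polydisc d z (min e r)" for y
        using e(2)[of y] r(2) that polydisc_mono[of "min e r" e d z] polydisc_mono[of "min e r" r d z'] by auto
      then show ?thesis using e(1) r(1) by (intro exI[of _ "min e r"]) auto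
    qed
  qed (auto intro: zero_less_one)
  then obtain e where e: "\<And>s. e s > 0" "\<And>s u y. s permutes {..<d} \<Longrightarrow> u \<in> polydisc d m (e s) \<Longrightarrow> y \<in> polydisc d z (e s) \<Longrightarrow>
      u \<circ> s \<notin> polydisc d m' (e s) \<or> normalise d (y \<circ> s) \<notin> polydisc d z' (e s)" by metis
  define r where "r = Min (insert 1 (e ` {s. s permutes {..<d}}))"
  have fin: "finite (e ` {s. s permutes {..<d}})" by (intro finite_imageI finite_permutations) simp
  have r: "r > 0" using e(1) fin by (auto simp: r_def)
  have re: "r \<le> e s" if "s permutes {..<d}" for s unfolding r_def using fin that by (intro Min_le) auto
  let ?Q = "\<lambda>m z. (\<lambda>(w, y). config_class d w y) ` {(w, y). w \<in> Res d \<inter> polydisc d m r \<and> y \<in> config d w \<inter> polydisc d z r}"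
  have "disjnt (?Q m z) (?Q m' z')"
  proof (rule ccontr)
    assume "\<not> disjnt (?Q m z) (?Q m' z')"
    then obtain u y u' y' where u: "u \<in> Res d" "u \<in> polydisc d m r" "y \<in> config d u" "y \<in> polydisc d z r"
      and u': "u' \<in> Res d" "u' \<in> polydisc d m' r" "y' \<in> config d u'" "y' \<in> polydisc d z' r" and eq: "config_class d u y = config_class d u' y'"
      by (auto simp: disjnt_def)
    obtain s where s: "s permutes {..<d}" "u' = u \<circ> s" "y' = normalise d (y \<circ> s)"
      using config_class_eqD[OF d u(1,3) u'(1,3) eq] by blast
    have "u \<circ> s \<notin> polydisc d m' (e s) \<or> normalise d (y \<circ> s) \<notin> polydisc d z' (e s)"
      using u(2,4) polydisc_mono[OF re[OF s(1)]] by (intro e(2)[OF s(1)]) auto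
    then show False using u'(2,4) s(2,3) polydisc_mono[OF re[OF s(1)]] by blast
  qed
  moreover have "c \<in> ?Q m z"
    using m centre_in_polydisc[OF Res_Cn[OF m(1)] r] centre_in_polydisc[OF config_Cn[OF m(2)] r]
    by (intro image_eqI[of _ _ "(m, z)"]) auto
  moreover have "c' \<in> ?Q m' z'"
    using m' centre_in_polydisc[OF Res_Cn[OF m'(1)] r] centre_in_polydisc[OF config_Cn[OF m'(2)] r]
    by (intro image_eqI[of _ _ "(m', z')"]) auto
  ultimately show "\<exists>U V. openin (MP_sub d (Phi_preimage d VV)) U \<and> openin (MP_sub d (Phi_preimage d VV)) V \<and> c \<in> U \<and> c' \<in> V \<and> disjnt U V"
    using openin_subtopology_Int2[OF openin_config_class_polydisc[OF d, of m r z r], of "Phi_preimage d VV"]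
      openin_subtopology_Int2[OF openin_config_class_polydisc[OF d, of m' r z' r], of "Phi_preimage d VV"] c
    by (intro exI[of _ "Phi_preimage d VV \<inter> ?Q m z"] exI[of _ "Phi_preimage d VV \<inter> ?Q m' z'"]) (auto simp: disjnt_def)
qed

lemma multiplier_class_connectedin:
  assumes D: "D \<subseteq> Res d" "m \<in> D"
    and path: "\<And>u. u \<in> D \<Longrightarrow> \<exists>p. continuous_on {0..1::real} p \<and> p 0 = 0 \<and> p 1 = 1 \<and>
       (\<forall>t\<in>{0..1}. (\<lambda>i. m i + p t * (u i - m i)) \<in> D)"
  shows "connectedin (cs_top (Lambda_tilde_space d)) (multiplier_class d ` D)"
proof (rule connectedin_star_image[OF D path])
  fix u assume u: "u \<in> D"
  then have "multiplier_class d u \<in> V_tilde d" using D(1) by (auto simp: V_tilde_eq)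
  then show "multiplier_class d u \<in> topspace (cs_top (Lambda_tilde_space d))" using V_tilde_topspace by blast
  show "eventually (\<lambda>v. v \<in> Res d \<longrightarrow> multiplier_class d v \<in> W) (near d u)"
    if "openin (cs_top (Lambda_tilde_space d)) W" "multiplier_class d u \<in> W" for W
    using Lambda_tilde_open_near[OF that(1) _ that(2)] u D(1) by blast
qed

lemma type_zero_forms_eq:
  "m \<in> Res d \<Longrightarrow> u \<in> Res d \<Longrightarrow> I_res d m = I_res d u \<Longrightarrow> K_res d m = K_res d u \<Longrightarrow> zero_forms d m = zero_forms d u"
  using zero_forms_eq_iff_IK[of m d u] by (simp add: I_res_def K_res_def)

lemma line_in_type:
  assumes m: "m \<in> Res d" "I_res d m = \<I>" "K_res d m = \<K>" and u: "u \<in> Res d"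
    and z: "zero_forms d (\<lambda>i. m i + c * (u i - m i)) = zero_forms d m"
  shows "(\<lambda>i. m i + c * (u i - m i)) \<in> {m \<in> Res d. I_res d m = \<I> \<and> K_res d m = \<K>}"
proof -
  have "(\<lambda>i. m i + c * (u i - m i)) \<in> Cn d" using m(1) u by (auto simp: Res_def Cn_def)
  then have R: "(\<lambda>i. m i + c * (u i - m i)) \<in> Res d" using zero_forms_Res[OF _ m(1) _ z] d by simp
  then show ?thesis using zero_forms_eq_iff_IK[OF R m(1)] z m(2,3) by (simp add: I_res_def K_res_def)
qed

lemma V_tilde_IK_connected: "connected_space (Lambda_tilde_sub d (V_tilde_IK d \<I> \<K>))"
proof (cases "{m \<in> Res d. I_res d m = \<I> \<and> K_res d m = \<K>} = {}")
  case True
  have "connected_space (Lambda_tilde_sub d {})"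
    using connectedin_empty[of "cs_top (Lambda_tilde_space d)"] unfolding connectedin_def by (rule conjunct2)
  then show ?thesis unfolding V_tilde_IK_eq True image_empty .
next
  case False
  then obtain m where m: "m \<in> Res d" "I_res d m = \<I>" "K_res d m = \<K>" by auto
  have "connectedin (cs_top (Lambda_tilde_space d)) (V_tilde_IK d \<I> \<K>)"
    unfolding V_tilde_IK_eq
  proof (rule multiplier_class_connectedin[of _ m])
    fix u assume u: "u \<in> {m \<in> Res d. I_res d m = \<I> \<and> K_res d m = \<K>}"
    then have u': "u \<in> Res d" "I_res d u = \<I>" "K_res d u = \<K>" by blast+
    have "zero_forms d m = zero_forms d u" by (rule type_zero_forms_eq[OF m(1) u'(1)]) (simp_all only: m u')
    then obtain p where p: "continuous_on {0..1::real} p" "p 0 = (0::complex)" "p 1 = 1"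
      "\<And>t. t \<in> {0..1} \<Longrightarrow> zero_forms d (\<lambda>i. m i + p t * (u i - m i)) = zero_forms d m"
      by (rule stratum_path) (rule that)
    show "\<exists>p. continuous_on {0..1::real} p \<and> p 0 = 0 \<and> p 1 = 1 \<and>
       (\<forall>t\<in>{0..1}. (\<lambda>i. m i + p t * (u i - m i)) \<in> {m \<in> Res d. I_res d m = \<I> \<and> K_res d m = \<K>})"
    proof (intro exI[of _ p] conjI ballI)
      fix t :: real assume t: "t \<in> {0..1}"
      show "(\<lambda>i. m i + p t * (u i - m i)) \<in> {m \<in> Res d. I_res d m = \<I> \<and> K_res d m = \<K>}"
        by (rule line_in_type[OF m u'(1) p(4)[OF t]])
    qed (rule p(1-3))+
  qed (use m in auto)
  then show ?thesis by (simp add: connectedin_def)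
qed

text \<open>The points of the stratum in a small polydisc around \<open>m\<close> form a star with centre \<open>m\<close>: the forms vanishing
  at both ends of a segment vanish on it, and close to \<open>m\<close> no others vanish.\<close>

lemma V_tilde_IK_locally_connected:
  assumes T: "openin (Lambda_tilde_sub d (V_tilde_IK d \<I> \<K>)) T" "y \<in> T"
  shows "\<exists>T'. openin (Lambda_tilde_sub d (V_tilde_IK d \<I> \<K>)) T' \<and> y \<in> T' \<and> T' \<subseteq> T \<and> connectedin (Lambda_tilde_sub d (V_tilde_IK d \<I> \<K>)) T'"
proof -
  let ?\<Sigma> = "{m \<in> Res d. I_res d m = \<I> \<and> K_res d m = \<K>}" and ?VV = "V_tilde_IK d \<I> \<K>"
  obtain O' where O': "openin (cs_top (Lambda_tilde_space d)) O'" "T = O' \<inter> ?VV" using T(1) by (auto simp: openin_subtopology)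
  then obtain m where m: "m \<in> Res d" "I_res d m = \<I>" "K_res d m = \<K>" "y = multiplier_class d m" using T(2) by (auto simp: V_tilde_IK_eq)
  have "eventually (\<lambda>u. (u \<in> Res d \<longrightarrow> multiplier_class d u \<in> O') \<and> zero_forms d u \<subseteq> zero_forms d m) (near d m)"
    using Lambda_tilde_open_near[OF O'(1) m(1)] T(2) O'(2) m(4) by (intro eventually_conj eventually_zero_forms_subset) auto
  then obtain r where r: "r > 0" "\<And>u. u \<in> polydisc d m r \<Longrightarrow> u \<in> Res d \<Longrightarrow> multiplier_class d u \<in> O'"
    "\<And>u. u \<in> polydisc d m r \<Longrightarrow> zero_forms d u \<subseteq> zero_forms d m" by (auto simp: eventually_near)
  define D where "D = ?\<Sigma> \<inter> polydisc d m r"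
  define T' where "T' = ?VV \<inter> multiplier_class d ` (Res d \<inter> polydisc d m r)"
  have T'D: "T' = multiplier_class d ` D"
  proof
    show "T' \<subseteq> multiplier_class d ` D"
    proof
      fix x assume x: "x \<in> T'"
      then obtain u where u: "u \<in> Res d" "u \<in> polydisc d m r" "x = multiplier_class d u" "multiplier_class d u \<in> ?VV" by (auto simp: T'_def)
      have "I_res d u = I_res d m" using I_res_rigid[OF u(1) r(3)[OF u(2)]] u(4) V_tilde_IK_subset(1)[of d \<I> \<K>] m(2) by auto
      moreover have "K_res d u = K_res d m" using K_res_rigid[OF u(1) r(3)[OF u(2)]] u(4) V_tilde_IK_subset(2)[of d \<I> \<K>] m(3) by auto
      ultimately show "x \<in> multiplier_class d ` D" using u m by (auto simp: D_def)
    qed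
    show "multiplier_class d ` D \<subseteq> T'" by (auto simp: T'_def D_def V_tilde_IK_eq)
  qed
  have mD: "m \<in> D" using m centre_in_polydisc[OF Res_Cn[OF m(1)] r(1)] by (simp add: D_def)
  have "connectedin (cs_top (Lambda_tilde_space d)) (multiplier_class d ` D)"
  proof (rule multiplier_class_connectedin[OF _ mD])
    show "D \<subseteq> Res d" by (auto simp: D_def)
    fix u assume u: "u \<in> D"
    then have uR: "u \<in> Res d" and zt: "zero_forms d m = zero_forms d u" using type_zero_forms_eq[OF m(1), of u] m by (auto simp: D_def)
    have "(\<lambda>i. m i + of_real t * (u i - m i)) \<in> D" if t: "t \<in> {0..1::real}" for t
    proof -
      let ?g = "\<lambda>i. m i + of_real t * (u i - m i)"
      have "cmod (?g i - m i) < r" if "i < d" for i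
      proof -
        have "cmod (?g i - m i) = t * cmod (u i - m i)" using t by (simp add: norm_mult)
        also have "\<dots> \<le> 1 * cmod (u i - m i)" using t by (intro mult_right_mono) auto
        also have "\<dots> < r" using u that by (simp add: D_def polydisc_def)
        finally show ?thesis .
      qed
      moreover have "?g \<in> Cn d" using m(1) uR by (auto simp: Res_def Cn_def)
      ultimately have gP: "?g \<in> polydisc d m r" by (simp add: polydisc_def)
      have "zero_forms d m \<subseteq> zero_forms d ?g"
      proof
        fix a assume a: "a \<in> zero_forms d m"
        then have "lin d a m = 0" "lin d a u = 0" using zt by (auto simp: zero_forms_def)
        moreover have "lin d a (\<lambda>i. u i - m i) = lin d a u - lin d a m"
          by (simp add: lin_def right_diff_distrib sum_subtractf)
        ultimately show "a \<in> zero_forms d ?g" using a by (simp add: zero_forms_def lin_shift)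
      qed
      then have "zero_forms d ?g = zero_forms d m" using r(3)[OF gP] by blast
      then show ?thesis using line_in_type[OF m(1-3) uR] gP by (simp add: D_def)
    qed
    moreover have "continuous_on {0..1::real} (\<lambda>t. complex_of_real t)" by (intro continuous_intros)
    ultimately show "\<exists>p. continuous_on {0..1::real} p \<and> p 0 = 0 \<and> p 1 = 1 \<and> (\<forall>t\<in>{0..1}. (\<lambda>i. m i + p t * (u i - m i)) \<in> D)"
      by (intro exI[of _ complex_of_real]) auto
  qed
  then have "connectedin (Lambda_tilde_sub d ?VV) T'" unfolding connectedin_subtopology T'D by (auto simp: T'D[symmetric] T'_def)
  moreover have "openin (Lambda_tilde_sub d ?VV) T'" unfolding T'_def by (rule openin_subtopology_Int2[OF openin_multiplier_class_polydisc])
  moreover have "y \<in> T'" using mD m(4) T'D by blast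
  moreover have "T' \<subseteq> T" using r(2) O'(2) by (auto simp: T'_def)
  ultimately show ?thesis by blast
qed

lemma Phi_component_covering:
  assumes C: "C \<in> connected_components_of (MP_sub d (Phi_preimage d (V_tilde_IK d \<I> \<K>)))"
  shows "covering_map (MP_sub d C) (Lambda_tilde_sub d (V_tilde_IK d \<I> \<K>)) Phi"
proof -
  let ?VV = "V_tilde_IK d \<I> \<K>"
  let ?X = "MP_sub d (Phi_preimage d ?VV)" and ?Y = "Lambda_tilde_sub d ?VV"
  have VV: "?VV \<subseteq> V_tilde d" using V_tilde_IK_subset(1) V_tilde_I_subset by blast
  have "covering_map (subtopology ?X C) ?Y Phi"
  proof (rule proper_local_homeomorphism_component_covering[OF Phi_continuous[OF VV] Phi_proper[OF V_tilde_IK_subset(1)]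
        Phi_locally_homeomorphic[OF V_tilde_IK_subset(2)] MP_Hausdorff[OF VV] _ V_tilde_IK_connected V_tilde_IK_locally_connected C])
    show "finite {x \<in> topspace ?X. Phi x = y}" if "y \<in> topspace ?Y" for y
      unfolding topspace_MP_sub using finite_fibre[OF VV] that topspace_Lambda_tilde_sub[OF VV] by auto
  qed
  moreover have "C \<subseteq> Phi_preimage d ?VV" using connected_components_of_subset[OF C] by (simp only: topspace_MP_sub)
  ultimately show ?thesis by (simp add: subtopology_subtopology Int_absorb1)
qed

end

theorem theorem2:
  fixes d :: nat
  assumes "d \<ge> 2"
  shows
    "(\<forall>l\<in>V d. \<forall>l'\<in>V d. I_set d l = I_set d l' \<and> K_set d l = K_set d l' \<longrightarrow>
        (\<exists>Ut Ut' U U' \<LL> Lt L.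
           openin (Lambda_tilde_sub d (V_tilde d)) Ut \<and> pr d l \<in> Ut \<and>
           openin (Lambda_tilde_sub d (V_tilde d)) Ut' \<and> pr d l' \<in> Ut' \<and>
           U = connected_component_of_set (subtopology (cs_top (Lambda_space d)) (pr_preimage d Ut)) l \<and>
           U' = connected_component_of_set (subtopology (cs_top (Lambda_space d)) (pr_preimage d Ut')) l' \<and>
           biholomorphic_between (MP_space d) (Phi_preimage d Ut) (MP_space d) (Phi_preimage d Ut') \<LL> \<and>
           biholomorphic_between (Lambda_tilde_space d) Ut (Lambda_tilde_space d) Ut' Lt \<and>
           biholomorphic_between (Lambda_space d) U (Lambda_space d) U' L \<and>
           L l = l' \<and>
           (\<forall>c\<in>Phi_preimage d Ut. Phi (\<LL> c) = Lt (Phi c)) \<and>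
           (\<forall>m\<in>U. pr d (L m) = Lt (pr d m)) \<and>
           (\<forall>m\<in>U. I_set d m = I_set d (L m) \<and> K_set d m = K_set d (L m))))
     \<and>
     (\<forall>\<I> \<K>. (\<I>, \<K>) \<in> {(I_set d l, K_set d l) | l. l \<in> V d} \<longrightarrow>
        proper_map (MP_sub d (Phi_preimage d (V_tilde_I d \<I>)))
                   (Lambda_tilde_sub d (V_tilde_I d \<I>)) Phi
        \<and>
        locally_homeomorphic_map (MP_sub d (Phi_preimage d (V_tilde_K d \<K>)))
                   (Lambda_tilde_sub d (V_tilde_K d \<K>)) Phi
        \<and>
        (\<forall>X\<in>connected_components_of (MP_sub d (Phi_preimage d (V_tilde_IK d \<I> \<K>))).
           covering_map (MP_sub d X) (Lambda_tilde_sub d (V_tilde_IK d \<I> \<K>)) Phi))"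
  using local_isomorphism[OF assms] Phi_proper[OF assms order_refl] Phi_locally_homeomorphic[OF assms order_refl]
    Phi_component_covering[OF assms]
  by (intro conjI ballI allI impI) blast+

end
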